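(* Let $k$ be an even positive integer and $p$ an odd prime number. Let $L$ be a lattice in the genus $II_{(l_+,l_-)}p^{\epsilon n}$ with $l_+,l_-\ge1$ and $l_++l_-\ge3$. Write $a=\nu_p(k)$ and $k=k'p^a$. There exists a primitive vector $x\in L$ with $x^2=k$ and $\mathrm{div}(x)=1$ if and only if one of the following conditions is met: (I-1) $a=0$, $n<\mathrm{rk}\,L-1$; (II-1) $a=0$, $n=\mathrm{rk}\,L-1$ and $\left(\frac{-1}{p}\right)^{l_-}\left(\frac{k'}{p}\right)=\epsilon$; (III-1) $a>0$, $n<\mathrm{rk}\,L-2$; (IV-1) $a>0$, $n=\mathrm{rk}\,L-2$ and $l_+-l_-\equiv0\pmod 8$. There exists a primitive vector $x\in L$ with $x^2=k$ and $\mathrm{div}(x)=p$ if and only if one of the following conditions is met: (I-p) $a=1$, $n>1$; (II-p) $a=1$, $n=1$ and $\left(\frac{k'}{p}\right)=\epsilon$; (III-p) $a>1$, $n>2$; (IV-p) $a>1$, $n=2$ and $l_+-l_-\equiv0\pmod8$. If $l_+=1$ or $l_-=0$, the given conditions are still necessary but possibly not sufficient.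
   Context: $II_{(l_+,l_-)}p^{\epsilon n}$ (Conway–Sloane notation), with $\epsilon\in\{\pm1\}$, is the genus of even $\mathbb{Z}$-lattices $L$ of signature $(l_+,l_-)$ with $L^\vee/L\cong(\mathbb{Z}/p\mathbb{Z})^n$, where $\epsilon$ is the sign of the $p$-modular Jordan component: $L\otimes\mathbb{Z}_p\cong L_0\oplus L_1(p)$ with $L_0,L_1$ unimodular over $\mathbb{Z}_p$, $\mathrm{rk}\,L_1=n$ and $\epsilon=\left(\frac{\det L_1}{p}\right)$. $\left(\frac{\cdot}{p}\right)$ is the Legendre symbol, $\nu_p$ the $p$-adic valuation. For $x\in L$, $x^2=b(x,x)$ where $b$ is the bilinear form of $L$, and $\mathrm{div}(x)$ is the positive generator of the ideal $b(x,L)\subseteq\mathbb{Z}$. A vector $x$ is primitive if $L/\mathbb{Z}x$ is torsion free. *)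

theory Defs
  imports
    "HOL-Number_Theory.Number_Theory"
    "HOL-Algebra.Product_Groups"
    "HOL-Combinatorics.Permutations"
    "Jordan_Normal_Form.Matrix"
begin

(* A lattice of rank r is given by the Gram matrix G (an integer r x r matrix) of its bilinear
   form in a Z-basis: L = Z^r = carrier_vec (rk G), b(x, y) = x^T G y. *)

definition rk :: "'a mat \<Rightarrow> nat" where
  "rk G = dim_row G"

definition bil :: "'a :: comm_ring_1 mat \<Rightarrow> 'a vec \<Rightarrow> 'a vec \<Rightarrow> 'a" where
  "bil G x y = x \<bullet> (G *\<^sub>v y)"

definition even_lattice :: "int mat \<Rightarrow> bool" where
  "even_lattice G \<longleftrightarrow> square_mat G \<and> transpose_mat G = G \<and> (\<forall>x \<in> carrier_vec (rk G). even (bil G x x))"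

definition primitive_vec :: "int mat \<Rightarrow> int vec \<Rightarrow> bool" where
  "primitive_vec G x \<longleftrightarrow> x \<in> carrier_vec (rk G) \<and>
     (\<forall>y \<in> carrier_vec (rk G). \<forall>m. m \<noteq> 0 \<and> m \<cdot>\<^sub>v y \<in> range (\<lambda>c. c \<cdot>\<^sub>v x) \<longrightarrow> y \<in> range (\<lambda>c. c \<cdot>\<^sub>v x))"

(* Meaningful only if b(x, L) is not the zero ideal, in particular whenever b(x, x) is nonzero. *)
definition lat_div :: "int mat \<Rightarrow> int vec \<Rightarrow> int" where
  "lat_div G x = (THE d. d > 0 \<and> bil G x ` carrier_vec (rk G) = range ((*) d))"

definition dual_lattice :: "int mat \<Rightarrow> rat vec set" where
  "dual_lattice G = {v \<in> carrier_vec (rk G).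
     \<forall>x \<in> carrier_vec (rk G). bil (map_mat rat_of_int G) v (map_vec rat_of_int x) \<in> \<int>}"

definition disc_group :: "int mat \<Rightarrow> rat vec set monoid" where
  "disc_group G = (monoid_vec TYPE(rat) (rk G))\<lparr>carrier := dual_lattice G\<rparr>
     Mod (map_vec rat_of_int ` carrier_vec (rk G))"

(* Existence of an isometry of the real quadratic space with R^(lp,lm); in particular the form
   is nondegenerate. *)
definition has_signature :: "int mat \<Rightarrow> nat \<Rightarrow> nat \<Rightarrow> bool" where
  "has_signature G lp lm \<longleftrightarrow> G \<in> carrier_mat (lp + lm) (lp + lm) \<and>
     (\<exists>T \<in> carrier_mat (lp + lm) (lp + lm). invertible_mat T \<and>
        transpose_mat T * map_mat real_of_int G * T =
          mat (lp + lm) (lp + lm) (\<lambda>(i, j). if i \<noteq> j then 0 else if i < lp then 1 else -1))"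

(* The ring of p-adic integers as the inverse limit of the rings Z/p^i, with elements of Z/p^i
   represented by 0, ..., p^i - 1. *)
definition padic_int :: "nat \<Rightarrow> (nat \<Rightarrow> int) ring" where
  "padic_int p = \<lparr>
     carrier = {x. \<forall>i. 0 \<le> x i \<and> x i < int p ^ i \<and> x (Suc i) mod int p ^ i = x i},
     mult = (\<lambda>x y i. (x i * y i) mod int p ^ i),
     one = (\<lambda>i. 1 mod int p ^ i),
     zero = (\<lambda>i. 0),
     add = (\<lambda>x y i. (x i + y i) mod int p ^ i)\<rparr>"

definition padic_of_int :: "nat \<Rightarrow> int \<Rightarrow> (nat \<Rightarrow> int)" where
  "padic_of_int p z = (\<lambda>i. z mod int p ^ i)"

lemma padic_int_cring:
  assumes "p > 0"
  shows "cring (padic_int p)"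
proof -
  let ?R = "padic_int p"
  have comp: "(f (x (Suc i)) (y (Suc i)) mod int p ^ Suc i) mod int p ^ i = f (x i) (y i) mod int p ^ i"
    if "x \<in> carrier ?R" "y \<in> carrier ?R" and f: "f = (+) \<or> f = (*)" for f x y i
  proof -
    have "x (Suc i) mod int p ^ i = x i" "y (Suc i) mod int p ^ i = y i"
      using that by (auto simp: padic_int_def)
    moreover have "f (x (Suc i)) (y (Suc i)) mod int p ^ i
        = f (x (Suc i) mod int p ^ i) (y (Suc i) mod int p ^ i) mod int p ^ i"
      using f by (auto simp: mod_simps)
    ultimately show ?thesis by (simp add: mod_mod_cancel)
  qed
  have pos: "int p ^ i > 0" for i using assms by simp
  have neg: "\<exists>y\<in>carrier ?R. y \<oplus>\<^bsub>?R\<^esub> x = \<zero>\<^bsub>?R\<^esub>" if x: "x \<in> carrier ?R" for x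
  proof (rule bexI[of _ "\<lambda>i. (- x i) mod int p ^ i"])
    show "(\<lambda>i. (- x i) mod int p ^ i) \<oplus>\<^bsub>?R\<^esub> x = \<zero>\<^bsub>?R\<^esub>"
      by (simp add: padic_int_def mod_simps)
    have "((- x (Suc i)) mod int p ^ Suc i) mod int p ^ i = (- x i) mod int p ^ i" for i
    proof -
      have "x (Suc i) mod int p ^ i = x i" using x by (auto simp: padic_int_def)
      then have "(- x (Suc i)) mod int p ^ i = (- x i) mod int p ^ i"
        by (metis mod_minus_eq)
      then show ?thesis by (simp add: mod_mod_cancel)
    qed
    then show "(\<lambda>i. (- x i) mod int p ^ i) \<in> carrier ?R"
      using pos by (simp add: padic_int_def)
  qed
  have one: "\<one>\<^bsub>?R\<^esub> \<in> carrier ?R" using pos by (simp add: padic_int_def mod_mod_cancel)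
  have add: "x \<oplus>\<^bsub>?R\<^esub> y \<in> carrier ?R" if "x \<in> carrier ?R" "y \<in> carrier ?R" for x y
    using comp[OF that, of "(+)"] pos by (simp add: padic_int_def)
  have mult: "x \<otimes>\<^bsub>?R\<^esub> y \<in> carrier ?R" if "x \<in> carrier ?R" "y \<in> carrier ?R" for x y
    using comp[OF that, of "(*)"] pos by (simp add: padic_int_def)
  show ?thesis
  proof (intro cringI abelian_groupI comm_monoidI)
    show "\<zero>\<^bsub>?R\<^esub> \<in> carrier ?R" using pos by (simp add: padic_int_def)
  qed (use one add mult neg in \<open>auto simp: padic_int_def mod_simps algebra_simps\<close>)
qed

(* The matrix library's product and determinant need a type of class comm_ring_1, whereas
   padic_int p is a ring with a carrier. *)

definition ring_mat :: "('a, 'm) ring_scheme \<Rightarrow> nat \<Rightarrow> 'a mat \<Rightarrow> bool" where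
  "ring_mat R m A \<longleftrightarrow> A \<in> carrier_mat m m \<and> elements_mat A \<subseteq> carrier R"

definition ring_mat_mult :: "('a, 'm) ring_scheme \<Rightarrow> 'a mat \<Rightarrow> 'a mat \<Rightarrow> 'a mat" where
  "ring_mat_mult R A B = mat (dim_row A) (dim_col B)
     (\<lambda>(i, j). finsum R (\<lambda>l. A $$ (i, l) \<otimes>\<^bsub>R\<^esub> B $$ (l, j)) {..<dim_col A})"

definition ring_det :: "('a, 'm) ring_scheme \<Rightarrow> 'a mat \<Rightarrow> 'a" where
  "ring_det R A = finsum R
     (\<lambda>\<sigma>. (if evenperm \<sigma> then \<one>\<^bsub>R\<^esub> else \<ominus>\<^bsub>R\<^esub> \<one>\<^bsub>R\<^esub>) \<otimes>\<^bsub>R\<^esub> finprod R (\<lambda>i. A $$ (i, \<sigma> i)) {..<dim_row A})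
     {\<sigma>. \<sigma> permutes {..<dim_row A}}"

definition unimodular :: "('a, 'm) ring_scheme \<Rightarrow> nat \<Rightarrow> 'a mat \<Rightarrow> bool" where
  "unimodular R m A \<longleftrightarrow> ring_mat R m A \<and> transpose_mat A = A \<and> ring_det R A \<in> Units R"

(* isometry of the bilinear modules R^m with Gram matrices A and B *)
definition ring_isometric :: "('a, 'm) ring_scheme \<Rightarrow> nat \<Rightarrow> 'a mat \<Rightarrow> 'a mat \<Rightarrow> bool" where
  "ring_isometric R m A B \<longleftrightarrow> (\<exists>T. ring_mat R m T \<and> ring_det R T \<in> Units R \<and>
     ring_mat_mult R (transpose_mat T) (ring_mat_mult R A T) = B)"

definition orth_sum :: "('a, 'm) ring_scheme \<Rightarrow> 'a mat \<Rightarrow> 'a mat \<Rightarrow> 'a mat" where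
  "orth_sum R A B = four_block_mat A (mat (dim_row A) (dim_col B) (\<lambda>_. \<zero>\<^bsub>R\<^esub>))
     (mat (dim_row B) (dim_col A) (\<lambda>_. \<zero>\<^bsub>R\<^esub>)) B"

(* G over the p-adic integers is L0 + L1(p) with L0, L1 unimodular, rk L1 = n, and eps is the
   Legendre symbol of det L1; (ring_det ...) 1 is the residue class of det L1 modulo p. *)
definition jordan_sign :: "int mat \<Rightarrow> nat \<Rightarrow> nat \<Rightarrow> int \<Rightarrow> bool" where
  "jordan_sign G p n eps \<longleftrightarrow> n \<le> rk G \<and>
     (\<exists>L0 L1. unimodular (padic_int p) (rk G - n) L0 \<and> unimodular (padic_int p) n L1 \<and>
        ring_isometric (padic_int p) (rk G) (map_mat (padic_of_int p) G)
          (orth_sum (padic_int p) L0 (map_mat (\<lambda>c. padic_of_int p (int p) \<otimes>\<^bsub>padic_int p\<^esub> c) L1)) \<and>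
        eps = Legendre (ring_det (padic_int p) L1 1) (int p))"

(* membership in the genus II_(lp,lm) p^(eps n) *)
definition in_genus_II :: "int mat \<Rightarrow> nat \<Rightarrow> nat \<Rightarrow> nat \<Rightarrow> int \<Rightarrow> nat \<Rightarrow> bool" where
  "in_genus_II G lp lm p eps n \<longleftrightarrow> even_lattice G \<and> has_signature G lp lm \<and>
     disc_group G \<cong> product_group {..<n} (\<lambda>_. integer_mod_group p) \<and>
     eps \<in> {1, -1} \<and> jordan_sign G p n eps"

definition represents :: "int mat \<Rightarrow> nat \<Rightarrow> int \<Rightarrow> bool" where
  "represents G k d \<longleftrightarrow> (\<exists>x. primitive_vec G x \<and> bil G x x = int k \<and> lat_div G x = d)"

definition conditions_1 :: "int mat \<Rightarrow> nat \<Rightarrow> nat \<Rightarrow> nat \<Rightarrow> int \<Rightarrow> nat \<Rightarrow> nat \<Rightarrow> bool" where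
  "conditions_1 G lp lm p eps n k \<longleftrightarrow>
    (let a = multiplicity p k; k' = k div p ^ a in
       a = 0 \<and> int n < int (rk G) - 1
     \<or> a = 0 \<and> int n = int (rk G) - 1 \<and> Legendre (-1) (int p) ^ lm * Legendre (int k') (int p) = eps
     \<or> a > 0 \<and> int n < int (rk G) - 2
     \<or> a > 0 \<and> int n = int (rk G) - 2 \<and> [int lp - int lm = 0] (mod 8))"

definition conditions_p :: "nat \<Rightarrow> nat \<Rightarrow> nat \<Rightarrow> int \<Rightarrow> nat \<Rightarrow> nat \<Rightarrow> bool" where
  "conditions_p lp lm p eps n k \<longleftrightarrow>
    (let a = multiplicity p k; k' = k div p ^ a in
       a = 1 \<and> n > 1
     \<or> a = 1 \<and> n = 1 \<and> Legendre (int k') (int p) = eps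
     \<or> a > 1 \<and> n > 2
     \<or> a > 1 \<and> n = 2 \<and> [int lp - int lm = 0] (mod 8))"

end

theory Submission
 imports Defs "Jordan_Normal_Form.Determinant" "HOL-Library.Multiset"
begin

text \<open>
 Necessity is local at p: in a Jordan splitting \<open>L\<^sub>0 \<oplus> L\<^sub>1(p)\<close>, a primitive vector of divisor 1 (of divisor p)
 reduces to a nonzero solution modulo p of the diagonal form on \<open>L\<^sub>0\<close> (on \<open>L\<^sub>1\<close>). This is a restriction only if that
 component has rank at most 2, and there its sign is tied to the signature by the oddity formula, which is read off
 from the Witt group of the rationals. For sufficiency, reciprocity shows that an indefinite lattice of rank at
 least 3 which ramifies at p only is isotropic. A primitive isotropic vector e is completed by some f with
 b(e, f) = 1 or p, and a local solution u, made orthogonal to e and f, yields the vector e + m f + u of norm k. That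
 the conditions do not suffice for definite lattices is witnessed by a lattice of rank 4 and determinant 433.
\<close>

text \<open>Isotropy over the rationals is reached without a local-global principle: a diagonal form
  is isotropic as soon as a shorter one is Witt equivalent to it. An even lattice that is unimodular
  at 2 has even rank, so rank 3 becomes rank 4, and what is wanted is a model with the same
  signature, the same residue at p, no other residues, and fewer coefficients. Coefficients 1 and p
  up to sign, possibly doubled, go a long way. The obstacle is p = 1 mod 4: there -1 is a square
  modulo p, so signs do not reach the nonsquare class, and 2 reaches it only if p = 5 mod 8. A prime
  l = 3 mod 4 with (l/p) = -1 is brought in; then (p/l) = -1 as well, and in the pair pl, l the
  residues at l cancel. That l exists is shown by a weighted character sum that would otherwise be
  both bounded and unbounded. The same models yield the oddity formula: an invariant with values in
  Z/8, depending on 2-adic data only, vanishes on the lattice and is computed on the model.\<close>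

section \<open>Witt equivalence of diagonal forms and its invariants\<close>

text \<open>Generators and relations of the Witt group of a field of characteristic not 2, written
  on multisets of diagonal coefficients. Hyperbolic planes vanish, squares are absorbed, and
  \<open>witt_sum\<close> passes from the basis of a plane to the vector of norm a + b and its
  orthogonal complement. An invariant therefore has just three relations to respect.\<close>

inductive witt :: "'a :: field multiset \<Rightarrow> 'a multiset \<Rightarrow> bool" where
 witt_refl: "witt X X"
| witt_sym: "witt X Y ==> witt Y X"
| witt_trans [trans]: "witt X Y ==> witt Y Z ==> witt X Z"
| witt_hyp: "a ~= 0 ==> witt (Z + {#a, - a#}) Z"
| witt_sq: "a ~= 0 ==> c ~= 0 ==> witt (Z + {#a * c\<^sup>2#}) (Z + {#a#})"
| witt_sum: "a ~= 0 ==> b ~= 0 ==> a + b ~= 0 ==> witt (Z + {#a, b#}) (Z + {#a + b, a * b * (a + b)#})"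

lemma witt_add_right: "witt X Y ==> witt (X + Z) (Y + Z)"
proof (induction rule: witt.induct)
 case (witt_hyp a U) then show ?case
 using witt.witt_hyp[of a "U + Z"] by (simp add: add_ac)
next
 case (witt_sq a c U) then show ?case
 using witt.witt_sq[of a c "U + Z"] by (simp add: add_ac)
next
 case (witt_sum a b U) then show ?case
 using witt.witt_sum[of a b "U + Z"] by (simp add: add_ac)
qed (blast intro: witt.intros)+

lemma witt_add: "witt X Y ==> witt Z W ==> witt (X + Z) (Y + W)"
 using witt_add_right[of X Y Z] witt_add_right[of Z W Y] by (metis add.commute witt_trans)

lemma witt_sq1: "a ~= 0 ==> c ~= 0 ==> witt {#a * c\<^sup>2#} {#a#}"
 using witt_sq[of a c "{#}"] by simp

lemma witt_hyp1: "a ~= 0 ==> witt {#a, - a#} {#}"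
 using witt_hyp[of a "{#}"] by simp

lemma witt_sum1: "a ~= 0 ==> b ~= 0 ==> a + b ~= 0 ==> witt {#a, b#} {#a + b, a * b * (a + b)#}"
 using witt_sum[of a b "{#}"] by simp

lemma witt_scale:
 assumes "witt X Y" "t ~= 0"
 shows "witt (image_mset ((*) t) X) (image_mset ((*) t) Y)"
 using assms(1)
proof (induction rule: witt.induct)
 case (witt_hyp a Z) then show ?case
 using witt.witt_hyp[of "t * a"] assms(2) by simp
next
 case (witt_sq a c Z) then show ?case
 using witt.witt_sq[of "t * a" c] assms(2) by (simp add: algebra_simps)
next
 case (witt_sum a b Z)
 have "witt (image_mset ((*) t) Z + {#t * a, t * b#})
 (image_mset ((*) t) Z + {#t * a + t * b, (t * a) * (t * b) * (t * a + t * b)#})"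
 using witt_sum assms(2) by (intro witt.witt_sum) (auto simp flip: distrib_left)
 \<comment> \<open>Scaling the sum relation by t leaves a surplus factor t^2 in the last
   coefficient, which \<open>witt_sq\<close> removes.\<close>
 also have "(t * a) * (t * b) * (t * a + t * b) = t * (a * b * (a + b)) * t\<^sup>2"
 by (simp add: algebra_simps power2_eq_square)
 also have "witt (image_mset ((*) t) Z + {#t * a + t * b, t * (a * b * (a + b)) * t\<^sup>2#})
 (image_mset ((*) t) Z + {#t * a + t * b, t * (a * b * (a + b))#})"
 using witt.witt_sq[of "t * (a * b * (a + b))" t "image_mset ((*) t) Z + {#t * a + t * b#}"] witt_sum assms(2)
 by (simp add: add_mset_commute)
 finally show ?case by (simp add: distrib_left)
qed (blast intro: witt.intros)+

lemma witt_neg: "0 \<notin># X ==> witt (X + image_mset uminus X) {#}"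
proof (induction X)
 case (add a X)
 then have "witt (X + image_mset uminus X + {#a, - a#}) {#}"
 using witt_hyp witt_trans by fastforce
 then show ?case by (simp add: add_ac add_mset_commute)
qed (auto intro: witt_refl)

text \<open>Relations in the Witt group are invariant under every function that respects the defining
 relations; the modulus \<open>N = 0\<close> gives integer-valued invariants.\<close>

lemma witt_invariant:
 fixes f :: "'a :: field \<Rightarrow> int"
 assumes sq: "\<And>a c. a ~= 0 ==> c ~= 0 ==> f (a * c\<^sup>2) = f a"
 and hyp: "\<And>a. a ~= 0 ==> [f a + f (- a) = 0] (mod N)"
 and sum: "\<And>a b. a ~= 0 ==> b ~= 0 ==> a + b ~= 0 ==> [f a + f b = f (a + b) + f (a * b * (a + b))] (mod N)"
 and "witt X Y"
 shows "[(\<Sum>a\<in>#X. f a) = (\<Sum>a\<in>#Y. f a)] (mod N)"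
 using \<open>witt X Y\<close>
proof (induction rule: witt.induct)
 case (witt_hyp a Z)
 then show ?case using cong_add[OF cong_refl hyp[of a], of "\<Sum>a\<in>#Z. f a"] by (simp add: add_ac)
next
 case (witt_sum a b Z)
 then show ?case using cong_add[OF cong_refl sum[of a b], of "\<Sum>a\<in>#Z. f a"] by (simp add: add_ac)
qed (auto simp: sq intro: cong_sym cong_trans)

lemma sgn_rel:
 fixes a b :: "'a :: linordered_field"
 assumes "a ~= 0" "b ~= 0" "a + b ~= 0"
 shows "sgn a + sgn b = sgn (a + b) + sgn (a * b * (a + b))"
proof -
 consider "a > 0" "b > 0" | "a > 0" "b < 0" | "a < 0" "b > 0" | "a < 0" "b < 0"
 using assms by linarith
 then show ?thesis
 proof cases
 case 2 then have "sgn a = 1" "sgn b = -1" by auto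
 moreover have "sgn (a * b * (a + b)) = - sgn (a + b)" using 2 by (simp add: sgn_mult)
 ultimately show ?thesis by simp
 next
 case 3 then have "sgn a = -1" "sgn b = 1" by auto
 moreover have "sgn (a * b * (a + b)) = - sgn (a + b)" using 3 by (simp add: sgn_mult)
 ultimately show ?thesis by simp
 qed (auto simp: sgn_mult)
qed

text \<open>\<open>sgn\<close> takes its values in the field itself, whereas
  \<open>witt_invariant\<close> works with integer values.\<close>

definition isgn :: "'a :: linordered_field \<Rightarrow> int" where
 "isgn a = (if a > 0 then 1 else if a < 0 then -1 else 0)"

lemma isgn_sgn: "of_int (isgn a) = sgn a"
 by (auto simp: isgn_def sgn_if)

lemma isgn_mult: "isgn (a * b) = isgn a * isgn b"
 by (auto simp: isgn_def zero_less_mult_iff mult_less_0_iff)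

lemma isgn_uminus [simp]: "isgn (- a) = - isgn a"
 by (auto simp: isgn_def)

lemma witt_isgn:
 assumes "witt X Y"
 shows "(\<Sum>a\<in>#X. isgn a) = (\<Sum>a\<in>#Y. isgn a)"
proof -
 have "[(\<Sum>a\<in>#X. isgn a) = (\<Sum>a\<in>#Y. isgn a)] (mod 0)"
 proof (rule witt_invariant[OF _ _ _ assms])
 fix a b :: 'a assume "a ~= 0" "b ~= 0" "a + b ~= 0"
 then have "of_int (isgn a + isgn b) = (of_int (isgn (a + b) + isgn (a * b * (a + b))) :: 'a)"
 by (simp add: isgn_sgn sgn_rel)
 then show "[isgn a + isgn b = isgn (a + b) + isgn (a * b * (a + b))] (mod 0)"
 by (simp only: of_int_eq_iff cong_0_iff cong_def)
 next
 fix a c :: 'a assume "a ~= 0" "c ~= 0"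
 then have "isgn (c\<^sup>2) = 1" by (simp add: isgn_def)
 then show "isgn (a * c\<^sup>2) = isgn a" by (simp add: isgn_mult)
 qed auto
 then show ?thesis by simp
qed

text \<open>A function on nonzero integers that only depends on square classes extends to the
 rationals, because \<open>num / den\<close> and \<open>num * den\<close> lie in the same square class.\<close>

definition ext :: "(int \<Rightarrow> int) \<Rightarrow> rat \<Rightarrow> int" where
 "ext f a = f (fst (quotient_of a) * snd (quotient_of a))"

definition sqc :: "(int \<Rightarrow> int) \<Rightarrow> bool" where
 "sqc f \<longleftrightarrow> (\<forall>a c. a ~= 0 --> c ~= 0 --> f (a * c\<^sup>2) = f a)"

lemma ext_div:
 assumes "sqc f" "x ~= 0" "z ~= 0"
 shows "ext f (of_int x / of_int z) = f (x * z)"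
proof -
 obtain m d where q: "quotient_of (of_int x / of_int z) = (m, d)" by force
 then have d: "d > 0" and e: "of_int x / of_int z = (of_int m / of_int d :: rat)"
 using quotient_of_denom_pos quotient_of_div by blast+
 have "of_int (x * d) = (of_int (m * z) :: rat)"
 using e d assms by (simp add: field_simps)
 then have xd: "x * d = m * z" by (simp only: of_int_eq_iff)
 then have "m ~= 0" using d assms by auto
 have "(m * d) * z\<^sup>2 = (x * z) * d\<^sup>2"
 using xd by (simp add: power2_eq_square)
 then have "f (m * d) = f (x * z)"
 using assms d \<open>m ~= 0\<close> unfolding sqc_def by (metis mult_eq_0_iff order_less_irrefl)
 then show ?thesis by (simp add: ext_def q)
qed

lemma ext_of_int: "sqc f ==> x ~= 0 ==> ext f (of_int x) = f x"
 using ext_div[of f x 1] by simp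

lemma witt_ext:
 assumes sqf: "sqc f"
 and hyp: "\<And>a. a ~= 0 ==> [f a + f (- a) = 0] (mod N)"
 and sum: "\<And>a b. a ~= 0 ==> b ~= 0 ==> a + b ~= 0 ==> [f a + f b = f (a + b) + f (a * b * (a + b))] (mod N)"
 and w: "witt X Y"
 shows "[(\<Sum>a\<in>#X. ext f a) = (\<Sum>a\<in>#Y. ext f a)] (mod N)"
proof (rule witt_invariant[OF _ _ _ w])
 have rep: "\<exists>x z. a = of_int x / of_int z \<and> z ~= 0 \<and> x ~= 0" if "a ~= 0" for a :: rat
 using that by (metis Fract_of_int_quotient Rat_cases div_0 of_int_0 order_less_irrefl)
 fix a :: rat assume "a ~= 0"
 then obtain x z where xz: "a = of_int x / of_int z" "z ~= 0" "x ~= 0" using rep by blast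
 have "ext f (- a) = f (- x * z)" using ext_div[OF sqf, of "- x" z] xz by simp
 then show "[ext f a + ext f (- a) = 0] (mod N)"
 using hyp[of "x * z"] ext_div[OF sqf, of x z] xz by simp
 { fix c :: rat assume "c ~= 0"
 then obtain y w where yw: "c = of_int y / of_int w" "w ~= 0" "y ~= 0" using rep by blast
 have "a * c\<^sup>2 = of_int (x * y\<^sup>2) / of_int (z * w\<^sup>2)" using xz yw by (simp add: power_divide)
 then have "ext f (a * c\<^sup>2) = f ((x * y\<^sup>2) * (z * w\<^sup>2))"
 using ext_div[OF sqf, of "x * y\<^sup>2" "z * w\<^sup>2"] xz yw by simp
 also have "(x * y\<^sup>2) * (z * w\<^sup>2) = (x * z) * (y * w)\<^sup>2" by (simp add: power_mult_distrib)
 also have "f ... = f (x * z)" using sqf xz yw unfolding sqc_def by simp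
 finally show "ext f (a * c\<^sup>2) = ext f a" using ext_div[OF sqf, of x z] xz by simp }
 { fix b :: rat assume b: "b ~= 0" "a + b ~= 0"
 then obtain y w where yw: "b = of_int y / of_int w" "w ~= 0" "y ~= 0" using rep by blast
 \<comment> \<open>With the common denominator (z w)^2, a square, the relation for a and b becomes
   the integer relation for the numerators.\<close>
 let ?A = "x * z * w\<^sup>2" and ?B = "y * w * z\<^sup>2"
 have nz: "z * w ~= 0" using xz yw by simp
 have e1: "a + b = of_int (?A + ?B) / of_int ((z * w)\<^sup>2)" using xz yw
 by (simp add: field_simps power2_eq_square)
 have nz2: "?A + ?B ~= 0"
 proof
 assume "?A + ?B = 0"
 then show False using e1 b by (simp only: of_int_0 div_0)
 qed
 have e2: "a * b * (a + b) = of_int (?A * ?B * (?A + ?B)) / of_int ((z * w) ^ 6)"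
 proof -
 have ea: "a = of_int ?A / of_int ((z * w)\<^sup>2)" and eb: "b = of_int ?B / of_int ((z * w)\<^sup>2)"
 using xz yw by (simp_all add: power2_eq_square)
 have "a * b * (a + b) = (of_int ?A * of_int ?B * of_int (?A + ?B)) /
 (of_int ((z * w)\<^sup>2) * of_int ((z * w)\<^sup>2) * of_int ((z * w)\<^sup>2))"
 unfolding e1 by (subst (1) ea, subst (1) eb) simp
 also have "... = of_int (?A * ?B * (?A + ?B)) / of_int ((z * w)\<^sup>2 * (z * w)\<^sup>2 * (z * w)\<^sup>2)"
 by (simp only: of_int_mult)
 also have "(z * w)\<^sup>2 * (z * w)\<^sup>2 * (z * w)\<^sup>2 = (z * w) ^ 6"
 by (simp flip: power_add)
 finally show ?thesis .
 qed
 have "ext f (a + b) = f ((?A + ?B) * (z * w)\<^sup>2)"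
 unfolding e1 using nz nz2 by (intro ext_div sqf) auto
 also have "... = f (?A + ?B)" using sqf nz nz2 unfolding sqc_def by blast
 finally have s1: "ext f (a + b) = f (?A + ?B)" .
 have "ext f (a * b * (a + b)) = f ((?A * ?B * (?A + ?B)) * (z * w) ^ 6)"
 unfolding e2 using nz nz2 xz yw by (intro ext_div sqf) auto
 also have "(z * w) ^ 6 = ((z * w) ^ 3)\<^sup>2" by (simp flip: power_mult)
 also have "f ((?A * ?B * (?A + ?B)) * ((z * w) ^ 3)\<^sup>2) = f (?A * ?B * (?A + ?B))"
 proof -
 have "?A * ?B * (?A + ?B) ~= 0" "(z * w) ^ 3 ~= 0" using nz nz2 xz yw by simp_all
 then show ?thesis using sqf unfolding sqc_def by blast
 qed
 finally have s2: "ext f (a * b * (a + b)) = f (?A * ?B * (?A + ?B))" .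
 have s3: "ext f a = f ?A" using ext_div[OF sqf, of x z] xz sqf yw by (simp add: sqc_def)
 have s4: "ext f b = f ?B" using ext_div[OF sqf, of y w] yw sqf xz by (simp add: sqc_def)
 show "[ext f a + ext f b = ext f (a + b) + ext f (a * b * (a + b))] (mod N)"
 unfolding s1 s2 s3 s4 using xz yw nz2 by (intro sum) auto }
qed

section \<open>Legendre symbols\<close>

lemma Legendre_cases: "Legendre a p = 0 \<or> Legendre a p = 1 \<or> Legendre a p = -1"
 by (auto simp: Legendre_def)

lemma Legendre_eq_0_iff: "Legendre a p = 0 \<longleftrightarrow> p dvd a"
 by (auto simp: Legendre_def cong_0_iff)

lemma Legendre_cong: assumes "[a = b] (mod p)" shows "Legendre a p = Legendre b p"
proof -
 have "[c = a] (mod p) \<longleftrightarrow> [c = b] (mod p)" "[a = c] (mod p) \<longleftrightarrow> [b = c] (mod p)" for c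
 using assms by (auto intro: cong_trans cong_sym)
 then show ?thesis by (simp add: Legendre_def QuadRes_def)
qed

text \<open>Two values among -1, 0, 1 differ by at most 2, which is too little for a modulus above
  2.\<close>

lemma Legendre_eqI:
 assumes "[Legendre a p = x] (mod p)" "x \<in> {-1, 0, 1}" "p > 2"
 shows "Legendre a p = x"
proof -
 have "p dvd Legendre a p - x" using assms(1) by (simp add: cong_iff_dvd_diff)
 moreover have "\<bar>Legendre a p - x\<bar> \<le> 2" using Legendre_cases[of a p] assms(2) by auto
 ultimately show ?thesis using assms(3) zdvd_not_zless[of "\<bar>Legendre a p - x\<bar>" p] by fastforce
qed

lemma odd_prime_gt2: "prime (p::nat) ==> odd p ==> p > 2"
 using prime_ge_2_nat[of p] by (cases "p = 2") auto

lemma Legendre_mult: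
 assumes "prime (p::nat)" "odd p"
 shows "Legendre (a * b) (int p) = Legendre a (int p) * Legendre b (int p)"
proof (rule Legendre_eqI)
 have p2: "2 < p" using odd_prime_gt2 assms by blast
 note ec = euler_criterion[OF assms(1) p2]
 have "[Legendre (a * b) (int p) = (a * b) ^ ((p - 1) div 2)] (mod int p)" by (rule ec)
 also have "(a * b) ^ ((p - 1) div 2) = a ^ ((p - 1) div 2) * b ^ ((p - 1) div 2)"
 by (simp add: power_mult_distrib)
 also have "[... = Legendre a (int p) * Legendre b (int p)] (mod int p)"
 by (intro cong_mult cong_sym[OF ec])
 finally show "[Legendre (a * b) (int p) = Legendre a (int p) * Legendre b (int p)] (mod int p)" .
 show "Legendre a (int p) * Legendre b (int p) \<in> {-1, 0, 1}"
 using Legendre_cases[of a "int p"] Legendre_cases[of b "int p"] by auto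
 show "int p > 2" using p2 by simp
qed

lemma Legendre_neg1:
 assumes "prime (p::nat)" "odd p"
 shows "Legendre (-1) (int p) = (if p mod 4 = 1 then 1 else -1)"
proof (rule Legendre_eqI)
 have p2: "2 < p" using odd_prime_gt2 assms by blast
 have "[Legendre (-1) (int p) = (-1) ^ ((p - 1) div 2)] (mod int p)"
 by (rule euler_criterion[OF assms(1) p2])
 also have "(-1) ^ ((p - 1) div 2) = (if p mod 4 = 1 then 1 else -1 :: int)"
 proof (cases "p mod 4 = 1")
 case True
 then obtain q where "p = 4 * q + 1" by (metis mult_div_mod_eq)
 then show ?thesis using True by simp
 next
 case False
 then have "p mod 4 = 3" using assms(2) by presburger
 then obtain q where "p = 4 * q + 3" by (metis mult_div_mod_eq)
 then have "(p - 1) div 2 = Suc (2 * q)" by simp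
 then show ?thesis using False by simp
 qed
 finally show "[Legendre (-1) (int p) = (if p mod 4 = 1 then 1 else -1)] (mod int p)" .
qed (use odd_prime_gt2 assms in auto)

lemma Legendre_unit: "\<not> p dvd a ==> Legendre a p = 1 \<or> Legendre a p = -1"
 using Legendre_cases[of a p] Legendre_eq_0_iff[of a p] by auto

lemma Legendre_sq:
 assumes "prime (p::nat)" "odd p" "\<not> int p dvd c"
 shows "Legendre (c\<^sup>2) (int p) = 1"
 using Legendre_unit[OF assms(3)] by (auto simp: power2_eq_square Legendre_mult[OF assms(1,2)])

lemma Legendre_1: assumes "prime (p::nat)" "odd p" shows "Legendre 1 (int p) = 1"
 using Legendre_sq[OF assms, of 1] prime_gt_1_nat[OF assms(1)] by (simp add: zdvd1_eq)

text \<open>The product a b is a square y^2 modulo p, and t = y / a works. The range of t matters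
  later: all prime factors of t are then below p.\<close>

lemma Legendre_ratio:
 assumes "prime (p::nat)" "odd p" "\<not> int p dvd a" "Legendre a (int p) = Legendre b (int p)"
 shows "\<exists>t. 0 < t \<and> t < int p \<and> [a * t\<^sup>2 = b] (mod int p)"
proof -
 have pp: "prime (int p)" using assms(1) by simp
 have nb: "\<not> int p dvd b" using assms(3,4) Legendre_eq_0_iff by metis
 have "Legendre (a * b) (int p) = 1"
 using Legendre_mult[OF assms(1,2)] Legendre_unit[OF assms(3)] assms(4) by auto
 then obtain y where y: "[y\<^sup>2 = a * b] (mod int p)"
 unfolding Legendre_def QuadRes_def by (auto split: if_splits)
 obtain a' where a': "[a * a' = 1] (mod int p)"
 using cong_solve_coprime_int[of a "int p"] assms(3) pp
 by (metis coprime_commute prime_imp_coprime)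
 let ?t = "(y * a') mod int p"
 have c: "[a * ?t\<^sup>2 = b] (mod int p)"
 proof -
 have "[a * ?t\<^sup>2 = a * (y * a')\<^sup>2] (mod int p)"
 by (intro cong_mult cong_refl cong_pow) (simp add: cong_def)
 also have "a * (y * a')\<^sup>2 = y\<^sup>2 * (a * a') * a'" by (simp add: power2_eq_square)
 also have "[... = (a * b) * 1 * a'] (mod int p)" by (intro cong_mult cong_refl y a')
 also have "(a * b) * 1 * a' = b * (a * a')" by simp
 also have "[... = b * 1] (mod int p)" by (intro cong_mult cong_refl a')
 finally show ?thesis by simp
 qed
 have "?t ~= 0"
 proof
 assume "?t = 0"
 then have "[0 = b] (mod int p)" using c by (simp add: power2_eq_square)
 then show False using nb cong_0_iff cong_sym by blast
 qed
 moreover have "?t \<ge> 0" "?t < int p" using prime_gt_0_nat[OF assms(1)] by auto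
 ultimately show ?thesis using c by (intro exI[of _ ?t]) linarith
qed

section \<open>Residues at odd primes\<close>

definition unit_part :: "int \<Rightarrow> int \<Rightarrow> int" where
 "unit_part q a = a div q ^ multiplicity q a"

text \<open>The Witt group of the field with q elements, mapped to Z/4. For q = 3 mod 4 it is cyclic
  of order 4 and the class of u goes to its Legendre symbol. For q = 1 mod 4 it is a Klein four
  group, of which only the discriminant is recorded, as 0 or 2; the parity of the rank is left to
  \<open>par\<close>.\<close>

definition pm :: "nat \<Rightarrow> int \<Rightarrow> int" where
 "pm q u = (if q mod 4 = 1 then 1 - Legendre u (int q) else Legendre u (int q))"

text \<open>The second residue map at q, followed by \<open>pm\<close>.\<close>

definition res :: "nat \<Rightarrow> int \<Rightarrow> int" where
 "res q a = (if even (multiplicity (int q) a) then 0 else pm q (unit_part (int q) a))"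

definition par :: "nat \<Rightarrow> int \<Rightarrow> int" where
 "par q a = int (multiplicity (int q) a mod 2)"

lemma prime_decomp:
 assumes "prime (q::nat)" "a ~= 0"
 obtains k u where "a = int q ^ k * u" "\<not> int q dvd u"
 using multiplicity_decompose'[of a "int q"] assms
 by (metis not_prime_unit prime_nat_int_transfer)

lemma multiplicity_pu:
 assumes "prime (q::nat)" "\<not> int q dvd u"
 shows "multiplicity (int q) (int q ^ k * u) = k"
proof (rule multiplicity_eqI)
 have "int q ^ k ~= 0" using prime_gt_0_nat[OF assms(1)] by simp
 then show "\<not> int q ^ Suc k dvd int q ^ k * u"
 using assms(2) dvd_mult_cancel_left[of "int q ^ k" "int q" u] by (simp only: power_Suc2) blast
qed simp

lemma unit_part_pu:
 assumes "prime (q::nat)" "\<not> int q dvd u"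
 shows "unit_part (int q) (int q ^ k * u) = u"
 using multiplicity_pu[OF assms] prime_gt_0_nat[OF assms(1)] by (simp add: unit_part_def)

lemma res_pu:
 assumes "prime (q::nat)" "\<not> int q dvd u"
 shows "res q (int q ^ k * u) = (if even k then 0 else pm q u)"
 using multiplicity_pu[OF assms] unit_part_pu[OF assms] by (simp add: res_def)

lemma par_pu:
 assumes "prime (q::nat)" "\<not> int q dvd u"
 shows "par q (int q ^ k * u) = int (k mod 2)"
 using multiplicity_pu[OF assms] by (simp add: par_def)

lemma pm_cong: "[u = v] (mod int q) ==> pm q u = pm q v"
 by (simp add: pm_def Legendre_cong)

lemma pm_sq: "prime q ==> odd q ==> \<not> int q dvd t ==> pm q (u * t\<^sup>2) = pm q u"
 by (simp add: pm_def Legendre_mult Legendre_sq)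

lemma pm_neg:
 assumes "prime q" "odd q" "\<not> int q dvd u"
 shows "[pm q u + pm q (- u) = 0] (mod 4)"
 using Legendre_unit[OF assms(3)] Legendre_mult[OF assms(1,2), of "-1" u] Legendre_neg1[OF assms(1,2)]
 by (auto simp: pm_def cong_def)

text \<open>Over a finite field of odd order, rank and discriminant determine a form; both sides
  have rank 2 and discriminant u w up to squares.\<close>

lemma pm_sum:
 assumes "prime q" "odd q" "\<not> int q dvd u" "\<not> int q dvd v" "\<not> int q dvd w"
 shows "[pm q u + pm q w = pm q v + pm q (u * w * v)] (mod 4)"
 using Legendre_unit[OF assms(3)] Legendre_unit[OF assms(4)] Legendre_unit[OF assms(5)]
 by (auto simp: pm_def cong_def Legendre_mult[OF assms(1,2)])

lemma pm_cong_neg_product: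
 assumes "prime q" "odd q" "\<not> int q dvd u" "\<not> int q dvd v" "[w = - u] (mod int q)"
 shows "[pm q v + pm q (u * w * v) = 0] (mod 4)"
proof -
 have "[u * w * v = u * (- u) * v] (mod int q)" by (intro cong_mult cong_refl assms)
 then have "pm q (u * w * v) = pm q (- v * u\<^sup>2)" using pm_cong by (simp add: power2_eq_square algebra_simps)
 also have "... = pm q (- v)" using pm_sq assms by blast
 finally show ?thesis using pm_neg assms by simp
qed

lemma prime_not_dvd_mult: "prime (q::nat) ==> \<not> int q dvd u ==> \<not> int q dvd v ==> \<not> int q dvd u * v"
 by (metis prime_dvd_mult_iff prime_nat_int_transfer)

text \<open>The lower power of q dominates: a + b has the unit part of a modulo q. In a b (a + b)
  the powers coming from a and a + b are equal, which leaves the class of b.\<close>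

lemma res_sum_less:
 assumes q: "prime q" "odd q" and u: "\<not> int q dvd u" and w: "\<not> int q dvd w" and "i < j"
 defines "a \<equiv> int q ^ i * u" and "b \<equiv> int q ^ j * w"
 shows "res q (a + b) = res q a" "res q (a * b * (a + b)) = res q b"
proof -
 define u' where "u' = u + int q ^ (j - i) * w"
 have "int q dvd int q ^ (j - i)" using \<open>i < j\<close> by (simp add: dvd_power)
 then have cu: "[u' = u] (mod int q)" by (simp add: u'_def cong_iff_dvd_diff)
 then have u': "\<not> int q dvd u'" using u cong_dvd_iff by blast
 have ab: "a + b = int q ^ i * u'"
 using \<open>i < j\<close> by (simp add: a_def b_def u'_def distrib_left mult.assoc[symmetric] power_add[symmetric])
 show "res q (a + b) = res q a"
 unfolding ab using res_pu[OF q(1) u'] res_pu[OF q(1) u] pm_cong[OF cu] by (simp add: a_def)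
 have abab: "a * b * (a + b) = int q ^ (i + j + i) * (u * w * u')"
 unfolding ab by (simp add: a_def b_def power_add)
 have "[u * w * u' = u * w * u] (mod int q)" by (intro cong_mult cong_refl cu)
 then have "pm q (u * w * u') = pm q (w * u\<^sup>2)" using pm_cong by (simp add: power2_eq_square mult_ac)
 also have "... = pm q w" using pm_sq q u by blast
 finally show "res q (a * b * (a + b)) = res q b"
 unfolding abab using res_pu[OF q(1)] prime_not_dvd_mult q(1) u w u' by (simp add: b_def)
qed

lemma res_sum:
 assumes q: "prime q" "odd q" and nz: "a ~= 0" "b ~= 0" "a + b ~= 0"
 shows "[res q a + res q b = res q (a + b) + res q (a * b * (a + b))] (mod 4)"
proof -
 obtain i u where a: "a = int q ^ i * u" and u: "\<not> int q dvd u" using prime_decomp[OF q(1) nz(1)] .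
 obtain j w where b: "b = int q ^ j * w" and w: "\<not> int q dvd w" using prime_decomp[OF q(1) nz(2)] .
 consider "i < j" | "j < i" | "i = j" by linarith
 then show ?thesis
 proof cases
 case 1 then show ?thesis using res_sum_less[OF q u w 1] a b by simp
 next
 case 2
 have "a * b * (a + b) = b * a * (b + a)" by (simp add: algebra_simps)
 moreover have "res q (b + a) = res q b" "res q (b * a * (b + a)) = res q a"
 using res_sum_less[OF q w u 2] unfolding a b by blast+
 ultimately show ?thesis by (simp only: ac_simps) simp
 next
 case 3
 have "u + w ~= 0" using nz(3) a b 3 by (auto simp flip: distrib_left)
 then obtain e v where v: "u + w = int q ^ e * v" "\<not> int q dvd v" using prime_decomp[OF q(1)] by blast
 have ab: "a + b = int q ^ (i + e) * v" using a b 3 v by (simp add: distrib_left[symmetric] power_add)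
 have abab: "a * b * (a + b) = int q ^ (i + i + (i + e)) * (u * w * v)"
 unfolding ab by (simp add: a b 3 power_add)
 have n: "\<not> int q dvd u * w * v" using prime_not_dvd_mult q u w v by blast
 have s: "res q a = (if even i then 0 else pm q u)" "res q b = (if even i then 0 else pm q w)"
 "res q (a + b) = (if even (i + e) then 0 else pm q v)"
 "res q (a * b * (a + b)) = (if even (i + e) then 0 else pm q (u * w * v))"
 proof -
 show "res q (a + b) = (if even (i + e) then 0 else pm q v)"
 unfolding ab by (rule res_pu[OF q(1) v(2)])
 show "res q (a * b * (a + b)) = (if even (i + e) then 0 else pm q (u * w * v))"
 unfolding abab using res_pu[OF q(1) n, of "i + i + (i + e)"] by simp
 qed (simp_all add: a b 3 res_pu q u w)
 show ?thesis
 proof (cases "e = 0")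
 case True then show ?thesis unfolding s using pm_sum[OF q u v(2) w] by simp
 next
 case False
 \<comment> \<open>When q divides u + w, both planes are hyperbolic modulo q, so both sides vanish
   whatever the parities of the valuations.\<close>
 then have "int q dvd u + w" using v by (simp add: dvd_power)
 then have c: "[w = - u] (mod int q)" by (simp add: cong_iff_dvd_diff add.commute)
 have "[pm q u + pm q w = 0] (mod 4)" using pm_neg[OF q u] pm_cong[OF c] by simp
 moreover have "[pm q v + pm q (u * w * v) = 0] (mod 4)" by (rule pm_cong_neg_product[OF q u v(2) c])
 ultimately show ?thesis unfolding s by (auto intro: cong_trans cong_sym)
 qed
 qed
qed

lemma res_hyp:
 assumes q: "prime q" "odd q" and nz: "a ~= 0"
 shows "[res q a + res q (- a) = 0] (mod 4)"
proof -
 obtain i u where a: "a = int q ^ i * u" and u: "\<not> int q dvd u" using prime_decomp[OF q(1) nz(1)] .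
 have "- a = int q ^ i * (- u)" using a by simp
 then have "res q (- a) = (if even i then 0 else pm q (- u))" "res q a = (if even i then 0 else pm q u)"
 using res_pu[OF q(1), of "- u" i] res_pu[OF q(1), of u i] u a by simp_all
 then show ?thesis using pm_neg[OF q u] by simp
qed

lemma sqc_res: assumes q: "prime q" "odd q" shows "sqc (res q)"
 unfolding sqc_def
proof (intro allI impI)
 fix a c :: int assume nz: "a ~= 0" "c ~= 0"
 obtain i u where a: "a = int q ^ i * u" and u: "\<not> int q dvd u" using prime_decomp[OF q(1) nz(1)] .
 obtain j t where c: "c = int q ^ j * t" and t: "\<not> int q dvd t" using prime_decomp[OF q(1) nz(2)] .
 have e: "a * c\<^sup>2 = int q ^ (i + 2 * j) * (u * t\<^sup>2)"
 unfolding a c by (simp add: power_add power_mult power_mult_distrib mult_ac power_even_eq)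
 have "\<not> int q dvd u * t\<^sup>2" using prime_not_dvd_mult[OF q(1)] u t by (simp add: power2_eq_square)
 then show "res q (a * c\<^sup>2) = res q a" unfolding e unfolding a by (simp add: res_pu q u pm_sq t)
qed

lemma par_mult:
 assumes "prime q" "a ~= 0" "b ~= 0"
 shows "[par q (a * b) = par q a + par q b] (mod 2)"
proof -
 have m: "multiplicity (int q) (a * b) = multiplicity (int q) a + multiplicity (int q) b"
 using assms by (simp add: prime_elem_multiplicity_mult_distrib)
 have "[int ((x + y) mod 2) = int (x mod 2) + int (y mod 2)] (mod 2)" for x y :: nat
 by (auto simp: cong_def mod2_eq_if)
 then show ?thesis unfolding par_def m .
qed

lemma par_uminus: "par q (- a) = par q a"
 using multiplicity_times_unit_right[of "-1::int" "int q" a] by (simp add: par_def)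

lemma sqc_par: assumes q: "prime q" shows "sqc (par q)"
 unfolding sqc_def
proof (intro allI impI)
 fix a c :: int assume "a ~= 0" "c ~= 0"
 then show "par q (a * c\<^sup>2) = par q a"
 using q prime_elem_multiplicity_mult_distrib[of "int q" a "c\<^sup>2"]
 prime_elem_multiplicity_mult_distrib[of "int q" c c]
 by (simp add: par_def power2_eq_square flip: mult_2)
qed

lemma par_sum:
 assumes q: "prime q" and nz: "a ~= 0" "b ~= 0" "a + b ~= 0"
 shows "[par q a + par q b = par q (a + b) + par q (a * b * (a + b))] (mod 2)"
proof -
 have m: "multiplicity (int q) (a * b * (a + b)) = multiplicity (int q) a + multiplicity (int q) b + multiplicity (int q) (a + b)"
 using q nz by (simp add: prime_elem_multiplicity_mult_distrib)
 have "[int (x mod 2) + int (y mod 2) = int (z mod 2) + int ((x + y + z) mod 2)] (mod 2)" for x y z :: nat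
 by (auto simp: cong_def mod2_eq_if)
 then show ?thesis unfolding par_def m .
qed

section \<open>The invariant at 2\<close>

text \<open>The flag says that the power of 2 is odd. A unit that is 3 or 5 modulo 8 then gives an
  antisquare in the sense of Conway and Sloane, and these are shifted by 4.\<close>

definition tab :: "bool \<Rightarrow> int \<Rightarrow> int" where
 "tab d r = (if d \<and> (r = 3 \<or> r = 5) then (r + 4) mod 8 else r)"

text \<open>The oddity of a form of rank one. Summed over the coefficients it is additive on Witt
  classes with values in Z/8, and it is the term at 2 of the oddity formula.\<close>

definition g2 :: "int \<Rightarrow> int" where
 "g2 a = tab (odd (multiplicity 2 a)) (unit_part 2 a mod 8)"

lemma g2_pu: assumes "odd u" shows "g2 (2 ^ k * u) = tab (odd k) (u mod 8)"
 using multiplicity_pu[of 2 u k] unit_part_pu[of 2 u k] assms by (simp add: g2_def)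

lemma odd_mod8: "odd (u::int) ==> u mod 8 = 1 \<or> u mod 8 = 3 \<or> u mod 8 = 5 \<or> u mod 8 = 7"
 by presburger

lemma two_decomp:
 assumes "a ~= 0" obtains k u where "a = 2 ^ k * u" "odd (u::int)"
 using prime_decomp[of 2 a] assms by auto

lemma mod8_mult3: "(u * w * v) mod 8 = ((u mod 8) * (w mod 8) * (v mod 8)) mod (8::int)"
proof -
 have "[u * w * v = (u mod 8) * (w mod 8) * (v mod 8)] (mod 8)"
 by (intro cong_mult) (simp_all add: cong_def)
 then show ?thesis by (simp only: cong_def)
qed

lemma mod8_lin: "(u + c * w) mod 8 = (u mod 8 + c * (w mod 8)) mod (8::int)"
proof -
 have "[u + c * w = u mod 8 + c * (w mod 8)] (mod 8)"
 by (intro cong_add cong_mult) (simp_all add: cong_def)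
 then show ?thesis by (simp only: cong_def)
qed

text \<open>For a = 2^i u and b = 2^j w with i < j, only the units modulo 8 and 2^(j - i) modulo 8
  enter, so the relation is a finite check: j - i = 1, j - i = 2, and anything larger.\<close>

lemma tab_less_table:
 "\<forall>r\<in>set [1, 3, 5, 7]. \<forall>s\<in>set [1, 3, 5, 7]. \<forall>b\<in>set [True, False].
 (tab b r + tab (\<not> b) s) mod 8 = (tab b ((r + 2 * s) mod 8) + tab (\<not> b) ((r * s * ((r + 2 * s) mod 8)) mod 8)) mod 8 \<and>
 (tab b r + tab b s) mod 8 = (tab b ((r + 4 * s) mod 8) + tab b ((r * s * ((r + 4 * s) mod 8)) mod 8)) mod 8 \<and>
 (r * s * r) mod 8 = s"
 by code_simp

lemma tab_less:
 assumes "r = 1 \<or> r = 3 \<or> r = 5 \<or> r = 7" "s = 1 \<or> s = 3 \<or> s = 5 \<or> s = 7"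
 shows "[tab b r + tab (\<not> b) s = tab b ((r + 2 * s) mod 8) + tab (\<not> b) ((r * s * ((r + 2 * s) mod 8)) mod 8)] (mod 8)"
 and "[tab b r + tab b s = tab b ((r + 4 * s) mod 8) + tab b ((r * s * ((r + 4 * s) mod 8)) mod 8)] (mod 8)"
 and "[tab b r + tab c s = tab b r + tab c ((r * s * r) mod 8)] (mod 8)"
proof -
 have "r \<in> set [1, 3, 5, 7]" "s \<in> set [1, 3, 5, 7]" "b \<in> set [True, False]"
 using assms by (simp_all only: list.set insert_iff empty_iff) blast+
 note T = tab_less_table[THEN bspec, OF this(1), THEN bspec, OF this(2), THEN bspec, OF this(3)]
 show "[tab b r + tab (\<not> b) s = tab b ((r + 2 * s) mod 8) + tab (\<not> b) ((r * s * ((r + 2 * s) mod 8)) mod 8)] (mod 8)"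
 using T unfolding cong_def by iprover
 show "[tab b r + tab b s = tab b ((r + 4 * s) mod 8) + tab b ((r * s * ((r + 4 * s) mod 8)) mod 8)] (mod 8)"
 using T unfolding cong_def by iprover
 have "(r * s * r) mod 8 = s" using T by iprover
 then show "[tab b r + tab c s = tab b r + tab c ((r * s * r) mod 8)] (mod 8)" by (simp only: cong_refl)
qed

text \<open>Equal valuations: u + w = 2^e v with e at least 1. The three lines are e = 1, e = 2 and
  e at least 3; in the last one the parity of e is free because both planes are hyperbolic at
  2.\<close>

lemma tab_eq_table:
 "\<forall>r\<in>set [1, 3, 5, 7]. \<forall>s\<in>set [1, 3, 5, 7]. \<forall>t\<in>set [1, 3, 5, 7]. \<forall>b\<in>set [True, False]. \<forall>c\<in>set [True, False].
 ((r + s) mod 8 = (2 * t) mod 8 --> (tab b r + tab b s) mod 8 = (tab (\<not> b) t + tab (\<not> b) ((r * s * t) mod 8)) mod 8) \<and>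
 ((r + s) mod 8 = (4 * t) mod 8 --> (tab b r + tab b s) mod 8 = (tab b t + tab b ((r * s * t) mod 8)) mod 8) \<and>
 ((r + s) mod 8 = 0 --> (tab b r + tab b s) mod 8 = (tab c t + tab c ((r * s * t) mod 8)) mod 8)"
 by code_simp

lemma tab_eq:
 assumes "r = 1 \<or> r = 3 \<or> r = 5 \<or> r = 7" "s = 1 \<or> s = 3 \<or> s = 5 \<or> s = 7" "t = 1 \<or> t = 3 \<or> t = 5 \<or> t = 7"
 shows "(r + s) mod 8 = (2 * t) mod 8 ==> [tab b r + tab b s = tab (\<not> b) t + tab (\<not> b) ((r * s * t) mod 8)] (mod 8)"
 and "(r + s) mod 8 = (4 * t) mod 8 ==> [tab b r + tab b s = tab b t + tab b ((r * s * t) mod 8)] (mod 8)"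
 and "(r + s) mod 8 = 0 ==> [tab b r + tab b s = tab c t + tab c ((r * s * t) mod 8)] (mod 8)"
proof -
 have "r \<in> set [1, 3, 5, 7]" "s \<in> set [1, 3, 5, 7]" "t \<in> set [1, 3, 5, 7]" "b \<in> set [True, False]" "c \<in> set [True, False]"
 using assms by (simp_all only: list.set insert_iff empty_iff) blast+
 note T = tab_eq_table[THEN bspec, OF this(1), THEN bspec, OF this(2), THEN bspec, OF this(3),
 THEN bspec, OF this(4), THEN bspec, OF this(5)]
 show "(r + s) mod 8 = (2 * t) mod 8 ==> [tab b r + tab b s = tab (\<not> b) t + tab (\<not> b) ((r * s * t) mod 8)] (mod 8)"
 using T unfolding cong_def by iprover
 show "(r + s) mod 8 = (4 * t) mod 8 ==> [tab b r + tab b s = tab b t + tab b ((r * s * t) mod 8)] (mod 8)"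
 using T unfolding cong_def by iprover
 show "(r + s) mod 8 = 0 ==> [tab b r + tab b s = tab c t + tab c ((r * s * t) mod 8)] (mod 8)"
 using T unfolding cong_def by iprover
qed

lemma g2_sum_less:
 assumes u: "odd u" and w: "odd w" and "i < j"
 defines "a \<equiv> 2 ^ i * u" and "b \<equiv> 2 ^ j * w"
 shows "[g2 a + g2 b = g2 (a + b) + g2 (a * b * (a + b))] (mod 8)"
proof -
 define u' where "u' = u + 2 ^ (j - i) * w"
 have u': "odd u'" using \<open>i < j\<close> u by (simp add: u'_def)
 have ab: "a + b = 2 ^ i * u'"
 using \<open>i < j\<close> by (simp add: a_def b_def u'_def distrib_left mult.assoc[symmetric] power_add[symmetric])
 have abab: "a * b * (a + b) = 2 ^ (i + j + i) * (u * w * u')"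
 unfolding ab by (simp add: a_def b_def power_add)
 have s: "g2 a = tab (odd i) (u mod 8)" "g2 b = tab (odd j) (w mod 8)" "g2 (a + b) = tab (odd i) (u' mod 8)"
 "g2 (a * b * (a + b)) = tab (odd j) (((u mod 8) * (w mod 8) * (u' mod 8)) mod 8)"
 proof -
 show "g2 (a + b) = tab (odd i) (u' mod 8)" unfolding ab by (rule g2_pu[OF u'])
 have "odd (u * w * u')" using u w u' by simp
 then show "g2 (a * b * (a + b)) = tab (odd j) (((u mod 8) * (w mod 8) * (u' mod 8)) mod 8)"
 unfolding abab mod8_mult3[symmetric] using g2_pu[of "u * w * u'" "i + j + i"] by (cases "even i") simp_all
 qed (simp_all only: a_def b_def g2_pu[OF u] g2_pu[OF w])
 consider "j = i + 1" | "j = i + 2" | k where "j = i + 3 + k"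
 proof -
 have "j = i + 1 \<or> j = i + 2 \<or> i + 3 \<le> j" using \<open>i < j\<close> by linarith
 then show ?thesis using that le_iff_add by blast
 qed
 then show ?thesis
 proof cases
 case 1
 then have "u' = u + 2 * w" "odd j \<longleftrightarrow> \<not> odd i" by (simp_all add: u'_def)
 then have e: "u' mod 8 = (u mod 8 + 2 * (w mod 8)) mod 8" "odd j \<longleftrightarrow> \<not> odd i" using mod8_lin by blast+
 show ?thesis unfolding s e by (rule tab_less) (rule odd_mod8[OF u], rule odd_mod8[OF w])
 next
 case 2
 then have "u' = u + 4 * w" "odd j \<longleftrightarrow> odd i" by (simp_all add: u'_def)
 then have e: "u' mod 8 = (u mod 8 + 4 * (w mod 8)) mod 8" "odd j \<longleftrightarrow> odd i" using mod8_lin by blast+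
 show ?thesis unfolding s e by (rule tab_less) (rule odd_mod8[OF u], rule odd_mod8[OF w])
 next
 case 3
 then have "2 ^ (j - i) * w = 8 * (2 ^ k * w)" by (simp add: power_add)
 then have e: "u' mod 8 = u mod 8" by (simp only: u'_def mod_mult_self2)
 show ?thesis unfolding s e by (rule tab_less) (rule odd_mod8[OF u], rule odd_mod8[OF w])
 qed
qed

lemma g2_sum:
 assumes nz: "a ~= 0" "b ~= 0" "a + b ~= 0"
 shows "[g2 a + g2 b = g2 (a + b) + g2 (a * b * (a + b))] (mod 8)"
proof -
 obtain i u where a: "a = 2 ^ i * u" and u: "odd u" using two_decomp[OF nz(1)] .
 obtain j w where b: "b = 2 ^ j * w" and w: "odd w" using two_decomp[OF nz(2)] .
 consider "i < j" | "j < i" | "i = j" by linarith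
 then show ?thesis
 proof cases
 case 1 then show ?thesis using g2_sum_less[OF u w 1] a b by simp
 next
 case 2
 have "a * b * (a + b) = b * a * (b + a)" by (simp add: algebra_simps)
 moreover have "[g2 b + g2 a = g2 (b + a) + g2 (b * a * (b + a))] (mod 8)"
 using g2_sum_less[OF w u 2] unfolding a b .
 ultimately show ?thesis by (simp only: ac_simps)
 next
 case 3
 have "u + w ~= 0" using nz(3) a b 3 by (auto simp flip: distrib_left)
 then obtain e v where v: "u + w = 2 ^ e * v" "odd v" using two_decomp by blast
 have "e ~= 0"
 proof
 assume "e = 0"
 then have "odd (u + w)" using v by simp
 then show False using u w by simp
 qed
 have ab: "a + b = 2 ^ (i + e) * v" using a b 3 v by (simp add: distrib_left[symmetric] power_add)
 have abab: "a * b * (a + b) = 2 ^ (i + i + (i + e)) * (u * w * v)"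
 unfolding ab by (simp add: a b 3 power_add)
 have s: "g2 a = tab (odd i) (u mod 8)" "g2 b = tab (odd i) (w mod 8)"
 "g2 (a + b) = tab (odd (i + e)) (v mod 8)"
 "g2 (a * b * (a + b)) = tab (odd (i + e)) (((u mod 8) * (w mod 8) * (v mod 8)) mod 8)"
 proof -
 show "g2 (a + b) = tab (odd (i + e)) (v mod 8)" unfolding ab by (rule g2_pu[OF v(2)])
 have "odd (u * w * v)" using u w v by simp
 then show "g2 (a * b * (a + b)) = tab (odd (i + e)) (((u mod 8) * (w mod 8) * (v mod 8)) mod 8)"
 unfolding abab mod8_mult3[symmetric] using g2_pu[of "u * w * v" "i + i + (i + e)"] by simp
 qed (simp_all only: a b 3 g2_pu[OF u] g2_pu[OF w])
 have uw: "(u mod 8 + w mod 8) mod 8 = ((2 ^ e mod 8) * (v mod 8)) mod 8"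
 using v(1) by (metis mod_add_eq mod_mult_eq)
 consider "e = 1" | "e = 2" | k where "e = 3 + k"
 proof -
 have "e = 1 \<or> e = 2 \<or> 3 \<le> e" using \<open>e ~= 0\<close> by linarith
 then show ?thesis using that le_iff_add by blast
 qed
 then show ?thesis
 proof cases
 case 1
 then have p: "odd (i + e) \<longleftrightarrow> \<not> odd i" by simp
 have "(u mod 8 + w mod 8) mod 8 = (2 * (v mod 8)) mod 8" using uw 1 by simp
 then show ?thesis unfolding s p by (intro tab_eq odd_mod8 u w v)
 next
 case 2
 then have p: "odd (i + e) \<longleftrightarrow> odd i" by simp
 have "(u mod 8 + w mod 8) mod 8 = (4 * (v mod 8)) mod 8" using uw 2 by simp
 then show ?thesis unfolding s p by (intro tab_eq odd_mod8 u w v)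
 next
 case 3
 then have "(2::int) ^ e mod 8 = 0" by (simp add: power_add)
 then have "(u mod 8 + w mod 8) mod 8 = 0" using uw by simp
 then show ?thesis unfolding s by (intro tab_eq odd_mod8 u w v)
 qed
 qed
qed

lemma tab_neg_table:
 "\<forall>r\<in>set [1, 3, 5, 7]. \<forall>b\<in>set [True, False]. (tab b r + tab b ((8 - r) mod 8)) mod 8 = 0 mod 8"
 by code_simp

lemma g2_hyp:
 assumes nz: "a ~= 0"
 shows "[g2 a + g2 (- a) = 0] (mod 8)"
proof -
 obtain i u where a: "a = 2 ^ i * u" and u: "odd u" using two_decomp[OF nz] .
 have na: "- a = 2 ^ i * (- u)" using a by simp
 have "g2 a = tab (odd i) (u mod 8)" "g2 (- a) = tab (odd i) ((8 - (u mod 8)) mod 8)"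
 proof -
 have m: "(- u) mod 8 = (8 - u mod 8) mod 8" by presburger
 have "odd (- u)" using u by simp
 from g2_pu[OF this, of i] show "g2 (- a) = tab (odd i) ((8 - (u mod 8)) mod 8)"
 unfolding na m .
 qed (simp only: a g2_pu[OF u])
 moreover have "u mod 8 \<in> set [1, 3, 5, 7]" "odd i \<in> set [True, False]" using odd_mod8[OF u] by auto
 ultimately show ?thesis using tab_neg_table unfolding cong_def by metis
qed

lemma sqc_g2: "sqc g2"
 unfolding sqc_def
proof (intro allI impI)
 fix a c :: int assume nz: "a ~= 0" "c ~= 0"
 obtain i u where a: "a = 2 ^ i * u" and u: "odd u" using two_decomp[OF nz(1)] .
 obtain j t where c: "c = 2 ^ j * t" and t: "odd t" using two_decomp[OF nz(2)] .
 have e: "a * c\<^sup>2 = 2 ^ (i + 2 * j) * (t * t * u)"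
 unfolding a c by (simp add: power_add power_mult power_mult_distrib mult_ac power_even_eq power2_eq_square)
 have "(t * t * u) mod 8 = ((t mod 8) * (t mod 8) * (u mod 8)) mod 8" by (rule mod8_mult3)
 also have "... = u mod 8" using odd_mod8[OF t] odd_mod8[OF u] by auto
 finally show "g2 (a * c\<^sup>2) = g2 a" unfolding e unfolding a by (simp add: g2_pu u t)
qed

lemma witt_res:
 assumes "prime q" "odd q" "witt X Y"
 shows "[(\<Sum>a\<in>#X. ext (res q) a) = (\<Sum>a\<in>#Y. ext (res q) a)] (mod 4)"
 using assms by (intro witt_ext sqc_res res_hyp res_sum)

lemma witt_par:
 assumes "prime q" "witt X Y"
 shows "[(\<Sum>a\<in>#X. ext (par q) a) = (\<Sum>a\<in>#Y. ext (par q) a)] (mod 2)"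
proof (intro witt_ext sqc_par par_sum assms)
 show "[par q a + par q (- a) = 0] (mod 2)" for a by (simp add: par_uminus cong_def flip: mult_2)
qed

lemma witt_g2:
 assumes "witt X Y"
 shows "[(\<Sum>a\<in>#X. ext g2 a) = (\<Sum>a\<in>#Y. ext g2 a)] (mod 8)"
 using assms by (intro witt_ext sqc_g2 g2_hyp g2_sum)

section \<open>Bilinear forms on finite index sets\<close>

text \<open>Index sets in place of dimensions allow a pivot to be deleted without renumbering the
  other indices.\<close>

definition bl :: "nat set \<Rightarrow> (nat \<Rightarrow> nat \<Rightarrow> 'a :: comm_ring_1) \<Rightarrow> (nat \<Rightarrow> 'a) \<Rightarrow> (nat \<Rightarrow> 'a) \<Rightarrow> 'a" where
 "bl I S u v = (\<Sum>j\<in>I. \<Sum>k\<in>I. u j * S j k * v k)"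

text \<open>The vectors are the columns of \<open>V\<close>. They have to be orthogonal with nonzero
  norms but need not generate the lattice, so integer matrices serve for rational
  diagonalizations.\<close>

definition obas :: "nat set \<Rightarrow> (nat \<Rightarrow> nat \<Rightarrow> 'a :: comm_ring_1) \<Rightarrow> (nat \<Rightarrow> nat \<Rightarrow> 'a) \<Rightarrow> (nat \<Rightarrow> 'a) \<Rightarrow> bool" where
 "obas I S V d \<longleftrightarrow> (\<forall>a\<in>I. d a ~= 0) \<and>
 (\<forall>a\<in>I. \<forall>b\<in>I. bl I S (\<lambda>k. V k a) (\<lambda>k. V k b) = (if a = b then d a else 0))"

lemma bl_cong: "(\<And>j k. j \<in> I ==> k \<in> I ==> S j k = S' j k) ==> (\<And>j. j \<in> I ==> u j = u' j) ==>
 (\<And>j. j \<in> I ==> v j = v' j) ==> bl I S u v = bl I S' u' v'"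
 unfolding bl_def by (intro sum.cong) auto

lemma bl_row: "bl I S u v = (\<Sum>j\<in>I. u j * (\<Sum>k\<in>I. S j k * v k))"
 unfolding bl_def by (simp add: sum_distrib_left mult.assoc)

lemma bl_sym: "(\<And>j k. j \<in> I ==> k \<in> I ==> S j k = S k j) ==> bl I S u v = bl I S v u"
 unfolding bl_def by (subst sum.swap) (auto intro!: sum.cong simp: mult_ac)

lemma bl_add_left: "bl I S (\<lambda>k. u k + w k) v = bl I S u v + bl I S w v"
 unfolding bl_def by (simp add: sum.distrib algebra_simps)
lemma bl_add_right: "bl I S v (\<lambda>k. u k + w k) = bl I S v u + bl I S v w"
 unfolding bl_def by (simp add: sum.distrib algebra_simps)
lemma bl_scale_left: "bl I S (\<lambda>k. c * u k) v = c * bl I S u v"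
 unfolding bl_def by (simp add: sum_distrib_left mult.assoc)
lemma bl_scale_right: "bl I S v (\<lambda>k. c * u k) = c * bl I S v u"
 unfolding bl_def by (simp add: sum_distrib_left mult_ac)
lemma bl_sum_left: "bl I S (\<lambda>k. \<Sum>a\<in>K. c a * x a k) v = (\<Sum>a\<in>K. c a * bl I S (x a) v)"
 unfolding bl_def sum_distrib_right sum_distrib_left
 by (subst (2) sum.swap, subst sum.swap) (auto intro!: sum.cong simp: mult_ac)
lemma bl_sum_right: "bl I S v (\<lambda>k. \<Sum>a\<in>K. c a * x a k) = (\<Sum>a\<in>K. c a * bl I S v (x a))"
 unfolding bl_def sum_distrib_right sum_distrib_left
 by (subst (2) sum.swap, subst sum.swap) (auto intro!: sum.cong simp: mult_ac)

definition symon :: "nat set \<Rightarrow> (nat \<Rightarrow> nat \<Rightarrow> 'a) \<Rightarrow> bool" where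
 "symon I S \<longleftrightarrow> (\<forall>j\<in>I. \<forall>k\<in>I. S j k = S k j)"

subsection \<open>Chain equivalence of diagonal forms\<close>

text \<open>The vector c1 e1 + c2 e2 of the plane has norm s, and the norm of its orthogonal
  complement is a1 a2 s up to squares.\<close>

lemma witt_plane:
 fixes a1 a2 c1 c2 s :: "'a :: field"
 assumes "a1 ~= 0" "a2 ~= 0" "c1 ~= 0" "c2 ~= 0" "s = a1 * c1\<^sup>2 + a2 * c2\<^sup>2" "s ~= 0"
 shows "witt {#a1, a2#} {#s, a1 * a2 * s#}"
proof -
 have "witt {#a1, a2#} ({#a1 * c1\<^sup>2#} + {#a2 * c2\<^sup>2#})"
 using witt_add[OF witt_sym[OF witt_sq1[of a1 c1]] witt_sym[OF witt_sq1[of a2 c2]]] assms by (simp add: add_mset_commute)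
 also have "witt ({#a1 * c1\<^sup>2#} + {#a2 * c2\<^sup>2#}) {#s, (a1 * c1\<^sup>2) * (a2 * c2\<^sup>2) * s#}"
 using witt_sum1[of "a1 * c1\<^sup>2" "a2 * c2\<^sup>2"] assms by (simp add: add_mset_commute)
 also have "(a1 * c1\<^sup>2) * (a2 * c2\<^sup>2) * s = (a1 * a2 * s) * (c1 * c2)\<^sup>2" by (simp add: power_mult_distrib)
 also have "witt {#s, (a1 * a2 * s) * (c1 * c2)\<^sup>2#} {#s, a1 * a2 * s#}"
 using witt_sq[of "a1 * a2 * s" "c1 * c2" "{#s#}"] assms by (simp add: add_mset_commute)
 finally show ?thesis .
qed

lemma image_mset_remove:
 assumes "finite I" "i \<in> I"
 shows "image_mset f (mset_set I) = add_mset (f i) (image_mset f (mset_set (I - {i})))"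
 using assms by (metis image_mset_add_mset mset_set.remove)

lemma divide_aux:
 fixes s :: "'a :: field"
 assumes "s ~= 0"
 shows "s * (A / s) * (B / s) + (D * s) * (E / s) * (F / s) = (A * B + D * E * F) / s"
 using assms by (simp add: add_divide_distrib)

text \<open>The fractions are the coordinates of x and y with respect to c1 e1 + c2 e2 and - a2 c2
  e1 + a1 c1 e2, whose norms are s and a1 a2 s; both sides are the same scalar product.\<close>

lemma plane_identity:
 fixes s :: "'a :: field"
 assumes s: "s = a1 * c1 * c1 + a2 * c2 * c2" "s ~= 0"
 shows "s * ((a1 * c1 * x1 + a2 * c2 * x2) / s) * ((a1 * c1 * y1 + a2 * c2 * y2) / s) +
 (a1 * a2 * s) * ((c1 * x2 - c2 * x1) / s) * ((c1 * y2 - c2 * y1) / s) = a1 * x1 * y1 + a2 * x2 * y2"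
proof -
 have "(a1 * c1 * x1 + a2 * c2 * x2) * (a1 * c1 * y1 + a2 * c2 * y2) + (a1 * a2) * (c1 * x2 - c2 * x1) * (c1 * y2 - c2 * y1)
 = s * (a1 * x1 * y1 + a2 * x2 * y2)" unfolding s(1) by (simp add: algebra_simps)
 moreover have "s * ((a1 * c1 * x1 + a2 * c2 * x2) / s) * ((a1 * c1 * y1 + a2 * c2 * y2) / s) +
 (a1 * a2 * s) * ((c1 * x2 - c2 * x1) / s) * ((c1 * y2 - c2 * y1) / s)
 = ((a1 * c1 * x1 + a2 * c2 * x2) * (a1 * c1 * y1 + a2 * c2 * y2) + (a1 * a2) * (c1 * x2 - c2 * x1) * (c1 * y2 - c2 * y1)) / s"
 by (rule divide_aux[OF s(2)])
 ultimately show ?thesis using s(2) by simp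
qed

text \<open>Witt's chain equivalence. One vector of the second basis is brought onto a basis vector
  by changing the orthogonal basis inside planes, each change removing one of its nonzero
  coordinates; then both are split off. A change inside a plane is exactly what the relations of
  \<open>witt\<close> provide.\<close>

lemma chain_equivalence:
 fixes a b :: "nat \<Rightarrow> 'a :: field_char_0"
 assumes "finite I" "finite J" "card I = card J" "\<And>i. i \<in> I ==> a i ~= 0" "\<And>j. j \<in> J ==> b j ~= 0"
 and "\<And>j j'. j \<in> J ==> j' \<in> J ==> (\<Sum>i\<in>I. a i * P i j * P i j') = (if j = j' then b j else 0)"
 shows "witt (image_mset a (mset_set I)) (image_mset b (mset_set J))"
 using assms
proof (induction "card J" arbitrary: I J a b P)
 case 0
 then show ?case by (simp add: witt_refl)
next
 case (Suc n)
 note outer = Suc.hyps(1) and cJ = Suc.hyps(2)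
 obtain j0 where j0: "j0 \<in> J" using cJ by fastforce
 show ?case using Suc.prems
 proof (induction "card {i\<in>I. P i j0 ~= 0}" arbitrary: a P rule: less_induct)
 case less
 note fI = less.prems(1) and fJ = less.prems(2) and IJ = less.prems(3) and an = less.prems(4) and bn = less.prems(5) and orth = less.prems(6)
 let ?T = "{i\<in>I. P i j0 ~= 0}"
 have finT: "finite ?T" using fI by simp
 have bj: "(\<Sum>i\<in>?T. a i * P i j0 * P i j0) = b j0"
 proof -
 have "(\<Sum>i\<in>?T. a i * P i j0 * P i j0) = (\<Sum>i\<in>I. a i * P i j0 * P i j0)"
 using fI by (intro sum.mono_neutral_left) auto
 then show ?thesis using orth[OF j0 j0] by simp
 qed
 have "?T ~= {}"
 proof
 assume "?T = {}"
 then have "b j0 = 0" using bj by (metis sum.empty)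
 then show False using bn j0 by blast
 qed
 then obtain i0 where i0: "i0 \<in> ?T" by blast
 show ?case
 proof (cases "?T = {i0}")
 case True
 then have z: "P i j0 = 0" if "i \<in> I" "i ~= i0" for i using that by auto
 have i0I: "i0 \<in> I" and c0: "P i0 j0 ~= 0" using i0 by auto
 have b0: "b j0 = a i0 * (P i0 j0)\<^sup>2" using bj True by (simp add: power2_eq_square mult.assoc)
 \<comment> \<open>The vector of index \<open>j0\<close> is now a multiple of the basis vector
   \<open>i0\<close>, so orthogonality to it clears the rest of the row \<open>i0\<close>.\<close>
 have r0: "P i0 j = 0" if "j \<in> J" "j ~= j0" for j
 proof -
 have "(\<Sum>i\<in>I. a i * P i j0 * P i j) = a i0 * P i0 j0 * P i0 j"
 using fI i0I z by (simp add: sum.remove[of I i0])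
 then show ?thesis using orth[OF j0 that(1)] that(2) an[OF i0I] c0 by auto
 qed
 have "witt (image_mset a (mset_set (I - {i0}))) (image_mset b (mset_set (J - {j0})))"
 proof (rule outer)
 show "n = card (J - {j0})" using cJ j0 fJ by simp
 show "card (I - {i0}) = card (J - {j0})" using IJ i0I j0 fI fJ by simp
 fix j j' assume jj: "j \<in> J - {j0}" "j' \<in> J - {j0}"
 have "(\<Sum>i\<in>I. a i * P i j * P i j') = (\<Sum>i\<in>I - {i0}. a i * P i j * P i j')"
 using fI i0I r0 jj by (simp add: sum.remove[of I i0])
 then show "(\<Sum>i\<in>I - {i0}. a i * P i j * P i j') = (if j = j' then b j else 0)"
 using orth[of j j'] jj by simp
 qed (use fI fJ an bn in auto)
 moreover have "witt {#a i0#} {#b j0#}"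
 unfolding b0 using an[OF i0I] c0 by (intro witt_sym[OF witt_sq1])
 ultimately have "witt (image_mset a (mset_set (I - {i0})) + {#a i0#}) (image_mset b (mset_set (J - {j0})) + {#b j0#})"
 by (rule witt_add)
 then show ?thesis by (subst image_mset_remove[OF fI i0I], subst image_mset_remove[OF fJ j0]) simp
 next
 case False
 \<comment> \<open>A plane with nonzero partial norm is needed. If all pairs had partial norm 0, two
   coordinates alone would give \<open>b j0\<close> = 0, and three would give 2 \<open>q i0\<close>
   = 0, impossible in characteristic 0.\<close>
 have "\<exists>i1\<in>?T. \<exists>i2\<in>?T. i1 ~= i2 \<and> a i1 * P i1 j0 * P i1 j0 + a i2 * P i2 j0 * P i2 j0 ~= 0"
 proof (rule ccontr)
 assume nex: "\<not> ?thesis"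
 define q where "q = (\<lambda>i. a i * P i j0 * P i j0)"
 have q2: "q i + q i' = 0" if "i \<in> ?T" "i' \<in> ?T" "i ~= i'" for i i' using nex that unfolding q_def by blast
 have q0: "q i ~= 0" if "i \<in> ?T" for i using that an by (auto simp: q_def)
 obtain i1 where i1: "i1 \<in> ?T" "i1 ~= i0" using False i0 by blast
 show False
 proof (cases "?T = {i0, i1}")
 case True
 then have "b j0 = q i0 + q i1" using bj i1 unfolding q_def by (simp add: True)
 then show False using q2[OF i0 i1(1)] i1 bn[OF j0] by simp
 next
 case F: False
 then obtain i2 where i2: "i2 \<in> ?T" "i2 ~= i0" "i2 ~= i1" using i0 i1 by blast
 have "q i0 = - q i1" "q i0 = - q i2" "q i1 = - q i2"
 using q2[OF i0 i1(1)] q2[OF i0 i2(1)] q2[OF i1(1) i2(1)] i1 i2 by (auto simp: add_eq_0_iff2)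
 then have "2 * q i0 = 0" by simp
 then show False using q0[OF i0] by simp
 qed
 qed
 then obtain i1 i2 where i12: "i1 \<in> ?T" "i2 \<in> ?T" "i1 ~= i2" and
 snz: "a i1 * P i1 j0 * P i1 j0 + a i2 * P i2 j0 * P i2 j0 ~= 0" by blast
 define c1 c2 a1 a2 where "c1 = P i1 j0" and "c2 = P i2 j0" and "a1 = a i1" and "a2 = a i2"
 define s where "s = a1 * c1 * c1 + a2 * c2 * c2"
 have s0: "s ~= 0" using snz by (simp add: s_def c1_def c2_def a1_def a2_def)
 have cn: "c1 ~= 0" "c2 ~= 0" "a1 ~= 0" "a2 ~= 0" using i12 an by (auto simp: c1_def c2_def a1_def a2_def)
 have I12: "i1 \<in> I" "i2 \<in> I - {i1}" using i12 by auto
 define a' where "a' = a(i1 := s, i2 := a1 * a2 * s)"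
 define P' where "P' = (\<lambda>i j. if i = i1 then (a1 * c1 * P i1 j + a2 * c2 * P i2 j) / s
 else if i = i2 then (c1 * P i2 j - c2 * P i1 j) / s else P i j)"
 let ?R = "I - {i1} - {i2}"
 have a'R: "image_mset a' (mset_set ?R) = image_mset a (mset_set ?R)"
 using fI by (intro image_mset_cong) (auto simp: a'_def)
 have sp: "(\<Sum>i\<in>I. h i) = h i1 + h i2 + (\<Sum>i\<in>?R. h i)" for h :: "nat \<Rightarrow> 'a"
 using fI I12 by (simp add: sum.remove[of I i1] sum.remove[of "I - {i1}" i2])
 have ms: "image_mset f (mset_set I) = image_mset f (mset_set ?R) + {#f i1, f i2#}" for f :: "nat \<Rightarrow> 'a"
 using image_mset_remove[of I i1 f] image_mset_remove[of "I - {i1}" i2 f] fI I12 by (simp add: add_mset_commute)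
 have w1: "witt (image_mset a (mset_set I)) (image_mset a' (mset_set I))"
 proof -
 have "witt {#a1, a2#} {#s, a1 * a2 * s#}"
 using cn s0 by (intro witt_plane[of _ _ c1 c2]) (auto simp: s_def power2_eq_square mult.assoc)
 then have "witt (image_mset a (mset_set ?R) + {#a1, a2#}) (image_mset a (mset_set ?R) + {#s, a1 * a2 * s#})"
 by (intro witt_add witt_refl)
 then show ?thesis unfolding ms a'R using i12(3) by (simp add: a'_def a1_def a2_def)
 qed
 have "witt (image_mset a' (mset_set I)) (image_mset b (mset_set J))"
 proof (rule less.hyps)
 have "{i\<in>I. P' i j0 ~= 0} = ?T - {i2}"
 proof -
 have e1: "P' i1 j0 = 1" using s0 unfolding P'_def c1_def[symmetric] c2_def[symmetric] by (simp add: s_def)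
 have e2: "P' i2 j0 = 0" using i12(3) unfolding P'_def c1_def[symmetric] c2_def[symmetric] by simp
 have e3: "P' i j0 = P i j0" if "i ~= i1" "i ~= i2" for i using that by (simp add: P'_def)
 show ?thesis
 proof (rule Set.set_eqI)
 fix i
 show "i \<in> {i\<in>I. P' i j0 ~= 0} \<longleftrightarrow> i \<in> ?T - {i2}"
 proof (cases "i = i1 \<or> i = i2")
 case True then show ?thesis using i12 e1 e2 by auto
 next
 case False then show ?thesis using e3[of i] by simp
 qed
 qed
 qed
 then show "card {i\<in>I. P' i j0 ~= 0} < card ?T" using i12(2) finT by (metis card_Diff1_less)
 show "a' i ~= 0" if "i \<in> I" for i using that an s0 cn by (auto simp: a'_def)
 fix j j' assume jj: "j \<in> J" "j' \<in> J"
 have "(\<Sum>i\<in>?R. a' i * P' i j * P' i j') = (\<Sum>i\<in>?R. a i * P i j * P i j')"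
 by (intro sum.cong) (auto simp: a'_def P'_def)
 moreover have "a' i1 * P' i1 j * P' i1 j' + a' i2 * P' i2 j * P' i2 j' = a i1 * P i1 j * P i1 j' + a i2 * P i2 j * P i2 j'"
 using plane_identity[OF s_def s0, of "P i1 j" "P i2 j" "P i1 j'" "P i2 j'"] i12(3)
 by (simp add: a'_def P'_def a1_def a2_def)
 ultimately have "(\<Sum>i\<in>I. a' i * P' i j * P' i j') = (\<Sum>i\<in>I. a i * P i j * P i j')"
 unfolding sp by simp
 then show "(\<Sum>i\<in>I. a' i * P' i j * P' i j') = (if j = j' then b j else 0)" using orth[OF jj] by simp
 qed (use less.prems in auto)
 then show ?thesis using w1 witt_trans by blast
 qed
 qed
qed

subsection \<open>Uniqueness of the Witt class of a nondegenerate form\<close>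

definition mt :: "nat \<Rightarrow> (nat \<Rightarrow> nat \<Rightarrow> 'a) \<Rightarrow> 'a mat" where
 "mt n S = mat n n (\<lambda>(i, j). S i j)"

lemma mt_carrier [simp]: "mt n S \<in> carrier_mat n n"
 by (simp add: mt_def)

lemma mt_index [simp]: "i < n ==> j < n ==> mt n S $$ (i, j) = S i j"
 by (simp add: mt_def)

lemma mt_dim [simp]: "dim_row (mt n S) = n" "dim_col (mt n S) = n"
 by (simp_all add: mt_def)

lemma mt_congruence:
 assumes "a < n" "b < n"
 shows "(transpose_mat (mt n V) * mt n S * mt n V) $$ (a, b) = bl {..<n} S (\<lambda>k. V k a) (\<lambda>k. V k b)"
 using assms unfolding bl_def
 by (simp add: scalar_prod_def sum_distrib_right atLeast0LessThan)
 (subst sum.swap, simp)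

lemma obas_mat:
 assumes "obas {..<n} S V d"
 shows "transpose_mat (mt n V) * mt n S * mt n V = mt n (\<lambda>i j. if i = j then d i else 0)"
 by (rule eq_matI) (use assms in \<open>auto simp: mt_congruence obas_def simp del: index_mult_mat(1)\<close>)

lemma det_diag: "det (mt n (\<lambda>i j. if i = j then d i else (0 :: 'a :: comm_ring_1))) = (\<Prod>i<n. d i)"
proof -
 have "det (mt n (\<lambda>i j. if i = j then d i else 0)) = prod_list (diag_mat (mt n (\<lambda>i j. if i = j then d i else 0)))"
 by (rule det_upper_triangular[of _ n]) auto
 also have "diag_mat (mt n (\<lambda>i j. if i = j then d i else 0)) = map d [0..<n]"
 by (simp add: diag_mat_def)
 also have "prod_list (map d [0..<n]) = (\<Prod>i<n. d i)"
 by (metis atLeast_upt prod.distinct_set_conv_list distinct_upt)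
 finally show ?thesis .
qed

lemma obas_det:
 assumes "obas {..<n} S V d"
 shows "(det (mt n V))\<^sup>2 * det (mt n S) = (\<Prod>i<n. d i)"
proof -
 have "det (transpose_mat (mt n V) * mt n S * mt n V) = det (mt n V) * det (mt n S) * det (mt n V)"
 using det_mult[of "transpose_mat (mt n V) * mt n S" n "mt n V"] det_mult[of "transpose_mat (mt n V)" n "mt n S"]
 det_transpose[of "mt n V" n] by (simp add: mult_carrier_mat[of _ n n])
 then show ?thesis using obas_mat[OF assms] det_diag[of n d] by (simp add: power2_eq_square mult_ac)
qed

lemma mat_assoc5:
 assumes "A \<in> carrier_mat n n" "B \<in> carrier_mat n n" "D \<in> carrier_mat n n" "R \<in> carrier_mat n n" "W \<in> carrier_mat n n"
 shows "(A * B) * D * (R * W) = A * (B * D * R) * W"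
proof -
 have BD: "B * D \<in> carrier_mat n n" using assms by (intro mult_carrier_mat[of _ n n])
 have BDR: "B * D * R \<in> carrier_mat n n" using BD assms by (intro mult_carrier_mat[of _ n n])
 have RW: "R * W \<in> carrier_mat n n" using assms by (intro mult_carrier_mat[of _ n n])
 have "(A * B) * D = A * (B * D)" by (rule assoc_mult_mat[OF assms(1-3)])
 also have "A * (B * D) * (R * W) = A * ((B * D) * (R * W))" by (rule assoc_mult_mat[OF assms(1) BD RW])
 also have "(B * D) * (R * W) = B * D * R * W" by (rule assoc_mult_mat[OF BD assms(4,5), symmetric])
 also have "A * (B * D * R * W) = A * (B * D * R) * W" by (rule assoc_mult_mat[OF assms(1) BDR assms(5), symmetric])
 finally show ?thesis .
qed

lemma obas_witt:
 fixes S :: "nat \<Rightarrow> nat \<Rightarrow> 'a :: field_char_0"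
 assumes o1: "obas {..<n} S V d" and o2: "obas {..<n} S V' d'" and sym: "symon {..<n} S"
 shows "witt (image_mset d (mset_set {..<n})) (image_mset d' (mset_set {..<n}))"
proof -
 let ?D = "mt n (\<lambda>i j. if i = j then d i else 0)" and ?E = "mt n (\<lambda>i j. if i = j then inverse (d i) else 0)"
 let ?S = "mt n S" and ?V = "mt n V" and ?V' = "mt n V'"
 have d0: "\<And>i. i < n ==> d i ~= 0" using o1 by (simp add: obas_def)
 have delta: "(\<Sum>k = 0..<n. (if i = k then x k else 0) * y k) = x i * y i" if "i < n" for x y :: "nat \<Rightarrow> 'a" and i
 using that by (subst sum.remove[of _ i]) (auto intro!: sum.neutral)
 have ED: "?E * ?D = 1\<^sub>m n"
 by (rule eq_matI) (auto simp: scalar_prod_def delta d0)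
 have tE: "transpose_mat ?E = ?E" and tD: "transpose_mat ?D = ?D" by (rule eq_matI; auto)+
 have tS: "transpose_mat ?S = ?S" using sym by (intro eq_matI) (auto simp: symon_def)
 \<comment> \<open>An orthogonal basis is inverted by means of its norms: R is the inverse of V, and
   R V' expresses the second basis in the first one.\<close>
 define R where "R = ?E * (transpose_mat ?V * ?S)"
 have VS: "transpose_mat ?V * ?S \<in> carrier_mat n n" by (rule mult_carrier_mat[of _ n n]) auto
 have R: "R \<in> carrier_mat n n" unfolding R_def using VS by (intro mult_carrier_mat[of _ n n]) auto
 have "R * ?V = ?E * (transpose_mat ?V * ?S * ?V)"
 unfolding R_def by (rule assoc_mult_mat[of _ n n _ n _ n]) auto
 then have "R * ?V = 1\<^sub>m n" using obas_mat[OF o1] ED by simp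
 then have VR: "?V * R = 1\<^sub>m n" using mat_mult_left_right_inverse[OF R, of ?V] by simp
 have tR: "transpose_mat R = ?S * ?V * ?E"
 proof -
 have "transpose_mat R = transpose_mat (transpose_mat ?V * ?S) * transpose_mat ?E"
 unfolding R_def by (rule transpose_mult[of _ n n _ n]) auto
 also have "transpose_mat (transpose_mat ?V * ?S) = transpose_mat ?S * transpose_mat (transpose_mat ?V)"
 by (rule transpose_mult[of _ n n _ n]) auto
 finally show ?thesis by (simp add: tE tS)
 qed
 have c: "transpose_mat R * ?D * R = ?S"
 proof -
 have "transpose_mat R * ?D = ?S * ?V * (?E * ?D)"
 unfolding tR by (rule assoc_mult_mat[of _ n n _ n _ n]) auto
 also have "... = ?S * ?V" unfolding ED by (rule right_mult_one_mat[of _ n n], rule mult_carrier_mat[of _ n n]) auto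
 finally have "transpose_mat R * ?D * R = ?S * ?V * R" by simp
 also have "... = ?S * (?V * R)" using R by (intro assoc_mult_mat[of _ n n _ n _ n]) auto
 also have "... = ?S" unfolding VR by (rule right_mult_one_mat[of _ n n]) auto
 finally show ?thesis .
 qed
 define P where "P = R * ?V'"
 have P: "P \<in> carrier_mat n n" unfolding P_def using R by (intro mult_carrier_mat[of _ n n]) auto
 have PP: "transpose_mat P * ?D * P = transpose_mat ?V' * ?S * ?V'"
 proof -
 have tP: "transpose_mat P = transpose_mat ?V' * transpose_mat R"
 unfolding P_def by (rule transpose_mult[OF R]) auto
 have "transpose_mat P * ?D * P = transpose_mat ?V' * (transpose_mat R * ?D * R) * ?V'"
 unfolding tP unfolding P_def using R by (intro mat_assoc5[of _ n]) auto
 then show ?thesis using c by simp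
 qed
 define p where "p = (\<lambda>i j. P $$ (i, j))"
 have Pp: "P = mt n p" using P by (intro eq_matI) (auto simp: p_def)
 show ?thesis
 proof (rule chain_equivalence)
 fix j j' assume jj: "j \<in> {..<n}" "j' \<in> {..<n}"
 have "bl {..<n} (\<lambda>i j. if i = j then d i else 0) (\<lambda>k. p k j) (\<lambda>k. p k j') = (if j = j' then d' j else 0)"
 using jj PP obas_mat[OF o2] mt_congruence[of j n j' p "\<lambda>i j. if i = j then d i else 0"] unfolding Pp by auto
 moreover have "bl {..<n} (\<lambda>i j. if i = j then d i else 0) (\<lambda>k. p k j) (\<lambda>k. p k j') = (\<Sum>i<n. d i * p i j * p i j')"
 unfolding bl_row
 proof (rule sum.cong[OF refl])
 fix i assume "i \<in> {..<n}"
 then have "(\<Sum>k<n. (if i = k then d i else 0) * p k j') = d i * p i j'"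
 by (subst sum.remove[of _ i]) (auto intro!: sum.neutral)
 then show "p i j * (\<Sum>k<n. (if i = k then d i else 0) * p k j') = d i * p i j * p i j'" by simp
 qed
 ultimately show "(\<Sum>i<n. d i * p i j * p i j') = (if j = j' then d' j else 0)" by simp
 qed (use o1 o2 in \<open>auto simp: obas_def\<close>)
qed

lemma obas_congruence:
 assumes "obas I S' V d" and fin: "finite I"
 and S': "\<And>j k. j \<in> I ==> k \<in> I ==> S' j k = bl I S (\<lambda>i. T i j) (\<lambda>i. T i k)"
 shows "obas I S (\<lambda>i a. \<Sum>j\<in>I. V j a * T i j) d"
 unfolding obas_def
proof (intro conjI ballI)
 fix a b assume ab: "a \<in> I" "b \<in> I"
 have "bl I S (\<lambda>i. \<Sum>j\<in>I. V j a * T i j) (\<lambda>i. \<Sum>j\<in>I. V j b * T i j) =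
 (\<Sum>j\<in>I. V j a * (\<Sum>k\<in>I. V k b * bl I S (\<lambda>i. T i j) (\<lambda>i. T i k)))"
 by (simp add: bl_sum_left bl_sum_right)
 also have "... = bl I S' (\<lambda>k. V k a) (\<lambda>k. V k b)"
 proof -
 have "(\<Sum>k\<in>I. V k b * bl I S (\<lambda>i. T i j) (\<lambda>i. T i k)) = (\<Sum>k\<in>I. S' j k * V k b)" if "j \<in> I" for j
 by (intro sum.cong) (simp_all add: S' that mult.commute)
 then show ?thesis unfolding bl_row by simp
 qed
 finally show "bl I S (\<lambda>i. \<Sum>j\<in>I. V j a * T i j) (\<lambda>i. \<Sum>j\<in>I. V j b * T i j) = (if a = b then d a else 0)"
 using assms(1) ab by (simp add: obas_def)
qed (use assms(1) in \<open>simp add: obas_def\<close>)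

lemma obas_of_int:
 assumes "obas I S V d"
 shows "obas I (\<lambda>i j. rat_of_int (S i j)) (\<lambda>i j. rat_of_int (V i j)) (\<lambda>i. rat_of_int (d i))"
proof -
 have "bl I (\<lambda>i j. rat_of_int (S i j)) (\<lambda>k. rat_of_int (V k a)) (\<lambda>k. rat_of_int (V k b))
 = rat_of_int (bl I S (\<lambda>k. V k a) (\<lambda>k. V k b))" for a b by (simp add: bl_def)
 then show ?thesis using assms unfolding obas_def by simp
qed

subsection \<open>Pivoting\<close>

text \<open>Nondegeneracy modulo p stated as injectivity: unlike a determinant it makes sense on any
  index set and passes easily to pivots.\<close>

definition nd :: "int \<Rightarrow> nat set \<Rightarrow> (nat \<Rightarrow> nat \<Rightarrow> int) \<Rightarrow> bool" where
 "nd p I S \<longleftrightarrow> (\<forall>x. (\<forall>i\<in>I. p dvd (\<Sum>k\<in>I. S i k * x k)) --> (\<forall>i\<in>I. p dvd x i))"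

lemma nd_entry:
 assumes "nd p I S" "i \<in> I" "finite I" "prime p"
 shows "\<exists>j\<in>I. \<not> p dvd S j i"
proof (rule ccontr)
 assume h: "\<not> ?thesis"
 let ?x = "\<lambda>k. if k = i then 1 else (0::int)"
 have "(\<Sum>k\<in>I. S j k * ?x k) = S j i" for j using assms(2,3) by (subst sum.remove[of _ i]) (auto intro!: sum.neutral)
 then have "\<forall>j\<in>I. p dvd (\<Sum>k\<in>I. S j k * ?x k)" using h by simp
 then have "p dvd ?x i"
 using assms(1)[unfolded nd_def, THEN spec[of _ ?x], THEN mp] assms(2) by blast
 then show False using assms(4) by (simp add: not_prime_unit)
qed

text \<open>The Schur complement of the entry \<open>S i i\<close>, multiplied by its square to stay
  integral: the Gram matrix of the vectors \<open>S i i\<close> e_k - \<open>S i k\<close> e_i,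
  which are orthogonal to e_i and which \<open>plift\<close> combines.\<close>

definition piv :: "(nat \<Rightarrow> nat \<Rightarrow> 'a :: comm_ring_1) \<Rightarrow> nat \<Rightarrow> nat \<Rightarrow> nat \<Rightarrow> 'a" where
 "piv S i j k = S i i * S i i * S j k - S i i * S i j * S i k"

definition plift :: "nat set \<Rightarrow> (nat \<Rightarrow> nat \<Rightarrow> 'a :: comm_ring_1) \<Rightarrow> nat \<Rightarrow> (nat \<Rightarrow> 'a) \<Rightarrow> nat \<Rightarrow> 'a" where
 "plift I S i y = (\<lambda>k. if k = i then - (\<Sum>j\<in>I - {i}. S i j * y j) else S i i * y k)"

lemma plift_rows:
 assumes "finite I" "i \<in> I"
 shows "(\<Sum>k\<in>I. S i k * plift I S i y k) = 0"
 and "j \<in> I ==> j ~= i ==> S j i = S i j ==> S i i * (\<Sum>k\<in>I. S j k * plift I S i y k) = (\<Sum>k\<in>I - {i}. piv S i j k * y k)"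
proof -
 have sp: "(\<Sum>k\<in>I. S j k * plift I S i y k) = - S j i * (\<Sum>j\<in>I - {i}. S i j * y j) + S i i * (\<Sum>k\<in>I - {i}. S j k * y k)" for j
 proof -
 have "(\<Sum>k\<in>I - {i}. S j k * plift I S i y k) = S i i * (\<Sum>k\<in>I - {i}. S j k * y k)"
 unfolding sum_distrib_left by (intro sum.cong) (auto simp: plift_def mult_ac)
 then show ?thesis using assms by (simp add: sum.remove[of I i] plift_def)
 qed
 show "(\<Sum>k\<in>I. S i k * plift I S i y k) = 0" unfolding sp by simp
 show "S i i * (\<Sum>k\<in>I. S j k * plift I S i y k) = (\<Sum>k\<in>I - {i}. piv S i j k * y k)"
 if "j \<in> I" "j ~= i" "S j i = S i j"
 unfolding sp that(3) piv_def
 by (simp add: sum_distrib_left sum_subtractf sum_negf algebra_simps)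
qed

lemma plift_bl:
 assumes fin: "finite I" "i \<in> I" and sym: "symon I S"
 shows "bl I S (plift I S i y) (plift I S i z) = bl (I - {i}) (piv S i) y z"
proof -
 have "bl I S (plift I S i y) (plift I S i z) = (\<Sum>j\<in>I - {i}. plift I S i y j * (\<Sum>k\<in>I. S j k * plift I S i z k))"
 unfolding bl_row using fin plift_rows(1)[OF fin, of S z] by (simp add: sum.remove[of I i])
 also have "... = (\<Sum>j\<in>I - {i}. y j * (\<Sum>k\<in>I - {i}. piv S i j k * z k))"
 proof (rule sum.cong[OF refl])
 fix j assume j: "j \<in> I - {i}"
 have "plift I S i y j * (\<Sum>k\<in>I. S j k * plift I S i z k) = y j * (S i i * (\<Sum>k\<in>I. S j k * plift I S i z k))"
 using j by (simp add: plift_def mult_ac)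
 then show "plift I S i y j * (\<Sum>k\<in>I. S j k * plift I S i z k) = y j * (\<Sum>k\<in>I - {i}. piv S i j k * z k)"
 using plift_rows(2)[OF fin, of j S z] j sym fin by (simp add: symon_def)
 qed
 finally show ?thesis unfolding bl_row .
qed

lemma obas_pivot:
 assumes fin: "finite I" "i \<in> I" and sym: "symon I S" and s: "S i i ~= 0"
 and o: "obas (I - {i}) (piv S i) V d"
 shows "obas I S (\<lambda>k a. if a = i then (if k = i then 1 else 0) else plift I S i (\<lambda>k. V k a) k) (d(i := S i i))"
 (is "obas I S ?W ?d")
proof -
 have e: "bl I S (\<lambda>k. if k = i then 1 else 0) v = (\<Sum>k\<in>I. S i k * v k)" for v
 unfolding bl_row using fin by (subst sum.remove[of _ i]) (auto intro!: sum.neutral)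
 have e2: "(\<Sum>k\<in>I. S i k * (if k = i then 1 else 0)) = S i i"
 using fin by (subst sum.remove[of _ i]) (auto intro!: sum.neutral)
 show ?thesis
 unfolding obas_def
 proof (intro conjI ballI)
 show "?d a ~= 0" if "a \<in> I" for a using that s o by (auto simp: obas_def)
 fix a b assume ab: "a \<in> I" "b \<in> I"
 have sym': "bl I S u v = bl I S v u" for u v using sym by (intro bl_sym) (auto simp: symon_def)
 consider "a = i" "b = i" | "a = i" "b ~= i" | "a ~= i" "b = i" | "a ~= i" "b ~= i" by blast
 then show "bl I S (\<lambda>k. ?W k a) (\<lambda>k. ?W k b) = (if a = b then ?d a else 0)"
 proof cases
 case 1 then show ?thesis using e e2 by simp
 next
 case 2 then show ?thesis using e plift_rows(1)[OF fin] by simp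
 next
 case 3
 then have "bl I S (\<lambda>k. ?W k a) (\<lambda>k. ?W k b) = bl I S (\<lambda>k. if k = i then 1 else 0) (plift I S i (\<lambda>k. V k a))"
 using sym'[of "plift I S i (\<lambda>k. V k a)"] by simp
 then show ?thesis using 3 e plift_rows(1)[OF fin] by simp
 next
 case 4
 then have "bl I S (\<lambda>k. ?W k a) (\<lambda>k. ?W k b) = bl (I - {i}) (piv S i) (\<lambda>k. V k a) (\<lambda>k. V k b)"
 using plift_bl[OF fin sym] by simp
 then show ?thesis using 4 ab o by (simp add: obas_def)
 qed
 qed
qed

lemma nd_pivot:
 assumes fin: "finite I" "i \<in> I" and sym: "symon I S" and p: "prime p" and s: "\<not> p dvd S i i" and n: "nd p I S"
 shows "nd p (I - {i}) (piv S i)"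
 unfolding nd_def
proof (intro allI impI ballI)
 fix x j assume h: "\<forall>j\<in>I - {i}. p dvd (\<Sum>k\<in>I - {i}. piv S i j k * x k)" and j: "j \<in> I - {i}"
 have "\<forall>j\<in>I. p dvd (\<Sum>k\<in>I. S j k * plift I S i x k)"
 proof
 fix j assume j: "j \<in> I"
 show "p dvd (\<Sum>k\<in>I. S j k * plift I S i x k)"
 proof (cases "j = i")
 case True then show ?thesis using plift_rows(1)[OF fin, of S x] by simp
 next
 case False
 then have "p dvd S i i * (\<Sum>k\<in>I. S j k * plift I S i x k)"
 using plift_rows(2)[OF fin j, of S x] h j sym fin by (simp add: symon_def)
 then show ?thesis using p s prime_dvd_mult_iff by blast
 qed
 qed
 then have "p dvd plift I S i x j" using n j unfolding nd_def by blast
 then have "p dvd S i i * x j" using j by (simp add: plift_def)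
 then show "p dvd x j" using p s prime_dvd_mult_iff by blast
qed

lemma symon_piv: "symon I S ==> symon (I - {i}) (piv S i)"
 unfolding symon_def piv_def by (auto simp: mult_ac)

text \<open>The Gram matrix after e_i has been replaced by e_i + e_j. For odd p this creates a unit
  on the diagonal when p divides all diagonal entries but not \<open>S j i\<close>.\<close>

definition addb :: "(nat \<Rightarrow> nat \<Rightarrow> 'a :: comm_ring_1) \<Rightarrow> nat \<Rightarrow> nat \<Rightarrow> nat \<Rightarrow> nat \<Rightarrow> 'a" where
 "addb S i j a b = S a b + (if a = i then S j b else 0) + (if b = i then S a j else 0) + (if a = i \<and> b = i then S j j else 0)"

lemma addb_rows:
 assumes "finite I" "i \<in> I" "j \<in> I" "i ~= j"
 shows "(\<Sum>b\<in>I. addb S i j a b * y b) =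
 (\<Sum>b\<in>I. S a b * (y(j := y j + y i)) b) + (if a = i then (\<Sum>b\<in>I. S j b * (y(j := y j + y i)) b) else 0)"
proof -
 have r: "(\<Sum>b\<in>I. f b * (y(j := y j + y i)) b) = (\<Sum>b\<in>I. f b * y b) + f j * y i" for f :: "nat \<Rightarrow> 'a"
 proof -
 have "(\<Sum>b\<in>I. f b * (y(j := y j + y i)) b) = f j * (y j + y i) + (\<Sum>b\<in>I - {j}. f b * y b)"
 using assms by (simp add: sum.remove[of I j])
 then show ?thesis using assms by (simp add: sum.remove[of I j] algebra_simps)
 qed
 have d: "(\<Sum>b\<in>I. (if b = i then c else 0) * y b) = c * y i" for c
 using assms by (subst sum.remove[of _ i]) (auto intro!: sum.neutral)
 show ?thesis
 unfolding r using d[of "S a j"] d[of "S j j"] unfolding addb_def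
 by (cases "a = i") (simp_all add: distrib_right sum.distrib algebra_simps)
qed

lemma addb_bl:
 assumes "finite I" "i \<in> I" "j \<in> I" "i ~= j"
 shows "bl I S (y(j := y j + y i)) (z(j := z j + z i)) = bl I (addb S i j) y z"
proof -
 let ?r = "\<lambda>a. \<Sum>b\<in>I. S a b * (z(j := z j + z i)) b"
 have "bl I (addb S i j) y z = (\<Sum>a\<in>I. y a * (?r a + (if a = i then ?r j else 0)))"
 unfolding bl_row addb_rows[OF assms] ..
 also have "... = (\<Sum>a\<in>I. y a * ?r a) + y i * ?r j"
 proof -
 have "(\<Sum>a\<in>I. y a * (if a = i then ?r j else 0)) = y i * ?r j"
 using assms by (subst sum.remove[of _ i]) (auto intro!: sum.neutral)
 then show ?thesis by (simp add: distrib_left sum.distrib)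
 qed
 also have "... = (\<Sum>a\<in>I. (y(j := y j + y i)) a * ?r a)"
 using assms by (simp add: sum.remove[of I j] algebra_simps)
 finally show ?thesis unfolding bl_row by simp
qed

lemma obas_addb:
 assumes "finite I" "i \<in> I" "j \<in> I" "i ~= j" "obas I (addb S i j) V d"
 shows "obas I S (\<lambda>k a. if k = j then V j a + V i a else V k a) d"
proof -
 have "bl I S (\<lambda>k. if k = j then V j a + V i a else V k a) (\<lambda>k. if k = j then V j b + V i b else V k b)
 = bl I (addb S i j) (\<lambda>k. V k a) (\<lambda>k. V k b)" for a b
 using addb_bl[OF assms(1-4), of S "\<lambda>k. V k a" "\<lambda>k. V k b"] by (simp add: fun_upd_def)
 then show ?thesis using assms(5) unfolding obas_def by simp
qed

lemma symon_addb: "symon I S ==> i \<in> I ==> j \<in> I ==> symon I (addb S i j)"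
 unfolding symon_def addb_def by auto

lemma nd_addb:
 assumes "finite I" "i \<in> I" "j \<in> I" "i ~= j" "nd p I S"
 shows "nd p I (addb S i j)"
 unfolding nd_def
proof (intro allI impI)
 fix x assume h: "\<forall>a\<in>I. p dvd (\<Sum>b\<in>I. addb S i j a b * x b)"
 let ?x = "x(j := x j + x i)"
 have j: "p dvd (\<Sum>b\<in>I. S j b * ?x b)" using h assms addb_rows[OF assms(1-4), of S j x] by auto
 have "\<forall>a\<in>I. p dvd (\<Sum>b\<in>I. S a b * ?x b)"
 proof
 fix a assume a: "a \<in> I"
 show "p dvd (\<Sum>b\<in>I. S a b * ?x b)"
 proof (cases "a = i")
 case True
 then have "p dvd (\<Sum>b\<in>I. S a b * ?x b) + (\<Sum>b\<in>I. S j b * ?x b)"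
 using h a addb_rows[OF assms(1-4), of S a x] by auto
 then show ?thesis using j by (metis dvd_add_left_iff)
 next
 case False
 then show ?thesis using h a addb_rows[OF assms(1-4), of S a x] by auto
 qed
 qed
 then have d: "\<forall>a\<in>I. p dvd ?x a" using assms(5) unfolding nd_def by blast
 then have xi: "p dvd x i" using assms(2,4) by (metis fun_upd_other)
 show "\<forall>a\<in>I. p dvd x a"
 proof
 fix a assume a: "a \<in> I"
 show "p dvd x a"
 proof (cases "a = j")
 case True
 have "p dvd x j + x i" using d assms(3) by (metis fun_upd_same)
 then show ?thesis using xi True by (metis dvd_add_left_iff)
 next
 case False then show ?thesis using d a by (metis fun_upd_other)
 qed
 qed
qed

section \<open>Totally isotropic subspaces and the Witt index\<close>

text \<open>A diagonal form is given by the list of its coefficients.\<close>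

definition dform :: "'a :: field list \<Rightarrow> (nat \<Rightarrow> 'a) \<Rightarrow> (nat \<Rightarrow> 'a) \<Rightarrow> 'a" where
 "dform xs u v = (\<Sum>i<length xs. xs ! i * u i * v i)"

definition lin_indep :: "nat \<Rightarrow> nat set \<Rightarrow> (nat \<Rightarrow> nat \<Rightarrow> 'a :: field) \<Rightarrow> bool" where
 "lin_indep n S v \<longleftrightarrow> (\<forall>c. (\<forall>i<n. (\<Sum>s\<in>S. c s * v s i) = 0) --> (\<forall>s\<in>S. c s = 0))"

text \<open>A totally isotropic subspace of dimension k, given by a basis; the largest such k is the
  Witt index.\<close>

definition isotr :: "'a :: field list \<Rightarrow> nat \<Rightarrow> bool" where
 "isotr xs k \<longleftrightarrow> (\<exists>S v. finite S \<and> card S = k \<and> lin_indep (length xs) S v \<and> (\<forall>s\<in>S. \<forall>t\<in>S. dform xs (v s) (v t) = 0))"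

lemma dform_sum_right: "dform xs u (\<lambda>i. \<Sum>s\<in>S. c s * v s i) = (\<Sum>s\<in>S. c s * dform xs u (v s))"
 unfolding dform_def sum_distrib_left by (subst sum.swap) (simp add: mult_ac)

lemma dform_diff_left: "dform xs (\<lambda>i. u i - c * w i) v = dform xs u v - c * dform xs w v"
 unfolding dform_def sum_distrib_left sum_subtractf[symmetric] by (simp add: algebra_simps)

lemma dform_diff_right: "dform xs v (\<lambda>i. u i - c * w i) = dform xs v u - c * dform xs v w"
 unfolding dform_def sum_distrib_left sum_subtractf[symmetric] by (simp add: algebra_simps)

lemma isotr_0: "isotr xs 0"
 unfolding isotr_def by (rule exI[of _ "{}"]) (simp add: lin_indep_def)

lemma isotr_transfer:
 assumes iso: "isotr xs k"
 and lin: "\<And>(S :: nat set) c v j. finite S ==> j < length ys ==> M (\<lambda>i. \<Sum>s\<in>S. c s * v s i) j = (\<Sum>s\<in>S. c s * M (v s) j)"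
 and inj: "\<And>u i. (\<And>j. j < length ys ==> M u j = 0) ==> i < length xs ==> u i = 0"
 and isom: "\<And>u v. dform ys (M u) (M v) = dform xs u v"
 shows "isotr ys k"
proof -
 obtain S v where S: "finite S" "card S = k" "lin_indep (length xs) S v"
 "\<And>s t. s \<in> S ==> t \<in> S ==> dform xs (v s) (v t) = 0"
 using iso unfolding isotr_def by blast
 have "lin_indep (length ys) S (\<lambda>s. M (v s))"
 unfolding lin_indep_def
 proof (intro allI impI)
 fix c assume "\<forall>j<length ys. (\<Sum>s\<in>S. c s * M (v s) j) = 0"
 then have "\<And>j. j < length ys ==> M (\<lambda>i. \<Sum>s\<in>S. c s * v s i) j = 0" using lin S(1) by simp
 then have "\<forall>i<length xs. (\<Sum>s\<in>S. c s * v s i) = 0" using inj by blast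
 then show "\<forall>s\<in>S. c s = 0" using S(3) unfolding lin_indep_def by blast
 qed
 then show ?thesis using S isom unfolding isotr_def by (intro exI[of _ S] exI[of _ "\<lambda>s. M (v s)"]) auto
qed

lemma isotr_permute:
 assumes "mset xs = mset ys" "isotr xs k"
 shows "isotr ys k"
proof -
 obtain \<pi> where p: "\<pi> permutes {..<length ys}" and xs: "permute_list \<pi> ys = xs"
 using mset_eq_permutation[OF assms(1)] .
 have len: "length xs = length ys" using xs by auto
 have pi: "inv_into UNIV \<pi> permutes {..<length ys}" using permutes_inv p by blast
 show ?thesis
 proof (rule isotr_transfer[OF assms(2), where M = "\<lambda>u j. u (inv_into UNIV \<pi> j)"])
 fix u :: "nat \<Rightarrow> 'a" and i assume "\<And>j. j < length ys ==> u (inv_into UNIV \<pi> j) = 0" "i < length xs"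
 moreover have "\<pi> i < length ys" using permutes_in_image[OF p] \<open>i < length xs\<close> len by auto
 ultimately show "u i = 0" using permutes_inverses(2)[OF p] by metis
 next
 fix u v :: "nat \<Rightarrow> 'a"
 have "dform ys (\<lambda>j. u (inv_into UNIV \<pi> j)) (\<lambda>j. v (inv_into UNIV \<pi> j)) = (\<Sum>i<length ys. ys ! \<pi> i * u (inv_into UNIV \<pi> (\<pi> i)) * v (inv_into UNIV \<pi> (\<pi> i)))"
 unfolding dform_def by (rule sum.permute[OF p, unfolded comp_def])
 also have "... = dform xs u v"
 unfolding dform_def len xs[symmetric]
 by (intro sum.cong) (auto simp: permutes_inverses(2)[OF p] permute_list_nth[OF p])
 finally show "dform ys (\<lambda>j. u (inv_into UNIV \<pi> j)) (\<lambda>j. v (inv_into UNIV \<pi> j)) = dform xs u v" .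
 qed auto
qed

lemma dform_Cons: "dform (x # xs) u v = x * u 0 * v 0 + dform xs (\<lambda>i. u (Suc i)) (\<lambda>i. v (Suc i))"
 unfolding dform_def by (simp add: sum.lessThan_Suc_shift del: sum.lessThan_Suc)

lemma isotr_sq:
 assumes "c ~= 0" shows "isotr (a * c\<^sup>2 # xs) k \<longleftrightarrow> isotr (a # xs) k"
proof
 assume *: "isotr (a * c\<^sup>2 # xs) k"
 show "isotr (a # xs) k"
 proof (rule isotr_transfer[OF *, where M = "\<lambda>u i. if i = 0 then c * u i else u i"])
 fix u :: "nat \<Rightarrow> 'a" and i
 assume "\<And>j. j < length (a # xs) ==> (if j = 0 then c * u j else u j) = 0" "i < length (a * c\<^sup>2 # xs)"
 then show "u i = 0" using assms by (metis length_Cons mult_eq_0_iff)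
 qed (auto simp: dform_Cons sum_distrib_left power2_eq_square algebra_simps)
next
 assume *: "isotr (a # xs) k"
 show "isotr (a * c\<^sup>2 # xs) k"
 proof (rule isotr_transfer[OF *, where M = "\<lambda>u i. if i = 0 then inverse c * u i else u i"])
 fix u :: "nat \<Rightarrow> 'a" and i
 assume "\<And>j. j < length (a * c\<^sup>2 # xs) ==> (if j = 0 then inverse c * u j else u j) = 0" "i < length (a # xs)"
 then show "u i = 0" using assms by (metis length_Cons mult_eq_0_iff inverse_nonzero_iff_nonzero)
 next
 fix u v :: "nat \<Rightarrow> 'a"
 show "dform (a * c\<^sup>2 # xs) (\<lambda>i. if i = 0 then inverse c * u i else u i) (\<lambda>i. if i = 0 then inverse c * v i else v i) = dform (a # xs) u v"
 using assms by (simp add: dform_Cons field_simps power2_eq_square)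
 qed (auto simp: sum_distrib_left mult_ac)
qed

lemma sum_lin2:
 fixes c :: "'b \<Rightarrow> 'a :: comm_ring_1"
 shows "x * (\<Sum>s\<in>S. c s * v s i) + y * (\<Sum>s\<in>S. c s * v s j) = (\<Sum>s\<in>S. c s * (x * v s i + y * v s j))"
 unfolding sum_distrib_left sum.distrib[symmetric] by (intro sum.cong) (auto simp: algebra_simps)

lemma isotr_sum:
 assumes "a ~= 0" "b ~= 0" "a + b ~= 0"
 shows "isotr (a # b # xs) k \<longleftrightarrow> isotr ((a + b) # (a * b * (a + b)) # xs) k"
proof
 \<comment> \<open>Coordinates with respect to e0 + e1 of norm a + b and - b e0 + a e1 of norm a b
   (a + b).\<close>
 let ?M = "\<lambda>u i. if i = 0 then a / (a + b) * u 0 + b / (a + b) * u 1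
 else if i = 1 then (- 1 / (a + b)) * u 0 + (1 / (a + b)) * u 1 else u i"
 assume *: "isotr (a # b # xs) k"
 show "isotr ((a + b) # (a * b * (a + b)) # xs) k"
 proof (rule isotr_transfer[OF *, where M = ?M])
 fix S c and v :: "nat \<Rightarrow> nat \<Rightarrow> 'a" and j assume "finite (S :: nat set)"
 show "?M (\<lambda>i. \<Sum>s\<in>S. c s * v s i) j = (\<Sum>s\<in>S. c s * ?M (v s) j)"
 by (simp only: sum_lin2 split: if_split) simp
 next
 fix u :: "nat \<Rightarrow> 'a" and i
 assume h: "\<And>j. j < length ((a + b) # (a * b * (a + b)) # xs) ==> ?M u j = 0" and i: "i < length (a # b # xs)"
 have "(u 1 - u 0) / (a + b) = 0" using h[of 1] by (simp add: diff_divide_distrib)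
 then have "u 1 = u 0" using assms by simp
 moreover have "(a * u 0 + b * u 1) / (a + b) = 0" using h[of 0] by (simp add: add_divide_distrib)
 then have "a * u 0 + b * u 1 = 0" using assms by simp
 ultimately have "(a + b) * u 0 = 0" by (simp add: algebra_simps)
 then have "u 0 = 0" "u 1 = 0" using assms \<open>u 1 = u 0\<close> by auto
 then show "u i = 0" using h[of i] i by (cases "i = 0"; cases "i = 1") auto
 next
 fix u v :: "nat \<Rightarrow> 'a"
 define t where "t = 1 / (a + b)"
 have t: "(a + b) * t = 1" using assms(3) by (simp add: t_def)
 have "(a + b) * (a * t * u 0 + b * t * u 1) * (a * t * v 0 + b * t * v 1) +
 (a * b * (a + b)) * (- t * u 0 + t * u 1) * (- t * v 0 + t * v 1) =
 ((a + b) * t) * ((a + b) * t) * (a * u 0 * v 0 + b * u 1 * v 1)"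
 by (simp add: algebra_simps)
 also have "... = a * u 0 * v 0 + b * u 1 * v 1" by (simp add: t)
 finally have "(a + b) * (a / (a + b) * u 0 + b / (a + b) * u 1) * (a / (a + b) * v 0 + b / (a + b) * v 1) +
 (a * b * (a + b)) * ((- 1 / (a + b)) * u 0 + (1 / (a + b)) * u 1) * ((- 1 / (a + b)) * v 0 + (1 / (a + b)) * v 1)
 = a * u 0 * v 0 + b * u 1 * v 1"
 by (simp add: t_def)
 then show "dform ((a + b) # (a * b * (a + b)) # xs) (?M u) (?M v) = dform (a # b # xs) u v"
 by (simp add: dform_Cons add.assoc[symmetric])
 qed
next
 let ?M = "\<lambda>u i. if i = 0 then 1 * u 0 + (- b) * u 1 else if i = 1 then 1 * u 0 + a * u 1 else u i"
 assume *: "isotr ((a + b) # (a * b * (a + b)) # xs) k"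
 show "isotr (a # b # xs) k"
 proof (rule isotr_transfer[OF *, where M = ?M])
 fix S c and v :: "nat \<Rightarrow> nat \<Rightarrow> 'a" and j assume "finite (S :: nat set)"
 show "?M (\<lambda>i. \<Sum>s\<in>S. c s * v s i) j = (\<Sum>s\<in>S. c s * ?M (v s) j)"
 by (simp only: sum_lin2 split: if_split) simp
 next
 fix u :: "nat \<Rightarrow> 'a" and i
 assume h: "\<And>j. j < length (a # b # xs) ==> ?M u j = 0" and i: "i < length ((a + b) # (a * b * (a + b)) # xs)"
 have 0: "u 0 + - b * u 1 = 0" "u 0 + a * u 1 = 0" using h[of 0] h[of 1] by simp_all
 then have "(a + b) * u 1 = 0" by (simp add: algebra_simps)
 then have "u 1 = 0" using assms by auto
 then have "u 0 = 0" using 0 by simp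
 then show "u i = 0" using h[of i] i \<open>u 1 = 0\<close> by (cases "i = 0"; cases "i = 1") auto
 next
 fix u v :: "nat \<Rightarrow> 'a"
 show "dform (a # b # xs) (?M u) (?M v) = dform ((a + b) # (a * b * (a + b)) # xs) u v"
 by (simp add: dform_Cons algebra_simps)
 qed
qed

lemma isotr_hyp1:
 assumes "isotr zs k" "a ~= (0 :: 'a :: field)"
 shows "isotr (a # - a # zs) (Suc k)"
proof -
 obtain S v where S: "finite S" "card S = k" "lin_indep (length zs) S v"
 "\<And>s t. s \<in> S ==> t \<in> S ==> dform zs (v s) (v t) = 0"
 using assms(1) unfolding isotr_def by blast
 obtain n where n: "n \<notin> S" using ex_new_if_finite[OF infinite_UNIV_nat S(1)] by blast
 define w where "w = (\<lambda>s i. if s = n then (if i < 2 then 1 else 0 :: 'a) else if i < 2 then 0 else v s (i - 2))"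
 have w0: "w s 0 = (if s = n then 1 else 0)" "w s (Suc 0) = (if s = n then 1 else 0)"
 "w s (Suc (Suc i)) = (if s = n then 0 else v s i)" for s i by (auto simp: w_def)
 have "lin_indep (length (a # - a # zs)) (insert n S) w"
 unfolding lin_indep_def
 proof (intro allI impI)
 fix c assume h: "\<forall>i<length (a # - a # zs). (\<Sum>s\<in>insert n S. c s * w s i) = 0"
 have eq: "(\<Sum>s\<in>insert n S. c s * w s i) = c n * w n i + (\<Sum>s\<in>S. c s * w s i)" for i
 using n S(1) by simp
 have "(\<Sum>s\<in>S. c s * w s 0) = 0" using n by (intro sum.neutral) (auto simp: w0)
 then have "c n = 0" using h[rule_format, of 0] eq[of 0] by (simp add: w0)
 have "\<forall>i<length zs. (\<Sum>s\<in>S. c s * v s i) = 0"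
 proof (intro allI impI)
 fix i assume i: "i < length zs"
 have "(\<Sum>s\<in>S. c s * w s (Suc (Suc i))) = (\<Sum>s\<in>S. c s * v s i)"
 using n by (intro sum.cong) (auto simp: w0)
 then show "(\<Sum>s\<in>S. c s * v s i) = 0"
 using h[rule_format, of "Suc (Suc i)"] eq[of "Suc (Suc i)"] \<open>c n = 0\<close> i by simp
 qed
 then show "\<forall>s\<in>insert n S. c s = 0" using S(3) \<open>c n = 0\<close> unfolding lin_indep_def by blast
 qed
 moreover have "dform (a # - a # zs) (w s) (w t) = 0" if "s \<in> insert n S" "t \<in> insert n S" for s t
 proof -
 have "dform zs (\<lambda>i. if s = n then 0 else v s i) (\<lambda>i. if t = n then 0 else v t i) = 0"
 using S(4)[of s t] that by (cases "s = n"; cases "t = n") (auto simp: dform_def)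
 then show ?thesis by (simp add: dform_Cons w0)
 qed
 ultimately show ?thesis unfolding isotr_def
 using S n by (intro exI[of _ "insert n S"] exI[of _ w]) auto
qed

text \<open>The vector (1, 1, 0, ..., 0) is isotropic, and orthogonality to it means equal first two
  entries. Passing to the orthogonal part of the subspace costs at most one dimension, and so does
  projecting along that vector; the two losses exclude each other, because a vector that is not
  orthogonal to (1, 1, 0, ..., 0) keeps it out of the subspace.\<close>

lemma isotr_hyp2:
 assumes "isotr (a # - a # zs) (Suc k)" "a ~= (0 :: 'a :: field)"
 shows "isotr zs k"
proof -
 let ?xs = "a # - a # zs"
 obtain S v where S: "finite S" "card S = Suc k" "lin_indep (length ?xs) S v"
 "\<And>s t. s \<in> S ==> t \<in> S ==> dform ?xs (v s) (v t) = 0"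
 using assms(1) unfolding isotr_def by blast
 have ind: "\<forall>s\<in>S. c s = 0" if "\<And>i. i < length ?xs ==> (\<Sum>s\<in>S. c s * v s i) = 0" for c
 using S(3) that unfolding lin_indep_def by blast
 define tl2 where "tl2 = (\<lambda>(u :: nat \<Rightarrow> 'a) i. u (Suc (Suc i)))"
 have dtl: "dform ?xs u w = dform zs (tl2 u) (tl2 w)" if "u 0 = u 1" "w 0 = w 1" for u w
 using that by (simp add: dform_Cons tl2_def)
 have finish: "isotr zs k" if T: "T \<subseteq> S" "card T = k" and ww: "\<And>s. s \<in> T ==> w s 0 = w s 1"
 "\<And>s t. s \<in> T ==> t \<in> T ==> dform ?xs (w s) (w t) = 0"
 "\<And>c. (\<And>i. i < length zs ==> (\<Sum>s\<in>T. c s * w s (Suc (Suc i))) = 0) ==> \<forall>s\<in>T. c s = 0" for T w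
 unfolding isotr_def
 proof (intro exI[of _ T] exI[of _ "\<lambda>s. tl2 (w s)"] conjI ballI)
 show "finite T" using T(1) S(1) finite_subset by blast
 show "lin_indep (length zs) T (\<lambda>s. tl2 (w s))"
 unfolding lin_indep_def tl2_def using ww(3) by blast
 show "dform zs (tl2 (w s)) (tl2 (w t)) = 0" if "s \<in> T" "t \<in> T" for s t
 using dtl[of "w s" "w t"] ww that by simp
 qed (use T in simp)
 have comb0: "i = 0 \<or> i = 1 \<or> (\<exists>j<length zs. i = Suc (Suc j))" if "i < length ?xs" for i
 using that by (cases i; cases "i - 1") auto
 show ?thesis
 proof (cases "\<forall>s\<in>S. v s 0 = v s 1")
 case True
 show ?thesis
 proof (cases "\<exists>c. (\<forall>i<length zs. (\<Sum>s\<in>S. c s * v s (Suc (Suc i))) = 0) \<and> (\<exists>s\<in>S. c s ~= 0)")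
 case False
 obtain s0 where s0: "s0 \<in> S" using S(2) by fastforce
 show ?thesis
 proof (rule finish[of "S - {s0}" v])
 show "card (S - {s0}) = k" using s0 S by simp
 fix c assume h: "\<And>i. i < length zs ==> (\<Sum>s\<in>S - {s0}. c s * v s (Suc (Suc i))) = 0"
 define c' where "c' = (\<lambda>s. if s = s0 then 0 else c s)"
 have "(\<Sum>s\<in>S. c' s * v s i) = (\<Sum>s\<in>S - {s0}. c s * v s i)" for i
 using s0 S(1) by (simp add: sum.remove[of S s0] c'_def)
 then have "\<forall>i<length zs. (\<Sum>s\<in>S. c' s * v s (Suc (Suc i))) = 0" using h by simp
 then have c'0: "\<forall>s\<in>S. c' s = 0" using False by blast
 show "\<forall>s\<in>S - {s0}. c s = 0"
 proof
 fix s assume "s \<in> S - {s0}"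
 then show "c s = 0" using c'0[rule_format, of s] by (simp add: c'_def)
 qed
 qed (use True S(4) in auto)
 next
 case True': True
 then obtain c s0 where c: "\<And>i. i < length zs ==> (\<Sum>s\<in>S. c s * v s (Suc (Suc i))) = 0" "s0 \<in> S" "c s0 ~= 0" by blast
 \<comment> \<open>A relation among the projections is a vector (t, t, 0, ..., 0) in the subspace;
   dropping a vector with nonzero coefficient in this relation leaves independent
   projections.\<close>
 define t where "t = (\<Sum>s\<in>S. c s * v s 0)"
 have t1: "(\<Sum>s\<in>S. c s * v s 1) = t" unfolding t_def using True by (intro sum.cong) auto
 have tn: "t ~= 0"
 proof
 assume "t = 0"
 then have "(\<Sum>s\<in>S. c s * v s i) = 0" if "i < length ?xs" for i
 using comb0[OF that] c(1) t1 t_def by (elim disjE exE conjE) simp_all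
 then have "\<forall>s\<in>S. c s = 0" by (rule ind)
 then show False using c by blast
 qed
 show ?thesis
 proof (rule finish[of "S - {s0}" v])
 show "card (S - {s0}) = k" using c S by simp
 fix d assume h: "\<And>i. i < length zs ==> (\<Sum>s\<in>S - {s0}. d s * v s (Suc (Suc i))) = 0"
 define d' where "d' = (\<lambda>s. if s = s0 then 0 else d s)"
 have d': "(\<Sum>s\<in>S. d' s * v s i) = (\<Sum>s\<in>S - {s0}. d s * v s i)" for i
 using c S(1) by (simp add: sum.remove[of S s0] d'_def)
 define r where "r = (\<Sum>s\<in>S. d' s * v s 0)"
 have r1: "(\<Sum>s\<in>S. d' s * v s 1) = r" unfolding r_def using True by (intro sum.cong) auto
 have "(\<Sum>s\<in>S. (t * d' s - r * c s) * v s i) = t * (\<Sum>s\<in>S. d' s * v s i) - r * (\<Sum>s\<in>S. c s * v s i)" for i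
 by (simp add: sum_distrib_left sum_subtractf algebra_simps)
 moreover have "t * (\<Sum>s\<in>S. d' s * v s i) - r * (\<Sum>s\<in>S. c s * v s i) = 0" if "i < length ?xs" for i
 using comb0[OF that]
 proof (elim disjE exE conjE)
 assume "i = 0" then show ?thesis by (simp add: t_def[symmetric] r_def[symmetric])
 next
 assume "i = 1" then show ?thesis by (simp only: t1 r1) simp
 next
 fix j assume "j < length zs" "i = Suc (Suc j)"
 then show ?thesis using c(1) d' h by simp
 qed
 ultimately have z: "\<forall>s\<in>S. t * d' s - r * c s = 0" by (intro ind) simp
 have "r * c s0 = 0" using z[rule_format, OF c(2)] by (simp add: d'_def)
 then have "r = 0" using c by simp
 show "\<forall>s\<in>S - {s0}. d s = 0"
 proof
 fix s assume "s \<in> S - {s0}"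
 then show "d s = 0" using z[rule_format, of s] tn \<open>r = 0\<close> by (simp add: d'_def)
 qed
 qed (use True S(4) in auto)
 qed
 next
 case False
 then obtain s0 where s0: "s0 \<in> S" "v s0 0 ~= v s0 1" by blast
 \<comment> \<open>A multiple of \<open>v s0\<close> is subtracted from each vector so that its
   first two entries become equal.\<close>
 define f where "f = (\<lambda>s. (v s 0 - v s 1) / (v s0 0 - v s0 1))"
 define w where "w = (\<lambda>s i. v s i - f s * v s0 i)"
 have w01: "w s 0 = w s 1" for s
 using s0 by (simp add: w_def f_def field_simps)
 have wv: "dform ?xs (w s) (v t) = 0" if "s \<in> S" "t \<in> S" for s t
 unfolding w_def dform_diff_left using S(4) that s0 by simp
 have ww: "dform ?xs (w s) (w t) = 0" if "s \<in> S" "t \<in> S" for s t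
 unfolding w_def[of] using wv[OF that] wv[OF that(1) s0(1)] dform_diff_right[of ?xs "w s" "v t" "f t" "v s0"]
 by (simp add: w_def)
 show ?thesis
 proof (rule finish[of "S - {s0}" w])
 show "card (S - {s0}) = k" using s0 S by simp
 fix d assume h: "\<And>i. i < length zs ==> (\<Sum>s\<in>S - {s0}. d s * w s (Suc (Suc i))) = 0"
 define e where "e = (\<lambda>i. \<Sum>s\<in>S - {s0}. d s * w s i)"
 have e1: "e 1 = e 0" unfolding e_def using w01 by simp
 have "dform ?xs (v s0) e = (\<Sum>s\<in>S - {s0}. d s * dform ?xs (v s0) (w s))"
 unfolding e_def by (rule dform_sum_right)
 also have "... = 0"
 proof (intro sum.neutral ballI)
 fix s assume "s \<in> S - {s0}"
 then have "dform ?xs (w s) (v s0) = 0" using wv s0 by blast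
 then show "d s * dform ?xs (v s0) (w s) = 0" by (simp add: dform_def mult_ac)
 qed
 finally have "dform ?xs (v s0) e = 0" .
 moreover have "dform zs (\<lambda>i. v s0 (Suc (Suc i))) (\<lambda>i. e (Suc (Suc i))) = 0"
 unfolding dform_def using h by (intro sum.neutral) (auto simp: e_def)
 \<comment> \<open>The tail of \<open>e\<close> vanishes, so its product with \<open>v s0\<close>
   comes from the first two coordinates alone, and these are equal in \<open>e\<close>.\<close>
 ultimately have "a * (v s0 0 - v s0 1) * e 0 = 0"
 using e1 by (simp add: dform_Cons algebra_simps)
 then have e0: "e 0 = 0" using assms(2) s0 by simp
 define c where "c = (\<lambda>s. if s = s0 then - (\<Sum>s\<in>S - {s0}. d s * f s) else d s)"
 have "(\<Sum>s\<in>S. c s * v s i) = e i" for i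
 proof -
 have "(\<Sum>s\<in>S. c s * v s i) = - (\<Sum>s\<in>S - {s0}. d s * f s) * v s0 i + (\<Sum>s\<in>S - {s0}. d s * v s i)"
 using s0 S(1) by (simp add: sum.remove[of S s0] c_def)
 also have "... = e i"
 unfolding e_def w_def
 by (simp add: sum_distrib_right sum_subtractf right_diff_distrib mult.assoc)
 finally show ?thesis .
 qed
 moreover have "e i = 0" if "i < length ?xs" for i
 using comb0[OF that]
 proof (elim disjE exE conjE)
 fix j assume "j < length zs" "i = Suc (Suc j)"
 then show ?thesis using h by (simp add: e_def)
 qed (use e0 e1 in simp_all)
 ultimately have c0: "\<forall>s\<in>S. c s = 0" by (intro ind) simp
 show "\<forall>s\<in>S - {s0}. d s = 0"
 proof
 fix s assume "s \<in> S - {s0}"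
 then show "d s = 0" using c0[rule_format, of s] by (simp add: c_def)
 qed
 qed (use w01 ww in auto)
 qed
qed

lemma isotr_perm_iff: assumes "mset xs = mset ys" shows "isotr xs k \<longleftrightarrow> isotr ys k"
 using isotr_permute[OF assms] isotr_permute[OF assms[symmetric]] by blast

text \<open>Each relation shifts the rank by 2d and the dimensions of isotropic subspaces by d: d =
  -1 when a hyperbolic plane is removed, d = 0 otherwise. Integer k truncated by \<open>nat\<close>
  makes the shift reversible, since dimension 0 is always attained.\<close>

lemma witt_isotr:
 assumes "witt X Y"
 shows "\<forall>xs ys. mset xs = X --> mset ys = Y -->
 (\<exists>d. int (length ys) = int (length xs) + 2 * d \<and> (\<forall>k. isotr xs (nat k) \<longleftrightarrow> isotr ys (nat (k + d))))"
 using assms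
proof (induction rule: witt.induct)
 case (witt_refl X)
 then show ?case by (metis isotr_perm_iff size_mset add_0_right mult_zero_right)
next
 case (witt_sym X Y)
 show ?case
 proof (intro allI impI)
 fix xs ys assume "mset xs = Y" "mset ys = X"
 then obtain d where "int (length xs) = int (length ys) + 2 * d" "\<And>k. isotr ys (nat k) \<longleftrightarrow> isotr xs (nat (k + d))"
 using witt_sym.IH by blast
 then show "\<exists>d. int (length ys) = int (length xs) + 2 * d \<and> (\<forall>k. isotr xs (nat k) \<longleftrightarrow> isotr ys (nat (k + d)))"
 by (intro exI[of _ "- d"]) simp
 qed
next
 case (witt_trans X Y Z)
 show ?case
 proof (intro allI impI)
 fix xs zs assume m: "mset xs = X" "mset zs = Z"
 obtain ys where ys: "mset ys = Y" using ex_mset by blast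
 obtain d where d: "int (length ys) = int (length xs) + 2 * d" "\<And>k. isotr xs (nat k) \<longleftrightarrow> isotr ys (nat (k + d))"
 using witt_trans.IH(1) m ys by blast
 obtain e where e: "int (length zs) = int (length ys) + 2 * e" "\<And>k. isotr ys (nat k) \<longleftrightarrow> isotr zs (nat (k + e))"
 using witt_trans.IH(2) m ys by blast
 show "\<exists>d. int (length zs) = int (length xs) + 2 * d \<and> (\<forall>k. isotr xs (nat k) \<longleftrightarrow> isotr zs (nat (k + d)))"
 using d e by (intro exI[of _ "d + e"]) (simp add: add.assoc)
 qed
next
 case (witt_hyp a Z)
 show ?case
 proof (intro allI impI)
 fix xs ys assume m: "mset xs = Z + {#a, - a#}" "mset ys = Z"
 have "mset xs = mset (a # - a # ys)" using m by (simp add: add_mset_commute)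
 then have i: "isotr xs j \<longleftrightarrow> isotr (a # - a # ys) j" for j by (rule isotr_perm_iff)
 have "isotr xs (nat k) \<longleftrightarrow> isotr ys (nat (k + - 1))" for k
 proof (cases "k \<ge> 1")
 case True
 then have "nat k = Suc (nat (k + - 1))" by simp
 then show ?thesis using i isotr_hyp1[of ys _ a] isotr_hyp2[of a ys] witt_hyp by metis
 next
 case False
 then show ?thesis using isotr_0[of xs] isotr_0[of ys] by simp
 qed
 moreover have "length xs = length ys + 2" using arg_cong[OF m(1), of size] arg_cong[OF m(2), of size] by simp
 ultimately show "\<exists>d. int (length ys) = int (length xs) + 2 * d \<and> (\<forall>k. isotr xs (nat k) \<longleftrightarrow> isotr ys (nat (k + d)))"
 by (intro exI[of _ "-1"]) simp
 qed
next
 case (witt_sq a c Z)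
 show ?case
 proof (intro allI impI)
 fix xs ys assume m: "mset xs = Z + {#a * c\<^sup>2#}" "mset ys = Z + {#a#}"
 obtain zs where zs: "mset zs = Z" using ex_mset by blast
 have "isotr xs j \<longleftrightarrow> isotr (a * c\<^sup>2 # zs) j" "isotr ys j \<longleftrightarrow> isotr (a # zs) j" for j
 using m zs by (auto intro!: isotr_perm_iff)
 moreover have "length xs = length ys" using arg_cong[OF m(1), of size] arg_cong[OF m(2), of size] by simp
 ultimately show "\<exists>d. int (length ys) = int (length xs) + 2 * d \<and> (\<forall>k. isotr xs (nat k) \<longleftrightarrow> isotr ys (nat (k + d)))"
 using isotr_sq[OF witt_sq(2), of a zs] by (intro exI[of _ 0]) simp
 qed
next
 case (witt_sum a b Z)
 show ?case
 proof (intro allI impI)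
 fix xs ys assume m: "mset xs = Z + {#a, b#}" "mset ys = Z + {#a + b, a * b * (a + b)#}"
 obtain zs where zs: "mset zs = Z" using ex_mset by blast
 have "isotr xs j \<longleftrightarrow> isotr (a # b # zs) j" "isotr ys j \<longleftrightarrow> isotr ((a + b) # (a * b * (a + b)) # zs) j" for j
 using m zs by (auto intro!: isotr_perm_iff simp: add_mset_commute)
 moreover have "length xs = length ys" using arg_cong[OF m(1), of size] arg_cong[OF m(2), of size] by simp
 ultimately show "\<exists>d. int (length ys) = int (length xs) + 2 * d \<and> (\<forall>k. isotr xs (nat k) \<longleftrightarrow> isotr ys (nat (k + d)))"
 using isotr_sum[OF witt_sum, of zs] by (intro exI[of _ 0]) simp
 qed
qed

theorem witt_smaller_imp_isotropic:
 assumes "witt (mset xs) Y" "size Y < length xs"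
 shows "\<exists>v. (\<exists>i<length xs. v i ~= 0) \<and> (\<Sum>i<length xs. xs ! i * v i * v i) = 0"
proof -
 obtain ys where ys: "mset ys = Y" using ex_mset by blast
 obtain d where d: "int (length ys) = int (length xs) + 2 * d" "\<And>k. isotr xs (nat k) \<longleftrightarrow> isotr ys (nat (k + d))"
 using witt_isotr[OF assms(1)] ys by blast
 have "length ys < length xs" using assms(2) ys by auto
 then have "d < 0" using d(1) by linarith
 \<comment> \<open>At k = - d the shorter form is only asked for an isotropic subspace of dimension
   0.\<close>
 then have "isotr xs (nat (- d))" using d(2)[of "- d"] isotr_0 by simp
 moreover obtain k where "nat (- d) = Suc k" using \<open>d < 0\<close> by (cases "nat (- d)") auto
 ultimately obtain S v where S: "finite S" "card S = Suc k" "lin_indep (length xs) S v"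
 "\<And>s t. s \<in> S ==> t \<in> S ==> dform xs (v s) (v t) = 0"
 unfolding isotr_def by auto
 then obtain s where s: "s \<in> S" by fastforce
 have "\<exists>i<length xs. v s i ~= 0"
 proof (rule ccontr)
 assume "\<not> ?thesis"
 then have v0: "\<And>i. i < length xs ==> v s i = 0" by blast
 have "(\<Sum>t\<in>S. (if t = s then 1 else 0) * v t i) = v s i" for i
 proof -
 have "(\<Sum>t\<in>S. (if t = s then 1 else 0) * v t i) = (\<Sum>t\<in>S. if t = s then v s i else 0)"
 by (intro sum.cong) auto
 then show ?thesis using s S(1) by simp
 qed
 then have "\<forall>i<length xs. (\<Sum>t\<in>S. (if t = s then 1 else 0) * v t i) = 0" using v0 by simp
 moreover have "(\<forall>i<length xs. (\<Sum>t\<in>S. c t * v t i) = 0) --> (\<forall>t\<in>S. c t = 0)" for c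
 using S(3) unfolding lin_indep_def by (rule spec)
 ultimately have "\<forall>t\<in>S. (if t = s then 1 else (0::'a)) = 0" by (rule rev_mp)
 then have "(if s = s then 1 else (0::'a)) = 0" using s by (rule bspec)
 then show False by simp
 qed
 moreover have "(\<Sum>i<length xs. xs ! i * v s i * v s i) = 0" using S(4)[OF s s] unfolding dform_def .
 ultimately show ?thesis by blast
qed

section \<open>A prime that is 3 modulo 4 and a nonresidue modulo p\<close>

definition bdd_partial :: "(nat \<Rightarrow> real) \<Rightarrow> real \<Rightarrow> bool" where
 "bdd_partial f C \<longleftrightarrow> (\<forall>m. \<bar>\<Sum>n\<le>m. f n\<bar> \<le> C)"

text \<open>Summation by parts against the decreasing weights 1 / sqrt n.\<close>

lemma abel_sqrt:
 assumes "bdd_partial f C" "a < b"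
 shows "\<bar>(\<Sum>n\<in>{a<..b}. f n / sqrt n)\<bar> \<le> 2 * C / sqrt (a + 1)"
proof -
 define S where "S = (\<lambda>m. \<Sum>n\<le>m. f n)"
 define g where "g = (\<lambda>n::nat. 1 / sqrt n)"
 have C: "\<bar>S m\<bar> \<le> C" for m using assms(1) unfolding bdd_partial_def S_def by blast
 have key: "\<bar>(\<Sum>n\<in>{a<..a + 1 + k}. f n * g n) - S (a + 1 + k) * g (a + 1 + k) + S a * g (a + 1)\<bar> \<le> C * (g (a + 1) - g (a + 1 + k))" for k
 proof (induction k)
 case 0
 have "{a<..a + 1} = {a + 1}" by auto
 moreover have "S (a + 1) = S a + f (a + 1)" by (simp add: S_def)
 ultimately show ?case by (simp add: algebra_simps)
 next
 case (Suc k)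
 let ?b = "a + 1 + k"
 have 1: "{a<..a + 1 + Suc k} = insert (Suc ?b) {a<..?b}" by auto
 have 2: "S (Suc ?b) = S ?b + f (Suc ?b)" by (simp add: S_def)
 have gd: "g ?b - g (Suc ?b) \<ge> 0" by (simp add: g_def frac_le)
 have "(\<Sum>n\<in>{a<..a + 1 + Suc k}. f n * g n) - S (a + 1 + Suc k) * g (a + 1 + Suc k) + S a * g (a + 1)
 = ((\<Sum>n\<in>{a<..?b}. f n * g n) - S ?b * g ?b + S a * g (a + 1)) + S ?b * (g ?b - g (Suc ?b))"
 unfolding 1 using 2 by (simp add: algebra_simps)
 moreover have "\<bar>S ?b * (g ?b - g (Suc ?b))\<bar> \<le> C * (g ?b - g (Suc ?b))"
 unfolding abs_mult using C[of ?b] gd by (simp add: mult_right_mono)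
 ultimately show ?case using Suc by (simp add: algebra_simps)
 qed
 obtain k where b: "b = a + 1 + k" using assms(2) by (metis add.assoc less_iff_Suc_add plus_1_eq_Suc add.commute)
 have g0: "g n \<ge> 0" for n by (simp add: g_def)
 have "\<bar>S b * g b\<bar> \<le> C * g b" "\<bar>S a * g (a + 1)\<bar> \<le> C * g (a + 1)"
 unfolding abs_mult using C g0 by (simp_all add: mult_right_mono)
 then have "\<bar>\<Sum>n\<in>{a<..b}. f n * g n\<bar> \<le> 2 * C * g (a + 1)"
 using key[of k] unfolding b by (simp add: algebra_simps)
 then show ?thesis by (simp add: g_def add.commute)
qed

lemma abel_sqrt':
 assumes "bdd_partial f C" "a \<le> b"
 shows "\<bar>(\<Sum>n\<le>b. f n / sqrt n) - (\<Sum>n\<le>a. f n / sqrt n)\<bar> \<le> 2 * C / sqrt (a + 1)"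
proof (cases "a = b")
 case True
 have "C \<ge> 0" using assms(1) abs_ge_zero order_trans unfolding bdd_partial_def by blast
 then show ?thesis using True by simp
next
 case False
 then have "{..b} = {..a} \<union> {a<..b}" "{..a} \<inter> {a<..b} = {}" using assms(2) by auto
 then have "(\<Sum>n\<le>b. f n / sqrt n) - (\<Sum>n\<le>a. f n / sqrt n) = (\<Sum>n\<in>{a<..b}. f n / sqrt n)"
 by (simp add: sum.union_disjoint)
 then show ?thesis using abel_sqrt[OF assms(1)] False assms(2) by simp
qed

lemma sum_inv_sqrt: fixes s :: nat shows "(\<Sum>n\<in>{1..s}. 1 / sqrt n) \<le> 2 * sqrt s"
proof (induction s)
 case (Suc s)
 have "sqrt (Suc s) * sqrt (Suc s) = real s + 1" "sqrt s * sqrt s = real s" by simp_all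
 moreover have "0 \<le> (sqrt (Suc s) - sqrt s) * (sqrt (Suc s) - sqrt s)" by simp
 ultimately have "1 \<le> 2 * (sqrt (Suc s) * sqrt (Suc s)) - 2 * (sqrt s * sqrt (Suc s))"
 by (simp add: algebra_simps)
 then have "1 \<le> (2 * sqrt (Suc s) - 2 * sqrt s) * sqrt (Suc s)" by (simp add: algebra_simps)
 then have "1 / sqrt (Suc s) \<le> 2 * sqrt (Suc s) - 2 * sqrt s"
 by (subst pos_divide_le_eq) simp_all
 then show ?case using Suc by simp
qed simp

text \<open>Dirichlet's hyperbola method.\<close>

lemma hyperbola_bound:
 fixes f g :: "nat \<Rightarrow> real" and s :: nat
 assumes f: "bdd_partial f C" "\<And>n. \<bar>f n\<bar> \<le> 1" and g: "bdd_partial g C" "\<And>n. \<bar>g n\<bar> \<le> 1" and s: "s > 0"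
 shows "\<bar>\<Sum>d\<in>{1..s\<^sup>2}. \<Sum>e\<in>{1..s\<^sup>2 div d}. (f d / sqrt d) * (g e / sqrt e)\<bar> \<le> 4 * C\<^sup>2 + 8 * C"
proof -
 define N where "N = s\<^sup>2"
 define F where "F = (\<lambda>m. \<Sum>n\<in>{1..m}. f n / sqrt n)"
 define G where "G = (\<lambda>m. \<Sum>n\<in>{1..m}. g n / sqrt n)"
 have C0: "C \<ge> 0" using f(1) abs_ge_zero order_trans unfolding bdd_partial_def by blast
 have at1: "(\<Sum>n\<le>m. h n / sqrt n) = (\<Sum>n\<in>{1..m}. h n / sqrt n)" for h :: "nat \<Rightarrow> real" and m
 by (rule sum.mono_neutral_right) auto
 have FF: "\<bar>F b - F a\<bar> \<le> 2 * C / sqrt (a + 1)" if "a \<le> b" for a b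
 using abel_sqrt'[OF f(1) that] unfolding at1 F_def .
 have GG: "\<bar>G b - G a\<bar> \<le> 2 * C / sqrt (a + 1)" if "a \<le> b" for a b
 using abel_sqrt'[OF g(1) that] unfolding at1 G_def .
 have F0: "\<bar>F b\<bar> \<le> 2 * C" for b using FF[of 0 b] by (simp add: F_def)
 have G0: "\<bar>G b\<bar> \<le> 2 * C" for b using GG[of 0 b] by (simp add: G_def)
 have sN: "s \<le> N" using s by (simp add: N_def power2_eq_square)
 \<comment> \<open>Pairs with d at most s are summed over e first, pairs with d > s over d first;
   because of d e at most s^2, the latter have e at most s.\<close>
 have "(\<Sum>d\<in>{1..N}. \<Sum>e\<in>{1..N div d}. (f d / sqrt d) * (g e / sqrt e)) =
 (\<Sum>d\<in>{1..s}. \<Sum>e\<in>{1..N div d}. (f d / sqrt d) * (g e / sqrt e)) +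
 (\<Sum>d\<in>{s<..N}. \<Sum>e\<in>{1..N div d}. (f d / sqrt d) * (g e / sqrt e))"
 using sN by (subst sum.union_disjoint[symmetric]) (auto intro!: sum.cong)
 also have "(\<Sum>d\<in>{s<..N}. \<Sum>e\<in>{1..N div d}. (f d / sqrt d) * (g e / sqrt e)) =
 (\<Sum>e\<in>{1..s}. \<Sum>d\<in>{s<..N div e}. (f d / sqrt d) * (g e / sqrt e))"
 proof -
 have "e \<le> N div d \<and> 1 \<le> e \<and> s < d \<and> d \<le> N \<longleftrightarrow> d \<le> N div e \<and> s < d \<and> 1 \<le> e \<and> e \<le> s" for d e :: nat
 proof -
 have 1: "e \<le> N div d \<longleftrightarrow> e * d \<le> N" if "d > 0" using that by (simp add: less_eq_div_iff_mult_less_eq)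
 have 2: "d \<le> N div e \<longleftrightarrow> d * e \<le> N" if "e > 0" using that by (simp add: less_eq_div_iff_mult_less_eq)
 have 3: "e \<le> s" if "e * d \<le> N" "s < d"
 proof (rule ccontr)
 assume "\<not> e \<le> s"
 then have "s * s < e * d" using that(2) by (intro mult_strict_mono) auto
 then show False using that(1) by (simp add: N_def power2_eq_square)
 qed
 have 4: "d \<le> N" if "d * e \<le> N" "1 \<le> e" using that by (metis le_trans mult_le_mono2 mult.right_neutral)
 show ?thesis using 1 2 3 4 by (auto simp: mult.commute)
 qed
 note mem = this
 have "(\<Sum>d\<in>{s<..N}. \<Sum>e\<in>{1..N div d}. (f d / sqrt d) * (g e / sqrt e)) =
 (\<Sum>(d, e)\<in>(SIGMA d:{s<..N}. {1..N div d}). (f d / sqrt d) * (g e / sqrt e))"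
 by (rule sum.Sigma) auto
 also have "... = (\<Sum>(e, d)\<in>(SIGMA e:{1..s}. {s<..N div e}). (f d / sqrt d) * (g e / sqrt e))"
 proof (rule sum.reindex_bij_witness[where i = "\<lambda>(a, b). (b, a)" and j = "\<lambda>(a, b). (b, a)"]; clarify)
 fix d e assume "d \<in> {s<..N}" "e \<in> {1..N div d}"
 then show "e \<in> {1..s} \<and> d \<in> {s<..N div e}" using mem[of e d] by simp
 next
 fix e d assume "e \<in> {1..s}" "d \<in> {s<..N div e}"
 then show "d \<in> {s<..N} \<and> e \<in> {1..N div d}" using mem[of e d] by simp
 qed
 also have "... = (\<Sum>e\<in>{1..s}. \<Sum>d\<in>{s<..N div e}. (f d / sqrt d) * (g e / sqrt e))"
 by (rule sum.Sigma[symmetric]) auto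
 finally show ?thesis .
 qed
 also have "(\<Sum>d\<in>{1..s}. \<Sum>e\<in>{1..N div d}. (f d / sqrt d) * (g e / sqrt e)) = (\<Sum>d\<in>{1..s}. (f d / sqrt d) * G (N div d))"
 by (simp add: G_def sum_distrib_left)
 also have "... = F s * G N + (\<Sum>d\<in>{1..s}. (f d / sqrt d) * (G (N div d) - G N))"
 by (simp add: F_def sum_distrib_right right_diff_distrib sum_subtractf)
 also have "(\<Sum>e\<in>{1..s}. \<Sum>d\<in>{s<..N div e}. (f d / sqrt d) * (g e / sqrt e)) = (\<Sum>e\<in>{1..s}. (g e / sqrt e) * (F (N div e) - F s))"
 proof (rule sum.cong[OF refl])
 fix e assume e: "e \<in> {1..s}"
 have "s \<le> N div e" using e by (auto simp: N_def power2_eq_square less_eq_div_iff_mult_less_eq)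
 then have "F (N div e) = F s + (\<Sum>d\<in>{s<..N div e}. f d / sqrt d)"
 unfolding F_def by (subst sum.union_disjoint[symmetric]) (auto intro!: sum.cong)
 then show "(\<Sum>d\<in>{s<..N div e}. (f d / sqrt d) * (g e / sqrt e)) = (g e / sqrt e) * (F (N div e) - F s)"
 by (simp add: sum_distrib_left mult_ac)
 qed
 finally have eq: "(\<Sum>d\<in>{1..N}. \<Sum>e\<in>{1..N div d}. (f d / sqrt d) * (g e / sqrt e)) =
 F s * G N + (\<Sum>d\<in>{1..s}. (f d / sqrt d) * (G (N div d) - G N)) + (\<Sum>e\<in>{1..s}. (g e / sqrt e) * (F (N div e) - F s))" .
 have b1: "\<bar>F s * G N\<bar> \<le> (2 * C) * (2 * C)" unfolding abs_mult using F0 G0 C0 by (intro mult_mono) auto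
 \<comment> \<open>From d (N div d + 1) > N = s^2 each term is at most 2C / s, and there are s
   terms.\<close>
 have b2: "\<bar>\<Sum>d\<in>{1..s}. (f d / sqrt d) * (G (N div d) - G N)\<bar> \<le> (\<Sum>d\<in>{1..s}. 2 * C / real s)"
 proof (rule order_trans[OF sum_abs sum_mono])
 fix d assume d: "d \<in> {1..s}"
 have "\<bar>G (N div d) - G N\<bar> \<le> 2 * C / sqrt (real (N div d) + 1)"
 using GG[of "N div d" N] by (simp add: abs_minus_commute add.commute)
 moreover have "\<bar>f d / sqrt d\<bar> \<le> 1 / sqrt d" using f(2)[of d] by (simp add: divide_right_mono)
 ultimately have "\<bar>(f d / sqrt d) * (G (N div d) - G N)\<bar> \<le> (1 / sqrt d) * (2 * C / sqrt (real (N div d) + 1))"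
 unfolding abs_mult using C0 by (intro mult_mono) auto
 also have "... = 2 * C / sqrt (real d * (real (N div d) + 1))" by (simp add: real_sqrt_mult)
 also have "... \<le> 2 * C / sqrt (real N)"
 proof -
 have "N < d * (N div d + 1)" using d by (metis atLeastAtMost_iff dividend_less_times_div less_le_trans less_one add.commute plus_1_eq_Suc mult_Suc_right zero_less_one)
 then have "real N \<le> real d * (real (N div d) + 1)"
 by (metis less_imp_le of_nat_1 of_nat_add of_nat_le_iff of_nat_mult)
 then have "sqrt (real N) \<le> sqrt (real d * (real (N div d) + 1))" by (rule real_sqrt_le_mono)
 moreover have "sqrt (real N) > 0" using s by (simp add: N_def)
 ultimately show ?thesis using C0 by (intro divide_left_mono mult_pos_pos) auto
 qed
 also have "sqrt (real N) = real s" by (simp add: N_def)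
 finally show "\<bar>(f d / sqrt d) * (G (N div d) - G N)\<bar> \<le> 2 * C / real s" .
 qed
 have b3: "\<bar>\<Sum>e\<in>{1..s}. (g e / sqrt e) * (F (N div e) - F s)\<bar> \<le> (\<Sum>e\<in>{1..s}. (1 / sqrt e) * (2 * C / sqrt s))"
 proof (rule order_trans[OF sum_abs sum_mono])
 fix e assume e: "e \<in> {1..s}"
 have "s \<le> N div e" using e by (auto simp: N_def power2_eq_square less_eq_div_iff_mult_less_eq)
 then have "\<bar>F (N div e) - F s\<bar> \<le> 2 * C / sqrt (real s + 1)" using FF[of s "N div e"] by (simp add: add.commute)
 also have "... \<le> 2 * C / sqrt s" using C0 s by (intro divide_left_mono) auto
 finally have "\<bar>F (N div e) - F s\<bar> \<le> 2 * C / sqrt s" .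
 moreover have "\<bar>g e / sqrt e\<bar> \<le> 1 / sqrt e" using g(2)[of e] by (simp add: divide_right_mono)
 ultimately show "\<bar>(g e / sqrt e) * (F (N div e) - F s)\<bar> \<le> (1 / sqrt e) * (2 * C / sqrt s)"
 unfolding abs_mult using C0 by (intro mult_mono) auto
 qed
 have "(\<Sum>e\<in>{1..s}. (1 / sqrt e) * (2 * C / sqrt s)) = (\<Sum>e\<in>{1..s}. 1 / sqrt e) * (2 * C / sqrt s)"
 by (rule sum_distrib_right[symmetric])
 also have "... \<le> (2 * sqrt s) * (2 * C / sqrt s)" using sum_inv_sqrt C0 by (intro mult_right_mono) auto
 also have "... = 4 * C" using s by simp
 finally have b3': "\<bar>\<Sum>e\<in>{1..s}. (g e / sqrt e) * (F (N div e) - F s)\<bar> \<le> 4 * C" using b3 by linarith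
 have "(\<Sum>d\<in>{1..s}. 2 * C / real s) = 2 * C" using s by simp
 then show ?thesis using eq b1 b2 b3' C0 unfolding N_def by (simp add: power2_eq_square)
qed

text \<open>Pairs (n, d) with d dividing n are reindexed as (d, n / d), and sqrt is
  multiplicative.\<close>

lemma convolution_sum:
 fixes f g :: "nat \<Rightarrow> real"
 shows "(\<Sum>n\<in>{1..N}. (\<Sum>d | d dvd n. f d * g (n div d)) / sqrt n) =
 (\<Sum>d\<in>{1..N}. \<Sum>e\<in>{1..N div d}. (f d / sqrt d) * (g e / sqrt e))"
proof -
 have "(\<Sum>n\<in>{1..N}. (\<Sum>d | d dvd n. f d * g (n div d)) / sqrt n) =
 (\<Sum>n\<in>{1..N}. \<Sum>d | d dvd n. (f d / sqrt d) * (g (n div d) / sqrt (n div d)))"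
 unfolding sum_divide_distrib
 proof (intro sum.cong refl)
 fix n d assume "n \<in> {1..N}" "d \<in> {d. d dvd n}"
 then have "n = d * (n div d)" by simp
 then have "sqrt n = sqrt d * sqrt (n div d)" by (metis of_nat_mult real_sqrt_mult)
 then show "f d * g (n div d) / sqrt n = (f d / sqrt d) * (g (n div d) / sqrt (n div d))" by simp
 qed
 also have "... = (\<Sum>d\<in>{1..N}. \<Sum>e\<in>{1..N div d}. (f d / sqrt d) * (g e / sqrt e))"
 proof -
 have fin: "finite {d. d dvd n}" if "n \<in> {1..N}" for n using that by (auto intro: finite_subset[of _ "{..n}"] dvd_imp_le)
 have "(\<Sum>n\<in>{1..N}. \<Sum>d | d dvd n. (f d / sqrt d) * (g (n div d) / sqrt (n div d))) =
 (\<Sum>(n, d)\<in>(SIGMA n:{1..N}. {d. d dvd n}). (f d / sqrt d) * (g (n div d) / sqrt (n div d)))"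
 by (rule sum.Sigma) (use fin in auto)
 also have "... = (\<Sum>(d, e)\<in>(SIGMA d:{1..N}. {1..N div d}). (f d / sqrt d) * (g e / sqrt e))"
 proof (rule sum.reindex_bij_witness[where i = "\<lambda>(d, e). (d * e, d)" and j = "\<lambda>(n, d). (d, n div d)"])
 fix a assume "a \<in> (SIGMA n:{1..N}. {d. d dvd n})"
 then obtain n d where a: "a = (n, d)" "1 \<le> n" "n \<le> N" "d dvd n" by auto
 have "d > 0" using a by (auto intro: Nat.gr0I)
 have "d \<le> n" using a by (auto intro: dvd_imp_le)
 have "n div d > 0" using \<open>d > 0\<close> \<open>d \<le> n\<close> by (simp add: div_greater_zero_iff)
 have "n div d \<le> N div d" using a by (intro div_le_mono)
 show "(case case a of (n, d) \<Rightarrow> (d, n div d) of (d, e) \<Rightarrow> (d * e, d)) = a" using a by simp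
 show "(case a of (n, d) \<Rightarrow> (d, n div d)) \<in> (SIGMA d:{1..N}. {1..N div d})"
 using a \<open>d > 0\<close> \<open>d \<le> n\<close> \<open>n div d > 0\<close> \<open>n div d \<le> N div d\<close> by simp
 show "(case case a of (n, d) \<Rightarrow> (d, n div d) of (d, e) \<Rightarrow> f d / sqrt (real d) * (g e / sqrt (real e))) =
 (case a of (n, d) \<Rightarrow> f d / sqrt (real d) * (g (n div d) / sqrt (real (n div d))))" using a by simp
 next
 fix b assume "b \<in> (SIGMA d:{1..N}. {1..N div d})"
 then obtain d e where b: "b = (d, e)" "1 \<le> d" "d \<le> N" "1 \<le> e" "e \<le> N div d" by auto
 have "d * e \<le> N" using b by (simp add: less_eq_div_iff_mult_less_eq mult.commute)
 then show "(case b of (d, e) \<Rightarrow> (d * e, d)) \<in> (SIGMA n:{1..N}. {d. d dvd n})" using b by simp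
 show "(case case b of (d, e) \<Rightarrow> (d * e, d) of (n, d) \<Rightarrow> (d, n div d)) = b" using b by simp
 qed
 also have "... = (\<Sum>d\<in>{1..N}. \<Sum>e\<in>{1..N div d}. (f d / sqrt d) * (g e / sqrt e))"
 by (rule sum.Sigma[symmetric]) auto
 finally show ?thesis .
 qed
 finally show ?thesis .
qed

definition conv :: "(nat \<Rightarrow> int) \<Rightarrow> (nat \<Rightarrow> int) \<Rightarrow> nat \<Rightarrow> int" where
 "conv f g n = (\<Sum>d | d dvd n. f d * g (n div d))"

text \<open>The divisors of q^k m are, uniquely, the products q^i d with i at most k and d dividing
  m, so the factor at q splits off.\<close>

lemma conv_prime_power:
 assumes f: "\<And>a b. f (a * b) = f a * f b" and g: "\<And>a b. g (a * b) = g a * g b"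
 and q: "prime q" "\<not> q dvd m" and m: "m > 0"
 shows "conv f g (q ^ k * m) = (\<Sum>i\<le>k. f (q ^ i) * g (q ^ (k - i))) * conv f g m"
proof -
 have q0: "q > 0" using q prime_gt_0_nat by blast
 let ?h = "\<lambda>(i, d). q ^ i * d" and ?A = "{..k} \<times> {d. d dvd m}"
 have nd: "\<not> q dvd d" if "d dvd m" for d using q(2) that dvd_trans by blast
 have mul: "multiplicity q (q ^ i * d) = i" if "d dvd m" for i d
 using q0 nd[OF that] by (intro multiplicity_eqI) (auto simp: mult.commute)
 have inj: "inj_on ?h ?A"
 proof (rule inj_onI)
 fix x y assume xy: "x \<in> ?A" "y \<in> ?A" "?h x = ?h y"
 obtain i d j e where p: "x = (i, d)" "y = (j, e)" by (metis surj_pair)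
 then have eq: "q ^ i * d = q ^ j * e" "d dvd m" "e dvd m" using xy by auto
 then have "i = j" using mul by metis
 then show "x = y" using eq p q0 by simp
 qed
 have im: "{d. d dvd q ^ k * m} = ?h ` ?A"
 proof (intro subset_antisym subsetI)
 fix n assume n: "n \<in> {d. d dvd q ^ k * m}"
 have "q ^ k * m ~= 0" using q0 m by simp
 then have n0: "n ~= 0" using n by (metis dvd_0_left mem_Collect_eq)
 obtain d where d: "n = q ^ multiplicity q n * d" "\<not> q dvd d"
 using multiplicity_decompose'[of n q] n0 q(1) by (metis not_prime_unit)
 let ?i = "multiplicity q n"
 have "coprime q d" using d(2) q(1) by (simp add: prime_imp_coprime)
 then have "coprime d (q ^ k)" by (simp add: coprime_commute)
 moreover have "d dvd q ^ k * m" using n d(1) by (metis dvd_mult_right mem_Collect_eq)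
 ultimately have dm: "d dvd m" by (simp add: coprime_dvd_mult_right_iff)
 have "q ^ ?i dvd q ^ k * m" using n multiplicity_dvd dvd_trans by blast
 moreover have "coprime (q ^ ?i) m" using q by (simp add: prime_imp_coprime)
 ultimately have "q ^ ?i dvd q ^ k" by (simp add: coprime_dvd_mult_left_iff)
 then have "?i \<le> k" using q(1) prime_gt_1_nat power_dvd_imp_le by blast
 then have "(?i, d) \<in> ?A" using dm by simp
 moreover have "n = ?h (?i, d)" using d(1) by simp
 ultimately show "n \<in> ?h ` ?A" by (rule rev_image_eqI)
 next
 fix n assume "n \<in> ?h ` ?A"
 then show "n \<in> {d. d dvd q ^ k * m}" by (auto simp: mult_dvd_mono le_imp_power_dvd)
 qed
 have "conv f g (q ^ k * m) = (\<Sum>x\<in>?A. f (?h x) * g (q ^ k * m div ?h x))"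
 unfolding conv_def im by (subst sum.reindex[OF inj]) (simp add: comp_def)
 also have "... = (\<Sum>(i, d)\<in>?A. (f (q ^ i) * g (q ^ (k - i))) * (f d * g (m div d)))"
 proof (rule sum.cong[OF refl])
 fix x assume x: "x \<in> ?A"
 obtain i d where p: "x = (i, d)" by (metis surj_pair)
 then have id: "i \<le> k" "d dvd m" using x by auto
 then have d0: "d > 0" using m by (auto intro: Nat.gr0I)
 obtain e where e: "m = d * e" using id(2) by blast
 have qk: "q ^ k = q ^ i * q ^ (k - i)" using id(1) by (simp add: power_add[symmetric])
 have eq: "q ^ k * m = (q ^ i * d) * (q ^ (k - i) * e)" unfolding qk e by (simp only: mult_ac)
 have "q ^ k * m div (q ^ i * d) = q ^ (k - i) * e"
 unfolding eq by (rule nonzero_mult_div_cancel_left) (use q0 d0 in simp)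
 moreover have "m div d = e" using e d0 by simp
 ultimately show "f (?h x) * g (q ^ k * m div ?h x) = (case x of (i, d) \<Rightarrow> (f (q ^ i) * g (q ^ (k - i))) * (f d * g (m div d)))"
 unfolding p by (simp add: f g)
 qed
 also have "... = (\<Sum>i\<le>k. f (q ^ i) * g (q ^ (k - i))) * conv f g m"
 by (simp add: conv_def sum_product sum.cartesian_product)
 finally show ?thesis .
qed

lemma mult_power_fun:
 assumes f: "\<And>a b. f (a * b) = f a * f b" and "f 1 = (1::int)"
 shows "f ((q::nat) ^ i) = f q ^ i"
 by (induction i) (use assms in auto)

lemma geom_pm: "(\<Sum>i\<le>k. (1::int) ^ i * (-1) ^ (k - i)) = (if even k then 1 else 0)"
 and geom_mp: "(\<Sum>i\<le>k. (-1::int) ^ i * 1 ^ (k - i)) = (if even k then 1 else 0)"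
proof -
 show 2: "(\<Sum>i\<le>k. (-1::int) ^ i * 1 ^ (k - i)) = (if even k then 1 else 0)" by (induction k) auto
 have "(\<Sum>i\<le>k. (1::int) ^ i * (-1) ^ (k - i)) = (\<Sum>i\<le>k. (1::int) ^ (k - i) * (-1) ^ (k - (k - i)))"
 by (rule sum.nat_diff_reindex[of "\<lambda>i. (1::int) ^ i * (-1) ^ (k - i)" "Suc k", symmetric, unfolded lessThan_Suc_atMost diff_Suc_Suc])
 also have "... = (\<Sum>i\<le>k. (-1::int) ^ i * 1 ^ (k - i))" by (intro sum.cong) auto
 finally show "(\<Sum>i\<le>k. (1::int) ^ i * (-1) ^ (k - i)) = (if even k then 1 else 0)" using 2 by simp
qed

text \<open>If no prime has both characters equal to \<open>-1\<close>, the convolution of the two characters is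
 nonnegative and positive at squares, although its weighted sums are bounded.\<close>

lemma conv_nonneg:
 assumes f: "\<And>a b. f (a * b) = f a * f b" "f 1 = 1" and g: "\<And>a b. g (a * b) = g a * g b" "g 1 = 1"
 and val: "\<And>q. prime q ==> f q = 0 \<and> g q = 0 \<or> f q = 1 \<and> g q = 1 \<or> f q = 1 \<and> g q = -1 \<or> f q = -1 \<and> g q = 1"
 shows "n > 0 ==> conv f g n \<ge> 0"
 and "m > 0 ==> (\<And>q. prime q ==> q dvd m ==> f q ~= 0) ==> conv f g (m\<^sup>2) \<ge> 1"
proof -
 \<comment> \<open>The factor at q is k + 1 if both values are 1, and 1 or 0 by the parity of k if
   the signs are opposite. If both values vanish it is 1 for k = 0 and 0 otherwise. Two values -1,
   which \<open>val\<close> excludes, would make it negative for odd k.\<close>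
 have pp: "(\<Sum>i\<le>k. f (q ^ i) * g (q ^ (k - i))) \<ge> 0 \<and> (f q ~= 0 --> even k --> (\<Sum>i\<le>k. f (q ^ i) * g (q ^ (k - i))) \<ge> 1)"
 if "prime q" for q k
 proof -
 have e: "(\<Sum>i\<le>k. f (q ^ i) * g (q ^ (k - i))) = (\<Sum>i\<le>k. f q ^ i * g q ^ (k - i))"
 using mult_power_fun[of f] mult_power_fun[of g] f g by simp
 from val[OF that] show ?thesis
 proof (elim disjE conjE)
 assume "f q = 0" "g q = 0"
 then show ?thesis unfolding e by (auto intro!: sum_nonneg)
 qed (unfold e, auto simp: geom_pm geom_mp[simplified] geom_pm[simplified])
 qed
 have one: "conv f g 1 = 1" using f g by (simp add: conv_def)
 show "n > 0 ==> conv f g n \<ge> 0"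
 proof (induction n rule: less_induct)
 case (less n)
 show ?case
 proof (cases "n = 1")
 case True then show ?thesis using one by simp
 next
 case False
 then obtain q where q: "prime q" "q dvd n" using prime_factor_nat by blast
 obtain m where m: "n = q ^ multiplicity q n * m" "\<not> q dvd m"
 using multiplicity_decompose'[of n q] q less.prems by (metis not_prime_unit less_irrefl)
 have "multiplicity q n > 0" using q less.prems by (simp add: prime_multiplicity_gt_zero_iff)
 then have "q ^ multiplicity q n > 1" using prime_gt_1_nat[OF q(1)] by (metis one_less_power)
 moreover have m0: "m > 0" using m(1) less.prems by (metis gr0I mult_0_right less_irrefl)
 ultimately have "m < n" using m(1) by (metis mult_less_cancel2 nat_mult_1)
 then have "conv f g m \<ge> 0" using less.IH m0 by blast
 then show ?thesis using conv_prime_power[OF f(1) g(1) q(1) m(2) m0, of "multiplicity q n"] pp[OF q(1)] m(1) by simp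
 qed
 qed
 show "m > 0 ==> (\<And>q. prime q ==> q dvd m ==> f q ~= 0) ==> conv f g (m\<^sup>2) \<ge> 1"
 proof (induction m rule: less_induct)
 case (less n)
 show ?case
 proof (cases "n = 1")
 case True then show ?thesis using one by simp
 next
 case False
 then obtain q where q: "prime q" "q dvd n" using prime_factor_nat by blast
 let ?k = "multiplicity q n"
 obtain m where m: "n = q ^ ?k * m" "\<not> q dvd m"
 using multiplicity_decompose'[of n q] q less.prems by (metis not_prime_unit less_irrefl)
 have "?k > 0" using q less.prems by (simp add: prime_multiplicity_gt_zero_iff)
 then have "q ^ ?k > 1" using prime_gt_1_nat[OF q(1)] by (metis one_less_power)
 moreover have m0: "m > 0" using m(1) less.prems by (metis gr0I mult_0_right less_irrefl)
 ultimately have "m < n" using m(1) by (metis mult_less_cancel2 nat_mult_1)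
 moreover have "f r ~= 0" if "prime r" "r dvd m" for r using less.prems(2) that m(1) by (metis dvd_mult)
 ultimately have c: "conv f g (m\<^sup>2) \<ge> 1" using less.IH m0 by blast
 have "n\<^sup>2 = q ^ (2 * ?k) * m\<^sup>2" using m(1) by (metis power_mult_distrib power_mult mult.commute)
 moreover have "\<not> q dvd m\<^sup>2" using m(2) q(1) prime_dvd_power by blast
 ultimately have "conv f g (n\<^sup>2) = (\<Sum>i\<le>2 * ?k. f (q ^ i) * g (q ^ (2 * ?k - i))) * conv f g (m\<^sup>2)"
 using conv_prime_power[OF f(1) g(1) q(1), of "m\<^sup>2" "2 * ?k"] m0 by simp
 moreover have "(\<Sum>i\<le>2 * ?k. f (q ^ i) * g (q ^ (2 * ?k - i))) \<ge> 1"
 using pp[OF q(1), of "2 * ?k"] less.prems(2)[OF q] by simp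
 ultimately show ?thesis using c mult_mono[of 1 "(\<Sum>i\<le>2 * ?k. f (q ^ i) * g (q ^ (2 * ?k - i)))" 1 "conv f g (m\<^sup>2)"] by simp
 qed
 qed
qed

lemma ln_le_harmonic: "ln (real (n + 1)) \<le> (\<Sum>j\<in>{1..n}. 1 / real j)"
proof (induction n)
 case (Suc n)
 have "real (Suc n + 1) = real (n + 1) * (1 + 1 / real (Suc n))" by (simp add: field_simps)
 then have "ln (real (Suc n + 1)) = ln (real (n + 1)) + ln (1 + 1 / real (Suc n))"
 proof -
 have "(0::real) < 1 + 1 / real (Suc n)" by (intro add_pos_pos) simp_all
 then show ?thesis using \<open>real (Suc n + 1) = real (n + 1) * (1 + 1 / real (Suc n))\<close>
 by (simp only: ln_mult_pos of_nat_0_less_iff zero_less_Suc Suc_eq_plus1[symmetric])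
 qed
 also have "ln (1 + 1 / real (Suc n)) \<le> 1 / real (Suc n)" by (intro ln_add_one_self_le_self) simp
 finally show ?case using Suc by simp
qed simp

text \<open>Complete periods cancel, so only the last, incomplete one counts.\<close>

lemma bdd_partial_periodic:
 fixes h :: "nat \<Rightarrow> int"
 assumes per: "\<And>n. h (n + P) = h n" and zero: "(\<Sum>n<P. h n) = 0" and P: "P > 0" and b: "\<And>n. \<bar>h n\<bar> \<le> 1"
 shows "\<bar>\<Sum>n<m. h n\<bar> \<le> int P"
proof (induction m rule: less_induct)
 case (less m)
 show ?case
 proof (cases "m < P")
 case True
 have "\<bar>\<Sum>n<m. h n\<bar> \<le> (\<Sum>n<m. 1)" by (rule order_trans[OF sum_abs sum_mono]) (rule b)
 then show ?thesis using True by simp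
 next
 case False
 then obtain k where k: "m = P + k" by (metis le_add_diff_inverse not_less)
 have "(\<Sum>n<m. h n) = (\<Sum>n<P. h n) + (\<Sum>n<k. h (n + P))"
 proof -
 have "(\<Sum>n<m. h n) = (\<Sum>n<P. h n) + (\<Sum>n\<in>{P..<P + k}. h n)"
 unfolding k by (subst sum.union_disjoint[symmetric]) (auto intro!: sum.cong)
 also have "(\<Sum>n\<in>{P..<P + k}. h n) = (\<Sum>n<k. h (n + P))"
 by (rule sum.reindex_bij_witness[of _ "\<lambda>n. n + P" "\<lambda>n. n - P"]) auto
 finally show ?thesis .
 qed
 then show ?thesis using zero per less.IH[of k] k P by simp
 qed
qed

text \<open>Without such a prime, the character modulo 4 and the Legendre symbol are never both -1
  at a prime, so their convolution is nonnegative, and at least 1 at squares prime to 2p. Its sum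
  with weights 1 / sqrt n is bounded by the hyperbola method, yet the squares of the numbers 2pj + 1
  alone contribute a harmonic series.\<close>

theorem ex_prime_nonresidue:
 assumes p: "prime p" "p mod 4 = 1"
 shows "\<exists>l. prime l \<and> l mod 4 = 3 \<and> Legendre (int l) (int p) = -1"
proof (rule ccontr)
 assume no: "\<not> ?thesis"
 have odd: "odd p" using p(2) by presburger
 have p2: "p > 2" using odd_prime_gt2 p(1) odd by blast
 have p4: "p mod 4 = 1" by (rule p(2))
 let ?L = "\<lambda>n::nat. Legendre (int n) (int p)"
 define c where "c = (\<lambda>n::nat. if n mod 4 = 1 then 1 else if n mod 4 = 3 then -1 else (0::int))"
 \<comment> \<open>Both characters are made to vanish at 2 and at p, so these two primes drop out of
   the convolution.\<close>
 define f where "f = (\<lambda>n. if p dvd n then 0 else c n)"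
 define g where "g = (\<lambda>n. if even n then 0 else ?L n)"
 have cm: "c (a * b) = c a * c b" for a b
 proof -
 have "a mod 4 \<in> {0,1,2,3}" "b mod 4 \<in> {0,1,2,3}" by auto
 moreover have "(a * b) mod 4 = ((a mod 4) * (b mod 4)) mod 4" by (simp add: mod_mult_eq)
 ultimately show ?thesis unfolding c_def by auto
 qed
 have fm: "f (a * b) = f a * f b" for a b using cm p(1) by (simp add: f_def prime_dvd_mult_iff)
 have gm: "g (a * b) = g a * g b" for a b using Legendre_mult[OF p(1) odd] by (simp add: g_def)
 have f1: "f 1 = 1" using p2 by (simp add: f_def c_def)
 have g1: "g 1 = 1" using Legendre_1[OF p(1) odd] by (simp add: g_def)
 have val: "f q = 0 \<and> g q = 0 \<or> f q = 1 \<and> g q = 1 \<or> f q = 1 \<and> g q = -1 \<or> f q = -1 \<and> g q = 1" if "prime q" for q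
 proof (cases "q = 2 \<or> q = p")
 case True
 moreover have "?L p = 0" by (simp add: Legendre_eq_0_iff)
 ultimately show ?thesis by (auto simp: f_def g_def c_def)
 next
 case False
 then have "odd q" using that prime_odd_nat prime_ge_2_nat[of q] by (metis le_neq_implies_less)
 have npq: "\<not> p dvd q" using False p(1) that primes_dvd_imp_eq by blast
 have "q mod 4 = 1 \<or> q mod 4 = 3" using \<open>odd q\<close> by presburger
 moreover have "?L q = 1 \<or> ?L q = -1" using npq by (intro Legendre_unit) simp
 ultimately show ?thesis using no that npq \<open>odd q\<close> by (auto simp: f_def g_def c_def)
 qed
 have fb: "\<bar>f n\<bar> \<le> 1" for n by (simp add: f_def c_def)
 have gb: "\<bar>g n\<bar> \<le> 1" for n using Legendre_cases[of "int n" "int p"] by (auto simp: g_def)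
 have fS: "\<bar>\<Sum>n<m. f n\<bar> \<le> int (4 * p)" for m
 proof (rule bdd_partial_periodic)
 \<comment> \<open>2p is 2 modulo 4, so a shift by 2p changes the sign of the character modulo 4 and
   the sum over a period 4p cancels.\<close>
 have anti: "f (n + 2 * p) = - f n" for n
 proof -
 have "n mod 4 \<in> {0, 1, 2, 3}" by auto
 moreover have "(n + 2 * p) mod 4 = (n mod 4 + 2) mod 4" using odd by presburger
 ultimately have "c (n + 2 * p) = - c n" unfolding c_def by auto
 then show ?thesis by (simp add: f_def)
 qed
 show "f (n + 4 * p) = f n" for n using anti[of n] anti[of "n + 2 * p"] by (simp add: add.assoc)
 have "(\<Sum>n<4 * p. f n) = (\<Sum>n<2 * p. f n) + (\<Sum>n\<in>{2 * p..<4 * p}. f n)"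
 by (subst sum.union_disjoint[symmetric]) (auto intro!: sum.cong)
 also have "(\<Sum>n\<in>{2 * p..<4 * p}. f n) = (\<Sum>n<2 * p. f (n + 2 * p))"
 by (rule sum.reindex_bij_witness[of _ "\<lambda>n. n + 2 * p" "\<lambda>n. n - 2 * p"]) auto
 finally show "(\<Sum>n<4 * p. f n) = 0" using anti by (simp add: sum_negf)
 qed (use p2 fb in auto)
 have LS: "\<bar>\<Sum>n<m. ?L n\<bar> \<le> int p" for m
 proof (rule bdd_partial_periodic)
 show "?L (n + p) = ?L n" for n by (rule Legendre_cong) (simp add: cong_def)
 obtain t where t: "?L t = -1"
 proof -
 \<comment> \<open>a nonresidue exists, since otherwise all nonzero residues would be roots of \<open>X^((p-1)/2) - 1\<close>\<close>
 have "\<exists>t. ?L t = -1"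
 proof (rule ccontr)
 assume nt: "\<not> ?thesis"
 obtain x where x: "residue_primroot p x" using prime_primitive_root_exists[OF prime_gt_1_nat[OF p(1)] p(1)] by blast
 then have cx: "coprime p x" by (simp add: residue_primroot_def)
 then have "\<not> int p dvd int x" using p(1) by (metis coprime_absorb_left int_dvd_int_iff not_prime_unit)
 then have "?L x = 1" using nt Legendre_unit by blast
 then have "[1 = int x ^ ((p - 1) div 2)] (mod int p)"
 using euler_criterion[OF p(1) p2, of "int x"] by simp
 then have "[x ^ ((p - 1) div 2) = 1] (mod p)"
 by (metis cong_int_iff cong_sym of_nat_1 of_nat_power)
 then have "ord p x dvd (p - 1) div 2" using ord_divides by blast
 moreover have "ord p x = p - 1" using x p(1) by (simp add: residue_primroot_def totient_prime)
 moreover have "(p - 1) div 2 > 0" "(p - 1) div 2 < p - 1" using p2 by auto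
 ultimately show False by (auto dest: dvd_imp_le)
 qed
 then show thesis using that by blast
 qed
 then have nt: "\<not> p dvd t" by (metis Legendre_eq_0_iff int_dvd_int_iff zero_neq_neg_one)
 have cop: "coprime t p" using nt p(1) prime_imp_coprime coprime_commute by blast
 \<comment> \<open>Multiplication by the nonresidue t permutes the residues and reverses the sign of
   their character sum, which is therefore 0.\<close>
 have inj: "inj_on (\<lambda>n. (t * n) mod p) {..<p}"
 proof (rule inj_onI)
 fix a b assume ab: "a \<in> {..<p}" "b \<in> {..<p}" "(t * a) mod p = (t * b) mod p"
 then have "[t * a = t * b] (mod p)" by (simp add: cong_def)
 then have "[a = b] (mod p)" using cop cong_mult_lcancel_nat by blast
 then show "a = b" using ab by (simp add: cong_def)
 qed
 have "(\<lambda>n. (t * n) mod p) ` {..<p} \<subseteq> {..<p}" using p2 by auto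
 then have im: "(\<lambda>n. (t * n) mod p) ` {..<p} = {..<p}"
 using endo_inj_surj[OF finite_lessThan _ inj] by blast
 have "(\<Sum>n<p. ?L n) = (\<Sum>n\<in>(\<lambda>n. (t * n) mod p) ` {..<p}. ?L n)" unfolding im ..
 also have "... = (\<Sum>n<p. ?L ((t * n) mod p))" using inj by (simp add: sum.reindex)
 also have "... = (\<Sum>n<p. ?L t * ?L n)"
 proof (rule sum.cong[OF refl])
 fix n
 have "?L ((t * n) mod p) = ?L (t * n)" by (rule Legendre_cong) (simp add: cong_def zmod_int)
 then show "?L ((t * n) mod p) = ?L t * ?L n" using Legendre_mult[OF p(1) odd] by simp
 qed
 also have "... = - (\<Sum>n<p. ?L n)" using t by (simp add: sum_negf)
 finally show "(\<Sum>n<p. ?L n) = 0" by simp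
 show "\<bar>?L n\<bar> \<le> 1" for n using Legendre_cases[of "int n" "int p"] by auto
 qed (use p2 in auto)
 have gS: "\<bar>\<Sum>n<m. g n\<bar> \<le> 2 * int p" for m
 proof -
 have "(\<Sum>n<m. g n) = (\<Sum>n<m. ?L n) - (\<Sum>n | n < m \<and> even n. ?L n)"
 proof -
 have "(\<Sum>n<m. g n) = (\<Sum>n<m. ?L n - (if even n then ?L n else 0))" by (intro sum.cong) (auto simp: g_def)
 also have "... = (\<Sum>n<m. ?L n) - (\<Sum>n<m. if even n then ?L n else 0)" by (rule sum_subtractf)
 also have "(\<Sum>n<m. if even n then ?L n else 0) = (\<Sum>n | n < m \<and> even n. ?L n)"
 by (subst sum.inter_filter[symmetric]) (auto intro!: sum.cong)
 finally show ?thesis .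
 qed
 \<comment> \<open>The terms at even n = 2j reproduce a partial sum of the full character, up to the
   factor (2/p).\<close>
 also have "(\<Sum>n | n < m \<and> even n. ?L n) = (\<Sum>j<(m + 1) div 2. ?L (2 * j))"
 by (rule sum.reindex_bij_witness[of _ "\<lambda>j. 2 * j" "\<lambda>n. n div 2"]) auto
 also have "... = ?L 2 * (\<Sum>j<(m + 1) div 2. ?L j)"
 using Legendre_mult[OF p(1) odd, of 2] by (simp add: sum_distrib_left)
 finally have e: "(\<Sum>n<m. g n) = (\<Sum>n<m. ?L n) - ?L 2 * (\<Sum>j<(m + 1) div 2. ?L j)" .
 have "\<bar>?L 2 * (\<Sum>j<(m + 1) div 2. ?L j)\<bar> \<le> 1 * int p"
 unfolding abs_mult using LS Legendre_cases[of 2 "int p"] by (intro mult_mono) auto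
 then show ?thesis unfolding e using LS[of m] by linarith
 qed
 define C where "C = 4 * real p"
 have bp: "bdd_partial (\<lambda>n. real_of_int (h n)) C" if "\<And>m. \<bar>\<Sum>n<m. h n\<bar> \<le> int (4 * p)" for h
 unfolding bdd_partial_def
 proof
 fix m
 have "\<bar>real_of_int (\<Sum>n<Suc m. h n)\<bar> \<le> real_of_int (int (4 * p))"
 using that[of "Suc m"] by (metis of_int_abs of_int_le_iff)
 then show "\<bar>\<Sum>n\<le>m. real_of_int (h n)\<bar> \<le> C" by (simp add: C_def lessThan_Suc_atMost)
 qed
 have bf: "bdd_partial (\<lambda>n. real_of_int (f n)) C" using fS by (rule bp)
 have bg: "bdd_partial (\<lambda>n. real_of_int (g n)) C"
 proof (rule bp)
 show "\<bar>\<Sum>n<m. g n\<bar> \<le> int (4 * p)" for m using gS[of m] by simp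
 qed
 note cn = conv_nonneg[OF fm f1 gm g1 val]
 \<comment> \<open>The numbers 2pj + 1 have no prime factor 2 or p, so the convolution is at least 1
   at their squares.\<close>
 let ?P = "2 * p"
 have low: "(\<Sum>j\<in>{1..J}. 1 / real (?P * j + 1)) \<le> 4 * C\<^sup>2 + 8 * C" for J
 proof -
 define s where "s = ?P * J + 1"
 have "(\<Sum>j\<in>{1..J}. 1 / real (?P * j + 1)) \<le> (\<Sum>j\<in>{1..J}. real_of_int (conv f g ((?P * j + 1)\<^sup>2)) / sqrt (real ((?P * j + 1)\<^sup>2)))"
 proof (rule sum_mono)
 fix j
 have "f q ~= 0" if "prime q" "q dvd ?P * j + 1" for q
 proof -
 have "odd q"
 proof
 assume "even q"
 then have "even (?P * j + 1)" using that(2) dvd_trans by blast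
 then show False by simp
 qed
 moreover have "\<not> p dvd q"
 proof
 assume "p dvd q"
 then have "p dvd ?P * j + 1" using that(2) dvd_trans by blast
 moreover have "p dvd ?P * j" by simp
 ultimately have "p dvd 1" using dvd_add_right_iff by blast
 then show False using p2 by simp
 qed
 moreover have "q mod 4 = 1 \<or> q mod 4 = 3" using \<open>odd q\<close> by presburger
 ultimately show ?thesis by (auto simp: f_def c_def)
 qed
 then have "conv f g ((?P * j + 1)\<^sup>2) \<ge> 1" using cn(2) by simp
 then have "real_of_int (conv f g ((?P * j + 1)\<^sup>2)) \<ge> 1" by simp
 then show "1 / real (?P * j + 1) \<le> real_of_int (conv f g ((?P * j + 1)\<^sup>2)) / sqrt (real ((?P * j + 1)\<^sup>2))"
 by (simp add: divide_right_mono del: of_nat_Suc)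
 qed
 also have "... = (\<Sum>n\<in>(\<lambda>j. (?P * j + 1)\<^sup>2) ` {1..J}. real_of_int (conv f g n) / sqrt n)"
 using p2 by (subst sum.reindex) (auto simp: inj_on_def)
 also have "... \<le> (\<Sum>n\<in>{1..s\<^sup>2}. real_of_int (conv f g n) / sqrt n)"
 proof (rule sum_mono2)
 show "(\<lambda>j. (?P * j + 1)\<^sup>2) ` {1..J} \<subseteq> {1..s\<^sup>2}" by (auto simp: s_def intro!: power_mono)
 show "0 \<le> real_of_int (conv f g n) / sqrt n" if "n \<in> {1..s\<^sup>2} - (\<lambda>j. (?P * j + 1)\<^sup>2) ` {1..J}" for n
 using cn(1)[of n] that by simp
 qed simp
 also have "... = (\<Sum>n\<in>{1..s\<^sup>2}. (\<Sum>d | d dvd n. real_of_int (f d) * real_of_int (g (n div d))) / sqrt n)"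
 by (simp add: conv_def)
 also have "... = (\<Sum>d\<in>{1..s\<^sup>2}. \<Sum>e\<in>{1..s\<^sup>2 div d}. (real_of_int (f d) / sqrt d) * (real_of_int (g e) / sqrt e))"
 by (rule convolution_sum)
 also have "... \<le> 4 * C\<^sup>2 + 8 * C"
 proof -
 have "\<bar>real_of_int (f n)\<bar> \<le> 1" "\<bar>real_of_int (g n)\<bar> \<le> 1" for n
 using fb[of n] gb[of n] by linarith+
 then show ?thesis using hyperbola_bound[OF bf _ bg, of s] by (simp add: s_def)
 qed
 finally show ?thesis .
 qed
 define B where "B = (4 * C\<^sup>2 + 8 * C) * real (?P + 1)"
 have "ln (real (J + 1)) \<le> B" for J
 proof -
 have "ln (real (J + 1)) \<le> (\<Sum>j\<in>{1..J}. 1 / real j)" by (rule ln_le_harmonic)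
 also have "... \<le> (\<Sum>j\<in>{1..J}. real (?P + 1) * (1 / real (?P * j + 1)))"
 proof (rule sum_mono)
 fix j assume "j \<in> {1..J}"
 then have "j > 0" "?P * j + 1 \<le> (?P + 1) * j" by auto
 then have "real (?P * j + 1) \<le> real (?P + 1) * real j" by (metis of_nat_le_iff of_nat_mult)
 moreover define D where "D = real (?P * j + 1)"
 moreover have "D > 0" unfolding D_def of_nat_0_less_iff by simp
 ultimately have "1 \<le> real (?P + 1) * real j / D" by (simp only: le_divide_eq_1_pos)
 moreover have "real (?P + 1) * (1 / D) * real j = real (?P + 1) * real j / D" by simp
 ultimately have "1 / real j \<le> real (?P + 1) * (1 / D)"
 using \<open>j > 0\<close> by (simp only: pos_divide_le_eq of_nat_0_less_iff)
 then show "1 / real j \<le> real (?P + 1) * (1 / real (?P * j + 1))" unfolding D_def .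
 qed
 also have "... = real (?P + 1) * (\<Sum>j\<in>{1..J}. 1 / real (?P * j + 1))" by (simp add: sum_distrib_left)
 also have "... \<le> real (?P + 1) * (4 * C\<^sup>2 + 8 * C)" using low by (intro mult_left_mono) auto
 finally show ?thesis by (simp add: B_def mult.commute)
 qed
 moreover obtain J where "exp (B + 1) \<le> real J" using real_arch_simple by blast
 ultimately have "B + 1 \<le> ln (real (J + 1))" "ln (real (J + 1)) \<le> B"
 by (auto simp: ln_ge_iff)
 then show False by simp
qed

subsection \<open>Truncations of matrices over the p-adic integers\<close>

lemma padic_level_mod:
 assumes "x \<in> carrier (padic_int p)" "i \<le> N"
 shows "x N mod int p ^ i = x i"
 using assms(2)
proof (induction N rule: dec_induct)
 case base
 have "0 \<le> x i" "x i < int p ^ i" using assms(1) by (simp_all add: padic_int_def)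
 then show ?case by simp
next
 case (step N)
 have "x (Suc N) mod int p ^ N = x N" using assms(1) by (simp add: padic_int_def)
 then have "x N mod int p ^ i = x (Suc N) mod int p ^ N mod int p ^ i" by simp
 also have "... = x (Suc N) mod int p ^ i" using step(1) by (intro mod_mod_cancel le_imp_power_dvd)
 finally show ?case using step by simp
qed

lemma padic_finsum_level:
 assumes p: "p > 0" and "finite A" "\<And>a. a \<in> A ==> f a \<in> carrier (padic_int p)"
 shows "[finsum (padic_int p) f A N = (\<Sum>a\<in>A. f a N)] (mod int p ^ N)"
 using assms(2,3)
proof (induction A rule: finite_induct)
 case empty
 interpret cring "padic_int p" by (rule padic_int_cring[OF p])
 have "finsum (padic_int p) f {} = \<zero>\<^bsub>padic_int p\<^esub>" by simp
 then show ?case by (simp add: padic_int_def cong_def)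
next
 case (insert a A)
 interpret cring "padic_int p" by (rule padic_int_cring[OF p])
 have "finsum (padic_int p) f (insert a A) = f a \<oplus>\<^bsub>padic_int p\<^esub> finsum (padic_int p) f A"
 using insert by (intro finsum_insert) auto
 then have "finsum (padic_int p) f (insert a A) N = (f a N + finsum (padic_int p) f A N) mod int p ^ N"
 by (simp add: padic_int_def)
 moreover have "[f a N + finsum (padic_int p) f A N = f a N + (\<Sum>a\<in>A. f a N)] (mod int p ^ N)"
 using insert by (intro cong_add cong_refl) auto
 ultimately show ?case using insert by (simp add: cong_def)
qed

lemma padic_finprod_level:
 assumes p: "p > 0" and "finite A" "\<And>a. a \<in> A ==> f a \<in> carrier (padic_int p)"
 shows "[finprod (padic_int p) f A N = (\<Prod>a\<in>A. f a N)] (mod int p ^ N)"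
 using assms(2,3)
proof (induction A rule: finite_induct)
 case empty
 interpret cring "padic_int p" by (rule padic_int_cring[OF p])
 have "finprod (padic_int p) f {} = \<one>\<^bsub>padic_int p\<^esub>" by simp
 then show ?case by (simp add: padic_int_def cong_def)
next
 case (insert a A)
 interpret cring "padic_int p" by (rule padic_int_cring[OF p])
 have "finprod (padic_int p) f (insert a A) = f a \<otimes>\<^bsub>padic_int p\<^esub> finprod (padic_int p) f A"
 using insert by (intro finprod_insert) auto
 then have "finprod (padic_int p) f (insert a A) N = (f a N * finprod (padic_int p) f A N) mod int p ^ N"
 by (simp add: padic_int_def)
 moreover have "[f a N * finprod (padic_int p) f A N = f a N * (\<Prod>a\<in>A. f a N)] (mod int p ^ N)"
 using insert by (intro cong_mult cong_refl) auto
 ultimately show ?case using insert by (simp add: cong_def)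
qed

lemma padic_neg_one_level:
 assumes p: "p > 0"
 shows "[(\<ominus>\<^bsub>padic_int p\<^esub> \<one>\<^bsub>padic_int p\<^esub>) N = - 1] (mod int p ^ N)"
proof -
 interpret cring "padic_int p" by (rule padic_int_cring[OF p])
 have "(\<ominus>\<^bsub>padic_int p\<^esub> \<one>\<^bsub>padic_int p\<^esub> \<oplus>\<^bsub>padic_int p\<^esub> \<one>\<^bsub>padic_int p\<^esub>) N = \<zero>\<^bsub>padic_int p\<^esub> N"
 by (simp add: l_neg)
 then have "((\<ominus>\<^bsub>padic_int p\<^esub> \<one>\<^bsub>padic_int p\<^esub>) N + 1 mod int p ^ N) mod int p ^ N = 0"
 by (simp add: padic_int_def)
 then have "[(\<ominus>\<^bsub>padic_int p\<^esub> \<one>\<^bsub>padic_int p\<^esub>) N + 1 = 0] (mod int p ^ N)"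
 by (simp add: cong_def mod_add_right_eq)
 then show ?thesis by (simp add: cong_iff_dvd_diff)
qed

text \<open>Representatives modulo p^N turn p-adic matrices into integer matrices, where ordinary
  determinants and congruences apply.\<close>

definition lev :: "nat \<Rightarrow> (nat \<Rightarrow> int) mat \<Rightarrow> nat \<Rightarrow> nat \<Rightarrow> int" where
 "lev N A = (\<lambda>i j. (A $$ (i, j)) N)"

lemma ring_mat_entry: "ring_mat R m A ==> i < m ==> j < m ==> A $$ (i, j) \<in> carrier R"
 unfolding ring_mat_def using elements_matI by blast

lemma det_mt: "det (mt n S) = (\<Sum>\<sigma> | \<sigma> permutes {..<n}. (if evenperm \<sigma> then 1 else - 1) * (\<Prod>i<n. S i (\<sigma> i)))"
 for S :: "nat \<Rightarrow> nat \<Rightarrow> int"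
proof -
 have "det (mt n S) = (\<Sum>\<sigma> | \<sigma> permutes {0..<n}. signof \<sigma> * (\<Prod>i = 0..<n. mt n S $$ (i, \<sigma> i)))"
 by (rule det_def') simp
 also have "... = (\<Sum>\<sigma> | \<sigma> permutes {..<n}. (if evenperm \<sigma> then 1 else - 1) * (\<Prod>i<n. S i (\<sigma> i)))"
 unfolding atLeast0LessThan
 proof (rule sum.cong[OF refl])
 fix \<sigma> assume "\<sigma> \<in> {\<sigma>. \<sigma> permutes {..<n}}"
 then have "\<And>i. i < n ==> \<sigma> i < n" using permutes_in_image by fastforce
 then have "(\<Prod>i<n. mt n S $$ (i, \<sigma> i)) = (\<Prod>i<n. S i (\<sigma> i))" by (intro prod.cong) auto
 then show "signof \<sigma> * (\<Prod>i<n. mt n S $$ (i, \<sigma> i)) = (if evenperm \<sigma> then 1 else - 1) * (\<Prod>i<n. S i (\<sigma> i))"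
 by (simp add: sign_def)
 qed
 finally show ?thesis .
qed

lemma det_mt_cong:
 fixes S S' :: "nat \<Rightarrow> nat \<Rightarrow> int"
 assumes "\<And>i j. i < n ==> j < n ==> [S i j = S' i j] (mod m)"
 shows "[det (mt n S) = det (mt n S')] (mod m)"
 unfolding det_mt
proof (intro cong_sum cong_mult cong_prod cong_refl)
 fix \<sigma> i assume "\<sigma> \<in> {\<sigma>. \<sigma> permutes {..<n}}" "i \<in> {..<n}"
 then have "\<sigma> i < n" using permutes_in_image by fastforce
 then show "[S i (\<sigma> i) = S' i (\<sigma> i)] (mod m)" using assms \<open>i \<in> {..<n}\<close> by blast
qed

lemma padic_det_level:
 assumes p: "p > 0" and A: "ring_mat (padic_int p) m A"
 shows "ring_det (padic_int p) A \<in> carrier (padic_int p)"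
 and "[ring_det (padic_int p) A N = det (mt m (lev N A))] (mod int p ^ N)"
proof -
 interpret cring "padic_int p" by (rule padic_int_cring[OF p])
 let ?R = "padic_int p"
 have dim: "dim_row A = m" using A by (auto simp: ring_mat_def)
 define t where "t = (\<lambda>\<sigma>. (if evenperm \<sigma> then \<one>\<^bsub>?R\<^esub> else \<ominus>\<^bsub>?R\<^esub> \<one>\<^bsub>?R\<^esub>) \<otimes>\<^bsub>?R\<^esub> finprod ?R (\<lambda>i. A $$ (i, \<sigma> i)) {..<m})"
 have rd: "ring_det ?R A = finsum ?R t {\<sigma>. \<sigma> permutes {..<m}}" unfolding ring_det_def t_def dim ..
 have fin: "finite {\<sigma>. \<sigma> permutes {..<m}}" by (simp add: finite_permutations)
 have en: "A $$ (i, \<sigma> i) \<in> carrier ?R" if "\<sigma> permutes {..<m}" "i \<in> {..<m}" for \<sigma> i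
 proof -
 have "\<sigma> i \<in> {..<m}" using permutes_in_image[OF that(1)] that(2) by blast
 then show ?thesis using ring_mat_entry[OF A] that(2) by simp
 qed
 have pc: "finprod ?R (\<lambda>i. A $$ (i, \<sigma> i)) {..<m} \<in> carrier ?R" if "\<sigma> permutes {..<m}" for \<sigma>
 using en[OF that] by (intro finprod_closed) auto
 have tc: "t \<sigma> \<in> carrier ?R" if "\<sigma> permutes {..<m}" for \<sigma>
 unfolding t_def using pc[OF that] by auto
 show "ring_det ?R A \<in> carrier ?R" unfolding rd using tc by (intro finsum_closed) auto
 have "[ring_det ?R A N = (\<Sum>\<sigma> | \<sigma> permutes {..<m}. t \<sigma> N)] (mod int p ^ N)"
 unfolding rd using fin tc by (intro padic_finsum_level p) auto
 also have "[(\<Sum>\<sigma> | \<sigma> permutes {..<m}. t \<sigma> N) = det (mt m (lev N A))] (mod int p ^ N)"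
 unfolding det_mt
 proof (rule cong_sum)
 fix \<sigma> assume s: "\<sigma> \<in> {\<sigma>. \<sigma> permutes {..<m}}"
 have 1: "[(if evenperm \<sigma> then \<one>\<^bsub>?R\<^esub> else \<ominus>\<^bsub>?R\<^esub> \<one>\<^bsub>?R\<^esub>) N = (if evenperm \<sigma> then 1 else - 1)] (mod int p ^ N)"
 proof (cases "evenperm \<sigma>")
 case True
 have "\<one>\<^bsub>?R\<^esub> N = 1 mod int p ^ N" by (simp add: padic_int_def)
 then show ?thesis using True by (simp add: cong_def)
 qed (use padic_neg_one_level[OF p] in simp)
 have 2: "[finprod ?R (\<lambda>i. A $$ (i, \<sigma> i)) {..<m} N = (\<Prod>i<m. lev N A i (\<sigma> i))] (mod int p ^ N)"
 unfolding lev_def using en s by (intro padic_finprod_level p) auto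
 have "t \<sigma> N = ((if evenperm \<sigma> then \<one>\<^bsub>?R\<^esub> else \<ominus>\<^bsub>?R\<^esub> \<one>\<^bsub>?R\<^esub>) N * finprod ?R (\<lambda>i. A $$ (i, \<sigma> i)) {..<m} N) mod int p ^ N"
 proof -
 have "(x \<otimes>\<^bsub>?R\<^esub> y) N = (x N * y N) mod int p ^ N" for x y by (simp add: padic_int_def)
 then show ?thesis unfolding t_def .
 qed
 then show "[t \<sigma> N = (if evenperm \<sigma> then 1 else - 1) * (\<Prod>i<m. lev N A i (\<sigma> i))] (mod int p ^ N)"
 using cong_mult[OF 1 2] by (simp add: cong_def)
 qed
 finally show "[ring_det ?R A N = det (mt m (lev N A))] (mod int p ^ N)" .
qed

lemma padic_unit_level:
 assumes p: "prime p" and u: "u \<in> Units (padic_int p)"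
 shows "\<not> int p dvd u 1"
proof
 assume d: "int p dvd u 1"
 obtain v where "u \<otimes>\<^bsub>padic_int p\<^esub> v = \<one>\<^bsub>padic_int p\<^esub>" using u unfolding Units_def by auto
 then have "(u \<otimes>\<^bsub>padic_int p\<^esub> v) 1 = \<one>\<^bsub>padic_int p\<^esub> 1" by simp
 then have "(u 1 * v 1) mod int p = 1 mod int p" by (simp add: padic_int_def)
 then have "[u 1 * v 1 = 1] (mod int p)" by (simp add: cong_def)
 moreover have "int p dvd u 1 * v 1" using d by simp
 ultimately have "int p dvd 1" using cong_dvd_iff by blast
 then show False using prime_gt_1_nat[OF p] by (simp add: zdvd1_eq)
qed

lemma padic_det_unit:
 assumes p: "prime p" and A: "ring_mat (padic_int p) m A" and u: "ring_det (padic_int p) A \<in> Units (padic_int p)" and N: "N \<ge> 1"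
 shows "\<not> int p dvd det (mt m (lev N A))"
 and "[det (mt m (lev N A)) = ring_det (padic_int p) A 1] (mod int p)"
proof -
 have p0: "p > 0" using p prime_gt_0_nat by blast
 let ?d = "ring_det (padic_int p) A"
 have "?d N mod int p ^ 1 = ?d 1" using padic_level_mod[OF padic_det_level(1)[OF p0 A] N] .
 then have 1: "[?d N = ?d 1] (mod int p)" unfolding cong_def power_one_right by (metis mod_mod_trivial)
 have "int p dvd int p ^ N" using N by (simp add: dvd_power)
 then have "[?d N = det (mt m (lev N A))] (mod int p)"
 using padic_det_level(2)[OF p0 A, of N] cong_dvd_modulus by blast
 then show 2: "[det (mt m (lev N A)) = ?d 1] (mod int p)" using 1 cong_trans cong_sym by blast
 show "\<not> int p dvd det (mt m (lev N A))" using padic_unit_level[OF p u] cong_dvd_iff[OF 2] by simp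
qed

lemma padic_mult_level: "(x \<otimes>\<^bsub>padic_int p\<^esub> y) N = (x N * y N) mod int p ^ N"
 by (simp add: padic_int_def)

lemma padic_matmult_level:
 assumes p: "p > 0" and A: "A \<in> carrier_mat m m" "B \<in> carrier_mat m m"
 "\<And>i j. i < m ==> j < m ==> A $$ (i, j) \<in> carrier (padic_int p)" "\<And>i j. i < m ==> j < m ==> B $$ (i, j) \<in> carrier (padic_int p)"
 and ij: "i < m" "j < m"
 shows "ring_mat_mult (padic_int p) A B $$ (i, j) \<in> carrier (padic_int p)"
 and "[(ring_mat_mult (padic_int p) A B $$ (i, j)) N = (\<Sum>l<m. lev N A i l * lev N B l j)] (mod int p ^ N)"
proof -
 interpret cring "padic_int p" by (rule padic_int_cring[OF p])
 have e: "ring_mat_mult (padic_int p) A B $$ (i, j) = finsum (padic_int p) (\<lambda>l. A $$ (i, l) \<otimes>\<^bsub>padic_int p\<^esub> B $$ (l, j)) {..<m}"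
 using A ij by (simp add: ring_mat_mult_def)
 have c: "A $$ (i, l) \<otimes>\<^bsub>padic_int p\<^esub> B $$ (l, j) \<in> carrier (padic_int p)" if "l \<in> {..<m}" for l
 using A ij that by (intro m_closed) auto
 show "ring_mat_mult (padic_int p) A B $$ (i, j) \<in> carrier (padic_int p)"
 unfolding e using c by (intro finsum_closed) auto
 have "[finsum (padic_int p) (\<lambda>l. A $$ (i, l) \<otimes>\<^bsub>padic_int p\<^esub> B $$ (l, j)) {..<m} N
 = (\<Sum>l<m. (A $$ (i, l) \<otimes>\<^bsub>padic_int p\<^esub> B $$ (l, j)) N)] (mod int p ^ N)"
 using c by (intro padic_finsum_level p) auto
 also have "[(\<Sum>l<m. (A $$ (i, l) \<otimes>\<^bsub>padic_int p\<^esub> B $$ (l, j)) N) = (\<Sum>l<m. lev N A i l * lev N B l j)] (mod int p ^ N)"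
 by (intro cong_sum) (simp add: padic_mult_level lev_def cong_def)
 finally show "[(ring_mat_mult (padic_int p) A B $$ (i, j)) N = (\<Sum>l<m. lev N A i l * lev N B l j)] (mod int p ^ N)"
 unfolding e .
qed

lemma padic_of_int_carrier: "p > 0 ==> padic_of_int p z \<in> carrier (padic_int p)"
 by (auto simp: padic_int_def padic_of_int_def mod_mod_cancel)

text \<open>Precision p^2 is what is needed: the p-modular block has to be divided by p and still be
  known modulo p. \<open>T\<close> is an integer matrix, so \<open>S\<close> is a true Gram matrix
  of lattice vectors; only its block shape is approximate.\<close>

lemma jordan_truncate:
 assumes p: "prime p" and G: "G \<in> carrier_mat r r" and j: "jordan_sign G p n eps"
 defines "g \<equiv> \<lambda>i j. G $$ (i, j)"
 shows "n \<le> r \<and> (\<exists>T B. \<not> int p dvd det (mt r T) \<and>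
 (let S = (\<lambda>j k. bl {..<r} g (\<lambda>i. T i j) (\<lambda>i. T i k)) in
 \<not> int p dvd det (mt (r - n) S) \<and>
 (\<forall>j<r. \<forall>k<r. (j < r - n) ~= (k < r - n) --> (int p)\<^sup>2 dvd S j k) \<and>
 (\<forall>j<n. \<forall>k<n. [S (r - n + j) (r - n + k) = int p * B j k] (mod (int p)\<^sup>2)) \<and>
 \<not> int p dvd det (mt n B) \<and> eps = Legendre (det (mt n B)) (int p)))"
proof -
 let ?R = "padic_int p"
 have p0: "p > 0" using p prime_gt_0_nat by blast
 have rk: "rk G = r" using G by (simp add: rk_def)
 obtain L0 L1 T where nr: "n \<le> r" and L0: "unimodular ?R (r - n) L0" and L1: "unimodular ?R n L1"
 and T: "ring_mat ?R r T" "ring_det ?R T \<in> Units ?R"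
 and eq: "ring_mat_mult ?R (transpose_mat T) (ring_mat_mult ?R (map_mat (padic_of_int p) G) T) =
 orth_sum ?R L0 (map_mat (\<lambda>c. padic_of_int p (int p) \<otimes>\<^bsub>?R\<^esub> c) L1)"
 and eps: "eps = Legendre (ring_det ?R L1 1) (int p)"
 using j unfolding jordan_sign_def ring_isometric_def rk by blast
 let ?m = "r - n"
 let ?O = "orth_sum ?R L0 (map_mat (\<lambda>c. padic_of_int p (int p) \<otimes>\<^bsub>?R\<^esub> c) L1)"
 let ?M = "ring_mat_mult ?R (map_mat (padic_of_int p) G) T"
 have c0: "L0 \<in> carrier_mat ?m ?m" and c1: "L1 \<in> carrier_mat n n" and cT: "T \<in> carrier_mat r r"
 using L0 L1 T by (auto simp: unimodular_def ring_mat_def)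
 define T' where "T' = lev 2 T"
 define B where "B = lev 2 L1"
 define S where "S = (\<lambda>j k. bl {..<r} g (\<lambda>i. T' i j) (\<lambda>i. T' i k))"
 have Te: "\<And>i j. i < r ==> j < r ==> T $$ (i, j) \<in> carrier ?R" using ring_mat_entry[OF T(1)] by blast
 have Ge: "\<And>i j. i < r ==> j < r ==> map_mat (padic_of_int p) G $$ (i, j) \<in> carrier ?R"
 using padic_of_int_carrier[OF p0] G by auto
 have Mc: "?M \<in> carrier_mat r r" using G cT by (simp add: ring_mat_mult_def)
 have Me: "?M $$ (i, j) \<in> carrier ?R" if "i < r" "j < r" for i j
 using padic_matmult_level(1)[OF p0 _ cT Ge Te that] G by simp
 have key: "[(?O $$ (j, k)) 2 = S j k] (mod int p ^ 2)" if jk: "j < r" "k < r" for j k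
 proof -
 have "[(?O $$ (j, k)) 2 = (\<Sum>l<r. lev 2 (transpose_mat T) j l * lev 2 ?M l k)] (mod int p ^ 2)"
 unfolding eq[symmetric] using cT Te jk by (intro padic_matmult_level(2)[OF p0 _ Mc _ Me]) auto
 also have "[(\<Sum>l<r. lev 2 (transpose_mat T) j l * lev 2 ?M l k) = (\<Sum>l<r. T' l j * (\<Sum>i<r. g l i * T' i k))] (mod int p ^ 2)"
 proof (intro cong_sum cong_mult)
 fix l assume l: "l \<in> {..<r}"
 show "[lev 2 (transpose_mat T) j l = T' l j] (mod int p ^ 2)" using cT l jk by (simp add: lev_def T'_def)
 have "[lev 2 ?M l k = (\<Sum>i<r. lev 2 (map_mat (padic_of_int p) G) l i * lev 2 T i k)] (mod int p ^ 2)"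
 unfolding lev_def[of 2 ?M] using padic_matmult_level(2)[OF p0 _ cT Ge Te, of l k 2] G l jk by simp
 also have "[(\<Sum>i<r. lev 2 (map_mat (padic_of_int p) G) l i * lev 2 T i k) = (\<Sum>i<r. g l i * T' i k)] (mod int p ^ 2)"
 using G l by (intro cong_sum cong_mult) (auto simp: lev_def padic_of_int_def g_def T'_def cong_def)
 finally show "[lev 2 ?M l k = (\<Sum>i<r. g l i * T' i k)] (mod int p ^ 2)" .
 qed
 finally show ?thesis unfolding S_def bl_row .
 qed
 have O1: "?O $$ (j, k) = L0 $$ (j, k)" if "j < ?m" "k < ?m" for j k
 using that c0 c1 by (simp add: orth_sum_def)
 have O2: "(?O $$ (j, k)) 2 = 0" if "j < r" "k < r" "(j < ?m) ~= (k < ?m)" for j k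
 using that c0 c1 nr by (auto simp: orth_sum_def padic_int_def)
 have O3: "?O $$ (?m + j, ?m + k) = padic_of_int p (int p) \<otimes>\<^bsub>?R\<^esub> L1 $$ (j, k)" if "j < n" "k < n" for j k
 proof -
 obtain m where m: "r = m + n" using nr by (metis le_add_diff_inverse2)
 show ?thesis using that c0 c1 unfolding m by (simp add: orth_sum_def)
 qed
 have u0: "\<not> int p dvd det (mt ?m (lev 2 L0))"
 using L0 padic_det_unit(1)[OF p, of ?m L0 2] by (simp add: unimodular_def)
 have "[det (mt ?m (lev 2 L0)) = det (mt ?m S)] (mod int p)"
 proof (rule det_mt_cong)
 fix i j assume ij: "i < ?m" "j < ?m"
 then have "[lev 2 L0 i j = S i j] (mod int p ^ 2)" using key[of i j] O1 by (simp add: lev_def)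
 then show "[lev 2 L0 i j = S i j] (mod int p)" by (rule cong_dvd_modulus) simp
 qed
 then have 1: "\<not> int p dvd det (mt ?m S)" using u0 cong_dvd_iff by blast
 have 2: "(int p)\<^sup>2 dvd S j k" if "j < r" "k < r" "(j < ?m) ~= (k < ?m)" for j k
 using cong_sym[OF key[OF that(1,2)]] O2[OF that] by (simp add: cong_0_iff)
 have 3: "[S (?m + j) (?m + k) = int p * B j k] (mod (int p)\<^sup>2)" if "j < n" "k < n" for j k
 proof -
 have e: "(?O $$ (?m + j, ?m + k)) 2 = (padic_of_int p (int p) \<otimes>\<^bsub>?R\<^esub> L1 $$ (j, k)) 2"
 using arg_cong[OF O3[OF that], of "\<lambda>x. x 2"] .
 have "[S (?m + j) (?m + k) = (?O $$ (?m + j, ?m + k)) 2] (mod (int p)\<^sup>2)"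
 using key[of "?m + j" "?m + k"] that nr by (simp add: cong_sym_eq)
 also have "[(?O $$ (?m + j, ?m + k)) 2 = int p * B j k] (mod (int p)\<^sup>2)"
 unfolding e unfolding padic_mult_level B_def lev_def padic_of_int_def cong_def by (simp add: mod_mult_left_eq)
 finally show ?thesis .
 qed
 have 4: "\<not> int p dvd det (mt n B)" "[det (mt n B) = ring_det ?R L1 1] (mod int p)"
 using L1 padic_det_unit[OF p, of n L1 2] by (auto simp: unimodular_def B_def)
 have 5: "\<not> int p dvd det (mt r T')" using padic_det_unit(1)[OF p T, of 2] by (simp add: T'_def)
 have 6: "eps = Legendre (det (mt n B)) (int p)" unfolding eps using Legendre_cong[OF 4(2)] ..
 show ?thesis
 using nr 1 2 3 4(1) 5 6 by (intro conjI exI[of _ T'] exI[of _ B]) (simp_all add: S_def[symmetric])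
qed

subsection \<open>Orthogonal bases over the localizations of the integers\<close>

lemma obas_empty: "obas {} S V d"
 by (simp add: obas_def)

text \<open>The indices of \<open>I0\<close> are pivoted away one by one. As p^2 divides the entries
  between the two blocks, each pivot multiplies the block on \<open>I1\<close> by a unit square
  modulo p^2. The resulting \<open>S'\<close> is handed back for a separate diagonalization, since a
  p-modular block has unit pivots only after division by p.\<close>

lemma jordan_split:
 fixes p :: int
 assumes p: "prime p" "\<not> p dvd 2"
 shows "finite I0 ==> finite I1 ==> I0 \<inter> I1 = {} ==> symon (I0 \<union> I1) S ==> nd p I0 S ==>
 (\<And>j k. j \<in> I0 ==> k \<in> I1 ==> p\<^sup>2 dvd S j k) ==>
 \<exists>S' t. \<not> p dvd t \<and> symon I1 S' \<and> (\<forall>j\<in>I1. \<forall>k\<in>I1. [S' j k = t\<^sup>2 * S j k] (mod p\<^sup>2)) \<and>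
 (\<forall>V1 d1. obas I1 S' V1 d1 -->
 (\<exists>V d. obas (I0 \<union> I1) S V d \<and> (\<forall>i\<in>I0. \<not> p dvd d i) \<and> (\<forall>i\<in>I1. d i = d1 i)))"
proof (induction "card I0" arbitrary: I0 S)
 case 0
 then have "I0 = {}" by simp
 then show ?case using 0 p(1) by (intro exI[of _ S] exI[of _ 1]) (auto simp: not_prime_unit)
next
 case (Suc n)
 note IH = Suc.hyps(1) and cI = Suc.hyps(2) and fin = Suc.prems(1,2) and dis = Suc.prems(3)
 let ?I = "I0 \<union> I1"
 let ?goal = "\<lambda>S. \<exists>S' t. \<not> p dvd t \<and> symon I1 S' \<and> (\<forall>j\<in>I1. \<forall>k\<in>I1. [S' j k = t\<^sup>2 * S j k] (mod p\<^sup>2)) \<and>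
 (\<forall>V1 d1. obas I1 S' V1 d1 -->
 (\<exists>V d. obas (I0 \<union> I1) S V d \<and> (\<forall>i\<in>I0. \<not> p dvd d i) \<and> (\<forall>i\<in>I1. d i = d1 i)))"
 have pivot: "?goal S" if sym: "symon ?I S" and n: "nd p I0 S" and mix: "\<And>j k. j \<in> I0 ==> k \<in> I1 ==> p\<^sup>2 dvd S j k"
 and i: "i \<in> I0" and s: "\<not> p dvd S i i" for S i
 proof -
 have ni: "i \<notin> I1" using i dis by blast
 have Ie: "?I - {i} = (I0 - {i}) \<union> I1" using ni by auto
 have fI: "finite ?I" "i \<in> ?I" using fin i by auto
 have "\<exists>S' t. \<not> p dvd t \<and> symon I1 S' \<and> (\<forall>j\<in>I1. \<forall>k\<in>I1. [S' j k = t\<^sup>2 * piv S i j k] (mod p\<^sup>2)) \<and>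
 (\<forall>V1 d1. obas I1 S' V1 d1 -->
 (\<exists>V d. obas ((I0 - {i}) \<union> I1) (piv S i) V d \<and> (\<forall>i\<in>I0 - {i}. \<not> p dvd d i) \<and> (\<forall>i\<in>I1. d i = d1 i)))"
 proof (rule IH)
 show "n = card (I0 - {i})" using cI i fin by simp
 show "symon ((I0 - {i}) \<union> I1) (piv S i)" using symon_piv[OF sym, of i] Ie by simp
 have "symon I0 S" using sym by (auto simp: symon_def)
 then show "nd p (I0 - {i}) (piv S i)" using nd_pivot[OF fin(1) i] p s n by blast
 show "p\<^sup>2 dvd piv S i j k" if "j \<in> I0 - {i}" "k \<in> I1" for j k
 using mix[of j k] mix[of i k] that i unfolding piv_def by (intro dvd_diff dvd_mult) auto
 qed (use fin dis in auto)
 then obtain S' t where S': "\<not> p dvd t" "symon I1 S'" "\<And>j k. j \<in> I1 ==> k \<in> I1 ==> [S' j k = t\<^sup>2 * piv S i j k] (mod p\<^sup>2)"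
 and ob: "\<And>V1 d1. obas I1 S' V1 d1 ==>
 (\<exists>V d. obas ((I0 - {i}) \<union> I1) (piv S i) V d \<and> (\<forall>i\<in>I0 - {i}. \<not> p dvd d i) \<and> (\<forall>i\<in>I1. d i = d1 i))" by blast
 have a1: "\<not> p dvd t * S i i" using p S'(1) s prime_dvd_mult_iff by blast
 have a2: "[S' j k = (t * S i i)\<^sup>2 * S j k] (mod p\<^sup>2)" if jk: "j \<in> I1" "k \<in> I1" for j k
 proof -
 have "[piv S i j k = S i i * S i i * S j k - 0] (mod p\<^sup>2)"
 unfolding piv_def using mix[OF i jk(1)] by (intro cong_diff cong_refl) (auto simp: cong_0_iff)
 then have "[t\<^sup>2 * piv S i j k = t\<^sup>2 * (S i i * S i i * S j k - 0)] (mod p\<^sup>2)" by (intro cong_mult cong_refl)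
 then show ?thesis
 using cong_trans[OF S'(3)[OF jk]] by (simp add: power2_eq_square mult_ac)
 qed
 have a3: "\<exists>V d. obas ?I S V d \<and> (\<forall>i\<in>I0. \<not> p dvd d i) \<and> (\<forall>i\<in>I1. d i = d1 i)" if "obas I1 S' V1 d1" for V1 d1
 proof -
 obtain V d where V: "obas ((I0 - {i}) \<union> I1) (piv S i) V d" "\<forall>i\<in>I0 - {i}. \<not> p dvd d i" "\<forall>i\<in>I1. d i = d1 i"
 using ob[OF \<open>obas I1 S' V1 d1\<close>] by blast
 have "S i i ~= 0" using s by auto
 moreover have "obas (?I - {i}) (piv S i) V d" using V(1) Ie by simp
 ultimately have "\<exists>V. obas ?I S V (d(i := S i i))" using obas_pivot[OF fI sym, of V d] by blast
 moreover have "\<forall>j\<in>I0. \<not> p dvd (d(i := S i i)) j" using V(2) s by auto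
 moreover have "\<forall>j\<in>I1. (d(i := S i i)) j = d1 j" using V(3) ni by auto
 ultimately show ?thesis by blast
 qed
 show ?thesis by (rule exI[of _ S'], rule exI[of _ "t * S i i"]) (use a1 S'(2) a2 a3 in blast)
 qed
 show ?case
 proof (cases "\<exists>i\<in>I0. \<not> p dvd S i i")
 case True
 then obtain i where "i \<in> I0" "\<not> p dvd S i i" by blast
 then show ?thesis using pivot[OF Suc.prems(4-6)] by blast
 next
 case False
 obtain i where i: "i \<in> I0" using cI by fastforce
 \<comment> \<open>All diagonal entries are divisible by p. Some \<open>S j i\<close> is a unit, and
   then e_i + e_j has norm \<open>S i i\<close> + \<open>S j j\<close> + 2 \<open>S j i\<close>, a
   unit because p is odd.\<close>
 obtain j where j: "j \<in> I0" "\<not> p dvd S j i" using nd_entry[OF Suc.prems(5) i fin(1) p(1)] by blast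
 have ij: "i ~= j" using False i j by auto
 let ?A = "addb S i j"
 have Sij: "S i j = S j i" using Suc.prems(4) i j unfolding symon_def by blast
 have nA: "\<not> p dvd ?A i i"
 proof
 assume "p dvd ?A i i"
 then have "p dvd S i i + S j j + 2 * S j i" using Sij by (simp add: addb_def algebra_simps)
 moreover have "p dvd S i i + S j j" using False i j by simp
 ultimately have "p dvd 2 * S j i" using dvd_add_right_iff by blast
 then show False using p j(2) prime_dvd_mult_iff by blast
 qed
 have sA: "symon ?I ?A" using symon_addb[OF Suc.prems(4)] i j by simp
 have ndA: "nd p I0 ?A" using nd_addb[OF fin(1) i j(1) ij Suc.prems(5)] .
 have mA: "p\<^sup>2 dvd ?A a b" if "a \<in> I0" "b \<in> I1" for a b
 using Suc.prems(6)[of a b] Suc.prems(6)[of j b] that j dis i unfolding addb_def by auto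
 have eA: "?A a b = S a b" if "a \<in> I1" "b \<in> I1" for a b using that i dis by (auto simp: addb_def)
 obtain S' t where S': "\<not> p dvd t" "symon I1 S'" "\<And>j k. j \<in> I1 ==> k \<in> I1 ==> [S' j k = t\<^sup>2 * ?A j k] (mod p\<^sup>2)"
 and ob: "\<And>V1 d1. obas I1 S' V1 d1 ==>
 (\<exists>V d. obas ?I ?A V d \<and> (\<forall>i\<in>I0. \<not> p dvd d i) \<and> (\<forall>i\<in>I1. d i = d1 i))"
 using pivot[OF sA ndA mA i nA] by blast
 have "\<exists>V d. obas ?I S V d \<and> (\<forall>i\<in>I0. \<not> p dvd d i) \<and> (\<forall>i\<in>I1. d i = d1 i)" if o: "obas I1 S' V1 d1" for V1 d1
 proof -
 obtain V d where V: "obas ?I ?A V d" "\<forall>i\<in>I0. \<not> p dvd d i" "\<forall>i\<in>I1. d i = d1 i" using ob[OF o] by blast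
 have "\<exists>V. obas ?I S V d" using obas_addb[OF _ _ _ ij V(1)] fin i j by blast
 then show ?thesis using V by blast
 qed
 moreover have "[S' j k = t\<^sup>2 * S j k] (mod p\<^sup>2)" if "j \<in> I1" "k \<in> I1" for j k
 using S'(3)[OF that] eA[OF that] by simp
 ultimately show ?thesis by - (rule exI[of _ S'], rule exI[of _ t], use S'(1,2) in blast)
 qed
qed

lemma local_orth_basis:
 fixes p :: int
 assumes "prime p" "\<not> p dvd 2" "finite I" "symon I S" "nd p I S"
 shows "\<exists>V d. obas I S V d \<and> (\<forall>i\<in>I. \<not> p dvd d i)"
proof -
 have "\<exists>S' t. \<not> p dvd t \<and> symon {} S' \<and> (\<forall>j\<in>{}. \<forall>k\<in>{}. [S' j k = t\<^sup>2 * S j k] (mod p\<^sup>2)) \<and>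
 (\<forall>V1 d1. obas {} S' V1 d1 -->
 (\<exists>V d. obas (I \<union> {}) S V d \<and> (\<forall>i\<in>I. \<not> p dvd d i) \<and> (\<forall>i\<in>{}. d i = d1 i)))"
 using assms by (intro jordan_split) auto
 then show ?thesis using obas_empty by (metis sup_bot.right_neutral)
qed

section \<open>Diagonalization at 2\<close>

text \<open>An even form offers no odd diagonal entry, so the pivot is a 2 x 2 block with odd
  determinant \<open>\<beta>\<close>. This is its Schur complement multiplied by the square of
  \<open>\<beta>\<close>.\<close>

definition piv2 :: "(nat \<Rightarrow> nat \<Rightarrow> int) \<Rightarrow> nat \<Rightarrow> nat \<Rightarrow> nat \<Rightarrow> nat \<Rightarrow> int" where
 "piv2 S i j k l = (let \<beta> = S i i * S j j - S i j * S i j in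
 \<beta> * \<beta> * S k l - \<beta> * (S j j * S i k * S i l - S i j * (S i k * S j l + S j k * S i l) + S i i * S j k * S j l))"

text \<open>The coefficients at i and j come from the adjugate of the block and make the lifted
  vector orthogonal to e_i and e_j.\<close>

definition lift2 :: "nat set \<Rightarrow> (nat \<Rightarrow> nat \<Rightarrow> int) \<Rightarrow> nat \<Rightarrow> nat \<Rightarrow> (nat \<Rightarrow> int) \<Rightarrow> nat \<Rightarrow> int" where
 "lift2 K S i j y = (\<lambda>k. let A = \<Sum>l\<in>K. S i l * y l; B = \<Sum>l\<in>K. S j l * y l in
 if k = i then - (S j j * A - S i j * B) else if k = j then - (S i i * B - S i j * A)
 else (S i i * S j j - S i j * S i j) * y k)"

definition blk :: "nat \<Rightarrow> nat \<Rightarrow> int \<Rightarrow> int \<Rightarrow> nat \<Rightarrow> int" where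
 "blk i j x y = (\<lambda>k. if k = i then x else if k = j then y else 0)"

lemma blk_rows:
 assumes "finite K" "i \<notin> K" "j \<notin> K" "i ~= j"
 shows "(\<Sum>k\<in>insert i (insert j K). f k * blk i j x y k) = f i * x + f j * y"
proof -
 have "(\<Sum>k\<in>K. f k * blk i j x y k) = 0" using assms by (intro sum.neutral) (auto simp: blk_def)
 then show ?thesis using assms by (simp add: blk_def)
qed

lemma lift2_rows:
 fixes S i j K
 defines "I \<equiv> insert i (insert j K)" and "\<beta> \<equiv> S i i * S j j - S i j * S i j"
 assumes K: "finite K" "i \<notin> K" "j \<notin> K" "i ~= j" and sym: "symon I S"
 shows "(\<Sum>k\<in>I. S i k * lift2 K S i j y k) = 0" "(\<Sum>k\<in>I. S j k * lift2 K S i j y k) = 0"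
 and "k \<in> K ==> \<beta> * (\<Sum>l\<in>I. S k l * lift2 K S i j y l) = (\<Sum>l\<in>K. piv2 S i j k l * y l)"
proof -
 define A B where "A = (\<Sum>l\<in>K. S i l * y l)" and "B = (\<Sum>l\<in>K. S j l * y l)"
 have Sji: "S j i = S i j" using sym unfolding symon_def I_def by blast
 have r: "(\<Sum>l\<in>I. f l * lift2 K S i j y l) = - f i * (S j j * A - S i j * B) - f j * (S i i * B - S i j * A) + \<beta> * (\<Sum>l\<in>K. f l * y l)" for f
 proof -
 have e1: "(\<Sum>l\<in>K. f l * lift2 K S i j y l) = \<beta> * (\<Sum>l\<in>K. f l * y l)"
 unfolding sum_distrib_left
 proof (rule sum.cong[OF refl])
 fix l assume "l \<in> K"
 then have "l ~= i" "l ~= j" using K by auto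
 then show "f l * lift2 K S i j y l = \<beta> * (f l * y l)" by (simp add: lift2_def \<beta>_def)
 qed
 have e2: "lift2 K S i j y i = - (S j j * A - S i j * B)" "lift2 K S i j y j = - (S i i * B - S i j * A)"
 using K by (simp_all add: lift2_def A_def B_def Let_def)
 show ?thesis unfolding I_def using K by (simp add: e1 e2 algebra_simps)
 qed
 show "(\<Sum>k\<in>I. S i k * lift2 K S i j y k) = 0"
 unfolding r A_def[symmetric] \<beta>_def by (simp add: algebra_simps)
 show "(\<Sum>k\<in>I. S j k * lift2 K S i j y k) = 0"
 unfolding r B_def[symmetric] \<beta>_def Sji by (simp add: algebra_simps)
 assume k: "k \<in> K"
 have Ski: "S k i = S i k" "S k j = S j k" using sym k unfolding symon_def I_def by blast+
 have "(\<Sum>l\<in>K. piv2 S i j k l * y l) = (\<Sum>l\<in>K. \<beta> * \<beta> * (S k l * y l) - \<beta> * (S j j * S i k - S i j * S j k) * (S i l * y l)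
 - \<beta> * (S i i * S j k - S i j * S i k) * (S j l * y l))"
 by (intro sum.cong refl) (simp add: piv2_def Let_def \<beta>_def[symmetric] algebra_simps)
 also have "... = \<beta> * \<beta> * (\<Sum>l\<in>K. S k l * y l) - \<beta> * (S j j * S i k - S i j * S j k) * A - \<beta> * (S i i * S j k - S i j * S i k) * B"
 unfolding A_def B_def by (simp add: sum_subtractf sum_distrib_left)
 also have "... = \<beta> * (\<Sum>l\<in>I. S k l * lift2 K S i j y l)"
 unfolding r Ski by (simp add: algebra_simps)
 finally show "\<beta> * (\<Sum>l\<in>I. S k l * lift2 K S i j y l) = (\<Sum>l\<in>K. piv2 S i j k l * y l)" ..
qed

lemma obas_block:
 fixes S i j K
 defines "I \<equiv> insert i (insert j K)"
 assumes K: "finite K" "i \<notin> K" "j \<notin> K" "i ~= j" and sym: "symon I S"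
 and o: "obas K (piv2 S i j) V d"
 and n0: "n0 = S i i * x0 * x0 + 2 * S i j * x0 * y0 + S j j * y0 * y0" "n0 ~= 0"
 and n1: "n1 = S i i * x1 * x1 + 2 * S i j * x1 * y1 + S j j * y1 * y1" "n1 ~= 0"
 and ort: "S i i * x0 * x1 + S i j * (x0 * y1 + x1 * y0) + S j j * y0 * y1 = 0"
 shows "\<exists>W. obas I S W (d(i := n0, j := n1))"
proof -
 define W where "W = (\<lambda>k a. if a = i then blk i j x0 y0 k else if a = j then blk i j x1 y1 k else lift2 K S i j (\<lambda>l. V l a) k)"
 have Sji: "S j i = S i j" using sym unfolding symon_def I_def by blast
 have fI: "finite I" using K by (simp add: I_def)
 have b: "bl I S (blk i j x y) v = x * (\<Sum>k\<in>I. S i k * v k) + y * (\<Sum>k\<in>I. S j k * v k)" for x y v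
 using blk_rows[OF K, of "\<lambda>j. \<Sum>k\<in>I. S j k * v k" x y] unfolding bl_row I_def by (simp add: mult.commute)
 have bb: "bl I S (blk i j x y) (blk i j x' y') = x * (S i i * x' + S i j * y') + y * (S i j * x' + S j j * y')" for x y x' y'
 unfolding b using blk_rows[OF K, of "S i" x' y'] blk_rows[OF K, of "S j" x' y'] Sji by (simp add: I_def)
 have bl0: "bl I S (blk i j x y) (lift2 K S i j z) = 0" for x y z
 unfolding b using lift2_rows(1,2)[OF K sym[unfolded I_def], of z] by (simp add: I_def)
 have s: "bl I S u v = bl I S v u" for u v using sym unfolding symon_def by (intro bl_sym) blast+
 have ll: "bl I S (lift2 K S i j y) (lift2 K S i j z) = bl K (piv2 S i j) y z" for y z
 proof -
 let ?r = "\<lambda>k. \<Sum>l\<in>I. S k l * lift2 K S i j z l"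
 have "bl I S (lift2 K S i j y) (lift2 K S i j z) = (\<Sum>k\<in>K. lift2 K S i j y k * ?r k)"
 unfolding bl_row using K lift2_rows(1,2)[OF K sym[unfolded I_def], of z] by (simp add: I_def)
 also have "... = (\<Sum>k\<in>K. y k * (\<Sum>l\<in>K. piv2 S i j k l * z l))"
 proof (rule sum.cong[OF refl])
 fix k assume k: "k \<in> K"
 then have "k ~= i" "k ~= j" using K by auto
 then have "lift2 K S i j y k * ?r k = y k * ((S i i * S j j - S i j * S i j) * ?r k)" by (simp add: lift2_def mult_ac)
 then show "lift2 K S i j y k * ?r k = y k * (\<Sum>l\<in>K. piv2 S i j k l * z l)"
 using lift2_rows(3)[OF K sym[unfolded I_def] k, of z] by (simp add: I_def)
 qed
 finally show ?thesis unfolding bl_row .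
 qed
 have "obas I S W (d(i := n0, j := n1))"
 unfolding obas_def
 proof (intro conjI ballI)
 show "(d(i := n0, j := n1)) a ~= 0" if "a \<in> I" for a using that n0(2) n1(2) o K by (auto simp: obas_def I_def)
 fix a c assume ac: "a \<in> I" "c \<in> I"
 have W: "(\<lambda>k. W k i) = blk i j x0 y0" "(\<lambda>k. W k j) = blk i j x1 y1"
 "\<And>a. a \<in> K ==> (\<lambda>k. W k a) = lift2 K S i j (\<lambda>l. V l a)" using K by (auto simp: W_def)
 have d: "a \<in> K ==> (d(i := n0, j := n1)) a = d a" for a using K by auto
 have 00: "bl I S (blk i j x0 y0) (blk i j x0 y0) = n0" unfolding bb n0 by (simp add: algebra_simps)
 have 11: "bl I S (blk i j x1 y1) (blk i j x1 y1) = n1" unfolding bb n1 by (simp add: algebra_simps)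
 have 01: "bl I S (blk i j x0 y0) (blk i j x1 y1) = 0" unfolding bb using ort by (simp add: algebra_simps)
 have 10: "bl I S (blk i j x1 y1) (blk i j x0 y0) = 0" using 01 s by metis
 have 20: "bl I S (lift2 K S i j z) (blk i j x y) = 0" for x y z using bl0 s by metis
 have "a = i \<or> a = j \<or> a \<in> K" "c = i \<or> c = j \<or> c \<in> K" using ac by (auto simp: I_def)
 then show "bl I S (\<lambda>k. W k a) (\<lambda>k. W k c) = (if a = c then (d(i := n0, j := n1)) a else 0)"
 proof (elim disjE)
 assume "a \<in> K" "c \<in> K"
 then show ?thesis using W(3) ll d o by (simp add: obas_def)
 qed (use W 00 11 01 10 20 bl0 K in auto)
 qed
 then show ?thesis by blast
qed

lemma tab_block_table:
 "\<forall>r\<in>set [1, 3, 5, 7]. (tab True r + tab True ((r * 3) mod 8)) mod 8 = 0 mod 8 \<and> (r * 7) mod 8 = (8 - r) mod 8"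
 by code_simp

text \<open>The plane with Gram entries a, b, c diagonalizes to a and a (ac - b^2), and ac - b^2 is
  7 or 3 modulo 8. With 7 the two oddities are opposite. With 3, a is twice an odd number, and the
  antisquare shift makes the two values cancel.\<close>

lemma g2_block:
 assumes "a ~= 0" "even a" "even c" "odd b"
 shows "[g2 a + g2 (a * (a * c - b * b)) = 0] (mod 8)"
proof -
 obtain k u where a: "a = 2 ^ k * u" and u: "odd u" using two_decomp[OF assms(1)] .
 let ?b = "a * c - b * b"
 have ob: "odd ?b" using assms by simp
 have "odd (u * ?b)" using u ob by simp
 moreover have "a * ?b = 2 ^ k * (u * ?b)" by (simp add: a)
 ultimately have g: "g2 a = tab (odd k) (u mod 8)" "g2 (a * ?b) = tab (odd k) ((u * ?b) mod 8)"
 using g2_pu u a by metis+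
 have um: "u mod 8 \<in> set [1, 3, 5, 7]" using odd_mod8[OF u] by auto
 have m: "(u * ?b) mod 8 = ((u mod 8) * (?b mod 8)) mod 8" by (simp only: mod_mult_eq)
 obtain x where x: "a = 2 * x" using assms(2) by blast
 obtain y where y: "c = 2 * y" using assms(3) by blast
 obtain z where z: "b = 2 * z + 1" using assms(4) by (auto elim: oddE)
 have bb: "?b = 4 * (x * y) - 4 * (z * (z + 1)) - 1" unfolding x y z by (simp add: algebra_simps)
 have "even (z * (z + 1))" by simp
 then obtain w where w: "z * (z + 1) = 2 * w" by blast
 show ?thesis
 proof (cases "even (x * y)")
 case True
 then obtain v where "x * y = 2 * v" by blast
 then have e: "?b = 7 + 8 * (v - w - 1)" unfolding bb w by simp
 have "?b mod 8 = 7" unfolding e mod_mult_self2 by simp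
 moreover have "(u mod 8 * 7) mod 8 = (8 - u mod 8) mod 8" using um by auto
 ultimately have "(u * ?b) mod 8 = (8 - u mod 8) mod 8" using m by simp
 moreover have "odd k \<in> set [True, False]" by auto
 ultimately show ?thesis unfolding g cong_def using tab_neg_table um by metis
 next
 case False
 then obtain v where "x * y = 2 * v + 1" using oddE by blast
 then have e: "?b = 3 + 8 * (v - w)" unfolding bb w by simp
 have b3: "?b mod 8 = 3" unfolding e mod_mult_self2 by simp
 have "odd x" using False by simp
 then have "k = 1"
 proof -
 have "k ~= 0" using a u assms(2) by (metis mult_1 power_0)
 moreover have "\<not> k \<ge> 2"
 proof
 assume "k \<ge> 2"
 then have "(2::int) ^ 2 dvd 2 ^ k" by (rule le_imp_power_dvd)
 then have "4 dvd a" using a by simp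
 then show False using x \<open>odd x\<close> by presburger
 qed
 ultimately show ?thesis by linarith
 qed
 moreover have "\<forall>r\<in>set [1, 3, 5, 7]. (tab True r + tab True ((r * 3) mod 8)) mod 8 = 0 mod 8"
 using tab_block_table by blast
 from this[rule_format, OF um] have "(tab True (u mod 8) + tab True ((u mod 8 * 3) mod 8)) mod 8 = 0 mod 8" .
 ultimately show ?thesis unfolding g cong_def m b3 by simp
 qed
qed

lemma par_block:
 assumes "a ~= 0" "odd b"
 shows "[par 2 a + par 2 (a * b) = 0] (mod 2)"
proof -
 have "par 2 b = 0" using par_pu[OF two_is_prime_nat, of b 0] assms(2) by simp
 moreover have "b ~= 0" using assms(2) by auto
 ultimately have "[par 2 (a * b) = par 2 a] (mod 2)" using par_mult[OF two_is_prime_nat assms(1), of b] by simp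
 then have "[par 2 a + par 2 (a * b) = par 2 a + par 2 a] (mod 2)" by (intro cong_add cong_refl)
 then show ?thesis by (simp add: cong_def)
qed

text \<open>A form that is even and nondegenerate modulo 2 splits into even planes with odd
  off-diagonal entry. Hence the rank is even, and every plane contributes 0 to the oddity and to the
  parity at 2.\<close>

lemma dyadic_orth_basis:
 assumes "finite I" "symon I S" "\<And>i. i \<in> I ==> even (S i i)" "nd 2 I S"
 shows "even (card I) \<and> (\<exists>V d. obas I S V d \<and> [(\<Sum>i\<in>I. g2 (d i)) = 0] (mod 8) \<and> [(\<Sum>i\<in>I. par 2 (d i)) = 0] (mod 2))"
 using assms
proof (induction "card I" arbitrary: I S rule: less_induct)
 case less
 show ?case
 proof (cases "I = {}")
 case True then show ?thesis by (simp add: obas_empty)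
 next
 case False
 then obtain i where i: "i \<in> I" by blast
 obtain j where j: "j \<in> I" "odd (S j i)" using nd_entry[OF less.prems(4) i less.prems(1)] by auto
 have ij: "i ~= j" using less.prems(3) i j by auto
 define K where "K = I - {i, j}"
 have I: "I = insert i (insert j K)" using i j by (auto simp: K_def)
 have K: "finite K" "i \<notin> K" "j \<notin> K" using less.prems(1) by (auto simp: K_def)
 have cI: "card I = card K + 2" using I K ij by simp
 have sym: "symon (insert i (insert j K)) S" using less.prems(2) I by simp
 have Sji: "S j i = S i j" using less.prems(2) i j unfolding symon_def by blast
 have ob: "odd (S i j)" using j Sji by simp
 have ev: "even (S i i)" "even (S j j)" using less.prems(3) i j by auto
 define \<beta> where "\<beta> = S i i * S j j - S i j * S i j"
 have odb: "odd \<beta>" using ev ob by (simp add: \<beta>_def)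
 have "even (card K) \<and> (\<exists>V d. obas K (piv2 S i j) V d \<and> [(\<Sum>i\<in>K. g2 (d i)) = 0] (mod 8) \<and> [(\<Sum>i\<in>K. par 2 (d i)) = 0] (mod 2))"
 proof (rule less.hyps)
 show "card K < card I" using cI by simp
 show "symon K (piv2 S i j)" unfolding symon_def
 proof (intro ballI)
 fix k l assume "k \<in> K" "l \<in> K"
 then have "S k l = S l k" using sym unfolding symon_def by blast
 then show "piv2 S i j k l = piv2 S i j l k" unfolding piv2_def Let_def by (simp add: algebra_simps)
 qed
 show "even (piv2 S i j k k)" if "k \<in> K" for k
 proof -
 have "even (S k k)" using that less.prems(3) I by auto
 then show ?thesis using ev unfolding piv2_def Let_def by (simp add: mult.commute[of "S i k"])
 qed
 show "nd 2 K (piv2 S i j)" unfolding nd_def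
 proof (intro allI impI ballI)
 fix x k assume h: "\<forall>k\<in>K. 2 dvd (\<Sum>l\<in>K. piv2 S i j k l * x l)" and k: "k \<in> K"
 have "\<forall>k\<in>I. 2 dvd (\<Sum>l\<in>I. S k l * lift2 K S i j x l)"
 proof
 fix k assume "k \<in> I"
 then consider "k = i" | "k = j" | "k \<in> K" using I by auto
 then show "2 dvd (\<Sum>l\<in>I. S k l * lift2 K S i j x l)"
 proof cases
 case 3
 then have "even (\<beta> * (\<Sum>l\<in>I. S k l * lift2 K S i j x l))"
 using h lift2_rows(3)[OF K ij sym 3, of x] unfolding I \<beta>_def by simp
 then show ?thesis using odb by simp
 qed (use lift2_rows(1,2)[OF K ij sym, of x] I in simp_all)
 qed
 then have "2 dvd lift2 K S i j x k" using less.prems(4) k I unfolding nd_def by blast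
 moreover have "lift2 K S i j x k = \<beta> * x k" using k K by (auto simp: lift2_def \<beta>_def Let_def)
 ultimately show "2 dvd x k" using odb by simp
 qed
 qed (use K in auto)
 then obtain V d where V: "even (card K)" "obas K (piv2 S i j) V d" "[(\<Sum>i\<in>K. g2 (d i)) = 0] (mod 8)"
 "[(\<Sum>i\<in>K. par 2 (d i)) = 0] (mod 2)" by blast
 have fin: "even (card I) \<and> (\<exists>V d. obas I S V d \<and> [(\<Sum>i\<in>I. g2 (d i)) = 0] (mod 8) \<and> [(\<Sum>i\<in>I. par 2 (d i)) = 0] (mod 2))"
 if n0: "n0 = S i i * x0 * x0 + 2 * S i j * x0 * y0 + S j j * y0 * y0" "n0 ~= 0"
 and n1: "n1 = S i i * x1 * x1 + 2 * S i j * x1 * y1 + S j j * y1 * y1" "n1 ~= 0"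
 and ort: "S i i * x0 * x1 + S i j * (x0 * y1 + x1 * y0) + S j j * y0 * y1 = 0"
 and g: "[g2 n0 + g2 n1 = 0] (mod 8)" and pr: "[par 2 n0 + par 2 n1 = 0] (mod 2)" for n0 n1 x0 y0 x1 y1
 proof -
 obtain W where W: "obas I S W (d(i := n0, j := n1))"
 using obas_block[OF K ij sym V(2) n0 n1 ort] I by blast
 have s: "(\<Sum>a\<in>I. f ((d(i := n0, j := n1)) a)) = (f n0 + f n1) + (\<Sum>a\<in>K. f (d a))" for f :: "int \<Rightarrow> int"
 proof -
 have "(\<Sum>a\<in>K. f ((d(i := n0, j := n1)) a)) = (\<Sum>a\<in>K. f (d a))" using K by (intro sum.cong) auto
 then show ?thesis unfolding I using K ij by simp
 qed
 have A: "[(\<Sum>a\<in>I. g2 ((d(i := n0, j := n1)) a)) = 0] (mod 8)"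
 unfolding s using cong_add[OF g V(3)] by simp
 have B: "[(\<Sum>a\<in>I. par 2 ((d(i := n0, j := n1)) a)) = 0] (mod 2)"
 unfolding s using cong_add[OF pr V(4)] by simp
 have "even (card I)" using V(1) cI by simp
 then show ?thesis
 by (rule conjI, intro exI[of _ W] exI[of _ "d(i := n0, j := n1)"] conjI W A B)
 qed
 \<comment> \<open>The diagonalization of the plane starts from a vector of nonzero norm: e_i, or
   e_j, or e_i + e_j when both norms vanish.\<close>
 consider "S i i ~= 0" | "S i i = 0" "S j j ~= 0" | "S i i = 0" "S j j = 0" by blast
 then show ?thesis
 proof cases
 case 1
 have "\<beta> ~= 0" using odb by auto
 show ?thesis
 proof (rule fin[of "S i i" 1 0 "S i i * \<beta>" "- S i j" "S i i"])
 show "[g2 (S i i) + g2 (S i i * \<beta>) = 0] (mod 8)" unfolding \<beta>_def using g2_block 1 ev ob by blast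
 show "[par 2 (S i i) + par 2 (S i i * \<beta>) = 0] (mod 2)" by (rule par_block[OF 1 odb])
 qed (use 1 \<open>\<beta> ~= 0\<close> in \<open>auto simp: \<beta>_def algebra_simps\<close>)
 next
 case 2
 have "\<beta> ~= 0" using odb by auto
 show ?thesis
 proof (rule fin[of "S j j" 0 1 "S j j * \<beta>" "S j j" "- S i j"])
 show "[g2 (S j j) + g2 (S j j * \<beta>) = 0] (mod 8)"
 using g2_block[of "S j j" "S i i" "S i j"] 2 ev ob by (simp add: \<beta>_def)
 show "[par 2 (S j j) + par 2 (S j j * \<beta>) = 0] (mod 2)" by (rule par_block[OF 2(2) odb])
 qed (use 2 \<open>\<beta> ~= 0\<close> in \<open>auto simp: \<beta>_def algebra_simps\<close>)
 next
 case 3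
 have "S i j ~= 0" using ob by auto
 show ?thesis
 proof (rule fin[of "2 * S i j" 1 1 "- (2 * S i j)" 1 "-1"])
 show "[g2 (2 * S i j) + g2 (- (2 * S i j)) = 0] (mod 8)" using g2_hyp \<open>S i j ~= 0\<close> by simp
 show "[par 2 (2 * S i j) + par 2 (- (2 * S i j)) = 0] (mod 2)" unfolding par_uminus by (simp add: cong_def)
 qed (use 3 \<open>S i j ~= 0\<close> in auto)
 qed
 qed
qed

subsection \<open>Quadratic forms modulo an odd prime\<close>

text \<open>For x and y from 0 to (p - 1)/2, the values d1 x^2 and k - d2 y^2 fill (p + 1)/2 residue
  classes each, too many to be disjoint.\<close>

lemma binary_universal:
 assumes p: "prime (p::nat)" "odd p" and d: "\<not> int p dvd d1" "\<not> int p dvd d2"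
 shows "\<exists>x y. [d1 * x * x + d2 * y * y = k] (mod int p)"
proof -
 define h where "h = (p - 1) div 2"
 have ph: "p = 2 * h + 1" using p(2) by (auto simp: h_def elim: oddE)
 have pp: "prime (int p)" using p(1) by simp
 let ?f = "\<lambda>x. (d1 * int x * int x) mod int p" and ?g = "\<lambda>y. (k - d2 * int y * int y) mod int p"
 have inj: "x = y" if "x \<le> h" "y \<le> h" "int p dvd d * (int x * int x - int y * int y)" "\<not> int p dvd d" for d x y
 proof -
 have "int p dvd int x * int x - int y * int y" using that pp prime_dvd_mult_iff by blast
 then have "int p dvd (int x - int y) * (int x + int y)" by (simp add: algebra_simps)
 then consider "int p dvd int x - int y" | "int p dvd int x + int y" using pp prime_dvd_mult_iff by blast
 then show "x = y"
 proof cases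
 case 1
 show ?thesis
 proof (rule ccontr)
 assume "x ~= y"
 then have "\<bar>int p\<bar> \<le> \<bar>int x - int y\<bar>" using dvd_imp_le_int[of "int x - int y" "int p"] 1 by simp
 then show False using that(1,2) ph by linarith
 qed
 next
 case 2
 then have "p dvd x + y" by (metis int_dvd_int_iff of_nat_add)
 moreover have "x + y < p" using that(1,2) ph by simp
 ultimately have "x + y = 0" using nat_dvd_not_less by blast
 then show ?thesis by simp
 qed
 qed
 have i1: "inj_on ?f {..h}"
 proof (rule inj_onI)
 fix x y assume "x \<in> {..h}" "y \<in> {..h}" "?f x = ?f y"
 then have "int p dvd d1 * (int x * int x - int y * int y)"
 by (simp add: mod_eq_dvd_iff algebra_simps)
 then show "x = y" using inj d(1) \<open>x \<in> {..h}\<close> \<open>y \<in> {..h}\<close> by blast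
 qed
 have i2: "inj_on ?g {..h}"
 proof (rule inj_onI)
 fix x y assume xy: "x \<in> {..h}" "y \<in> {..h}" "?g x = ?g y"
 then have "int p dvd (k - d2 * int x * int x) - (k - d2 * int y * int y)" by (simp only: mod_eq_dvd_iff)
 then have "int p dvd - (d2 * (int x * int x - int y * int y))" by (simp add: algebra_simps)
 then have "int p dvd d2 * (int x * int x - int y * int y)" by simp
 then show "x = y" using inj d(2) xy by blast
 qed
 have "?f ` {..h} \<inter> ?g ` {..h} ~= {}"
 proof
 assume "?f ` {..h} \<inter> ?g ` {..h} = {}"
 then have "card (?f ` {..h} \<union> ?g ` {..h}) = 2 * h + 2"
 by (subst card_Un_disjoint) (auto simp: card_image i1 i2)
 moreover have "?f ` {..h} \<union> ?g ` {..h} \<subseteq> {0..<int p}" using ph by auto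
 then have "card (?f ` {..h} \<union> ?g ` {..h}) \<le> p" using card_mono[of "{0..<int p}"] by fastforce
 ultimately show False using ph by simp
 qed
 then obtain x y where "?f x = ?g y" by auto
 then have "[d1 * int x * int x = k - d2 * int y * int y] (mod int p)" by (simp add: cong_def)
 then have "[d1 * int x * int x + d2 * int y * int y = k - d2 * int y * int y + d2 * int y * int y] (mod int p)"
 by (intro cong_add cong_refl)
 then have "[d1 * int x * int x + d2 * int y * int y = k] (mod int p)" by simp
 then show ?thesis by blast
qed

lemma obas_comb:
 assumes "obas I S V d" "finite I"
 shows "bl I S (\<lambda>k. \<Sum>a\<in>I. c a * V k a) (\<lambda>k. \<Sum>a\<in>I. e a * V k a) = (\<Sum>a\<in>I. c a * e a * d a)"
proof -
 have "bl I S (\<lambda>k. \<Sum>a\<in>I. c a * V k a) (\<lambda>k. \<Sum>a\<in>I. e a * V k a) = (\<Sum>a\<in>I. c a * (\<Sum>b\<in>I. e b * bl I S (\<lambda>k. V k a) (\<lambda>k. V k b)))"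
 by (simp add: bl_sum_left bl_sum_right)
 also have "... = (\<Sum>a\<in>I. c a * e a * d a)"
 proof (rule sum.cong[OF refl])
 fix a assume a: "a \<in> I"
 have "(\<Sum>b\<in>I. e b * bl I S (\<lambda>k. V k a) (\<lambda>k. V k b)) = (\<Sum>b\<in>I. if b = a then e a * d a else 0)"
 using assms(1) a by (intro sum.cong) (auto simp: obas_def)
 also have "... = e a * d a" using assms(2) a by simp
 finally show "c a * (\<Sum>b\<in>I. e b * bl I S (\<lambda>k. V k a) (\<lambda>k. V k b)) = c a * e a * d a" by simp
 qed
 finally show ?thesis .
qed

lemma represents_mod:
 assumes p: "prime (p::nat)" "odd p" and I: "finite I" "symon I S" "nd (int p) I S" "card I \<ge> 2"
 shows "\<exists>x. [bl I S x x = k] (mod int p)"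
proof -
 have n2: "\<not> int p dvd 2" using p by (metis int_dvd_int_iff of_nat_numeral primes_dvd_imp_eq two_is_prime_nat even_numeral)
 have "prime (int p)" using p by simp
 then obtain V d where V: "obas I S V d" "\<forall>i\<in>I. \<not> int p dvd d i"
 using local_orth_basis[OF _ n2 I(1-3)] by blast
 obtain T where "T \<subseteq> I" "card T = 2" using obtain_subset_with_card_n[OF I(4)] by blast
 then obtain a b where ab: "a \<in> I" "b \<in> I" "a ~= b" unfolding card_2_iff by blast
 obtain x y where xy: "[d a * x * x + d b * y * y = k] (mod int p)"
 using binary_universal[OF p] V(2) ab by blast
 define c where "c = (\<lambda>i. if i = a then x else if i = b then y else 0)"
 have "(\<Sum>i\<in>I. c i * c i * d i) = d a * x * x + d b * y * y"
 proof -
 have "(\<Sum>i\<in>I. c i * c i * d i) = (\<Sum>i\<in>{a, b}. c i * c i * d i)"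
 using ab I(1) by (intro sum.mono_neutral_right) (auto simp: c_def)
 then show ?thesis using ab by (simp add: c_def mult_ac)
 qed
 then have "bl I S (\<lambda>k. \<Sum>a\<in>I. c a * V k a) (\<lambda>k. \<Sum>a\<in>I. c a * V k a) = d a * x * x + d b * y * y"
 using obas_comb[OF V(1) I(1), of c c] by simp
 then show ?thesis using xy by (intro exI[of _ "\<lambda>k. \<Sum>a\<in>I. c a * V k a"]) simp
qed

text \<open>Two vectors of an orthogonal basis represent minus the norm of a third one. The sum with
  the third is nonzero modulo p because its product with the third vector is a unit.\<close>

lemma isotropic_mod:
 assumes p: "prime (p::nat)" "odd p" and I: "finite I" "symon I S" "nd (int p) I S" "card I \<ge> 3"
 shows "\<exists>x. int p dvd bl I S x x \<and> (\<exists>i\<in>I. \<not> int p dvd x i)"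
proof -
 have n2: "\<not> int p dvd 2" using p by (metis int_dvd_int_iff of_nat_numeral primes_dvd_imp_eq two_is_prime_nat even_numeral)
 have "prime (int p)" using p by simp
 then obtain V d where V: "obas I S V d" "\<forall>i\<in>I. \<not> int p dvd d i"
 using local_orth_basis[OF _ n2 I(1-3)] by blast
 obtain T where "T \<subseteq> I" "card T = 3" using obtain_subset_with_card_n[OF I(4)] by blast
 then obtain a b e where ab: "a \<in> I" "b \<in> I" "e \<in> I" "a ~= b" "a ~= e" "b ~= e" unfolding card_3_iff by blast
 obtain x y where xy: "[d a * x * x + d b * y * y = - d e] (mod int p)"
 using binary_universal[OF p] V(2) ab by blast
 define c where "c = (\<lambda>i. if i = a then x else if i = b then y else if i = e then 1 else 0)"
 define z where "z = (\<lambda>k. \<Sum>a\<in>I. c a * V k a)"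
 have "(\<Sum>i\<in>I. c i * c i * d i) = d a * x * x + d b * y * y + d e"
 proof -
 have "(\<Sum>i\<in>I. c i * c i * d i) = (\<Sum>i\<in>{a, b, e}. c i * c i * d i)"
 using ab I(1) by (intro sum.mono_neutral_right) (auto simp: c_def)
 then show ?thesis using ab by (simp add: c_def mult_ac)
 qed
 then have "bl I S z z = d a * x * x + d b * y * y + d e" using obas_comb[OF V(1) I(1), of c c] by (simp add: z_def)
 moreover have "[d a * x * x + d b * y * y + d e = - d e + d e] (mod int p)" using xy by (intro cong_add cong_refl)
 ultimately have "int p dvd bl I S z z" by (simp add: cong_0_iff)
 moreover have "\<exists>i\<in>I. \<not> int p dvd z i"
 proof (rule ccontr)
 assume "\<not> ?thesis"
 then have zi: "int p dvd z i" if "i \<in> I" for i using that by blast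
 have "int p dvd bl I S z (\<lambda>k. \<Sum>a\<in>I. (if a = e then 1 else 0) * V k a)"
 unfolding bl_row using zi by (intro dvd_sum dvd_mult2)
 also have "bl I S z (\<lambda>k. \<Sum>a\<in>I. (if a = e then 1 else 0) * V k a) = (\<Sum>a\<in>I. c a * (if a = e then 1 else 0) * d a)"
 unfolding z_def by (rule obas_comb[OF V(1) I(1)])
 also have "... = (\<Sum>a\<in>I. if a = e then d e else 0)" using ab by (intro sum.cong) (auto simp: c_def)
 also have "... = d e" using ab I(1) by simp
 finally show False using V(2) ab by blast
 qed
 ultimately show ?thesis by blast
qed

text \<open>Completing the square: a times the form is (a x + b y)^2 + (a c - b^2) y^2, so a
  nontrivial zero amounts to a square root of - (a c - b^2).\<close>

lemma binary_isotropic_mod: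
 assumes p: "prime (p::nat)" "odd p" and D: "\<not> int p dvd a * c - b * b"
 shows "(\<exists>x y. int p dvd a * x * x + 2 * b * x * y + c * y * y \<and> \<not> (int p dvd x \<and> int p dvd y))
 \<longleftrightarrow> Legendre (- (a * c - b * b)) (int p) = 1"
proof
 have pp: "prime (int p)" using p by simp
 let ?D = "a * c - b * b"
 have nD: "\<not> int p dvd - ?D" using D by (simp only: dvd_minus_iff) simp
 assume "\<exists>x y. int p dvd a * x * x + 2 * b * x * y + c * y * y \<and> \<not> (int p dvd x \<and> int p dvd y)"
 then obtain x y where xy: "int p dvd a * x * x + 2 * b * x * y + c * y * y" "\<not> (int p dvd x \<and> int p dvd y)" by blast
 show "Legendre (- ?D) (int p) = 1"
 proof (cases "int p dvd y")
 case False
 have "(a * x + b * y)\<^sup>2 - (- ?D) * y\<^sup>2 = a * (a * x * x + 2 * b * x * y + c * y * y)"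
 by (simp add: power2_eq_square algebra_simps)
 then have "int p dvd (a * x + b * y)\<^sup>2 - (- ?D) * y\<^sup>2" using xy(1) by simp
 then have "[(a * x + b * y)\<^sup>2 = (- ?D) * y\<^sup>2] (mod int p)" by (simp add: cong_iff_dvd_diff)
 then have e: "Legendre ((a * x + b * y)\<^sup>2) (int p) = Legendre (- ?D) (int p)"
 using Legendre_cong Legendre_mult[OF p] Legendre_sq[OF p False] by simp
 have "Legendre ((a * x + b * y)\<^sup>2) (int p) ~= -1"
 using Legendre_mult[OF p, of "a * x + b * y" "a * x + b * y"] Legendre_cases[of "a * x + b * y" "int p"]
 by (auto simp: power2_eq_square)
 then show ?thesis using e Legendre_unit[OF nD] by auto
 next
 case True
 then have "int p dvd 2 * b * x * y + c * y * y" by simp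
 then have "int p dvd a * x * x" using xy(1) by (metis add.assoc dvd_add_left_iff)
 then have a: "int p dvd a" using True xy(2) pp prime_dvd_mult_iff by blast
 then have "[- ?D = b\<^sup>2] (mod int p)" by (simp add: cong_iff_dvd_diff power2_eq_square)
 moreover have "\<not> int p dvd b" using D a by auto
 ultimately show ?thesis using Legendre_cong Legendre_sq[OF p] by metis
 qed
next
 have pp: "prime (int p)" using p by simp
 let ?D = "a * c - b * b"
 assume "Legendre (- ?D) (int p) = 1"
 then obtain w where w: "[w\<^sup>2 = - ?D] (mod int p)" unfolding Legendre_def QuadRes_def by (auto split: if_splits)
 show "\<exists>x y. int p dvd a * x * x + 2 * b * x * y + c * y * y \<and> \<not> (int p dvd x \<and> int p dvd y)"
 proof (cases "int p dvd a")
 case True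
 then have "int p dvd a * 1 * 1 + 2 * b * 1 * 0 + c * 0 * 0 \<and> \<not> (int p dvd 1 \<and> int p dvd 0)"
 using prime_gt_1_nat[OF p(1)] by (simp add: zdvd1_eq)
 then show ?thesis by blast
 next
 case False
 have "a * (w - b) * (w - b) + 2 * b * (w - b) * a + c * a * a = a * (w\<^sup>2 - - ?D)"
 by (simp add: power2_eq_square algebra_simps)
 moreover have "int p dvd w\<^sup>2 - - ?D" using w by (simp only: cong_iff_dvd_diff)
 ultimately have "int p dvd a * (w - b) * (w - b) + 2 * b * (w - b) * a + c * a * a" by simp
 then show ?thesis using False by blast
 qed
qed

section \<open>The Witt group of the rationals\<close>

abbreviation fr :: "int multiset \<Rightarrow> rat multiset" where
 "fr X \<equiv> image_mset rat_of_int X"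

text \<open>The primes that occur in the coefficients filter the Witt group; at the bottom,
  \<open>smooth 2\<close> leaves only 1 and -1.\<close>

definition smooth :: "nat \<Rightarrow> int \<Rightarrow> bool" where
 "smooth N x \<longleftrightarrow> x ~= 0 \<and> (\<forall>q. prime q --> int q dvd x --> q < N)"

lemma smooth_mult: "smooth N x ==> smooth N y ==> smooth N (x * y)"
 unfolding smooth_def by (metis mult_eq_0_iff prime_dvd_mult_iff prime_nat_int_transfer)

lemma smooth_uminus [simp]: "smooth N (- x) = smooth N x"
 by (simp add: smooth_def)

lemma smooth_small: assumes "x ~= 0" "\<bar>x\<bar> < int N" shows "smooth N x"
 unfolding smooth_def
proof (intro conjI allI impI assms(1))
 fix q assume "int q dvd x"
 then have "\<bar>int q\<bar> \<le> \<bar>x\<bar>" using dvd_imp_le_int[OF assms(1)] by blast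
 then show "q < N" using assms(2) by simp
qed

lemma smooth_not_dvd: "prime l ==> smooth l x ==> \<not> int l dvd x"
 unfolding smooth_def by blast

text \<open>Because l n + k l^2 = l m, the sum relation equates the pair l n, k with the pair l m, m
  n k. So l m can be traded for l n at the cost of k and - m n k, which do not carry the extra
  factor l.\<close>

lemma wz_step:
 assumes "m = n + k * l" "m ~= 0" "n ~= 0" "k ~= 0" "l ~= 0"
 shows "witt (fr {#l * m#}) (fr {#l * n, k, - (m * n * k)#})"
proof -
 let ?r = rat_of_int
 have A: "witt {#?r (l * n), ?r k * (?r l)\<^sup>2#} {#?r (l * n), ?r k#}"
 using witt_sq[of "?r k" "?r l" "{#?r (l * n)#}"] assms by (simp add: add_mset_commute)
 have B: "witt {#?r (l * n), ?r k * (?r l)\<^sup>2#} {#?r (l * m), ?r (m * n * k)#}"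
 proof -
 have e: "?r (l * n) + ?r k * (?r l)\<^sup>2 = ?r (l * m)" using assms(1) by (simp add: algebra_simps power2_eq_square)
 have nz: "?r (l * n) ~= 0" "?r k * (?r l)\<^sup>2 ~= 0" "?r (l * n) + ?r k * (?r l)\<^sup>2 ~= 0"
 proof -
 have "l * m ~= 0" using assms(2,5) by simp
 then show "?r (l * n) + ?r k * (?r l)\<^sup>2 ~= 0" unfolding e by (simp only: of_int_eq_0_iff not_False_eq_True)
 qed (use assms(3-5) in simp_all)
 have "witt {#?r (l * n), ?r k * (?r l)\<^sup>2#} {#?r (l * m), ?r (l * n) * (?r k * (?r l)\<^sup>2) * ?r (l * m)#}"
 using witt_sum1[OF nz] unfolding e .
 also have "?r (l * n) * (?r k * (?r l)\<^sup>2) * ?r (l * m) = ?r (m * n * k) * (?r l * ?r l)\<^sup>2"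
 by (simp add: power2_eq_square)
 also have "witt {#?r (l * m), ?r (m * n * k) * (?r l * ?r l)\<^sup>2#} {#?r (l * m), ?r (m * n * k)#}"
 using witt_sq[of "?r (m * n * k)" "?r l * ?r l" "{#?r (l * m)#}"] assms(2-5) by (simp add: add_mset_commute)
 finally show ?thesis .
 qed
 have 1: "witt {#?r (l * m), ?r (m * n * k)#} {#?r (l * n), ?r k#}"
 by (rule witt_trans[OF witt_sym[OF B] A])
 have "witt {#?r (l * m)#} ({#?r (l * m)#} + {#?r (m * n * k), - ?r (m * n * k)#})"
 by (rule witt_sym[OF witt_hyp]) (use assms(2-5) in simp)
 also have "witt ... ({#?r (l * n), ?r k#} + {#- ?r (m * n * k)#})"
 using witt_add_right[OF 1, of "{#- ?r (m * n * k)#}"] by (simp add: add_mset_commute)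
 finally show ?thesis by (simp add: add_mset_commute)
qed

text \<open>Division with remainder, m = n + k l, feeds \<open>wz_step\<close>. The bound (l - 1)^2
  keeps the quotient below l in absolute value, so that it involves only primes below l.\<close>

lemma wz_reduce_small:
 assumes "prime l" "smooth l m" "\<bar>m\<bar> \<le> (int l - 1)\<^sup>2"
 shows "\<exists>S. (\<forall>x\<in>#S. smooth l x) \<and> witt (fr {#int l * m#}) (fr ({#int l * (m mod int l)#} + S))"
proof (cases "m div int l = 0")
 case True
 then have "m mod int l = m" by (metis add.left_neutral mult_div_mod_eq mult_zero_right)
 then show ?thesis by (intro exI[of _ "{#}"]) (simp add: witt_refl)
next
 case False
 have l1: "int l > 1" using prime_gt_1_nat[OF assms(1)] by simp
 let ?n = "m mod int l" and ?k = "m div int l"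
 have n: "?n ~= 0" using smooth_not_dvd[OF assms(1,2)] by (simp add: dvd_eq_mod_eq_0)
 have n2: "0 \<le> ?n" "?n < int l" using l1 by simp_all
 have e: "m = ?n + ?k * int l" by simp
 have m0: "m ~= 0" using assms(2) by (simp add: smooth_def)
 have kk: "\<bar>?k\<bar> < int l"
 proof -
 have "(int l - 1)\<^sup>2 = int l * int l - 2 * int l + 1" by (simp add: power2_eq_square algebra_simps)
 then have "?k * int l < int l * int l" "?k * int l > - (int l * int l)"
 using e n2 assms(3) l1 by linarith+
 then have "?k * int l < int l * int l" "(- int l) * int l < ?k * int l" by simp_all
 moreover have "0 \<le> int l" by simp
 ultimately have "?k < int l" "- int l < ?k" by (blast intro: mult_right_less_imp_less)+
 then show ?thesis by linarith
 qed
 have sk: "smooth l ?k" using smooth_small False kk by blast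
 have sn: "smooth l ?n" using smooth_small n n2 by simp
 have w: "witt (fr {#int l * m#}) (fr {#int l * ?n, ?k, - (m * ?n * ?k)#})"
 by (rule wz_step[OF e m0 n False]) (use l1 in simp)
 have sp: "smooth l (m * ?n * ?k)" by (intro smooth_mult assms(2) sn sk)
 have a: "{#int l * ?n, ?k, - (m * ?n * ?k)#} = {#int l * ?n#} + {#?k, - (m * ?n * ?k)#}" by simp
 show ?thesis
 proof (intro exI conjI)
 show "\<forall>x\<in>#{#?k, - (m * ?n * ?k)#}. smooth l x" using sk sp by simp
 show "witt (fr {#int l * m#}) (fr ({#int l * ?n#} + {#?k, - (m * ?n * ?k)#}))" using w unfolding a .
 qed
qed

lemma witt_fr_scale:
 assumes "witt (fr X) (fr Y)" "t ~= 0"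
 shows "witt (fr (image_mset ((*) t) X)) (fr (image_mset ((*) t) Y))"
 using witt_scale[OF assms(1), of "of_int t"] assms(2) by (simp add: multiset.map_comp comp_def)

text \<open>Prime factors q of m are split off one at a time: q < l times a remainder below l obeys
  the bound (l - 1)^2 of \<open>wz_reduce_small\<close>.\<close>

lemma wz_reduce:
 assumes "prime l" "smooth l m"
 shows "\<exists>S. (\<forall>x\<in>#S. smooth l x) \<and> witt (fr {#int l * m#}) (fr ({#int l * (m mod int l)#} + S))"
 using assms(2)
proof (induction "nat \<bar>m\<bar>" arbitrary: m rule: less_induct)
 case less
 have l1: "int l > 1" using prime_gt_1_nat[OF assms(1)] by simp
 have m0: "m ~= 0" using less.prems by (simp add: smooth_def)
 show ?case
 proof (cases "\<bar>m\<bar> = 1")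
 case True
 have "1 \<le> (int l - 1)\<^sup>2" using l1 by simp
 then show ?thesis using wz_reduce_small[OF assms(1) less.prems] True by simp
 next
 case False
 then have "nat \<bar>m\<bar> ~= 1" using m0 by linarith
 then obtain q where q: "prime q" "q dvd nat \<bar>m\<bar>" using prime_factor_nat by blast
 then have "int q dvd m" by auto
 then obtain m' where m': "m = int q * m'" by blast
 have ql: "q < l" using less.prems q \<open>int q dvd m\<close> unfolding smooth_def by blast
 have sm': "smooth l m'" using less.prems m' unfolding smooth_def by auto
 have q1: "int q > 1" using prime_gt_1_nat[OF q(1)] by simp
 have "\<bar>m'\<bar> > 0" using m' m0 by simp
 then have "\<bar>m'\<bar> * 1 < \<bar>m'\<bar> * int q" using q1 by (intro mult_strict_left_mono) auto
 then have "nat \<bar>m'\<bar> < nat \<bar>m\<bar>" using m' by (simp add: abs_mult mult.commute)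
 from less.hyps[OF this sm'] obtain S where S: "\<forall>x\<in>#S. smooth l x"
 "witt (fr {#int l * m'#}) (fr ({#int l * (m' mod int l)#} + S))" by blast
 let ?n = "m' mod int l"
 have n0: "?n ~= 0" using smooth_not_dvd[OF assms(1) sm'] by (simp add: dvd_eq_mod_eq_0)
 have n: "0 < ?n" "?n < int l" using l1 n0 pos_mod_sign[of "int l" m'] pos_mod_bound[of "int l" m'] by linarith+
 have sn: "smooth l ?n" using smooth_small n by simp
 have sq: "smooth l (int q)" using smooth_small[of "int q" l] ql q1 by simp
 have "int q * ?n \<le> (int l - 1) * (int l - 1)" using n ql q1 by (intro mult_mono) auto
 then have "\<bar>int q * ?n\<bar> \<le> (int l - 1)\<^sup>2" using n q1 by (simp add: power2_eq_square)
 from wz_reduce_small[OF assms(1) smooth_mult[OF sq sn] this] obtain S' where S': "\<forall>x\<in>#S'. smooth l x"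
 "witt (fr {#int l * (int q * ?n)#}) (fr ({#int l * ((int q * ?n) mod int l)#} + S'))" by blast
 have mm: "(int q * ?n) mod int l = m mod int l" unfolding m' by (rule mod_mult_right_eq)
 have "witt (fr {#int l * m#}) (fr {#int l * (int q * ?n)#} + fr (image_mset ((*) (int q)) S))"
 using witt_fr_scale[OF S(2), of "int q"] q1 m' by (simp add: mult_ac)
 also have "witt ... (fr ({#int l * (m mod int l)#} + S') + fr (image_mset ((*) (int q)) S))"
 using witt_add_right[OF S'(2)] mm by simp
 finally show ?thesis
 using S(1) S'(1) smooth_mult[OF sq]
 by (intro exI[of _ "S' + image_mset ((*) (int q)) S"]) auto
 qed
qed

text \<open>Equality in the quotient of two consecutive steps of the filtration, which for odd l is
  the Witt group of the field with l elements.\<close>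

definition RR :: "nat \<Rightarrow> int multiset \<Rightarrow> int multiset \<Rightarrow> bool" where
 "RR l T U \<longleftrightarrow> (\<exists>S. (\<forall>x\<in>#S. smooth l x) \<and>
 witt (fr (image_mset ((*) (int l)) T)) (fr (image_mset ((*) (int l)) U + S)))"

lemma RR_refl: "RR l T T"
 unfolding RR_def by (intro exI[of _ "{#}"]) (simp add: witt_refl)

lemma RR_witt: "witt (fr (image_mset ((*) (int l)) T)) (fr (image_mset ((*) (int l)) U)) ==> RR l T U"
 unfolding RR_def by (intro exI[of _ "{#}"]) simp

lemma RR_trans [trans]:
 assumes "RR l T U" "RR l U V" shows "RR l T V"
proof -
 obtain S where S: "\<forall>x\<in>#S. smooth l x" "witt (fr (image_mset ((*) (int l)) T)) (fr (image_mset ((*) (int l)) U + S))"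
 using assms(1) unfolding RR_def by blast
 obtain S' where S': "\<forall>x\<in>#S'. smooth l x" "witt (fr (image_mset ((*) (int l)) U)) (fr (image_mset ((*) (int l)) V + S'))"
 using assms(2) unfolding RR_def by blast
 have "witt (fr (image_mset ((*) (int l)) U + S)) (fr (image_mset ((*) (int l)) V + (S' + S)))"
 using witt_add_right[OF S'(2), of "fr S"] by (simp add: add.assoc)
 with S(2) have "witt (fr (image_mset ((*) (int l)) T)) (fr (image_mset ((*) (int l)) V + (S' + S)))" by (rule witt_trans)
 moreover have "\<forall>x\<in>#S' + S. smooth l x" using S(1) S'(1) by auto
 ultimately show ?thesis unfolding RR_def by blast
qed

lemma RR_sym: assumes "RR l T U" shows "RR l U T"
proof -
 obtain S where S: "\<forall>x\<in>#S. smooth l x" "witt (fr (image_mset ((*) (int l)) T)) (fr (image_mset ((*) (int l)) U + S))"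
 using assms(1) unfolding RR_def by blast
 let ?N = "image_mset uminus (fr S)"
 have "0 \<notin># fr S" using S(1) by (auto simp: smooth_def)
 then have A: "witt (fr (image_mset ((*) (int l)) U) + (fr S + ?N)) (fr (image_mset ((*) (int l)) U) + {#})"
 by (intro witt_add witt_refl witt_neg)
 have B: "witt (fr (image_mset ((*) (int l)) T) + ?N) (fr (image_mset ((*) (int l)) U) + (fr S + ?N))"
 using witt_add_right[OF S(2), of ?N] by (simp add: add.assoc)
 have "witt (fr (image_mset ((*) (int l)) U)) (fr (image_mset ((*) (int l)) T) + ?N)"
 using witt_trans[OF witt_sym[OF A] witt_sym[OF B]] by simp
 moreover have "?N = fr (image_mset uminus S)" by (simp add: multiset.map_comp comp_def)
 ultimately have "witt (fr (image_mset ((*) (int l)) U)) (fr (image_mset ((*) (int l)) T + image_mset uminus S))" by simp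
 moreover have "\<forall>x\<in>#image_mset uminus S. smooth l x" using S(1) by auto
 ultimately show ?thesis unfolding RR_def by blast
qed

lemma RR_add_right: assumes "RR l T U" shows "RR l (T + V) (U + V)"
proof -
 obtain S where S: "\<forall>x\<in>#S. smooth l x" "witt (fr (image_mset ((*) (int l)) T)) (fr (image_mset ((*) (int l)) U + S))"
 using assms(1) unfolding RR_def by blast
 show ?thesis unfolding RR_def
 using S(1) witt_add_right[OF S(2), of "fr (image_mset ((*) (int l)) V)"] by (intro exI[of _ S]) (simp add: add_ac)
qed

lemma RR_add: "RR l T U ==> RR l V W ==> RR l (T + V) (U + W)"
 using RR_add_right[of l T U V] RR_add_right[of l V W U] by (metis RR_trans add.commute)

lemma RR_mod: "prime l ==> smooth l m ==> RR l {#m#} {#m mod int l#}"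
 using wz_reduce[of l m] unfolding RR_def by simp

lemma RR_class:
 assumes "prime l" "odd l" "smooth l a" "smooth l b" "Legendre a (int l) = Legendre b (int l)"
 shows "RR l {#a#} {#b#}"
proof -
 obtain t where t: "0 < t" "t < int l" "[a * t\<^sup>2 = b] (mod int l)"
 using Legendre_ratio[OF assms(1,2) smooth_not_dvd[OF assms(1,3)] assms(5)] by blast
 have st: "smooth l t" using smooth_small t by simp
 have a0: "a ~= 0" "int l ~= 0" using assms(3) prime_gt_0_nat[OF assms(1)] by (auto simp: smooth_def)
 have "witt (fr (image_mset ((*) (int l)) {#a * t\<^sup>2#})) (fr (image_mset ((*) (int l)) {#a#}))"
 using witt_sq1[of "rat_of_int (int l * a)" "of_int t"] a0 t by (simp add: mult_ac)
 then have "RR l {#a#} {#a * t\<^sup>2#}" by (rule RR_witt[OF witt_sym])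
 also have "RR l ... {#(a * t\<^sup>2) mod int l#}"
 using assms st by (intro RR_mod) (auto simp: power2_eq_square intro: smooth_mult)
 also have "(a * t\<^sup>2) mod int l = b mod int l" using t(3) by (simp add: cong_def)
 also have "RR l {#b mod int l#} {#b#}" using RR_mod RR_sym assms by blast
 finally show ?thesis .
qed

lemma RR_cancel:
 assumes "prime l" "odd l" "smooth l a" "smooth l b" "Legendre b (int l) = Legendre (- a) (int l)"
 shows "RR l {#a, b#} {#}"
proof -
 have "RR l ({#a#} + {#b#}) ({#a#} + {#- a#})"
 using assms by (intro RR_add RR_refl RR_class) auto
 then have "RR l {#a, b#} {#a, - a#}" by (simp add: add_mset_commute)
 moreover have "RR l {#a, - a#} {#}"
 using witt_hyp1[of "rat_of_int (int l * a)"] assms(3) prime_gt_0_nat[OF assms(1)]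
 by (intro RR_witt) (simp add: smooth_def)
 ultimately show ?thesis by (rule RR_trans)
qed

text \<open>n + 1 is the least positive nonresidue; it exists because l - 1 is a nonresidue for l =
  3 mod 4.\<close>

lemma ex_residue_step:
 assumes "prime l" "l mod 4 = 3"
 shows "\<exists>n. 0 < n \<and> n + 1 < int l \<and> Legendre n (int l) = 1 \<and> Legendre (n + 1) (int l) = -1"
proof -
 have odd: "odd l" using assms(2) by presburger
 have l2: "l > 2" using odd_prime_gt2 assms(1) odd by blast
 define P where "P = (\<lambda>m::nat. m > 0 \<and> Legendre (int m) (int l) = -1)"
 have "[int (l - 1) = -1] (mod int l)" using l2 by (simp add: cong_iff_dvd_diff of_nat_diff)
 then have P1: "P (l - 1)"
 unfolding P_def using Legendre_cong Legendre_neg1[OF assms(1) odd] assms(2) l2 by simp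
 define m where "m = (LEAST m. P m)"
 have Pm: "P m" unfolding m_def using P1 by (rule LeastI)
 have le: "m \<le> l - 1" unfolding m_def using P1 by (rule Least_le)
 have "m ~= 1" using Pm Legendre_1[OF assms(1) odd] unfolding P_def by auto
 then have m2: "m - 1 > 0" using Pm unfolding P_def by simp
 have "\<not> P (m - 1)" unfolding m_def by (rule not_less_Least) (use m2 in \<open>simp add: m_def\<close>)
 moreover have "\<not> l dvd m - 1" using le m2 l2 by (intro nat_dvd_not_less) auto
 then have "\<not> int l dvd int (m - 1)" by (simp only: int_dvd_int_iff not_False_eq_True)
 ultimately have "Legendre (int (m - 1)) (int l) = 1" using Legendre_unit m2 unfolding P_def by blast
 then show ?thesis using Pm m2 le l2 unfolding P_def
 by (intro exI[of _ "int (m - 1)"]) (auto simp: of_nat_diff)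
qed

text \<open>For l = 3 mod 4 two squares and two nonsquares give the same form over the field with l
  elements. The sum relation for n and 1 realizes this over the integers, with n a residue and n + 1
  a nonresidue.\<close>

lemma RR_flip:
 assumes l: "prime l" "l mod 4 = 3" and sm: "smooth l a" "smooth l b"
 and cl: "Legendre a (int l) = x" "Legendre b (int l) = x"
 shows "\<exists>c d. smooth l c \<and> smooth l d \<and> Legendre c (int l) = - x \<and> Legendre d (int l) = - x \<and> RR l {#a, b#} {#c, d#}"
proof -
 have odd: "odd l" using l(2) by presburger
 obtain n where n: "0 < n" "n + 1 < int l" "Legendre n (int l) = 1" "Legendre (n + 1) (int l) = -1"
 using ex_residue_step[OF l] by blast
 have sn: "smooth l n" "smooth l (n + 1)" "smooth l (n * (n + 1))" "smooth l 1"
 using n by (auto intro!: smooth_mult intro: smooth_small)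
 have L2: "Legendre (n * (n + 1)) (int l) = -1" using Legendre_mult[OF l(1) odd] n by simp
 have L1: "Legendre 1 (int l) = 1" by (rule Legendre_1[OF l(1) odd])
 let ?r = rat_of_int
 have l0: "int l ~= 0" using prime_gt_0_nat[OF l(1)] by simp
 have key: "RR l {#n, 1#} {#n + 1, n * (n + 1)#}"
 proof (rule RR_witt)
 have e: "?r (int l * n) + ?r (int l) = ?r (int l * (n + 1))" by (simp add: algebra_simps)
 have "witt {#?r (int l * n), ?r (int l)#} {#?r (int l * (n + 1)), ?r (int l * n) * ?r (int l) * ?r (int l * (n + 1))#}"
 using witt_sum1[of "?r (int l * n)" "?r (int l)"] n l0 unfolding e by simp
 also have "?r (int l * n) * ?r (int l) * ?r (int l * (n + 1)) = ?r (int l * (n * (n + 1))) * (?r (int l))\<^sup>2"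
 by (simp add: power2_eq_square)
 also have "witt {#?r (int l * (n + 1)), ?r (int l * (n * (n + 1))) * (?r (int l))\<^sup>2#} {#?r (int l * (n + 1)), ?r (int l * (n * (n + 1)))#}"
 using witt_sq[of "?r (int l * (n * (n + 1)))" "?r (int l)" "{#?r (int l * (n + 1))#}"] n l0 by (simp add: add_mset_commute)
 finally show "witt (fr (image_mset ((*) (int l)) {#n, 1#})) (fr (image_mset ((*) (int l)) {#n + 1, n * (n + 1)#}))"
 by (simp add: add_mset_commute)
 qed
 have "x = 1 \<or> x = -1" using Legendre_unit smooth_not_dvd[OF l(1) sm(1)] cl by metis
 then show ?thesis
 proof
 assume x: "x = 1"
 have "RR l ({#a#} + {#b#}) ({#n#} + {#1#})"
 using l odd sm sn cl n L1 x by (intro RR_add RR_class) auto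
 then have "RR l {#a, b#} {#n, 1#}" by (simp add: add_mset_commute)
 then have "RR l {#a, b#} {#n + 1, n * (n + 1)#}" using key by (rule RR_trans)
 then show ?thesis using sn n L2 x by blast
 next
 assume x: "x = -1"
 have "RR l ({#a#} + {#b#}) ({#n + 1#} + {#n * (n + 1)#})"
 using l odd sm sn cl n L2 x by (intro RR_add RR_class) auto
 then have "RR l {#a, b#} {#n + 1, n * (n + 1)#}" by (simp add: add_mset_commute)
 then have "RR l {#a, b#} {#n, 1#}" using RR_sym[OF key] by (rule RR_trans)
 then show ?thesis using sn n L1 x by (intro exI[of _ n] exI[of _ 1]) simp
 qed
qed

text \<open>Pairs a, b with b in the class of - a cancel. If there is no such pair and l = 1 mod 4,
  each class occurs at most once, and \<open>pm\<close> rules out the two-element remainder. If l =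
  3 mod 4, all elements lie in one class, their number is a multiple of 4, and one pair can be
  flipped to cancel another.\<close>

lemma RR_trivial:
 assumes l: "prime l" "odd l" and "\<forall>x\<in>#T. smooth l x"
 and "[(\<Sum>x\<in>#T. pm l x) = 0] (mod 4)" "even (size T)"
 shows "RR l T {#}"
 using assms(3-5)
proof (induction "size T" arbitrary: T rule: less_induct)
 case less
 let ?L = "\<lambda>x. Legendre x (int l)"
 have Lv: "?L x = 1 \<or> ?L x = -1" if "x \<in># T" for x
 using less.prems(1) that Legendre_unit smooth_not_dvd[OF l(1)] by blast
 have Ln: "?L (- x) = ?L (-1) * ?L x" for x using Legendre_mult[OF l, of "-1" x] by simp
 show ?case
 proof (cases "\<exists>U a b. T = U + {#a, b#} \<and> ?L b = ?L (- a)")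
 case True
 then obtain U a b where T: "T = U + {#a, b#}" "?L b = ?L (- a)" by blast
 have sm: "smooth l a" "smooth l b" using less.prems(1) T by auto
 have "pm l b = pm l (- a)" using T(2) by (simp add: pm_def)
 then have "[pm l a + pm l b = 0] (mod 4)" using pm_neg[OF l smooth_not_dvd[OF l(1) sm(1)]] by simp
 moreover have "(\<Sum>x\<in>#T. pm l x) = (\<Sum>x\<in>#U. pm l x) + (pm l a + pm l b)" using T by simp
 ultimately have "[(\<Sum>x\<in>#U. pm l x) + (pm l a + pm l b) - (pm l a + pm l b) = 0 - 0] (mod 4)"
 using less.prems(2) by (intro cong_diff) simp_all
 then have "[(\<Sum>x\<in>#U. pm l x) = 0] (mod 4)" by simp
 then have "RR l U {#}" using less.hyps[of U] less.prems T by auto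
 moreover have "RR l {#a, b#} {#}" using RR_cancel[OF l sm T(2)] .
 ultimately have "RR l (U + {#a, b#}) ({#} + {#})" by (intro RR_add)
 then show ?thesis using T by simp
 next
 case False
 then have nc: "\<And>U a b. T = U + {#a, b#} ==> ?L b ~= ?L (- a)" by blast
 show ?thesis
 proof (cases "T = {#}")
 case True then show ?thesis by (simp add: RR_refl)
 next
 case ne: False
 then obtain a T1 where T1: "T = add_mset a T1" using multiset_cases by blast
 then have "T1 ~= {#}" using less.prems(3) by auto
 then obtain b T2 where T2: "T1 = add_mset b T2" using multiset_cases by blast
 have T: "T = T2 + {#a, b#}" using T1 T2 by (simp add: add_mset_commute)
 have "l mod 4 = 1 \<or> l mod 4 = 3" using l(2) by presburger
 then consider "l mod 4 = 1" | "l mod 4 = 3" by blast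
 then show ?thesis
 proof cases
 case 1
 have Lm: "?L (-1) = 1" using Legendre_neg1[OF l] 1 by simp
 have d: "?L y ~= ?L x" if "T = U + {#x, y#}" for x y U using nc[OF that] Ln[of x] Lm by simp
 have "T2 = {#}"
 proof (rule ccontr)
 assume "T2 ~= {#}"
 then obtain c T3 where T3: "T2 = add_mset c T3" using multiset_cases by blast
 have "T = (T3 + {#c#}) + {#a, b#}" "T = (T3 + {#b#}) + {#a, c#}" "T = (T3 + {#a#}) + {#b, c#}"
 using T T3 by (simp_all add: add_mset_commute)
 then have "?L b ~= ?L a" "?L c ~= ?L a" "?L c ~= ?L b" using d by blast+
 moreover have "a \<in># T" "b \<in># T" "c \<in># T" using T T3 by auto
 then have "?L a = 1 \<or> ?L a = -1" "?L b = 1 \<or> ?L b = -1" "?L c = 1 \<or> ?L c = -1" using Lv by blast+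
 ultimately show False by linarith
 qed
 then have "[pm l a + pm l b = 0] (mod 4)" using less.prems(2) T by simp
 moreover have "?L a ~= ?L b" using d[OF T] by simp
 moreover have "?L a = 1 \<or> ?L a = -1" "?L b = 1 \<or> ?L b = -1" using Lv T by auto
 ultimately show ?thesis using 1 by (auto simp: pm_def cong_def)
 next
 case 3: 2
 have Lm: "?L (-1) = -1" using Legendre_neg1[OF l] 3 by simp
 have same: "?L y = ?L a" if "y \<in># T1" for y
 proof -
 have "\<exists>U. T1 = add_mset y U" using that by (rule multi_member_split)
 then obtain U where "T1 = add_mset y U" by blast
 then have "T = U + {#a, y#}" using T1 by (simp add: add_mset_commute)
 then have "?L y ~= - ?L a" using nc[of U a y] Ln[of a] Lm by simp
 moreover have "a \<in># T" "y \<in># T" using that T1 by simp_all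
 then have "?L a = 1 \<or> ?L a = -1" "?L y = 1 \<or> ?L y = -1" using Lv by blast+
 ultimately show ?thesis by auto
 qed
 have same': "pm l y = ?L a" if "y \<in># T" for y
 using same[of y] that T1 3 by (auto simp: pm_def)
 have "(\<Sum>x\<in>#T. pm l x) = (\<Sum>x\<in>#T. ?L a)"
 using same' by (intro arg_cong[where f = sum_mset] image_mset_cong) auto
 also have "... = int (size T) * ?L a" by (simp add: sum_mset_constant)
 finally have "[int (size T) * ?L a = 0] (mod 4)" using less.prems(2) by simp
 moreover have "a \<in># T" using T by simp
 then have "?L a = 1 \<or> ?L a = -1" by (rule Lv)
 ultimately have "4 dvd int (size T)" by (elim disjE) (simp_all add: cong_0_iff)
 then have "size T \<ge> 4" using ne by (metis dvd_imp_le int_dvd_int_iff nonempty_has_size of_nat_numeral)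
 then have "size T2 \<ge> 2" using T by simp
 then obtain c T3 where T3: "T2 = add_mset c T3" by (metis multiset_cases not_numeral_le_zero size_empty)
 then have "T3 ~= {#}" using \<open>size T2 \<ge> 2\<close> by auto
 then obtain d T4 where T4: "T3 = add_mset d T4" using multiset_cases by blast
 have TT: "T = T4 + {#a, b#} + {#c, d#}" using T T3 T4 by (simp add: add_mset_commute)
 have Ls: "?L b = ?L a" "?L c = ?L a" "?L d = ?L a" using same T2 T3 T4 by auto
 have sm: "smooth l a" "smooth l b" "smooth l c" "smooth l d" using less.prems(1) TT by auto
 obtain e f where ef: "smooth l e" "smooth l f" "?L e = - ?L a" "?L f = - ?L a" "RR l {#a, b#} {#e, f#}"
 using RR_flip[OF l(1) 3 sm(1,2) refl Ls(1)] by blast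
 have "?L c = ?L (- e)" "?L d = ?L (- f)" using ef Ls Ln[of e] Ln[of f] Lm by simp_all
 then have "RR l {#e, c#} {#}" "RR l {#f, d#} {#}"
 using RR_cancel[OF l] ef(1,2) sm(3,4) by blast+
 then have "RR l ({#e, c#} + {#f, d#}) ({#} + {#})" by (rule RR_add)
 then have X: "RR l ({#e, c#} + {#f, d#}) {#}" by (simp only: add_0)
 have eq: "{#e, c#} + {#f, d#} = {#e, f#} + {#c, d#}" by (simp add: add_mset_commute)
 have "RR l ({#a, b#} + {#c, d#}) ({#e, f#} + {#c, d#})" using ef(5) by (rule RR_add_right)
 then have 1: "RR l ({#a, b#} + {#c, d#}) {#}" using X unfolding eq by (rule RR_trans)
 have "(\<Sum>x\<in>#T. pm l x) = (\<Sum>x\<in>#T4. pm l x) + 4 * ?L a"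
 proof -
 have "pm l a = ?L a" "pm l b = ?L a" "pm l c = ?L a" "pm l d = ?L a" using TT by (auto intro: same')
 then show ?thesis unfolding TT by simp
 qed
 then have "[(\<Sum>x\<in>#T4. pm l x) = 0] (mod 4)" using less.prems(2) by (simp add: cong_def)
 then have "RR l T4 {#}" using less.hyps[of T4] less.prems TT by auto
 then have "RR l (T4 + ({#a, b#} + {#c, d#})) ({#} + {#})" using 1 by (intro RR_add)
 then show ?thesis using TT by (simp add: add.assoc)
 qed
 qed
 qed
qed

lemma smooth_2: assumes "smooth 2 x" shows "x = 1 \<or> x = -1"
proof (rule ccontr)
 assume "\<not> ?thesis"
 then have "\<bar>x\<bar> ~= 1" by (simp add: abs_if split: if_splits)
 moreover have "int (nat \<bar>x\<bar>) = \<bar>x\<bar>" by simp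
 ultimately have "nat \<bar>x\<bar> ~= 1" by (metis of_nat_1)
 then have "\<exists>q. prime q \<and> q dvd nat \<bar>x\<bar>" by (rule prime_factor_nat)
 then obtain q where q: "prime q" "q dvd nat \<bar>x\<bar>" by (elim exE conjE)
 have "int q dvd int (nat \<bar>x\<bar>)" using q(2) by (simp only: int_dvd_int_iff)
 then have "int q dvd x" by simp
 then have "q < 2" using assms q(1) unfolding smooth_def by blast
 then show False using prime_ge_2_nat[OF q(1)] by simp
qed

text \<open>At 2 only the parity survives: 1 + 1 = 2 makes the pair 2, 2 equivalent to 1, 1.\<close>

lemma RR_trivial_2:
 assumes "\<forall>x\<in>#T. smooth 2 x" "even (size T)"
 shows "RR 2 T {#}"
 using assms
proof (induction "size T" arbitrary: T rule: less_induct)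
 case less
 show ?case
 proof (cases "T = {#}")
 case True then show ?thesis by (simp add: RR_refl)
 next
 case ne: False
 then obtain a T1 where T1: "T = add_mset a T1" using multiset_cases by blast
 then have "T1 ~= {#}" using less.prems(2) by auto
 then obtain b T2 where T2: "T1 = add_mset b T2" using multiset_cases by blast
 have T: "T = T2 + {#a, b#}" using T1 T2 by (simp add: add_mset_commute)
 have sm: "smooth 2 a" "smooth 2 b" using less.prems T by auto
 then have ab: "a = 1 \<or> a = -1" "b = 1 \<or> b = -1" using smooth_2 by blast+
 have "RR 2 {#a, b#} {#}"
 proof (cases "b = a")
 case False
 then have "b = - a" using ab by auto
 moreover have "witt {#rat_of_int (2 * a), - rat_of_int (2 * a)#} {#}" by (rule witt_hyp1) (use ab in auto)
 ultimately show ?thesis by (intro RR_witt) simp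
 next
 case True
 have "witt {#rat_of_int a, rat_of_int a#} {#rat_of_int (2 * a), rat_of_int (2 * a)#}"
 using witt_sum1[of "rat_of_int a" "rat_of_int a"] ab by auto
 then have "witt (fr {#2 * a, 2 * a#}) (fr {#a, a#})" using witt_sym by simp
 then show ?thesis unfolding RR_def using True sm by (intro exI[of _ "{#a, a#}"]) auto
 qed
 moreover have "RR 2 T2 {#}" using less.hyps[of T2] less.prems T by auto
 ultimately have "RR 2 (T2 + {#a, b#}) ({#} + {#})" by (intro RR_add)
 then show ?thesis using T by simp
 qed
qed

lemma wz_split:
 assumes l: "prime l" and "\<forall>x\<in>#X. smooth (Suc l) x"
 shows "\<exists>T S. (\<forall>x\<in>#T. smooth l x) \<and> (\<forall>x\<in>#S. smooth l x) \<and>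
 witt (fr X) (fr (image_mset ((*) (int l)) T + S))"
 using assms(2)
proof (induction X)
 case empty
 show ?case by (intro exI[of _ "{#}"]) (simp add: witt_refl)
next
 case (add x X)
 then obtain T S where TS: "\<forall>x\<in>#T. smooth l x" "\<forall>x\<in>#S. smooth l x"
 "witt (fr X) (fr (image_mset ((*) (int l)) T + S))" by auto
 have sx: "smooth (Suc l) x" using add.prems by simp
 then have x0: "x ~= 0" by (simp add: smooth_def)
 obtain i b where b: "x = int l ^ i * b" "\<not> int l dvd b" using prime_decomp[OF l x0] .
 have b0: "b ~= 0" using b by auto
 have sb: "smooth l b"
 unfolding smooth_def
 proof (intro conjI allI impI b0)
 fix q assume q: "prime q" "int q dvd b"
 then have "int q dvd x" using b(1) by simp
 then have "q < Suc l" using sx q(1) unfolding smooth_def by blast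
 moreover have "q ~= l" using q(2) b(2) by auto
 ultimately show "q < l" by simp
 qed
 have l0: "int l ~= 0" using prime_gt_0_nat[OF l] by simp
 show ?case
 proof (cases "even i")
 case True
 then obtain j where "i = 2 * j" by blast
 then have "rat_of_int x = rat_of_int b * (rat_of_int (int l ^ j))\<^sup>2"
 using b by (simp add: power_mult mult.commute power_even_eq)
 then have "witt {#rat_of_int x#} {#rat_of_int b#}" using witt_sq1[of "rat_of_int b" "rat_of_int (int l ^ j)"] b0 l0 by simp
 then have "witt (fr (add_mset x X)) (fr (image_mset ((*) (int l)) T + add_mset b S))"
 using witt_add[OF TS(3), of "{#rat_of_int x#}" "{#rat_of_int b#}"] by (simp add: add_ac)
 then show ?thesis using TS sb by (intro exI[of _ T] exI[of _ "add_mset b S"]) auto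
 next
 case False
 then obtain j where "i = 2 * j + 1" by (metis oddE)
 then have "rat_of_int x = rat_of_int (int l * b) * (rat_of_int (int l ^ j))\<^sup>2"
 using b by (simp add: power_mult mult.commute power_even_eq)
 then have "witt {#rat_of_int x#} {#rat_of_int (int l * b)#}"
 using witt_sq1[of "rat_of_int (int l * b)" "rat_of_int (int l ^ j)"] b0 l0 by simp
 then have "witt (fr (add_mset x X)) (fr (image_mset ((*) (int l)) (add_mset b T) + S))"
 using witt_add[OF TS(3), of "{#rat_of_int x#}" "{#rat_of_int (int l * b)#}"] by (simp add: add_ac)
 then show ?thesis using TS sb by (intro exI[of _ "add_mset b T"] exI[of _ S]) auto
 qed
qed

text \<open>The normal form of a class without residues: its signature times the class of 1.\<close>

definition ones :: "int \<Rightarrow> int multiset" where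
 "ones k = replicate_mset (nat k) 1 + replicate_mset (nat (- k)) (- 1)"

lemma ones_add1: "witt (fr (add_mset 1 (ones k))) (fr (ones (k + 1)))"
proof (cases "k \<ge> 0")
 case True
 then have "nat (k + 1) = Suc (nat k)" "nat (- k) = 0" "nat (- (k + 1)) = 0" by simp_all
 then show ?thesis by (simp add: ones_def witt_refl)
next
 case False
 then have e: "nat (- k) = Suc (nat (- (k + 1)))" "nat k = 0" "nat (k + 1) = 0" by simp_all
 show ?thesis using witt_hyp[of "1::rat" "fr (ones (k + 1))"] by (simp add: ones_def e add_mset_commute)
qed

lemma ones_sub1: "witt (fr (add_mset (-1) (ones k))) (fr (ones (k - 1)))"
proof (cases "k \<le> 0")
 case True
 then have "nat (1 - k) = Suc (nat (- k))" "nat k = 0" "nat (k - 1) = 0" by simp_all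
 then show ?thesis by (simp add: ones_def witt_refl)
next
 case False
 then have e: "nat k = Suc (nat (k - 1))" "nat (- k) = 0" "nat (1 - k) = 0" by simp_all
 show ?thesis using witt_hyp[of "1::rat" "fr (ones (k - 1))"] by (simp add: ones_def e add_mset_commute)
qed

lemma isgn_ones: "(\<Sum>a\<in>#fr (ones k). isgn a) = k"
 by (simp add: ones_def isgn_def sum_mset_constant multiset.map_comp comp_def)

lemma size_ones [simp]: "size (ones k) = nat \<bar>k\<bar>"
 by (auto simp: ones_def)

lemma smooth_1_ones:
 assumes "\<forall>x\<in>#X. smooth 2 x"
 shows "\<exists>k. witt (fr X) (fr (ones k))"
 using assms
proof (induction X)
 case empty show ?case by (intro exI[of _ 0]) (simp add: ones_def witt_refl)
next
 case (add x X)
 then obtain k where k: "witt (fr X) (fr (ones k))" by auto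
 then have 1: "witt (fr (add_mset x X)) (fr (add_mset x (ones k)))"
 using witt_add_right[OF k, of "{#rat_of_int x#}"] by simp
 have "x = 1 \<or> x = -1" using add.prems by (intro smooth_2) simp
 then show ?case
 proof
 assume "x = 1"
 then show ?thesis using witt_trans[OF 1] ones_add1[of k] by blast
 next
 assume "x = -1"
 then show ?thesis using witt_trans[OF 1] ones_sub1[of k] by blast
 qed
qed

lemma sum_ext_fr: "sqc f ==> 0 \<notin># X ==> (\<Sum>a\<in>#fr X. ext f a) = (\<Sum>x\<in>#X. f x)"
 by (induction X) (auto simp: ext_of_int)

lemma smooth_res: "prime l ==> smooth l x ==> res l x = 0"
 using res_pu[of l x 0] smooth_not_dvd by simp

lemma smooth_par: "prime l ==> smooth l x ==> par l x = 0"
 using par_pu[of l x 0] smooth_not_dvd by simp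

lemma smooth_mult_res: "prime l ==> smooth l x ==> res l (int l * x) = pm l x"
 using res_pu[of l x 1] smooth_not_dvd by simp

lemma smooth_mult_par: "prime l ==> smooth l x ==> par l (int l * x) = 1"
 using par_pu[of l x 1] smooth_not_dvd by simp

text \<open>Descent over the primes: the part at the largest prime l is removed because its residue
  is trivial, and the other residues, being invariants, remain trivial.\<close>

lemma wz_trivial_residues:
 assumes "\<forall>x\<in>#X. smooth N x"
 and "\<And>q. prime q ==> [(\<Sum>x\<in>#X. par q x) = 0] (mod 2)"
 and "\<And>q. prime q ==> odd q ==> [(\<Sum>x\<in>#X. res q x) = 0] (mod 4)"
 shows "\<exists>k. witt (fr X) (fr (ones k))"
 using assms
proof (induction N arbitrary: X)
 case 0
 then show ?case by (intro smooth_1_ones) (auto simp: smooth_def)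
next
 case (Suc l)
 show ?case
 proof (cases "prime l")
 case False
 have "smooth l x" if "smooth (Suc l) x" for x
 using that False unfolding smooth_def by (metis less_SucE)
 then have "\<forall>x\<in>#X. smooth l x" using Suc.prems(1) by blast
 then show ?thesis using Suc.IH Suc.prems by blast
 next
 case l: True
 obtain T S where TS: "\<forall>x\<in>#T. smooth l x" "\<forall>x\<in>#S. smooth l x"
 "witt (fr X) (fr (image_mset ((*) (int l)) T + S))" using wz_split[OF l Suc.prems(1)] by blast
 have l0: "int l ~= 0" using prime_gt_0_nat[OF l] by simp
 have nz: "0 \<notin># X" "0 \<notin># T" "0 \<notin># S" using Suc.prems(1) TS(1,2) unfolding smooth_def by blast+
 have nz': "0 \<notin># image_mset ((*) (int l)) T + S" using nz l0 by auto
 have "[(\<Sum>x\<in>#X. par l x) = (\<Sum>x\<in>#image_mset ((*) (int l)) T + S. par l x)] (mod 2)"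
 using witt_par[OF l TS(3)] sum_ext_fr[OF sqc_par[OF l] nz(1)] sum_ext_fr[OF sqc_par[OF l] nz'] by simp
 also have "(\<Sum>x\<in>#image_mset ((*) (int l)) T + S. par l x) = (\<Sum>x\<in>#T. par l (int l * x)) + (\<Sum>x\<in>#S. par l x)"
 by (simp add: multiset.map_comp comp_def)
 also have "(\<Sum>x\<in>#T. par l (int l * x)) = (\<Sum>x\<in>#T. 1)"
 using TS(1) smooth_mult_par[OF l] by (intro arg_cong[where f = sum_mset] image_mset_cong) auto
 also have "(\<Sum>x\<in>#S. par l x) = (\<Sum>x\<in>#S. 0)"
 using TS(2) smooth_par[OF l] by (intro arg_cong[where f = sum_mset] image_mset_cong) auto
 finally have *: "[(\<Sum>x\<in>#X. par l x) = (\<Sum>x\<in>#T. 1) + (\<Sum>x\<in>#S. 0)] (mod 2)" .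
 have "[int (size T) = 0] (mod 2)" using cong_trans[OF cong_sym[OF *] Suc.prems(2)[OF l]] by simp
 then have ev: "even (size T)" by (simp add: cong_0_iff)
 have "RR l T {#}"
 proof (cases "l = 2")
 case True then show ?thesis using RR_trivial_2 TS(1) ev by simp
 next
 case False
 then have odd: "odd l" using l prime_odd_nat prime_ge_2_nat[of l] by (metis le_neq_implies_less)
 have "[(\<Sum>x\<in>#X. res l x) = (\<Sum>x\<in>#image_mset ((*) (int l)) T + S. res l x)] (mod 4)"
 using witt_res[OF l odd TS(3)] sum_ext_fr[OF sqc_res[OF l odd] nz(1)] sum_ext_fr[OF sqc_res[OF l odd] nz'] by simp
 also have "(\<Sum>x\<in>#image_mset ((*) (int l)) T + S. res l x) = (\<Sum>x\<in>#T. res l (int l * x)) + (\<Sum>x\<in>#S. res l x)"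
 by (simp add: multiset.map_comp comp_def)
 also have "(\<Sum>x\<in>#T. res l (int l * x)) = (\<Sum>x\<in>#T. pm l x)"
 using TS(1) smooth_mult_res[OF l] by (intro arg_cong[where f = sum_mset] image_mset_cong) auto
 also have "(\<Sum>x\<in>#S. res l x) = (\<Sum>x\<in>#S. 0)"
 using TS(2) smooth_res[OF l] by (intro arg_cong[where f = sum_mset] image_mset_cong) auto
 finally have *: "[(\<Sum>x\<in>#X. res l x) = (\<Sum>x\<in>#T. pm l x) + (\<Sum>x\<in>#S. 0)] (mod 4)" .
 have "[(\<Sum>x\<in>#T. pm l x) = 0] (mod 4)" using cong_trans[OF cong_sym[OF *] Suc.prems(3)[OF l odd]] by simp
 then show ?thesis using RR_trivial[OF l odd TS(1) _ ev] by blast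
 qed
 then obtain S' where S': "\<forall>x\<in>#S'. smooth l x" "witt (fr (image_mset ((*) (int l)) T)) (fr S')"
 unfolding RR_def by auto
 have w: "witt (fr X) (fr (S' + S))"
 proof -
 have "witt (fr (image_mset ((*) (int l)) T + S)) (fr (S' + S))"
 using witt_add_right[OF S'(2), of "fr S"] by simp
 with TS(3) show ?thesis by (rule witt_trans)
 qed
 have nzS: "0 \<notin># S' + S" using S'(1) nz unfolding smooth_def by auto
 have "\<exists>k. witt (fr (S' + S)) (fr (ones k))"
 proof (rule Suc.IH)
 show "\<forall>x\<in>#S' + S. smooth l x" using S' TS by auto
 show "[(\<Sum>x\<in>#S' + S. par q x) = 0] (mod 2)" if q: "prime q" for q
 using witt_par[OF q w] unfolding sum_ext_fr[OF sqc_par[OF q] nz(1)] sum_ext_fr[OF sqc_par[OF q] nzS]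
 by (rule cong_trans[OF cong_sym Suc.prems(2)[OF q]])
 show "[(\<Sum>x\<in>#S' + S. res q x) = 0] (mod 4)" if q: "prime q" "odd q" for q
 using witt_res[OF q w] unfolding sum_ext_fr[OF sqc_res[OF q] nz(1)] sum_ext_fr[OF sqc_res[OF q] nzS]
 by (rule cong_trans[OF cong_sym Suc.prems(3)[OF q]])
 qed
 then obtain k where "witt (fr (S' + S)) (fr (ones k))" by blast
 then show ?thesis using witt_trans[OF w] by blast
 qed
qed

lemma witt_int: "0 \<notin># X ==> \<exists>Z. 0 \<notin># Z \<and> witt X (fr Z)"
proof (induction X)
 case empty show ?case by (intro exI[of _ "{#}"]) (simp add: witt_refl)
next
 case (add a X)
 then obtain Z where Z: "0 \<notin># Z" "witt X (fr Z)" by auto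
 obtain x z where a: "a = of_int x / of_int z" "z ~= 0"
 by (metis Fract_of_int_quotient Rat_cases order_less_irrefl)
 have x0: "x ~= 0" using a add.prems by auto
 have "a * (of_int z)\<^sup>2 = of_int (x * z)" using a by (simp add: power2_eq_square)
 then have "witt {#a#} {#of_int (x * z)#}"
 using witt_sq1[of a "of_int z"] a add.prems witt_sym by auto
 then have "witt (add_mset a X) (fr (add_mset (x * z) Z))"
 using witt_add[OF Z(2)] by fastforce
 then show ?case using Z(1) x0 a(2) by (intro exI[of _ "add_mset (x * z) Z"]) auto
qed

text \<open>The Witt group of the rationals is detected by the signature and the residues at all
 primes: this is the injectivity part of the Milnor-Husemoller computation of W(Q), where
 the residue at 2 is only the parity of the valuation.\<close>

theorem witt_rat_eqI:
 fixes X Y :: "rat multiset"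
 assumes nz: "0 \<notin># X" "0 \<notin># Y"
 and sg: "(\<Sum>a\<in>#X. isgn a) = (\<Sum>a\<in>#Y. isgn a)"
 and pr: "\<And>q. prime q ==> [(\<Sum>a\<in>#X. ext (par q) a) = (\<Sum>a\<in>#Y. ext (par q) a)] (mod 2)"
 and rs: "\<And>q. prime q ==> odd q ==> [(\<Sum>a\<in>#X. ext (res q) a) = (\<Sum>a\<in>#Y. ext (res q) a)] (mod 4)"
 shows "witt X Y"
proof -
 let ?N = "image_mset uminus Y"
 have YN: "witt (Y + ?N) {#}" using witt_neg nz(2) by blast
 have "0 \<notin># X + ?N" using nz by auto
 then obtain Z where Z: "0 \<notin># Z" "witt (X + ?N) (fr Z)" using witt_int by blast
 have "\<exists>k. witt (fr Z) (fr (ones k))"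
 proof (rule wz_trivial_residues[of _ "Suc (\<Sum>x\<in>#Z. nat \<bar>x\<bar>)"])
 show "\<forall>x\<in>#Z. smooth (Suc (\<Sum>x\<in>#Z. nat \<bar>x\<bar>)) x"
 proof
 fix x assume x: "x \<in># Z"
 obtain Z' where "Z = add_mset x Z'" using multi_member_split[OF x] by blast
 then have "nat \<bar>x\<bar> \<le> (\<Sum>x\<in>#Z. nat \<bar>x\<bar>)" by simp
 moreover have "\<bar>x\<bar> < int (Suc M)" if "nat \<bar>x\<bar> \<le> M" for M using that by linarith
 moreover have "x ~= 0" using x Z(1) by auto
 ultimately show "smooth (Suc (\<Sum>x\<in>#Z. nat \<bar>x\<bar>)) x" by (intro smooth_small) blast+
 qed
 show "[(\<Sum>x\<in>#Z. par q x) = 0] (mod 2)" if q: "prime q" for q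
 proof -
 have A: "[(\<Sum>a\<in>#Y. ext (par q) a) + (\<Sum>a\<in>#?N. ext (par q) a) = 0] (mod 2)"
 using witt_par[OF q YN] by simp
 have B: "[(\<Sum>a\<in>#X. ext (par q) a) + (\<Sum>a\<in>#?N. ext (par q) a) = (\<Sum>x\<in>#Z. par q x)] (mod 2)"
 using witt_par[OF q Z(2)] sum_ext_fr[OF sqc_par[OF q] Z(1)] by simp
 show ?thesis by (rule cong_trans[OF cong_sym[OF B] cong_trans[OF cong_add[OF pr[OF q] cong_refl] A]])
 qed
 show "[(\<Sum>x\<in>#Z. res q x) = 0] (mod 4)" if q: "prime q" "odd q" for q
 proof -
 have A: "[(\<Sum>a\<in>#Y. ext (res q) a) + (\<Sum>a\<in>#?N. ext (res q) a) = 0] (mod 4)"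
 using witt_res[OF q YN] by simp
 have B: "[(\<Sum>a\<in>#X. ext (res q) a) + (\<Sum>a\<in>#?N. ext (res q) a) = (\<Sum>x\<in>#Z. res q x)] (mod 4)"
 using witt_res[OF q Z(2)] sum_ext_fr[OF sqc_res[OF q] Z(1)] by simp
 show ?thesis by (rule cong_trans[OF cong_sym[OF B] cong_trans[OF cong_add[OF rs[OF q] cong_refl] A]])
 qed
 qed
 then obtain k where "witt (fr Z) (fr (ones k))" by blast
 with Z(2) have k: "witt (X + ?N) (fr (ones k))" by (rule witt_trans)
 have "(\<Sum>a\<in>#X. isgn a) + (\<Sum>a\<in>#?N. isgn a) = k" using witt_isgn[OF k] isgn_ones by simp
 moreover have "(\<Sum>a\<in>#Y. isgn a) + (\<Sum>a\<in>#?N. isgn a) = 0" using witt_isgn[OF YN] by simp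
 ultimately have "k = 0" using sg by simp
 then have XN: "witt (X + ?N) {#}" using k by (simp add: ones_def)
 have 1: "witt (X + (Y + ?N)) (X + {#})" by (intro witt_add witt_refl YN)
 have 2: "witt (Y + (X + ?N)) (Y + {#})" by (intro witt_add witt_refl XN)
 have e: "Y + (X + ?N) = X + (Y + ?N)" by (simp add: add_ac)
 show ?thesis using witt_trans[OF witt_sym[OF 1] 2[unfolded e]] by simp
qed

subsection \<open>Witt classes unramified outside a prime\<close>

text \<open>Signature \<open>s\<close>, no residues away from \<open>p\<close>, and residue \<open>(a, c)\<close> at \<open>p\<close>.\<close>

definition Cl :: "nat \<Rightarrow> int multiset \<Rightarrow> int \<Rightarrow> int \<Rightarrow> int \<Rightarrow> bool" where
 "Cl p Y s a c \<longleftrightarrow> 0 \<notin># Y \<and> (\<Sum>x\<in>#Y. sgn x) = s \<and>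
 (\<forall>q. prime q --> q ~= p --> [(\<Sum>x\<in>#Y. par q x) = 0] (mod 2) \<and> (odd q --> [(\<Sum>x\<in>#Y. res q x) = 0] (mod 4))) \<and>
 [(\<Sum>x\<in>#Y. par p x) = a] (mod 2) \<and> [(\<Sum>x\<in>#Y. res p x) = c] (mod 4)"

lemma isgn_of_int: "isgn (rat_of_int x) = sgn x"
 by (auto simp: isgn_def sgn_if)

lemma sum_isgn_fr: "(\<Sum>a\<in>#fr Y. isgn a) = (\<Sum>x\<in>#Y. sgn x)"
 by (induction Y) (auto simp: isgn_of_int)

lemma Cl_add:
 assumes "Cl p Y s a c" "Cl p Y' s' a' c'"
 shows "Cl p (Y + Y') (s + s') (a + a') (c + c')"
 using assms unfolding Cl_def
 by (auto intro: cong_add) (metis add.right_neutral cong_add)+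

lemma Cl_witt:
 assumes "prime p" "odd p" "Cl p Y s a c" "Cl p Y' s a' c'" "[a = a'] (mod 2)" "[c = c'] (mod 4)"
 shows "witt (fr Y) (fr Y')"
proof (rule witt_rat_eqI)
 have nz: "0 \<notin># Y" "0 \<notin># Y'" using assms by (auto simp: Cl_def)
 then show "0 \<notin># fr Y" "0 \<notin># fr Y'" by auto
 show "(\<Sum>a\<in>#fr Y. isgn a) = (\<Sum>a\<in>#fr Y'. isgn a)"
 unfolding sum_isgn_fr using assms by (simp add: Cl_def)
 fix q :: nat assume q: "prime q"
 show "[(\<Sum>a\<in>#fr Y. ext (par q) a) = (\<Sum>a\<in>#fr Y'. ext (par q) a)] (mod 2)"
 unfolding sum_ext_fr[OF sqc_par[OF q] nz(1)] sum_ext_fr[OF sqc_par[OF q] nz(2)]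
 proof (cases "q = p")
 case True
 have "[(\<Sum>x\<in>#Y. par p x) = a] (mod 2)" "[(\<Sum>x\<in>#Y'. par p x) = a'] (mod 2)" using assms(3,4) by (auto simp: Cl_def)
 then show "[(\<Sum>x\<in>#Y. par q x) = (\<Sum>x\<in>#Y'. par q x)] (mod 2)" using assms(5) True by (metis cong_sym cong_trans)
 next
 case False
 then have "[(\<Sum>x\<in>#Y. par q x) = 0] (mod 2)" "[(\<Sum>x\<in>#Y'. par q x) = 0] (mod 2)" using assms(3,4) q by (auto simp: Cl_def)
 then show "[(\<Sum>x\<in>#Y. par q x) = (\<Sum>x\<in>#Y'. par q x)] (mod 2)" by (metis cong_sym cong_trans)
 qed
 assume o: "odd q"
 show "[(\<Sum>a\<in>#fr Y. ext (res q) a) = (\<Sum>a\<in>#fr Y'. ext (res q) a)] (mod 4)"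
 unfolding sum_ext_fr[OF sqc_res[OF q o] nz(1)] sum_ext_fr[OF sqc_res[OF q o] nz(2)]
 proof (cases "q = p")
 case True
 have "[(\<Sum>x\<in>#Y. res p x) = c] (mod 4)" "[(\<Sum>x\<in>#Y'. res p x) = c'] (mod 4)" using assms(3,4) by (auto simp: Cl_def)
 then show "[(\<Sum>x\<in>#Y. res q x) = (\<Sum>x\<in>#Y'. res q x)] (mod 4)" using assms(6) True by (metis cong_sym cong_trans)
 next
 case False
 then have "[(\<Sum>x\<in>#Y. res q x) = 0] (mod 4)" "[(\<Sum>x\<in>#Y'. res q x) = 0] (mod 4)" using assms(3,4) q o by (auto simp: Cl_def)
 then show "[(\<Sum>x\<in>#Y. res q x) = (\<Sum>x\<in>#Y'. res q x)] (mod 4)" by (metis cong_sym cong_trans)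
 qed
qed

lemma unit_par: "prime q ==> \<not> int q dvd x ==> par q x = 0"
 using par_pu[of q x 0] by simp

lemma unit_res: "prime q ==> \<not> int q dvd x ==> res q x = 0"
 using res_pu[of q x 0] by simp

lemma unif_par: "prime q ==> \<not> int q dvd x ==> par q (int q * x) = 1"
 using par_pu[of q x 1] by simp

lemma unif_res: "prime q ==> \<not> int q dvd x ==> res q (int q * x) = pm q x"
 using res_pu[of q x 1] by simp

lemma prime_nat_dvd_int: "prime (q::nat) ==> prime p ==> int q dvd int p \<longleftrightarrow> q = p"
 using primes_dvd_imp_eq by auto

lemma prime_not_dvd_pm1: "prime (q::nat) ==> t = 1 \<or> t = -1 ==> \<not> int q dvd t"
 using prime_gt_1_nat[of q] by (auto simp: zdvd1_eq)

lemma Cl_unit: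
 assumes p: "prime p" and t: "t = 1 \<or> t = -1"
 shows "Cl p {#t#} t 0 0"
 using assms unit_par[of _ t] unit_res[of _ t] prime_not_dvd_pm1[of _ t] by (auto simp: Cl_def)

lemma Cl_ones: assumes p: "prime p" shows "Cl p (ones k) k 0 0"
proof -
 have r: "Cl p (replicate_mset m t) (int m * t) 0 0" if t: "t = 1 \<or> t = -1" for m t
 proof (induction m)
 case 0 then show ?case by (simp add: Cl_def)
 next
 case (Suc m)
 show ?case using Cl_add[OF Cl_unit[OF p t] Suc] by (simp add: algebra_simps)
 qed
 have "Cl p (ones k) (int (nat k) * 1 + int (nat (- k)) * -1) (0 + 0) (0 + 0)"
 unfolding ones_def by (intro Cl_add r) auto
 moreover have "int (nat k) * 1 + int (nat (- k)) * -1 = k" by simp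
 ultimately show ?thesis by simp
qed

lemma sgn_pm: "t = 1 \<or> t = -1 ==> x > 0 ==> sgn (t * x) = (t :: int)"
 by (auto simp: sgn_if)

lemma Cl_p:
 assumes p: "prime p" and t: "t = 1 \<or> t = -1"
 shows "Cl p {#int p * t#} t 1 (pm p t)"
proof -
 have pt: "\<not> int p dvd t" using prime_not_dvd_pm1 assms by blast
 have nd: "\<not> int q dvd int p * t" if "prime q" "q ~= p" for q
 using that t prime_nat_dvd_int[OF that(1) p] by auto
 show ?thesis using nd unit_par unit_res unif_par[OF p pt] unif_res[OF p pt] p t sgn_pm[of t "int p"] prime_gt_0_nat[OF p]
 unfolding Cl_def by (auto simp: mult.commute)
qed

text \<open>Twisting p t, t' by 2 leaves no residue at 2, since two odd valuations add up, but it
  changes the class at p by the symbol of 2.\<close>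

lemma Cl_2p:
 assumes p: "prime p" "odd p" and t: "t = 1 \<or> t = -1" and t': "t' = 1 \<or> t' = -1"
 shows "Cl p {#int p * (2 * t), 2 * t'#} (t + t') 1 (pm p (2 * t))"
proof -
 have p2: "\<not> int p dvd 2" using p by (metis int_dvd_int_iff of_nat_numeral primes_dvd_imp_eq two_is_prime_nat even_numeral)
 have pt: "\<not> int p dvd 2 * t" "\<not> int p dvd 2 * t'" using p2 t t' by auto
 have nd: "\<not> int q dvd int p * (2 * t) \<and> \<not> int q dvd 2 * t'" if "prime q" "q ~= p" "q ~= 2" for q
 proof -
 have "\<not> int q dvd 2" using that by (metis int_dvd_int_iff of_nat_numeral primes_dvd_imp_eq two_is_prime_nat)
 moreover have "\<not> int q dvd int p" using prime_nat_dvd_int[OF that(1) p(1)] that by simp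
 ultimately have "\<not> int q dvd int p * 2" using prime_not_dvd_mult[OF that(1)] by blast
 then show ?thesis using \<open>\<not> int q dvd 2\<close> t t' by auto
 qed
 have e: "int p * (2 * t) = int 2 * (int p * t)" "2 * t' = int 2 * t'" by simp_all
 have o: "\<not> int 2 dvd int p * t" "\<not> int 2 dvd t'" using p(2) t t' by auto
 have two: "par 2 (int p * (2 * t)) = 1" "par 2 (2 * t') = 1" unfolding e using unif_par[OF two_is_prime_nat] o by blast+
 have s: "sgn (int p * (2 * t)) = t" "sgn (2 * t') = t'" using t t' prime_gt_0_nat[OF p(1)] by (auto simp: sgn_if)
 show ?thesis
 unfolding Cl_def
 proof (intro conjI allI impI)
 show "0 \<notin># {#int p * (2 * t), 2 * t'#}" using t t' prime_gt_0_nat[OF p(1)] by auto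
 show "(\<Sum>x\<in>#{#int p * (2 * t), 2 * t'#}. sgn x) = t + t'" using s by simp
 show "[(\<Sum>x\<in>#{#int p * (2 * t), 2 * t'#}. par p x) = 1] (mod 2)" using unif_par[OF p(1) pt(1)] unit_par[OF p(1) pt(2)] by simp
 show "[(\<Sum>x\<in>#{#int p * (2 * t), 2 * t'#}. res p x) = pm p (2 * t)] (mod 4)" using unif_res[OF p(1) pt(1)] unit_res[OF p(1) pt(2)] by simp
 fix q :: nat assume q: "prime q" "q ~= p"
 show "[(\<Sum>x\<in>#{#int p * (2 * t), 2 * t'#}. par q x) = 0] (mod 2)"
 proof (cases "q = 2")
 case True then show ?thesis using two by (simp add: cong_def)
 next
 case False then show ?thesis using nd[OF q False] unit_par[OF q(1)] by simp
 qed
 assume "odd q"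
 then have "q ~= 2" by auto
 then show "[(\<Sum>x\<in>#{#int p * (2 * t), 2 * t'#}. res q x) = 0] (mod 4)" using nd[OF q] unit_res[OF q(1)] by simp
 qed
qed

text \<open>Since l = 3 mod 4 and (p/l) = -1, the residues of p l t and l t at l are opposite; what
  is left is the class of l t at p.\<close>

lemma Cl_pl:
 assumes p: "prime p" "odd p" and l: "prime l" "l mod 4 = 3" "l ~= p" "Legendre (int p) (int l) = -1"
 and t: "t = 1 \<or> t = -1"
 shows "Cl p {#int p * (int l * t), int l * t#} (2 * t) 1 (pm p (int l * t))"
proof -
 have lo: "odd l" using l(2) by presburger
 have pl: "\<not> int p dvd int l" "\<not> int l dvd int p" using prime_nat_dvd_int l p by auto
 have pt: "\<not> int p dvd int l * t" "\<not> int l dvd int p * t" "\<not> int l dvd t" using pl t prime_not_dvd_pm1[OF l(1) t] by auto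
 have nd: "\<not> int q dvd int p * (int l * t) \<and> \<not> int q dvd int l * t" if "prime q" "q ~= p" "q ~= l" for q
 proof -
 have "\<not> int q dvd int p" "\<not> int q dvd int l" using prime_nat_dvd_int that p l by auto
 then have "\<not> int q dvd int p * int l" using prime_not_dvd_mult[OF that(1)] by blast
 then show ?thesis using \<open>\<not> int q dvd int l\<close> t by auto
 qed
 have e: "int p * (int l * t) = int l * (int p * t)" by simp
 have parl: "par l (int p * (int l * t)) = 1" "par l (int l * t) = 1"
 unfolding e using unif_par[OF l(1)] pt by blast+
 have resl: "res l (int p * (int l * t)) = pm l (int p * t)" "res l (int l * t) = pm l t"
 unfolding e using unif_res[OF l(1)] pt by blast+
 have pml: "pm l (int p * t) + pm l t = 0"
 using l(2,4) Legendre_mult[OF l(1) lo] by (simp add: pm_def)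
 have "sgn (t * (int p * int l)) = t" "sgn (t * int l) = t"
 using prime_gt_0_nat[OF p(1)] prime_gt_0_nat[OF l(1)] by (auto intro!: sgn_pm[OF t])
 then have s: "sgn (int p * (int l * t)) = t" "sgn (int l * t) = t" by (simp_all only: mult_ac)
 let ?Y = "{#int p * (int l * t), int l * t#}"
 show ?thesis
 unfolding Cl_def
 proof (intro conjI allI impI)
 show "0 \<notin># ?Y" using t prime_gt_0_nat[OF p(1)] prime_gt_0_nat[OF l(1)] by auto
 show "(\<Sum>x\<in>#?Y. sgn x) = 2 * t" using s by simp
 show "[(\<Sum>x\<in>#?Y. par p x) = 1] (mod 2)" using unif_par[OF p(1) pt(1)] unit_par[OF p(1) pt(1)] by simp
 show "[(\<Sum>x\<in>#?Y. res p x) = pm p (int l * t)] (mod 4)" using unif_res[OF p(1) pt(1)] unit_res[OF p(1) pt(1)] by simp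
 fix q :: nat assume q: "prime q" "q ~= p"
 show "[(\<Sum>x\<in>#?Y. par q x) = 0] (mod 2)"
 proof (cases "q = l")
 case True then show ?thesis using parl by (simp add: cong_def)
 next
 case False then show ?thesis using nd[OF q False] unit_par[OF q(1)] by simp
 qed
 show "[(\<Sum>x\<in>#?Y. res q x) = 0] (mod 4)"
 proof (cases "q = l")
 case True then show ?thesis using resl pml by simp
 next
 case False then show ?thesis using nd[OF q False] unit_res[OF q(1)] by simp
 qed
 qed
qed

text \<open>For p = 1 mod 4 reciprocity is symmetric, so the nonresidue condition holds in both
  directions.\<close>

lemma ex_aux_prime:
 assumes p: "prime p" "p mod 4 = 1"
 shows "\<exists>l. prime l \<and> l mod 4 = 3 \<and> l ~= p \<and> Legendre (int l) (int p) = -1 \<and> Legendre (int p) (int l) = -1"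
proof -
 obtain l where l: "prime l" "l mod 4 = 3" "Legendre (int l) (int p) = -1" using ex_prime_nonresidue[OF p] by blast
 have lp: "l ~= p" using l p by auto
 have odd: "odd l" "odd p" using l(2) p(2) by presburger+
 have gt: "2 < l" "2 < p" using odd_prime_gt2 l p odd by blast+
 obtain h where "p = 4 * h + 1" using p(2) by (metis mult_div_mod_eq)
 then have "even ((p - 1) div 2 * ((l - 1) div 2))" by simp
 then have "Legendre (int p) (int l) * Legendre (int l) (int p) = 1"
 using Quadratic_Reciprocity[OF p(1) gt(2) l(1) gt(1)] lp by simp
 then show ?thesis using l lp by auto
qed

lemma witt_g2_int:
 assumes "witt (fr X) (fr Y)" "0 \<notin># X" "0 \<notin># Y"
 shows "[(\<Sum>x\<in>#X. g2 x) = (\<Sum>x\<in>#Y. g2 x)] (mod 8)"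
 using witt_g2[OF assms(1)] sum_ext_fr[OF sqc_g2] assms(2,3) by simp

lemma g2_odd: "odd x ==> [g2 x = x] (mod 8)"
 using g2_pu[of x 0] by (simp add: tab_def cong_def)

lemma g2_ones: "[(\<Sum>x\<in>#ones k. g2 x) = k] (mod 8)"
proof -
 have 1: "g2 1 = 1" using g2_pu[of 1 0] by (simp add: tab_def)
 have 7: "g2 (-1) = 7" using g2_pu[of "-1" 0] by (simp add: tab_def)
 have "(\<Sum>x\<in>#ones k. g2 x) = int (nat k) + int (nat (- k)) * 7" by (simp add: ones_def 1 7)
 also have "... = k + 8 * int (nat (- k))" by simp
 also have "[... = k] (mod 8)" by (simp add: cong_def)
 finally show ?thesis .
qed

text \<open>Were 2 a square modulo p, the forms 2p, 2 and p, 1 would agree in signature and in all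
  residues, hence be Witt equivalent; but their oddities differ when p is 3 or 5 modulo 8.\<close>

lemma Legendre_2_nonres:
 assumes p: "prime p" "odd p" and m: "p mod 8 = 3 \<or> p mod 8 = 5"
 shows "Legendre 2 (int p) = -1"
proof (rule ccontr)
 assume n: "Legendre 2 (int p) ~= -1"
 have p2: "\<not> int p dvd 2" using p by (metis int_dvd_int_iff of_nat_numeral primes_dvd_imp_eq two_is_prime_nat even_numeral)
 then have "pm p 2 = pm p 1" using n Legendre_unit[OF p2] Legendre_1[OF p] by (simp add: pm_def)
 moreover have "Cl p {#int p * 2, 2#} 2 1 (pm p 2)" using Cl_2p[OF p, of 1 1] by simp
 moreover have c1: "Cl p {#int p, 1#} 2 1 (pm p 1)" using Cl_add[OF Cl_p[OF p(1), of 1] Cl_unit[OF p(1), of 1]] by (simp add: add_mset_commute)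
 ultimately have "witt (fr {#int p * 2, 2#}) (fr {#int p, 1#})" using Cl_witt[OF p] cong_refl by metis
 then have "[(\<Sum>x\<in>#{#int p * 2, 2#}. g2 x) = (\<Sum>x\<in>#{#int p, 1#}. g2 x)] (mod 8)"
 using prime_gt_0_nat[OF p(1)] by (intro witt_g2_int) auto
 then have *: "[g2 (int p * 2) + g2 2 = g2 (int p) + g2 1] (mod 8)" by simp
 have a: "g2 (int p * 2) = tab True (int p mod 8)" "g2 2 = 1" "g2 (int p) = int p mod 8" "g2 1 = 1"
 using g2_pu[of "int p" 1] g2_pu[of 1 1] g2_pu[of "int p" 0] g2_pu[of 1 0] p(2) by (simp_all add: tab_def mult.commute)
 have "int p mod 8 = 3 \<or> int p mod 8 = 5" using m by presburger
 then show False using * unfolding a by (auto simp: tab_def cong_def)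
qed

lemma even_mod4: "even (x::int) ==> [x = 0] (mod 4) \<or> [x = 2] (mod 4)"
 by (simp add: cong_def) presburger

lemma odd_mod4: "odd (x::int) ==> [x = 1] (mod 4) \<or> [x = -1] (mod 4)"
 by (simp add: cong_def) presburger

lemma cong_0_D: "[x = 0] (mod m) ==> \<exists>k. x = m * (k::int)"
 by (auto simp: cong_0_iff elim!: dvdE)

lemma cong_I: "x = y + m * (k::int) ==> [x = y] (mod m)"
 by (simp add: cong_iff_dvd_diff)

section \<open>The oddity formula and short models of a Witt class\<close>

text \<open>What the lattice leaves after diagonalization: signature \<open>s\<close>, p-modular
  rank \<open>n\<close>, sign \<open>eps\<close>, oddity 0. The residue at p is a sum over the n
  p-modular coefficients; for p = 3 mod 4 it is a sum of n signs with product \<open>eps\<close>,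
  and such a sum is n - 1 + \<open>eps\<close> modulo 4.\<close>

locale p_form =
 fixes p :: nat and X :: "int multiset" and s :: int and n :: nat and eps :: int
 assumes p: "prime p" "odd p" and eps: "eps = 1 \<or> eps = -1"
 and cl: "Cl p X s (int n) (if p mod 4 = 1 then 1 - eps else int n - 1 + eps)"
 and dyadic: "[(\<Sum>x\<in>#X. g2 x) = 0] (mod 8)"
begin

abbreviation "c \<equiv> (if p mod 4 = 1 then 1 - eps else int n - 1 + eps)"

text \<open>A model with the right residue at p is completed to the right signature by coefficients
  1 or -1. The class is then the given one, and comparing oddities yields a congruence for
  \<open>s\<close> modulo 8.\<close>

lemma compare:
 assumes "Cl p Y t a d" "[int n = a] (mod 2)" "[c = d] (mod 4)"
 shows "witt (fr X) (fr (Y + ones (s - t)))" "[(\<Sum>x\<in>#Y. g2 x) + (s - t) = 0] (mod 8)"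
proof -
 have Y: "Cl p (Y + ones (s - t)) s a d" using Cl_add[OF assms(1) Cl_ones[OF p(1), of "s - t"]] by simp
 show w: "witt (fr X) (fr (Y + ones (s - t)))" using Cl_witt[OF p cl Y assms(2,3)] .
 have "0 \<notin># X" "0 \<notin># Y + ones (s - t)" using cl Y by (auto simp: Cl_def)
 then have "[(\<Sum>x\<in>#X. g2 x) = (\<Sum>x\<in>#Y. g2 x) + (\<Sum>x\<in>#ones (s - t). g2 x)] (mod 8)" using witt_g2_int[OF w] by simp
 moreover have "[(\<Sum>x\<in>#Y. g2 x) + (\<Sum>x\<in>#ones (s - t). g2 x) = (\<Sum>x\<in>#Y. g2 x) + (s - t)] (mod 8)"
 by (intro cong_add cong_refl g2_ones)
 ultimately show "[(\<Sum>x\<in>#Y. g2 x) + (s - t) = 0] (mod 8)" using dyadic by (metis cong_sym cong_trans)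
qed

lemma p_mod4: "p mod 4 = 1 \<or> p mod 4 = 3"
 using p(2) by presburger

lemma pm_1: "pm p 1 = (if p mod 4 = 1 then 0 else 1)" and pm_m1: "pm p (-1) = (if p mod 4 = 1 then 0 else -1)"
 using Legendre_1[OF p] Legendre_neg1[OF p] by (auto simp: pm_def)

lemma g2_p: "t = 1 \<or> t = -1 ==> [g2 (int p * t) = int p * t] (mod 8)"
 using p(2) by (intro g2_odd) auto

text \<open>For even n the residue at p is 0 or 2. The empty model carries 0; the model p, p carries
  2 if p = 3 mod 4, and p, pl, l carries it if p = 1 mod 4. Their oddities determine
  \<open>s\<close> modulo 8.\<close>

lemma even_case:
 assumes n: "even n"
 shows "[c = 0] (mod 4) \<and> [s = 0] (mod 8) \<or> [c = 2] (mod 4) \<and> [s = 4] (mod 8)"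
proof -
 have "[int n = 0] (mod 2)" using n by (simp add: cong_0_iff)
 have "[c = 0] (mod 4) \<or> [c = 2] (mod 4)"
 proof -
 have "even c" using n eps by auto
 then show ?thesis by (rule even_mod4)
 qed
 then show ?thesis
 proof
 assume c0: "[c = 0] (mod 4)"
 have "Cl p {#} 0 0 0" by (simp add: Cl_def)
 then have "[0 + (s - 0) = 0] (mod 8)" using compare(2)[of "{#}" 0 0 0] c0 \<open>[int n = 0] (mod 2)\<close> by simp
 then show ?thesis using c0 by simp
 next
 assume c2: "[c = 2] (mod 4)"
 have "[s = 4] (mod 8)"
 proof (cases "p mod 4 = 1")
 case False
 then have p3: "p mod 4 = 3" using p_mod4 by blast
 have "Cl p ({#int p * 1#} + {#int p * 1#}) (1 + 1) (1 + 1) (pm p 1 + pm p 1)" using p by (intro Cl_add Cl_p) auto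
 moreover have "[int n = 1 + 1] (mod 2)" using \<open>[int n = 0] (mod 2)\<close> by (simp add: cong_def)
 moreover have "pm p 1 + pm p 1 = 2" using pm_1 p3 by simp
 then have "[c = pm p 1 + pm p 1] (mod 4)" using c2 by (simp only:)
 ultimately have "[(\<Sum>x\<in>#{#int p * 1#} + {#int p * 1#}. g2 x) + (s - (1 + 1)) = 0] (mod 8)"
 by (rule compare(2))
 then obtain b where b: "(\<Sum>x\<in>#{#int p * 1#} + {#int p * 1#}. g2 x) + (s - (1 + 1)) = 8 * b" using cong_0_D by blast
 have "[g2 (int p) = int p] (mod 8)" using g2_p[of 1] by simp
 then have "8 dvd g2 (int p) - int p" by (simp only: cong_iff_dvd_diff)
 then obtain a where a: "g2 (int p) - int p = 8 * a" by blast
 have "p = 4 * (p div 4) + 3" using p3 by presburger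
 then obtain y where y: "p = 4 * y + 3" by blast
 have "s = 4 + 8 * (b - int y - 2 * a - 1)" using a b y by simp
 then show ?thesis by (rule cong_I)
 next
 case True
 obtain l where l: "prime l" "l mod 4 = 3" "l ~= p" "Legendre (int l) (int p) = -1" "Legendre (int p) (int l) = -1"
 using ex_aux_prime[OF p(1) True] by blast
 have "pm p (int l * 1) = 2" using l True by (simp add: pm_def)
 then have "Cl p ({#int p * 1#} + {#int p * (int l * 1), int l * 1#}) (1 + 2 * 1) (1 + 1) (0 + 2)"
 using Cl_add[OF Cl_p[OF p(1), of 1] Cl_pl[OF p l(1-3,5), of 1]] pm_1 True by simp
 moreover have "[int n = 1 + 1] (mod 2)" using \<open>[int n = 0] (mod 2)\<close> by (simp add: cong_def)
 moreover have "[c = 0 + 2] (mod 4)" using c2 by (simp only: add_0)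
 ultimately have "[(\<Sum>x\<in>#{#int p * 1#} + {#int p * (int l * 1), int l * 1#}. g2 x) + (s - (1 + 2 * 1)) = 0] (mod 8)"
 by (rule compare(2))
 then have *: "[g2 (int p) + (g2 (int p * int l) + g2 (int l)) + (s - 3) = 0] (mod 8)" by (simp add: algebra_simps)
 have ol: "odd l" using l(2) by presburger
 have "[g2 (int p) = int p] (mod 8)" "[g2 (int p * int l) = int p * int l] (mod 8)" "[g2 (int l) = int l] (mod 8)"
 using p(2) ol by (auto intro!: g2_odd)
 then have e: "[g2 (int p) + (g2 (int p * int l) + g2 (int l)) + (s - 3) = int p + (int p * int l + int l) + (s - 3)] (mod 8)"
 by (intro cong_add cong_refl)
 obtain b where b: "int p + (int p * int l + int l) + (s - 3) = 8 * b"
 using cong_0_D[OF cong_trans[OF cong_sym[OF e] *]] by blast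
 have "p = 4 * (p div 4) + 1" using True by presburger
 then obtain x where x: "p = 4 * x + 1" by blast
 have "l = 4 * (l div 4) + 3" using l(2) by presburger
 then obtain y where y: "l = 4 * y + 3" by blast
 have "s = 4 + 8 * (b - 2 * (int x * int y) - 2 * int x - int y - 1)" using b unfolding x y by (simp add: algebra_simps)
 then show ?thesis by (rule cong_I)
 qed
 then show ?thesis using c2 by simp
 qed
qed

text \<open>The sign condition says that the form of rank n over the field with p elements has the
  discriminant of n/2 hyperbolic planes, that is, trivial residue.\<close>

lemma oddity:
 assumes n: "even n"
 shows "4 dvd s \<and> ([s = 0] (mod 8) \<longleftrightarrow> eps * Legendre (-1) (int p) ^ (n div 2) = 1)"
proof -
 obtain h where h: "n = 2 * h" using n by blast
 have L: "Legendre (-1) (int p) = (if p mod 4 = 1 then 1 else -1)" using Legendre_neg1[OF p] .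
 have e: "[c = 0] (mod 4) \<longleftrightarrow> eps * Legendre (-1) (int p) ^ (n div 2) = 1"
 proof (cases "p mod 4 = 1")
 case True then show ?thesis using eps L by (auto simp: cong_def)
 next
 case False
 then have L1: "Legendre (-1) (int p) = -1" and ce: "c = 2 * int h - 1 + eps" using L h by auto
 have d: "n div 2 = h" using h by simp
 show ?thesis
 proof (cases "even h")
 case True
 then obtain m where m: "h = 2 * m" by blast
 have "[4 * int m = 0] (mod 4)" "\<not> [4 * int m - 2 = 0] (mod 4)"
 unfolding cong_0_iff by presburger+
 then show ?thesis using eps unfolding d L1 ce m by auto
 next
 case False
 then obtain m where m: "h = 2 * m + 1" by (auto elim: oddE)
 have "[4 * int m = 0] (mod 4)" "\<not> [4 * int m + 2 = 0] (mod 4)"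
 unfolding cong_0_iff by presburger+
 then show ?thesis using eps unfolding d L1 ce m by (auto simp: algebra_simps)
 qed
 qed
 have excl: "\<not> ([x = 0] (mod 4) \<and> [x = 2] (mod 4))" "\<not> ([x = 0] (mod 8) \<and> [x = 4] (mod 8))" for x :: int
 by (auto simp: cong_def)
 have "\<not> ([c = 0] (mod 4) \<and> [c = 2] (mod 4))" "\<not> ([s = 0] (mod 8) \<and> [s = 4] (mod 8))" using excl by blast+
 moreover have "[s = 0] (mod 8) \<or> [s = 4] (mod 8)" using even_case[OF n] by blast
 then have "4 dvd s"
 proof
 assume "[s = 0] (mod 8)"
 then obtain k where "s = 8 * k" using cong_0_D by blast
 then have "s = 4 * (2 * k)" by simp
 then show ?thesis by (metis dvd_triv_left)
 next
 assume "[s = 4] (mod 8)"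
 then have "8 dvd s - 4" by (simp only: cong_iff_dvd_diff)
 then obtain k where "s - 4 = 8 * k" by blast
 then have "s = 4 * (2 * k + 1)" by simp
 then show ?thesis by (metis dvd_triv_left)
 qed
 ultimately show ?thesis using even_case[OF n] e by blast
qed

text \<open>A model Y of signature t costs its size plus |s - t| further coefficients 1 or -1. Where
  possible its coefficients get the sign \<open>e\<close> of \<open>s\<close>, so that Y costs no
  more than the coefficients it replaces. The cases where |s| is too small for this are settled by
  the oddity congruence.\<close>

lemma smaller:
 assumes r: "even (size X)" "size X \<ge> 4" "\<bar>s\<bar> \<le> int (size X) - 2" "even s"
 shows "\<exists>Y. witt (fr X) (fr Y) \<and> size Y < size X"
proof -
 have fin: ?thesis if "Cl p Y t a d" "[int n = a] (mod 2)" "[c = d] (mod 4)" "int (size Y) + \<bar>s - t\<bar> < int (size X)" for Y t a d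
 proof -
 have "size (Y + ones (s - t)) < size X" using that(4) by simp
 then show ?thesis using compare(1)[OF that(1-3)] by blast
 qed
 have fin': ?thesis if "Cl p Y t a d" "[int n = a] (mod 2)" "[c = d] (mod 4)" "int (size Y) + \<bar>s - t\<bar> \<le> \<bar>s\<bar>" for Y t a d
 using that(4) r(3) by (intro fin[OF that(1-3)]) linarith
 define e where "e = (if s \<ge> 0 then 1 else - 1 :: int)"
 have e: "e = 1 \<or> e = -1" by (simp add: e_def)
 show ?thesis
 proof (cases "even n")
 case True
 have n0: "[int n = 0] (mod 2)" using True by (simp add: cong_0_iff)
 show ?thesis using even_case[OF True]
 proof (elim disjE conjE)
 assume "[c = 0] (mod 4)"
 moreover have "Cl p {#} 0 0 0" by (simp add: Cl_def)
 ultimately show ?thesis using n0 by (intro fin'[of "{#}" 0 0 0]) auto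
 next
 assume c2: "[c = 2] (mod 4)" and "[s = 4] (mod 8)"
 then obtain z where "s - 4 = 8 * z" unfolding cong_iff_dvd_diff by (auto elim!: dvdE)
 \<comment> \<open>From s = 4 mod 8, |s| is at least 4, enough for the two or three coefficients of
   the model to be paid for.\<close>
 then have s4: "\<bar>s\<bar> \<ge> 4" by (cases "z \<ge> 0") auto
 show ?thesis
 proof (cases "p mod 4 = 1")
 case False
 have "Cl p ({#int p * e#} + {#int p * e#}) (e + e) (1 + 1) (pm p e + pm p e)" using p e by (intro Cl_add Cl_p) auto
 then show ?thesis
 proof (rule fin')
 show "[int n = 1 + 1] (mod 2)" using n0 by (simp add: cong_def)
 have q: "pm p e + pm p e = 2 * e" using e pm_1 pm_m1 False by auto
 have w: "[2 = 2 * e] (mod 4)" using e by (auto simp: cong_def)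
 show "[c = pm p e + pm p e] (mod 4)" unfolding q by (rule cong_trans[OF c2 w])
 show "int (size ({#int p * e#} + {#int p * e#})) + \<bar>s - (e + e)\<bar> \<le> \<bar>s\<bar>" using s4 by (cases "s \<ge> 0") (auto simp: e_def)
 qed
 next
 case True
 obtain l where l: "prime l" "l mod 4 = 3" "l ~= p" "Legendre (int l) (int p) = -1" "Legendre (int p) (int l) = -1"
 using ex_aux_prime[OF p(1) True] by blast
 have pl: "pm p (int l * e) = 2"
 using l True e Legendre_mult[OF p, of "int l" "-1"] Legendre_neg1[OF p] by (auto simp: pm_def)
 have "Cl p ({#int p * e#} + {#int p * (int l * e), int l * e#}) (e + 2 * e) (1 + 1) (pm p e + pm p (int l * e))"
 by (intro Cl_add Cl_p Cl_pl p l e)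
 then show ?thesis
 proof (rule fin')
 show "[int n = 1 + 1] (mod 2)" using n0 by (simp add: cong_def)
 have "pm p e + pm p (int l * e) = 2" using e pm_1 pm_m1 True pl by auto
 then show "[c = pm p e + pm p (int l * e)] (mod 4)" using c2 by simp
 show "int (size ({#int p * e#} + {#int p * (int l * e), int l * e#})) + \<bar>s - (e + 2 * e)\<bar> \<le> \<bar>s\<bar>"
 using s4 by (cases "s \<ge> 0") (auto simp: e_def)
 qed
 qed
 qed
 next
 case False
 have n1: "[int n = 1] (mod 2)" using False by (simp add: cong_def) presburger
 show ?thesis
 proof (cases "p mod 4 = 1")
 case True
 show ?thesis
 proof (cases "eps = 1")
 case e1: True
 show ?thesis
 proof (rule fin[OF Cl_p[OF p(1) e] n1])
 show "[c = pm p e] (mod 4)" using e pm_1 pm_m1 True e1 by auto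
 show "int (size {#int p * e#}) + \<bar>s - e\<bar> < int (size X)"
 using r by (cases "s \<ge> 0"; cases "s = 0") (auto simp: e_def)
 qed
 next
 case False
 then have em: "eps = -1" using eps by blast
 obtain l where l: "prime l" "l mod 4 = 3" "l ~= p" "Legendre (int l) (int p) = -1" "Legendre (int p) (int l) = -1"
 using ex_aux_prime[OF p(1) True] by blast
 have pl: "pm p (int l * e) = 2"
 using l True e Legendre_mult[OF p, of "int l" "-1"] Legendre_neg1[OF p] by (auto simp: pm_def)
 have cc: "[c = pm p (int l * e)] (mod 4)" using em True pl by simp
 show ?thesis
 proof (cases "s = 0")
 case False
 then have "\<bar>s\<bar> \<ge> 2" using r(4) by (auto elim!: evenE)
 then show ?thesis
 by (intro fin'[OF Cl_pl[OF p l(1-3,5) e] n1 cc]) (cases "s \<ge> 0"; auto simp: e_def)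
 next
 \<comment> \<open>For s = 0 the model pl, l with two coefficients -1 would have size 4, possibly no
   gain. Its oddity congruence, however, forces p = 5 mod 8, so 2 is a nonresidue and the model 2p,
   -2 of signature 0 is available.\<close>
 case s0: True
 then have e': "e = 1" by (simp add: e_def)
 have "[(\<Sum>x\<in>#{#int p * (int l * e), int l * e#}. g2 x) + (s - 2 * e) = 0] (mod 8)"
 by (rule compare(2)[OF Cl_pl[OF p l(1-3,5) e] n1 cc])
 then have *: "[g2 (int p * int l) + g2 (int l) - 2 = 0] (mod 8)" using s0 e' by simp
 have ol: "odd l" using l(2) by presburger
 have "[g2 (int p * int l) = int p * int l] (mod 8)" "[g2 (int l) = int l] (mod 8)"
 using p(2) ol by (auto intro!: g2_odd)
 then have e: "[g2 (int p * int l) + g2 (int l) - 2 = int p * int l + int l - 2] (mod 8)"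
 by (intro cong_add cong_diff cong_refl)
 obtain b where b: "int p * int l + int l - 2 = 8 * b"
 using cong_0_D[OF cong_trans[OF cong_sym[OF e] *]] by blast
 have "p = 4 * (p div 4) + 1" using True by presburger
 then obtain x where x: "p = 4 * x + 1" by blast
 have "l = 4 * (l div 4) + 3" using l(2) by presburger
 then obtain y where y: "l = 4 * y + 3" by blast
 have "3 * int x + 1 = 2 * (b - 2 * (int x * int y) - int y)" using b unfolding x y by (simp add: algebra_simps)
 then have "even (3 * int x + 1)" by simp
 then have "odd x" by simp
 then obtain z where "x = 2 * z + 1" by (rule oddE)
 then have "p mod 8 = 5" using x by simp
 then have L2: "Legendre 2 (int p) = -1" using Legendre_2_nonres[OF p] by blast
 have "Cl p {#int p * (2 * 1), 2 * - 1#} (1 + - 1) 1 (pm p (2 * 1))" by (rule Cl_2p[OF p]) auto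
 then show ?thesis
 proof (rule fin[OF _ n1])
 show "[c = pm p (2 * 1)] (mod 4)" using L2 True em by (simp add: pm_def)
 qed (use s0 r in simp)
 qed
 qed
 next
 case p3: False
 then have p34: "p mod 4 = 3" using p_mod4 by blast
 have "odd c" using p3 False eps by auto
 then have "[c = 1] (mod 4) \<or> [c = -1] (mod 4)" by (rule odd_mod4)
 \<comment> \<open>For odd n and p = 3 mod 4 a single coefficient p or -p has the required residue;
   its oddity congruence excludes s = 0.\<close>
 then obtain \<kappa> where k: "\<kappa> = 1 \<or> \<kappa> = -1" "[c = \<kappa>] (mod 4)" by blast
 have pk: "pm p \<kappa> = \<kappa>" "pm p (- \<kappa>) = - \<kappa>" using k pm_1 pm_m1 p3 by auto
 have ck: "[c = pm p \<kappa>] (mod 4)" using k pk by simp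
 have "[(\<Sum>x\<in>#{#int p * \<kappa>#}. g2 x) + (s - \<kappa>) = 0] (mod 8)" by (rule compare(2)[OF Cl_p[OF p(1) k(1)] n1 ck])
 then have A: "[g2 (int p * \<kappa>) + (s - \<kappa>) = 0] (mod 8)" by simp
 have B: "[g2 (int p * \<kappa>) + (s - \<kappa>) = int p * \<kappa> + (s - \<kappa>)] (mod 8)" using g2_p[OF k(1)] by (intro cong_add cong_refl)
 obtain b where b: "int p * \<kappa> + (s - \<kappa>) = 8 * b" using cong_0_D[OF cong_trans[OF cong_sym[OF B] A]] by blast
 have "p = 4 * (p div 4) + 3" using p34 by presburger
 then obtain y where y: "p = 4 * y + 3" by blast
 have s0: "s ~= 0"
 proof
 assume "s = 0"
 then have "2 * int y + 1 = 4 * b \<or> 2 * int y + 1 = - 4 * b" using b k(1) unfolding y by auto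
 then show False by presburger
 qed
 show ?thesis
 proof (cases "\<kappa> = e")
 case True
 have "\<bar>s\<bar> \<ge> 1" using s0 by linarith
 then show ?thesis using True by (intro fin'[OF Cl_p[OF p(1) k(1)] n1 ck]) (cases "s \<ge> 0"; auto simp: e_def)
 next
 case ne: False
 then have ke: "\<kappa> = - e" using k(1) e by auto
 show ?thesis
 proof (cases "\<bar>s\<bar> \<ge> 3")
 case True
 \<comment> \<open>Three coefficients p \<open>e\<close> have residue 3 \<open>e\<close>, which
   equals - \<open>e\<close> modulo 4.\<close>
 have "Cl p ({#int p * e#} + ({#int p * e#} + {#int p * e#})) (e + (e + e)) (1 + (1 + 1)) (pm p e + (pm p e + pm p e))"
 by (intro Cl_add Cl_p p e)
 then show ?thesis
 proof (rule fin')
 show "[int n = 1 + (1 + 1)] (mod 2)" using n1 by (simp add: cong_def)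
 have q: "pm p e = e" using e pm_1 pm_m1 p3 by auto
 have w: "[- e = e + (e + e)] (mod 4)" using e by (auto simp: cong_def)
 show "[c = pm p e + (pm p e + pm p e)] (mod 4)" unfolding q by (rule cong_trans[OF k(2)[unfolded ke] w])
 show "int (size ({#int p * e#} + ({#int p * e#} + {#int p * e#}))) + \<bar>s - (e + (e + e))\<bar> \<le> \<bar>s\<bar>"
 using True by (cases "s \<ge> 0") (auto simp: e_def)
 qed
 next
 case False
 \<comment> \<open>Remaining case: |s| = 2 and the single coefficient has the sign opposite to
   \<open>s\<close>. Then the oddity gives p = 3 mod 8, so 2 is a nonresidue and doubling p
   \<open>e\<close>, \<open>e\<close> reverses the residue.\<close>
 then have s2: "s = 2 * e" using s0 r(4) by (auto simp: e_def elim!: evenE)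
 have "p mod 8 = 3"
 proof -
 have "int y = - 2 * b \<or> int y = 2 * b" using b s2 ke e unfolding y by auto
 then have "even y" by presburger
 then obtain z where "y = 2 * z" by blast
 then show ?thesis using y by simp
 qed
 then have L2: "Legendre 2 (int p) = -1" using Legendre_2_nonres[OF p] by blast
 have "pm p (2 * e) = - e"
 using L2 e p3 Legendre_mult[OF p, of 2 "-1"] Legendre_neg1[OF p] by (auto simp: pm_def)
 then have "[c = pm p (2 * e)] (mod 4)" using k(2) ke by simp
 then show ?thesis using s2 r by (intro fin[OF Cl_2p[OF p e e] n1]) auto
 qed
 qed
 qed
 qed
qed

end

subsection \<open>Local structure of the lattice\<close>

lemma ex_adj:
 fixes S :: "nat \<Rightarrow> nat \<Rightarrow> 'a :: comm_ring_1"
 obtains A where "\<And>i j. i < n ==> j < n ==> (\<Sum>k<n. S i k * A k j) = (if i = j then det (mt n S) else 0)"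
 "\<And>i j. i < n ==> j < n ==> (\<Sum>k<n. A i k * S k j) = (if i = j then det (mt n S) else 0)"
proof
 define A where "A = (\<lambda>i j. adj_mat (mt n S) $$ (i, j))"
 have c: "mt n S \<in> carrier_mat n n" by simp
 note a = adj_mat[OF c]
 have d: "dim_row (adj_mat (mt n S)) = n" "dim_col (adj_mat (mt n S)) = n" using a(1) by auto
 fix i j assume ij: "i < n" "j < n"
 have 1: "(mt n S * adj_mat (mt n S)) $$ (i, j) = (\<Sum>k<n. S i k * A k j)"
 using ij d by (simp add: scalar_prod_def A_def atLeast0LessThan)
 have 2: "(adj_mat (mt n S) * mt n S) $$ (i, j) = (\<Sum>k<n. A i k * S k j)"
 using ij d by (simp add: scalar_prod_def A_def atLeast0LessThan)
 have 3: "(det (mt n S) \<cdot>\<^sub>m 1\<^sub>m n) $$ (i, j) = (if i = j then det (mt n S) else 0)" using ij by auto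
 show "(\<Sum>k<n. S i k * A k j) = (if i = j then det (mt n S) else 0)" using 3 unfolding 1[symmetric] a(2) .
 show "(\<Sum>k<n. A i k * S k j) = (if i = j then det (mt n S) else 0)" using 3 unfolding 2[symmetric] a(3) .
qed

lemma nd_of_left_inverse:
 assumes "\<And>i j. i < n ==> j < n ==> (\<Sum>k<n. A i k * S k j) = (if i = j then D else 0)" "prime q" "\<not> q dvd D"
 shows "nd q {..<n} S"
 unfolding nd_def
proof (intro allI impI ballI)
 fix x i assume h: "\<forall>i\<in>{..<n}. q dvd (\<Sum>k<n. S i k * x k)" and i: "i \<in> {..<n}"
 have "(\<Sum>j<n. A i j * (\<Sum>k<n. S j k * x k)) = (\<Sum>k<n. (\<Sum>j<n. A i j * S j k) * x k)"
 unfolding sum_distrib_left sum_distrib_right by (subst sum.swap) (simp add: mult.assoc)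
 also have "... = (\<Sum>k<n. (if i = k then D * x k else 0))" using i assms(1) by (intro sum.cong) auto
 also have "... = D * x i" using i by simp
 finally have "D * x i = (\<Sum>j<n. A i j * (\<Sum>k<n. S j k * x k))" ..
 moreover have "q dvd (\<Sum>j<n. A i j * (\<Sum>k<n. S j k * x k))" using h by (intro dvd_sum) auto
 ultimately have "q dvd D * x i" by simp
 then show "q dvd x i" using assms(2,3) prime_dvd_mult_iff by blast
qed

lemma nd_of_det:
 assumes "prime q" "\<not> q dvd det (mt n S)" shows "nd q {..<n} S"
proof -
 obtain A where "\<And>i j. i < n ==> j < n ==> (\<Sum>k<n. S i k * A k j) = (if i = j then det (mt n S) else 0)"
 and A: "\<And>i j. i < n ==> j < n ==> (\<Sum>k<n. A i k * S k j) = (if i = j then det (mt n S) else 0)"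
 by (rule ex_adj[where n = n and S = S]) (rule that)
 show ?thesis by (rule nd_of_left_inverse[OF A assms])
qed

lemma ideal_gen:
 fixes w :: "nat \<Rightarrow> int"
 obtains d u where "d \<ge> 0" "(\<Sum>i<r. u i * w i) = d" "\<And>i. i < r ==> d dvd w i"
proof -
 have "\<exists>d u. d \<ge> 0 \<and> (\<Sum>i<r. u i * w i) = d \<and> (\<forall>i<r. d dvd w i)"
 proof (induction r)
 case 0 then show ?case by (intro exI[of _ 0]) simp
 next
 case (Suc r)
 then obtain d u where d: "d \<ge> 0" "(\<Sum>i<r. u i * w i) = d" "\<forall>i<r. d dvd w i" by blast
 obtain a b where ab: "a * d + b * w r = gcd d (w r)" using bezout_int by blast
 have "(\<Sum>i<r. (a * u i) * w i) = a * d" using d(2) by (simp add: sum_distrib_left[symmetric] mult.assoc)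
 moreover have "(\<Sum>i<r. ((\<lambda>i. a * u i)(r := b)) i * w i) = (\<Sum>i<r. (a * u i) * w i)" by (intro sum.cong) auto
 ultimately have S: "(\<Sum>i<Suc r. ((\<lambda>i. a * u i)(r := b)) i * w i) = gcd d (w r)" using ab by simp
 have D: "\<forall>i<Suc r. gcd d (w r) dvd w i" using d(3) by (auto simp: less_Suc_eq intro: dvd_trans)
 have g: "gcd d (w r) \<ge> 0" by simp
 show ?case by (rule exI, rule exI, rule conjI[OF g conjI[OF S D]])
 qed
 then show ?thesis using that by blast
qed

lemma no_prime_divisor_comb:
 fixes w :: "nat \<Rightarrow> int"
 assumes "\<And>q :: nat. prime q ==> \<exists>i<r. \<not> int q dvd w i"
 obtains u where "(\<Sum>i<r. u i * w i) = 1"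
proof -
 obtain d u where d: "d \<ge> 0" "(\<Sum>i<r. u i * w i) = d" "\<And>i. i < r ==> d dvd w i" by (rule ideal_gen[where w = w and r = r]) (rule that)
 have "nat d = 1"
 proof (rule ccontr)
 assume "nat d ~= 1"
 then obtain q where q: "prime q" "q dvd nat d" using prime_factor_nat by blast
 then have "int q dvd d" using d(1) by (metis int_dvd_int_iff int_nat_eq)
 then show False using assms[OF q(1)] d(3) dvd_trans by blast
 qed
 moreover have "int (nat d) = d" using d(1) by simp
 ultimately have "d = 1" by simp
 then have "(\<Sum>i<r. u i * w i) = 1" using d(2) by simp
 then show ?thesis by (rule that)
qed

lemma bl_diag:
 assumes "finite I"
 shows "bl I (\<lambda>j k. if j = k then c j else 0) x y = (\<Sum>i\<in>I. c i * x i * y i)"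
proof -
 have "(\<Sum>k\<in>I. (if j = k then c j else 0) * y k) = c j * y j" if "j \<in> I" for j
 using assms that by (subst sum.remove[of _ j]) (auto intro!: sum.neutral)
 then show ?thesis unfolding bl_row by (intro sum.cong) (auto simp: mult_ac)
qed

lemma nd_diag:
 assumes "finite I" "prime q" "\<And>i. i \<in> I ==> \<not> q dvd c i"
 shows "nd q I (\<lambda>j k. if j = k then c j else 0)"
 unfolding nd_def
proof (intro allI impI ballI)
 fix x i assume h: "\<forall>i\<in>I. q dvd (\<Sum>k\<in>I. (if i = k then c i else 0) * x k)" and i: "i \<in> I"
 have "(\<Sum>k\<in>I. (if i = k then c i else 0) * x k) = c i * x i"
 using assms(1) i by (subst sum.remove[of _ i]) (auto intro!: sum.neutral)
 then show "q dvd x i" using h i assms prime_dvd_mult_iff by (metis (no_types, lifting))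
qed

text \<open>Over a finite field every form of rank 3 is isotropic and every form of rank 2 is
  universal. The other cases are decided by the discriminant: rank 2 is isotropic when minus the
  discriminant is a square, and rank 1 represents a single square class.\<close>

lemma diagonal_solvable_iff:
 assumes p: "prime (p::nat)" "odd p" and I: "finite (I :: nat set)" and c: "\<And>i. i \<in> I ==> \<not> int p dvd c i"
 shows "(\<exists>y. [(\<Sum>i\<in>I. c i * y i * y i) = k] (mod int p) \<and> (\<exists>i\<in>I. \<not> int p dvd y i)) \<longleftrightarrow>
 (if int p dvd k then card I \<ge> 3 \<or> card I = 2 \<and> Legendre (- (\<Prod>i\<in>I. c i)) (int p) = 1
 else card I \<ge> 2 \<or> card I = 1 \<and> Legendre k (int p) = Legendre (\<Prod>i\<in>I. c i) (int p))"
 (is "?L \<longleftrightarrow> ?R")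
proof -
 let ?S = "\<lambda>j k. if j = k then c j else 0"
 have pp: "prime (int p)" using p by simp
 have sym: "symon I ?S" by (auto simp: symon_def)
 have nd: "nd (int p) I ?S" using nd_diag[OF I pp c] .
 have nz: "\<exists>i\<in>I. \<not> int p dvd y i" if "[(\<Sum>i\<in>I. c i * y i * y i) = k] (mod int p)" "\<not> int p dvd k" for y
 proof (rule ccontr)
 assume "\<not> ?thesis"
 then have "int p dvd (\<Sum>i\<in>I. c i * y i * y i)" by (intro dvd_sum) auto
 then show False using that cong_dvd_iff by blast
 qed
 have c0: "\<not> ?L" if "card I = 0" using that I by simp
 show ?thesis
 proof (cases "int p dvd k")
 case True
 have e: "[x = k] (mod int p) \<longleftrightarrow> int p dvd x" for x
 proof
 assume "[x = k] (mod int p)"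
 then show "int p dvd x" using True cong_dvd_iff by blast
 next
 assume "int p dvd x"
 then have "int p dvd x - k" using True by (rule dvd_diff)
 then show "[x = k] (mod int p)" by (simp only: cong_iff_dvd_diff)
 qed
 have Leq: "?L \<longleftrightarrow> (\<exists>y. int p dvd (\<Sum>i\<in>I. c i * y i * y i) \<and> (\<exists>i\<in>I. \<not> int p dvd y i))"
 unfolding e ..
 consider "card I = 0" | "card I = 1" | "card I = 2" | "card I \<ge> 3" by linarith
 then show ?thesis
 proof cases
 case 1 then show ?thesis using c0 True by simp
 next
 case 2
 then obtain i where i: "I = {i}" by (rule card_1_singletonE)
 have d: "int p dvd y i" if "int p dvd c i * y i * y i" for y
 using that c[of i] i pp by (simp add: prime_dvd_mult_iff)
 have LF: "?L = False"
 proof -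
 have False if L: "?L"
 proof -
 obtain y j where y: "int p dvd (\<Sum>i\<in>I. c i * y i * y i)" "j \<in> I" "\<not> int p dvd y j"
 using L unfolding Leq by blast
 from y(1) have "int p dvd c i * y i * y i" unfolding i by simp
 then have "int p dvd y i" by (rule d)
 then show False using y(2,3) i by simp
 qed
 then show ?thesis by blast
 qed
 show ?thesis unfolding LF using 2 True by simp
 next
 case 3
 then obtain i j where ij: "I = {i, j}" "i ~= j" unfolding card_2_iff by blast
 have D: "\<not> int p dvd c i * c j - 0 * 0" using c[of i] c[of j] ij pp by (simp add: prime_dvd_mult_iff)
 have E: "?L \<longleftrightarrow> (\<exists>x y. int p dvd c i * x * x + 2 * 0 * x * y + c j * y * y \<and> \<not> (int p dvd x \<and> int p dvd y))"
 proof (rule iffI)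
 assume ?L
 then obtain y l where y: "int p dvd (\<Sum>i\<in>I. c i * y i * y i)" "l \<in> I" "\<not> int p dvd y l" unfolding Leq by blast
 have "(\<Sum>i\<in>I. c i * y i * y i) = c i * y i * y i + 2 * 0 * y i * y j + c j * y j * y j" using ij by simp
 with y(1) have "int p dvd c i * y i * y i + 2 * 0 * y i * y j + c j * y j * y j" by (simp only:)
 moreover have "\<not> (int p dvd y i \<and> int p dvd y j)" using y(2,3) ij by auto
 ultimately show "\<exists>x y. int p dvd c i * x * x + 2 * 0 * x * y + c j * y * y \<and> \<not> (int p dvd x \<and> int p dvd y)"
 by blast
 next
 assume "\<exists>x y. int p dvd c i * x * x + 2 * 0 * x * y + c j * y * y \<and> \<not> (int p dvd x \<and> int p dvd y)"
 then obtain x z where xz: "int p dvd c i * x * x + 2 * 0 * x * z + c j * z * z" "\<not> (int p dvd x \<and> int p dvd z)"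
 by blast
 define w where "w = (\<lambda>l. if l = i then x else z)"
 have "(\<Sum>i\<in>I. c i * w i * w i) = c i * x * x + 2 * 0 * x * z + c j * z * z" using ij by (simp add: w_def)
 with xz(1) have "int p dvd (\<Sum>i\<in>I. c i * w i * w i)" by (simp only:)
 moreover have "\<exists>i\<in>I. \<not> int p dvd w i" using xz(2) ij by (auto simp: w_def)
 ultimately show ?L unfolding Leq by blast
 qed
 show ?thesis unfolding E binary_isotropic_mod[OF p D] using 3 True ij by simp
 next
 case 4
 have LT: "?L = True" unfolding Leq using isotropic_mod[OF p I sym nd 4] unfolding bl_diag[OF I] by blast
 show ?thesis unfolding LT using 4 True by simp
 qed
 next
 case False
 then have Leq: "?L \<longleftrightarrow> (\<exists>y. [(\<Sum>i\<in>I. c i * y i * y i) = k] (mod int p))" using nz[OF _ False] by blast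
 consider "card I = 0" | "card I = 1" | "card I \<ge> 2" by linarith
 then show ?thesis
 proof cases
 case 1 then show ?thesis using c0 False by simp
 next
 case 2
 then obtain i where i: "I = {i}" by (rule card_1_singletonE)
 have "(\<exists>y. [c i * y * y = k] (mod int p)) \<longleftrightarrow> Legendre k (int p) = Legendre (c i) (int p)"
 proof
 assume "\<exists>y. [c i * y * y = k] (mod int p)"
 then obtain y where y: "[c i * y * y = k] (mod int p)" by blast
 have "\<not> int p dvd c i * y * y" using False cong_dvd_iff[OF y] by simp
 then have "\<not> int p dvd y" by auto
 then have "Legendre (c i * (y\<^sup>2)) (int p) = Legendre (c i) (int p)"
 using Legendre_mult[OF p] Legendre_sq[OF p] by simp
 then show "Legendre k (int p) = Legendre (c i) (int p)" using Legendre_cong[OF y] by (simp add: power2_eq_square mult.assoc)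
 next
 assume "Legendre k (int p) = Legendre (c i) (int p)"
 then obtain t where "[c i * t\<^sup>2 = k] (mod int p)" using Legendre_ratio[OF p c[of i], of k] i by auto
 then show "\<exists>y. [c i * y * y = k] (mod int p)" by (metis power2_eq_square mult.assoc)
 qed
 moreover have "(\<exists>y. [(\<Sum>i\<in>I. c i * y i * y i) = k] (mod int p)) \<longleftrightarrow> (\<exists>y. [c i * y * y = k] (mod int p))"
 proof -
 have s: "(\<Sum>i\<in>I. c i * y i * y i) = c i * y i * y i" for y using i by simp
 show ?thesis
 proof (rule iffI)
 assume "\<exists>y. [(\<Sum>i\<in>I. c i * y i * y i) = k] (mod int p)"
 then obtain y where "[(\<Sum>i\<in>I. c i * y i * y i) = k] (mod int p)" by blast
 then have "[c i * y i * y i = k] (mod int p)" unfolding s .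
 then show "\<exists>y. [c i * y * y = k] (mod int p)" by blast
 next
 assume "\<exists>y. [c i * y * y = k] (mod int p)"
 then obtain y where y: "[c i * y * y = k] (mod int p)" by blast
 have h: "[(\<Sum>i\<in>I. c i * y * y) = k] (mod int p)" using y unfolding i by simp
 show "\<exists>y. [(\<Sum>i\<in>I. c i * y i * y i) = k] (mod int p)"
 by (rule exI[of "\<lambda>y. [(\<Sum>i\<in>I. c i * y i * y i) = k] (mod int p)" "\<lambda>_. y"]) (rule h)
 qed
 qed
 ultimately show ?thesis unfolding Leq using 2 False i by simp
 next
 case 3
 then show ?thesis using represents_mod[OF p I sym nd 3, of k] False unfolding Leq bl_diag[OF I] by auto
 qed
 qed
qed

text \<open>A sign f contributes 1 - f, which is 0 or 2, so modulo 4 only the parity of the number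
  of signs -1 counts.\<close>

lemma signs_sum_mod4:
 fixes f :: "'i \<Rightarrow> int"
 assumes "finite I" "\<And>i. i \<in> I ==> f i = 1 \<or> f i = -1"
 shows "[(\<Sum>i\<in>I. 1 - f i) = 1 - (\<Prod>i\<in>I. f i)] (mod 4) \<and> ((\<Prod>i\<in>I. f i) = 1 \<or> (\<Prod>i\<in>I. f i) = -1)"
 using assms
proof (induction I rule: finite_induct)
 case (insert i I)
 let ?P = "\<Prod>i\<in>I. f i"
 have IH: "[(\<Sum>i\<in>I. 1 - f i) = 1 - ?P] (mod 4)" "?P = 1 \<or> ?P = -1" using insert by auto
 have fi: "f i = 1 \<or> f i = -1" using insert by simp
 have "[(1 - f i) + (\<Sum>i\<in>I. 1 - f i) = (1 - f i) + (1 - ?P)] (mod 4)" using IH(1) by (intro cong_add cong_refl)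
 also have "[(1 - f i) + (1 - ?P) = 1 - f i * ?P] (mod 4)" using IH(2) fi by (auto simp: cong_def)
 finally show ?case using insert(1,2) IH(2) fi by auto
qed simp

section \<open>The lattice and its Jordan basis at p\<close>

text \<open>Here \<open>h\<close> is p times the inverse Gram matrix, integral because p kills the
  discriminant group. The assumption \<open>jordan\<close> is the Jordan splitting to precision
  p^2.\<close>

locale genus_lattice =
 fixes r n p lp lm :: nat and eps :: int and g h :: "nat \<Rightarrow> nat \<Rightarrow> int"
 assumes p: "prime p" "odd p" and r: "r = lp + lm" and nr: "n \<le> r"
 and sym: "symon {..<r} g" and ev: "\<And>x. even (bl {..<r} g x x)"
 and gh: "\<And>i j. i < r ==> j < r ==> (\<Sum>k<r. g i k * h k j) = (if i = j then int p else 0)"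
 and hg: "\<And>i j. i < r ==> j < r ==> (\<Sum>k<r. h i k * g k j) = (if i = j then int p else 0)"
 and sig: "\<exists>V. obas {..<r} (\<lambda>i j. real_of_int (g i j)) V (\<lambda>i. if i < lp then 1 else -1)"
 and eps: "eps = 1 \<or> eps = -1"
 and jordan: "\<exists>T B. \<not> int p dvd det (mt r T) \<and>
 (let S = (\<lambda>j k. bl {..<r} g (\<lambda>i. T i j) (\<lambda>i. T i k)) in
 \<not> int p dvd det (mt (r - n) S) \<and>
 (\<forall>j<r. \<forall>k<r. (j < r - n) ~= (k < r - n) --> (int p)\<^sup>2 dvd S j k) \<and>
 (\<forall>j<n. \<forall>k<n. [S (r - n + j) (r - n + k) = int p * B j k] (mod (int p)\<^sup>2)) \<and>
 \<not> int p dvd det (mt n B) \<and> eps = Legendre (det (mt n B)) (int p))"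
begin

abbreviation "b \<equiv> bl {..<r} g"
abbreviation "P \<equiv> int p"

text \<open>The coordinates of the functional y |-> b(y, x); their gcd is the divisor of x.\<close>

definition gr :: "(nat \<Rightarrow> int) \<Rightarrow> nat \<Rightarrow> int" where
 "gr x i = (\<Sum>k<r. g i k * x k)"

lemma primeP: "prime P" using p by simp
lemma P0: "P > 0" using prime_gt_0_nat[OF p(1)] by simp
lemma P2: "\<not> P dvd 2"
 using p by (metis int_dvd_int_iff of_nat_numeral primes_dvd_imp_eq two_is_prime_nat even_numeral)

lemma b_gr: "b x y = (\<Sum>i<r. x i * gr y i)"
 by (simp add: bl_row gr_def)

lemma b_sym: "b x y = b y x"
 using sym by (intro bl_sym) (auto simp: symon_def)

lemma gr_add: "gr (\<lambda>k. x k + y k) i = gr x i + gr y i"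
 by (simp add: gr_def algebra_simps sum.distrib)

lemma gr_scale: "gr (\<lambda>k. c * x k) i = c * gr x i"
 by (simp add: gr_def sum_distrib_left mult_ac)

lemma hgr: "i < r ==> (\<Sum>j<r. h i j * gr x j) = P * x i"
proof -
 assume i: "i < r"
 have "(\<Sum>j<r. h i j * gr x j) = (\<Sum>k<r. (\<Sum>j<r. h i j * g j k) * x k)"
 unfolding gr_def sum_distrib_left sum_distrib_right by (subst sum.swap) (simp add: mult.assoc)
 also have "... = (\<Sum>k<r. (if i = k then P * x k else 0))" using i hg by (intro sum.cong) auto
 finally show ?thesis using i by simp
qed

lemma grh: "i < r ==> gr (\<lambda>k. \<Sum>j<r. h k j * z j) i = P * z i"
proof -
 assume i: "i < r"
 have "gr (\<lambda>k. \<Sum>j<r. h k j * z j) i = (\<Sum>j<r. (\<Sum>k<r. g i k * h k j) * z j)"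
 unfolding gr_def sum_distrib_left sum_distrib_right by (subst sum.swap) (simp add: mult.assoc)
 also have "... = (\<Sum>k<r. (if i = k then P * z k else 0))" using i gh by (intro sum.cong) auto
 finally show ?thesis using i by simp
qed

lemma nd_other: assumes "prime q" "q ~= p" shows "nd (int q) {..<r} g"
proof (rule nd_of_left_inverse[OF hg])
 show "prime (int q)" using assms by simp
 show "\<not> int q dvd int p" using prime_nat_dvd_int[OF assms(1) p(1)] assms(2) by simp
qed

lemma prime_dvd_gr:
 assumes "prime q" "q ~= p" "\<And>i. i < r ==> int q dvd gr x i" "i < r"
 shows "int q dvd x i"
 using nd_other[OF assms(1,2)] assms(3,4) unfolding nd_def gr_def by auto

text \<open>The product of \<open>g\<close> and \<open>h\<close> is p, so the determinant divides a
  power of p; the signature gives its sign. The exponent is identified with n only in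
  \<open>jordan_basis\<close>.\<close>

lemma det_g: "\<exists>m. det (mt r g) = (-1) ^ lm * P ^ m"
proof -
 have "mt r g * mt r h = P \<cdot>\<^sub>m 1\<^sub>m r"
 by (rule eq_matI) (auto simp: scalar_prod_def gh atLeast0LessThan)
 then have "det (mt r g) * det (mt r h) = P ^ r"
 using det_mult[of "mt r g" r "mt r h"] by (simp add: det_smult)
 then have "det (mt r g) dvd P ^ r" by (metis dvd_triv_left)
 then have "int (nat \<bar>det (mt r g)\<bar>) dvd int (p ^ r)" by simp
 then have "nat \<bar>det (mt r g)\<bar> dvd p ^ r" by (simp only: int_dvd_int_iff)
 then obtain m where "nat \<bar>det (mt r g)\<bar> = p ^ m" using divides_primepow_nat[OF p(1)] by blast
 then have "int (nat \<bar>det (mt r g)\<bar>) = int (p ^ m)" by (rule arg_cong)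
 then have A: "\<bar>det (mt r g)\<bar> = P ^ m" by simp
 have B: "sgn (det (mt r g)) = (-1) ^ lm"
 proof -
 obtain V where V: "obas {..<r} (\<lambda>i j. real_of_int (g i j)) V (\<lambda>i. if i < lp then 1 else -1)" using sig by blast
 have m: "mt r (\<lambda>i j. real_of_int (g i j)) = map_mat real_of_int (mt r g)" by (rule eq_matI) auto
 have "(\<Prod>i<r. if i < lp then 1 else -1 :: real) = (\<Prod>i<lp. 1) * (\<Prod>i\<in>{lp..<lp + lm}. -1)"
 proof -
 have e: "{..<r} = {..<lp} \<union> {lp..<lp + lm}" using r by auto
 show ?thesis unfolding e by (subst prod.union_disjoint) (auto intro!: prod.cong)
 qed
 then have "(det (mt r V))\<^sup>2 * real_of_int (det (mt r g)) = (-1) ^ lm"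
 using obas_det[OF V] unfolding m of_int_hom.hom_det by simp
 then have "sgn ((det (mt r V))\<^sup>2 * real_of_int (det (mt r g))) = sgn ((-1) ^ lm)" by simp
 also have "sgn ((-1) ^ lm) = ((-1) ^ lm :: real)" by (cases "even lm") simp_all
 finally have "sgn ((det (mt r V))\<^sup>2 * real_of_int (det (mt r g))) = (-1) ^ lm" .
 moreover have "det (mt r V) ~= 0" using \<open>(det (mt r V))\<^sup>2 * real_of_int (det (mt r g)) = (-1) ^ lm\<close> by auto
 then have "(det (mt r V))\<^sup>2 > 0" by simp
 then have "sgn ((det (mt r V))\<^sup>2) = 1" by (rule sgn_pos)
 ultimately have "sgn (real_of_int (det (mt r g))) = (-1) ^ lm" by (simp add: sgn_mult)
 then have "real_of_int (sgn (det (mt r g))) = real_of_int ((-1) ^ lm)" by (simp add: sgn_if split: if_splits)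
 then show ?thesis by (simp only: of_int_eq_iff)
 qed
 have "det (mt r g) = sgn (det (mt r g)) * \<bar>det (mt r g)\<bar>" by (rule mult_sgn_abs[symmetric])
 also have "... = (-1) ^ lm * P ^ m" unfolding A B ..
 finally show ?thesis by blast
qed

text \<open>Integer vectors, exactly orthogonal, that form a basis over the localization at p and
  exhibit the Jordan splitting. The signs of the two blocks are tied by the determinant: the unit
  part of the product of all norms is (-1)^lm up to squares.\<close>

lemma jordan_basis:
 obtains W d w where "obas {..<r} g W d" "\<not> P dvd det (mt r W)"
 "\<And>a. a < r - n ==> \<not> P dvd d a" "\<And>a. r - n \<le> a ==> a < r ==> d a = P * w a \<and> \<not> P dvd w a"
 "Legendre (\<Prod>a\<in>{r - n..<r}. w a) P = eps"
 "Legendre (\<Prod>a<r - n. d a) P * eps = Legendre (-1) P ^ lm"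
proof -
 define m where "m = r - n"
 have rm: "r = m + n" using nr by (simp add: m_def)
 obtain T B where TB: "\<not> P dvd det (mt r T) \<and>
 (let S = (\<lambda>j k. bl {..<r} g (\<lambda>i. T i j) (\<lambda>i. T i k)) in
 \<not> P dvd det (mt (r - n) S) \<and>
 (\<forall>j<r. \<forall>k<r. (j < r - n) ~= (k < r - n) --> P\<^sup>2 dvd S j k) \<and>
 (\<forall>j<n. \<forall>k<n. [S (r - n + j) (r - n + k) = P * B j k] (mod P\<^sup>2)) \<and>
 \<not> P dvd det (mt n B) \<and> eps = Legendre (det (mt n B)) P)"
 using jordan by blast
 define S where "S = (\<lambda>j k. bl {..<r} g (\<lambda>i. T i j) (\<lambda>i. T i k))"
 have T: "\<not> P dvd det (mt r T)" and S0: "\<not> P dvd det (mt m S)"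
 and mix: "\<And>j k. j < r ==> k < r ==> (j < m) ~= (k < m) ==> P\<^sup>2 dvd S j k"
 and S1: "\<And>j k. j < n ==> k < n ==> [S (m + j) (m + k) = P * B j k] (mod P\<^sup>2)"
 and B: "\<not> P dvd det (mt n B)" "eps = Legendre (det (mt n B)) P"
 using TB unfolding Let_def S_def[symmetric] m_def[symmetric] by blast+
 have symS: "S j k = S k j" for j k unfolding S_def by (rule b_sym)
 let ?I0 = "{..<m}" and ?I1 = "{m..<r}"
 have U: "?I0 \<union> ?I1 = {..<r}" using rm by auto
 have "\<exists>S' t. \<not> P dvd t \<and> symon ?I1 S' \<and> (\<forall>j\<in>?I1. \<forall>k\<in>?I1. [S' j k = t\<^sup>2 * S j k] (mod P\<^sup>2)) \<and>
 (\<forall>V1 d1. obas ?I1 S' V1 d1 -->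
 (\<exists>V d. obas (?I0 \<union> ?I1) S V d \<and> (\<forall>i\<in>?I0. \<not> P dvd d i) \<and> (\<forall>i\<in>?I1. d i = d1 i)))"
 proof (rule jordan_split[OF primeP P2])
 show "symon (?I0 \<union> ?I1) S" using symS by (simp add: symon_def)
 show "nd P ?I0 S" using nd_of_det[OF primeP S0] .
 show "P\<^sup>2 dvd S j k" if "j \<in> ?I0" "k \<in> ?I1" for j k using that rm by (intro mix) auto
 qed auto
 then obtain S' t where S': "\<not> P dvd t" "symon ?I1 S'" "\<forall>j\<in>?I1. \<forall>k\<in>?I1. [S' j k = t\<^sup>2 * S j k] (mod P\<^sup>2)"
 and ext: "\<And>V1 d1. obas ?I1 S' V1 d1 ==>
 (\<exists>V d. obas {..<r} S V d \<and> (\<forall>i\<in>?I0. \<not> P dvd d i) \<and> (\<forall>i\<in>?I1. d i = d1 i))"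
 unfolding U by blast
 \<comment> \<open>The p-modular block divided by p. It agrees with t^2 B modulo p, so its
   determinant is in the square class of det B.\<close>
 define C where "C = (\<lambda>j k. S' (m + j) (m + k) div P)"
 have C: "S' (m + j) (m + k) = P * C j k" "[C j k = t\<^sup>2 * B j k] (mod P)" if jk: "j < n" "k < n" for j k
 proof -
 have "[S' (m + j) (m + k) = t\<^sup>2 * S (m + j) (m + k)] (mod P\<^sup>2)" using S'(3) jk rm by simp
 also have "[t\<^sup>2 * S (m + j) (m + k) = t\<^sup>2 * (P * B j k)] (mod P\<^sup>2)" by (intro cong_mult cong_refl S1 jk)
 finally have *: "P\<^sup>2 dvd S' (m + j) (m + k) - P * (t\<^sup>2 * B j k)" by (simp add: cong_iff_dvd_diff mult_ac)
 then have "P dvd S' (m + j) (m + k) - P * (t\<^sup>2 * B j k)" by (metis dvd_mult_left power2_eq_square)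
 then have "P dvd S' (m + j) (m + k)" by (simp add: dvd_diff_left_iff)
 then show 1: "S' (m + j) (m + k) = P * C j k" by (simp add: C_def)
 have "P * P dvd P * (C j k - t\<^sup>2 * B j k)" using * unfolding 1 by (simp add: power2_eq_square algebra_simps)
 then show "[C j k = t\<^sup>2 * B j k] (mod P)" using P0 by (simp add: cong_iff_dvd_diff)
 qed
 have symC: "symon {..<n} C" using S'(2) rm by (simp add: symon_def C_def)
 have dC: "[det (mt n C) = (t ^ n)\<^sup>2 * det (mt n B)] (mod P)"
 proof -
 have "[det (mt n C) = det (mt n (\<lambda>j k. t\<^sup>2 * B j k))] (mod P)" using C(2) by (intro det_mt_cong) auto
 moreover have "mt n (\<lambda>j k. t\<^sup>2 * B j k) = t\<^sup>2 \<cdot>\<^sub>m mt n B" by (rule eq_matI) auto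
 moreover have "(t\<^sup>2) ^ n = (t ^ n)\<^sup>2" by (simp add: power_mult[symmetric] mult.commute)
 ultimately show ?thesis by (simp add: det_smult)
 qed
 have tn: "\<not> P dvd t ^ n" using S'(1) primeP prime_dvd_power by blast
 have ndC: "\<not> P dvd det (mt n C)"
 proof -
 have "\<not> P dvd (t ^ n)\<^sup>2" using tn primeP prime_dvd_power by blast
 then have "\<not> P dvd (t ^ n)\<^sup>2 * det (mt n B)" using B(1) by (rule prime_not_dvd_mult[OF p(1)])
 then show ?thesis using cong_dvd_iff[OF dC] by blast
 qed
 obtain V1 c where V1: "obas {..<n} C V1 c" "\<forall>i\<in>{..<n}. \<not> P dvd c i"
 using local_orth_basis[OF primeP P2 _ symC nd_of_det[OF primeP ndC]] by blast
 have c_eps: "Legendre (\<Prod>i<n. c i) P = eps"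
 proof -
 have eq: "(det (mt n V1))\<^sup>2 * det (mt n C) = (\<Prod>i<n. c i)" by (rule obas_det[OF V1(1)])
 have "\<not> P dvd (\<Prod>i<n. c i)" using V1(2) primeP prime_dvd_prod_iff[of "{..<n}" P c] by auto
 moreover have "P dvd (\<Prod>i<n. c i)" if "P dvd det (mt n V1)"
 unfolding eq[symmetric] power2_eq_square using that by (intro dvd_mult2)
 ultimately have "\<not> P dvd det (mt n V1)" by blast
 then have "Legendre (\<Prod>i<n. c i) P = Legendre (det (mt n C)) P"
 unfolding eq[symmetric] using Legendre_mult[OF p] Legendre_sq[OF p] by simp
 also have "... = Legendre (det (mt n B)) P"
 unfolding Legendre_cong[OF dC] using Legendre_mult[OF p] Legendre_sq[OF p tn] by simp
 finally show ?thesis using B(2) by simp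
 qed
 define w where "w = (\<lambda>a. c (a - m))"
 have "obas ?I1 S' (\<lambda>k a. V1 (k - m) (a - m)) (\<lambda>a. P * w a)"
 unfolding obas_def
 proof (intro conjI ballI)
 show "P * w a ~= 0" if "a \<in> ?I1" for a
 proof -
 have "\<not> P dvd c (a - m)" using V1(2) that rm by auto
 then show ?thesis using P0 unfolding w_def by (metis dvd_0_right mult_eq_0_iff less_irrefl)
 qed
 fix a a' assume aa: "a \<in> ?I1" "a' \<in> ?I1"
 have re: "sum f ?I1 = (\<Sum>i<n. f (m + i))" for f :: "nat \<Rightarrow> int"
 unfolding rm using sum.shift_bounds_nat_ivl[of f 0 m n] by (simp add: atLeast0LessThan add.commute)
 have "bl ?I1 S' (\<lambda>k. V1 (k - m) (a - m)) (\<lambda>k. V1 (k - m) (a' - m))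
 = (\<Sum>j<n. \<Sum>k<n. V1 j (a - m) * S' (m + j) (m + k) * V1 k (a' - m))" unfolding bl_def re by simp
 also have "... = P * bl {..<n} C (\<lambda>k. V1 k (a - m)) (\<lambda>k. V1 k (a' - m))"
 unfolding bl_def sum_distrib_left by (intro sum.cong refl) (simp add: C(1))
 also have "... = P * (if a - m = a' - m then c (a - m) else 0)"
 using V1(1) aa rm unfolding obas_def by auto
 also have "... = (if a = a' then P * w a else 0)" using aa by (auto simp: w_def)
 finally show "bl ?I1 S' (\<lambda>k. V1 (k - m) (a - m)) (\<lambda>k. V1 (k - m) (a' - m)) = (if a = a' then P * w a else 0)" .
 qed
 then obtain V d where V: "obas {..<r} S V d" "\<forall>i\<in>?I0. \<not> P dvd d i" "\<forall>i\<in>?I1. d i = P * w i" using ext by blast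
 have w_unit: "\<not> P dvd w a" if "a \<in> ?I1" for a using V1(2) that rm by (auto simp: w_def)
 have w_eps: "Legendre (\<Prod>a\<in>?I1. w a) P = eps"
 proof -
 have "(\<Prod>a\<in>?I1. w a) = (\<Prod>i<n. c i)"
 unfolding rm using prod.shift_bounds_nat_ivl[of w 0 m n] by (simp add: atLeast0LessThan add.commute w_def)
 then show ?thesis using c_eps by simp
 qed
 define W where "W = (\<lambda>i a. \<Sum>j<r. V j a * T i j)"
 have W: "obas {..<r} g W d" unfolding W_def by (rule obas_congruence[OF V(1)]) (auto simp: S_def)
 define Y where "Y = (\<Prod>a<m. d a) * (\<Prod>a\<in>?I1. w a)"
 have prod_d: "(\<Prod>i<r. d i) = P ^ n * Y"
 proof -
 have "(\<Prod>i<r. d i) = (\<Prod>a<m. d a) * (\<Prod>a\<in>?I1. d a)" unfolding U[symmetric] by (rule prod.union_disjoint) auto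
 also have "(\<Prod>a\<in>?I1. d a) = (\<Prod>a\<in>?I1. P * w a)" using V(3) by (intro prod.cong) auto
 also have "... = P ^ n * (\<Prod>a\<in>?I1. w a)" using rm by (simp add: prod.distrib)
 finally show ?thesis by (simp add: Y_def mult_ac)
 qed
 have Y: "\<not> P dvd Y"
 proof -
 have "\<not> P dvd (\<Prod>a<m. d a)" using V(2) primeP prime_dvd_prod_iff[of "{..<m}" P d] by auto
 moreover have "\<not> P dvd (\<Prod>a\<in>?I1. w a)" using w_unit primeP prime_dvd_prod_iff[of ?I1 P w] by auto
 ultimately show ?thesis unfolding Y_def using prime_not_dvd_mult[OF p(1)] by blast
 qed
 \<comment> \<open>One factor p is taken out of each of the last n columns. Comparison with the
   product of the norms, p^n Y, then shows that det V is a unit at p.\<close>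
 have "P ^ n dvd det (mt r S)"
 proof -
 have col: "P dvd S j k" if "j < r" "k \<in> ?I1" for j k
 proof (cases "j < m")
 case True
 then have "P\<^sup>2 dvd S j k" using that by (intro mix) auto
 then show ?thesis by (metis dvd_mult_left power2_eq_square)
 next
 case False
 then have jk: "m + (j - m) = j" "j - m < n" "m + (k - m) = k" "k - m < n" using that rm by auto
 have "[S j k = P * B (j - m) (k - m)] (mod P\<^sup>2)" using S1[OF jk(2,4)] unfolding jk(1,3) .
 then have "[S j k = P * B (j - m) (k - m)] (mod P)" by (rule cong_dvd_modulus) (simp add: power2_eq_square)
 then show ?thesis using cong_dvd_iff by fastforce
 qed
 define S2 where "S2 = (\<lambda>j k. if k \<in> ?I1 then S j k div P else S j k)"
 let ?D = "mt r (\<lambda>i j. if i = j then (if i \<in> ?I1 then P else 1) else 0)"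
 have mS: "mt r S = mt r S2 * ?D"
 proof (rule eq_matI)
 fix i j assume "i < dim_row (mt r S2 * ?D)" "j < dim_col (mt r S2 * ?D)"
 then have ij: "i < r" "j < r" by simp_all
 have "(mt r S2 * ?D) $$ (i, j) = (\<Sum>k<r. S2 i k * (if k = j then (if k \<in> ?I1 then P else 1) else 0))"
 using ij by (simp add: scalar_prod_def atLeast0LessThan)
 also have "... = S2 i j * (if j \<in> ?I1 then P else 1)"
 using ij by (subst sum.remove[of _ j]) (auto intro!: sum.neutral)
 also have "... = S i j" using col[OF ij(1), of j] by (auto simp: S2_def)
 finally show "mt r S $$ (i, j) = (mt r S2 * ?D) $$ (i, j)" using ij by simp
 qed auto
 have 1: "det (mt r S2 * ?D) = det (mt r S2) * det ?D" by (rule det_mult[of _ r]) auto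
 have 2: "det ?D = (\<Prod>i<r. if i \<in> ?I1 then P else 1)" by (rule det_diag)
 have 3: "(\<Prod>i<r. if i \<in> ?I1 then P else 1) = (\<Prod>i<m. if i \<in> ?I1 then P else 1) * (\<Prod>i\<in>?I1. if i \<in> ?I1 then P else 1)"
 unfolding U[symmetric] by (rule prod.union_disjoint) auto
 have 4: "(\<Prod>i<m. if i \<in> ?I1 then P else 1) = 1" by (intro prod.neutral) auto
 have 5: "(\<Prod>i\<in>?I1. if i \<in> ?I1 then P else 1) = (\<Prod>i\<in>?I1. P)" by (intro prod.cong) auto
 have 6: "(\<Prod>i\<in>?I1. P) = P ^ n" using rm by simp
 have "det (mt r S) = det (mt r S2) * P ^ n" unfolding mS 1 2 3 4 5 6 by simp
 then show ?thesis by simp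
 qed
 then obtain D where D: "det (mt r S) = P ^ n * D" by blast
 have "P ^ n * ((det (mt r V))\<^sup>2 * D) = P ^ n * Y"
 using obas_det[OF V(1)] unfolding D prod_d by (simp add: mult_ac)
 then have "(det (mt r V))\<^sup>2 * D = Y" using P0 by simp
 moreover have "P dvd (det (mt r V))\<^sup>2 * D" if "P dvd det (mt r V)"
 unfolding power2_eq_square using that by (intro dvd_mult2)
 ultimately have V_unit: "\<not> P dvd det (mt r V)" using Y by auto
 have W_unit: "\<not> P dvd det (mt r W)"
 proof -
 have "mt r W = mt r T * mt r V"
 by (rule eq_matI) (auto simp: W_def scalar_prod_def atLeast0LessThan mult.commute)
 then have "det (mt r W) = det (mt r T) * det (mt r V)" using det_mult[of "mt r T" r "mt r V"] by simp
 then show ?thesis using T V_unit prime_not_dvd_mult[OF p(1)] by simp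
 qed
 have prod_L: "Legendre Y P = Legendre (-1) P ^ lm"
 proof -
 obtain e where e: "det (mt r g) = (-1) ^ lm * P ^ e" using det_g by blast
 define v where "v = (det (mt r W))\<^sup>2 * (-1) ^ lm"
 have "\<not> P dvd (det (mt r W))\<^sup>2" using W_unit primeP prime_dvd_power by blast
 moreover have "\<not> P dvd (-1) ^ lm" using prime_not_dvd_pm1[OF p(1), of "(-1) ^ lm"] by (cases "even lm") auto
 ultimately have v: "\<not> P dvd v" unfolding v_def using prime_not_dvd_mult[OF p(1)] by blast
 \<comment> \<open>Both sides are a power of p times a unit, so the exponents agree and the unit
   parts are equal.\<close>
 have eq: "P ^ e * v = P ^ n * Y"
 using obas_det[OF W] unfolding e prod_d v_def by (simp add: mult_ac)
 have "e = n" using multiplicity_pu[OF p(1) v, of e] multiplicity_pu[OF p(1) Y, of n] eq by simp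
 then have "v = Y" using eq P0 by simp
 moreover have "Legendre ((-1) ^ k) P = Legendre (-1) P ^ k" for k
 proof (induction k)
 case (Suc k)
 have "Legendre ((-1) ^ Suc k) P = Legendre (-1) P * Legendre ((-1) ^ k) P"
 unfolding power_Suc by (rule Legendre_mult[OF p])
 then show ?case using Suc by simp
 qed (use Legendre_1[OF p] in simp)
 moreover have "Legendre v P = Legendre ((det (mt r W))\<^sup>2) P * Legendre ((-1) ^ lm) P"
 unfolding v_def by (rule Legendre_mult[OF p])
 ultimately show ?thesis using Legendre_sq[OF p W_unit] by simp
 qed
 show ?thesis
 proof (rule that[OF W W_unit])
 show "\<not> P dvd d a" if "a < r - n" for a using V(2) that by (simp add: m_def)
 show "d a = P * w a \<and> \<not> P dvd w a" if "r - n \<le> a" "a < r" for a using V(3) w_unit that by (simp add: m_def)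
 show "Legendre (\<Prod>a\<in>{r - n..<r}. w a) P = eps" using w_eps by (simp add: m_def)
 have "Legendre (\<Prod>a<m. d a) P * eps = Legendre (-1) P ^ lm"
 using prod_L unfolding Y_def Legendre_mult[OF p] w_eps .
 then show "Legendre (\<Prod>a<r - n. d a) P * eps = Legendre (-1) P ^ lm" unfolding m_def .
 qed
qed

end

lemma witt_of_diagonalizations:
 assumes "obas {..<r} S V d" "obas {..<r} S V' d'" "symon {..<r} S"
 shows "witt (fr (image_mset d (mset_set {..<r}))) (fr (image_mset d' (mset_set {..<r})))"
proof -
 have "symon {..<r} (\<lambda>i j. rat_of_int (S i j))" using assms(3) by (simp add: symon_def)
 from obas_witt[OF obas_of_int[OF assms(1)] obas_of_int[OF assms(2)] this]
 show ?thesis by (simp add: multiset.map_comp comp_def)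
qed

lemma sum_mset_image: "(\<Sum>x\<in>#image_mset d (mset_set {..<r}). f x) = (\<Sum>a<r. f (d a))"
 by (simp add: sum_unfold_sum_mset multiset.map_comp comp_def)

lemma witt_sums:
 assumes "obas {..<r} S V d" "obas {..<r} S V' d'" "symon {..<r} S"
 shows "prime q ==> [(\<Sum>a<r. par q (d a)) = (\<Sum>a<r. par q (d' a))] (mod 2)"
 and "prime q ==> odd q ==> [(\<Sum>a<r. res q (d a)) = (\<Sum>a<r. res q (d' a))] (mod 4)"
 and "[(\<Sum>a<r. g2 (d a)) = (\<Sum>a<r. g2 (d' a))] (mod 8)"
proof -
 let ?X = "image_mset d (mset_set {..<r})" and ?Y = "image_mset d' (mset_set {..<r})"
 note w = witt_of_diagonalizations[OF assms]
 have nz: "0 \<notin># ?X" "0 \<notin># ?Y" using assms by (auto simp: obas_def)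
 show "[(\<Sum>a<r. par q (d a)) = (\<Sum>a<r. par q (d' a))] (mod 2)" if q: "prime q"
 using witt_par[OF q w] unfolding sum_ext_fr[OF sqc_par[OF q] nz(1)] sum_ext_fr[OF sqc_par[OF q] nz(2)] sum_mset_image .
 show "[(\<Sum>a<r. res q (d a)) = (\<Sum>a<r. res q (d' a))] (mod 4)" if q: "prime q" "odd q"
 using witt_res[OF q w] unfolding sum_ext_fr[OF sqc_res[OF q] nz(1)] sum_ext_fr[OF sqc_res[OF q] nz(2)] sum_mset_image .
 show "[(\<Sum>a<r. g2 (d a)) = (\<Sum>a<r. g2 (d' a))] (mod 8)"
 using witt_g2[OF w] unfolding sum_ext_fr[OF sqc_g2 nz(1)] sum_ext_fr[OF sqc_g2 nz(2)] sum_mset_image .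
qed

lemma clear_denominators:
 fixes v :: "nat \<Rightarrow> rat"
 obtains N z where "N > 0" "\<And>i. i < r ==> of_int N * v i = of_int (z i)"
proof -
 have "\<exists>N z. N > 0 \<and> (\<forall>i<r. of_int N * v i = of_int (z i))"
 proof (induction r)
 case 0 then show ?case by (intro exI[of _ 1]) simp
 next
 case (Suc r)
 then obtain N z where N: "N > 0" "\<forall>i<r. of_int N * v i = of_int (z i)" by blast
 obtain a b where ab: "v r = of_int a / of_int b" "b > 0" by (metis quotient_of_denom_pos quotient_of_div surj_pair)
 have "of_int (N * b) * v i = of_int (((\<lambda>i. b * z i)(r := N * a)) i)" if "i < Suc r" for i
 using that N(2) ab by (cases "i = r") (auto simp: field_simps)
 then show ?case using N(1) ab(2) by (intro exI[of _ "N * b"] exI[of _ "(\<lambda>i. b * z i)(r := N * a)"]) auto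
 qed
 then show ?thesis using that by blast
qed

locale genus_lattice_basis = genus_lattice +
 fixes W :: "nat \<Rightarrow> nat \<Rightarrow> int" and d w :: "nat \<Rightarrow> int"
 assumes W: "obas {..<r} g W d" and W_unit: "\<not> int p dvd det (mt r W)"
 and d_unit: "\<And>a. a < r - n ==> \<not> int p dvd d a"
 and d_w: "\<And>a. r - n \<le> a ==> a < r ==> d a = int p * w a" and w_unit: "\<And>a. r - n \<le> a ==> a < r ==> \<not> int p dvd w a"
 and w_eps: "Legendre (\<Prod>a\<in>{r - n..<r}. w a) (int p) = eps"
 and d_eps: "Legendre (\<Prod>a<r - n. d a) (int p) * eps = Legendre (-1) (int p) ^ lm"
begin

lemma range_split: "{..<r} = {..<r - n} \<union> {r - n..<r}"
 using nr by auto

lemma sum_split: "(\<Sum>a<r. f a) = (\<Sum>a<r - n. f a) + (\<Sum>a\<in>{r - n..<r}. f a :: int)"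
 unfolding range_split by (rule sum.union_disjoint) auto

lemma bW: "a < r ==> a' < r ==> b (\<lambda>k. W k a) (\<lambda>k. W k a') = (if a = a' then d a else 0)"
 using W by (auto simp: obas_def)

lemma nd_odd_diag:
 assumes "prime q" "odd q" "q ~= p"
 obtains V d' where "obas {..<r} g V d'" "\<And>a. a < r ==> \<not> int q dvd d' a"
proof -
 have "\<not> int q dvd 2" using assms by (metis int_dvd_int_iff of_nat_numeral primes_dvd_imp_eq two_is_prime_nat even_numeral)
 then show ?thesis using local_orth_basis[of "int q" "{..<r}" g] sym nd_other[OF assms(1,3)] assms(1) that by auto
qed

lemma dyadic_diag:
 obtains V d' where "even r" "obas {..<r} g V d'" "[(\<Sum>a<r. g2 (d' a)) = 0] (mod 8)" "[(\<Sum>a<r. par 2 (d' a)) = 0] (mod 2)"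
proof -
 have "even (g i i)" if "i \<in> {..<r}" for i
 proof -
 have "b (\<lambda>k. if k = i then 1 else 0) (\<lambda>k. if k = i then 1 else 0) = g i i"
 proof -
 have "(\<Sum>k<r. g j k * (if k = i then 1 else 0)) = g j i" for j
 using that by (subst sum.remove[of _ i]) (auto intro!: sum.neutral)
 then show ?thesis unfolding bl_row using that by (subst sum.remove[of _ i]) (auto intro!: sum.neutral)
 qed
 then show ?thesis using ev by metis
 qed
 moreover have "nd 2 {..<r} g" using nd_other[OF two_is_prime_nat] p(2) by fastforce
 ultimately have "even (card {..<r}) \<and> (\<exists>V d. obas {..<r} g V d \<and> [(\<Sum>i<r. g2 (d i)) = 0] (mod 8) \<and> [(\<Sum>i<r. par 2 (d i)) = 0] (mod 2))"
 using sym by (intro dyadic_orth_basis) auto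
 then show ?thesis using that by auto
qed

lemma even_r: "even r"
 using dyadic_diag by blast

text \<open>Witt invariance permits a different orthogonal basis at each prime: unit norms at odd q
  other than p, even planes at 2, the Jordan basis at p, and a real one for the signature.\<close>

lemma Cl_form: "Cl p (image_mset d (mset_set {..<r})) (int lp - int lm) (int n) (if p mod 4 = 1 then 1 - eps else int n - 1 + eps)"
 unfolding Cl_def sum_mset_image
proof (intro conjI allI impI)
 show "0 \<notin># image_mset d (mset_set {..<r})" using W by (auto simp: obas_def)
 show "(\<Sum>a<r. sgn (d a)) = int lp - int lm"
 proof -
 obtain V where V: "obas {..<r} (\<lambda>i j. real_of_int (g i j)) V (\<lambda>i. if i < lp then 1 else -1)" using sig by blast
 have "bl {..<r} (\<lambda>i j. real_of_int (g i j)) (\<lambda>k. real_of_int (W k a)) (\<lambda>k. real_of_int (W k a'))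
 = real_of_int (b (\<lambda>k. W k a) (\<lambda>k. W k a'))" for a a' by (simp add: bl_def)
 then have o: "obas {..<r} (\<lambda>i j. real_of_int (g i j)) (\<lambda>i j. real_of_int (W i j)) (\<lambda>i. real_of_int (d i))"
 using W unfolding obas_def by simp
 have "symon {..<r} (\<lambda>i j. real_of_int (g i j))" using sym by (simp add: symon_def)
 from witt_isgn[OF obas_witt[OF o V this]]
 have "(\<Sum>a<r. isgn (real_of_int (d a))) = (\<Sum>a<r. isgn (if a < lp then 1 else -1 :: real))"
 by (simp add: sum_unfold_sum_mset multiset.map_comp comp_def)
 moreover have "isgn (real_of_int x) = sgn x" for x by (auto simp: isgn_def sgn_if)
 moreover have "(\<Sum>a<r. isgn (if a < lp then 1 else -1 :: real)) = int lp - int lm"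
 proof -
 have e: "{..<r} = {..<lp} \<union> {lp..<lp + lm}" using r by auto
 have "(\<Sum>a<r. isgn (if a < lp then 1 else -1 :: real)) = (\<Sum>a<lp. 1) + (\<Sum>a\<in>{lp..<lp + lm}. -1)"
 unfolding e by (subst sum.union_disjoint) (auto intro!: sum.cong simp: isgn_def)
 then show ?thesis by simp
 qed
 ultimately show ?thesis by simp
 qed
 have p_par: "(\<Sum>a<r. par p (d a)) = int n"
 proof -
 have "(\<Sum>a<r - n. par p (d a)) = 0" using unit_par[OF p(1)] d_unit by (intro sum.neutral) auto
 moreover have "(\<Sum>a\<in>{r - n..<r}. par p (d a)) = (\<Sum>a\<in>{r - n..<r}. 1)"
 using unif_par[OF p(1)] d_w w_unit by (intro sum.cong) auto
 ultimately show ?thesis unfolding sum_split using nr by simp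
 qed
 then show "[(\<Sum>a<r. par p (d a)) = int n] (mod 2)" by simp
 have "(\<Sum>a<r. res p (d a)) = (\<Sum>a\<in>{r - n..<r}. pm p (w a))"
 proof -
 have "(\<Sum>a<r - n. res p (d a)) = 0" using unit_res[OF p(1)] d_unit by (intro sum.neutral) auto
 moreover have "(\<Sum>a\<in>{r - n..<r}. res p (d a)) = (\<Sum>a\<in>{r - n..<r}. pm p (w a))"
 using unif_res[OF p(1)] d_w w_unit by (intro sum.cong) auto
 ultimately show ?thesis unfolding sum_split by simp
 qed
 moreover have "[(\<Sum>a\<in>{r - n..<r}. pm p (w a)) = (if p mod 4 = 1 then 1 - eps else int n - 1 + eps)] (mod 4)"
 proof -
 let ?L = "\<lambda>a. Legendre (w a) P" and ?I = "{r - n..<r}"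
 have prod: "(\<Prod>a\<in>I. ?L a) = Legendre (\<Prod>a\<in>I. w a) P" if "finite I" for I
 using that by (induction I rule: finite_induct) (simp_all add: Legendre_1[OF p] Legendre_mult[OF p])
 have s: "[(\<Sum>a\<in>?I. 1 - ?L a) = 1 - eps] (mod 4)"
 using signs_sum_mod4[of ?I ?L] Legendre_unit w_unit prod[of ?I] w_eps by auto
 show ?thesis
 proof (cases "p mod 4 = 1")
 case True then show ?thesis using s by (simp add: pm_def)
 next
 case False
 have A: "(\<Sum>a\<in>?I. ?L a) = int n - (\<Sum>a\<in>?I. 1 - ?L a)" using nr by (simp add: sum_subtractf)
 have "[int n - (\<Sum>a\<in>?I. 1 - ?L a) = int n - (1 - eps)] (mod 4)" using s by (intro cong_diff cong_refl)
 then have "[(\<Sum>a\<in>?I. ?L a) = int n - (1 - eps)] (mod 4)" using A by (simp only:)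
 then show ?thesis using False by (simp add: pm_def algebra_simps)
 qed
 qed
 ultimately show "[(\<Sum>a<r. res p (d a)) = (if p mod 4 = 1 then 1 - eps else int n - 1 + eps)] (mod 4)" by simp
 fix q assume q: "prime q" "q ~= p"
 show "[(\<Sum>a<r. par q (d a)) = 0] (mod 2)"
 proof (cases "q = 2")
 case True
 obtain V d' where V: "obas {..<r} g V d'" "[(\<Sum>a<r. par 2 (d' a)) = 0] (mod 2)" by (rule dyadic_diag) blast
 show ?thesis using cong_trans[OF witt_sums(1)[OF W V(1) sym q(1)]] V(2) True by simp
 next
 case False
 then have o: "odd q" using q(1) primes_dvd_imp_eq two_is_prime_nat by blast
 obtain V d' where V: "obas {..<r} g V d'" "\<And>a. a < r ==> \<not> int q dvd d' a" using nd_odd_diag[OF q(1) o q(2)] by blast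
 have "(\<Sum>a<r. par q (d' a)) = 0" using unit_par[OF q(1)] V(2) by (intro sum.neutral) auto
 then show ?thesis using witt_sums(1)[OF W V(1) sym q(1)] by simp
 qed
 assume o: "odd q"
 obtain V d' where V: "obas {..<r} g V d'" "\<And>a. a < r ==> \<not> int q dvd d' a" using nd_odd_diag[OF q(1) o q(2)] by blast
 have "(\<Sum>a<r. res q (d' a)) = 0" using unit_res[OF q(1)] V(2) by (intro sum.neutral) auto
 then show "[(\<Sum>a<r. res q (d a)) = 0] (mod 4)" using witt_sums(2)[OF W V(1) sym q(1) o] by simp
qed

lemma p_form: "p_form p (image_mset d (mset_set {..<r})) (int lp - int lm) n eps"
proof
 show "prime p" "odd p" "eps = 1 \<or> eps = -1" using p eps by auto
 show "Cl p (image_mset d (mset_set {..<r})) (int lp - int lm) (int n) (if p mod 4 = 1 then 1 - eps else int n - 1 + eps)"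
 by (rule Cl_form)
 obtain V d' where V: "obas {..<r} g V d'" "[(\<Sum>a<r. g2 (d' a)) = 0] (mod 8)" by (rule dyadic_diag) blast
 show "[(\<Sum>x\<in>#image_mset d (mset_set {..<r}). g2 x) = 0] (mod 8)"
 unfolding sum_mset_image using cong_trans[OF witt_sums(3)[OF W V(1) sym] V(2)] .
qed

text \<open>Local condition for divisor 1: such a vector is nonzero modulo p on the unimodular
  block, and the p-modular block adds only multiples of p to its norm.\<close>

definition E1 :: "int \<Rightarrow> bool" where
 "E1 k \<longleftrightarrow> (\<exists>y. [(\<Sum>a<r - n. d a * y a * y a) = k] (mod P) \<and> (\<exists>a<r - n. \<not> P dvd y a))"

text \<open>Local condition for divisor p. The modulus is p^2 because the norms on the p-modular
  block are already multiples of p.\<close>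

definition Ep :: "int \<Rightarrow> bool" where
 "Ep k \<longleftrightarrow> (\<exists>y. [(\<Sum>a\<in>{r - n..<r}. d a * y a * y a) = k] (mod P\<^sup>2) \<and> (\<exists>a\<in>{r - n..<r}. \<not> P dvd y a))"

lemma Legendre_neg1_sq: "Legendre (-1) P * Legendre (-1) P = 1"
 using Legendre_neg1[OF p] by simp

lemma Legendre_neg1_pow: "Legendre (-1) P ^ m = (if even m then 1 else Legendre (-1) P)"
 using Legendre_neg1[OF p] by (auto simp: power_minus1_even)

lemma multiplicity_parts:
 assumes "k > 0"
 defines "a \<equiv> multiplicity p k" and "k' \<equiv> k div p ^ multiplicity p k"
 shows "int k = P ^ a * int k'" "\<not> P dvd int k'"
proof -
 have "k = p ^ a * k'" unfolding a_def k'_def by (simp add: multiplicity_dvd)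
 then show "int k = P ^ a * int k'" by (metis of_nat_mult of_nat_power)
 have "\<not> p dvd k'" unfolding k'_def
 using multiplicity_decompose[of k p] assms(1) p(1) by (metis not_prime_unit neq0_conv)
 then show "\<not> P dvd int k'" by simp
qed

lemma E1_iff:
 assumes "k > 0" and G: "rk G = r"
 shows "E1 (int k) \<longleftrightarrow> conditions_1 G lp lm p eps n k"
proof -
 define a k' where "a = multiplicity p k" and "k' = k div p ^ a"
 have k: "int k = P ^ a * int k'" "\<not> P dvd int k'" using multiplicity_parts[OF assms(1)] by (simp_all add: a_def k'_def)
 have pk: "P dvd int k \<longleftrightarrow> a > 0" using k by (cases a) auto
 let ?D = "\<Prod>a<r - n. d a"
 have LD: "Legendre ?D P = Legendre (-1) P ^ lm * eps"
 using d_eps eps Legendre_neg1_pow[of lm] by (auto simp: mult.commute)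
 have E: "E1 (int k) \<longleftrightarrow> (if P dvd int k then r - n \<ge> 3 \<or> r - n = 2 \<and> Legendre (- ?D) P = 1
 else r - n \<ge> 2 \<or> r - n = 1 \<and> Legendre (int k) P = Legendre ?D P)"
 unfolding E1_def using diagonal_solvable_iff[OF p, of "{..<r - n}" d "int k"] d_unit by auto
 have C: "conditions_1 G lp lm p eps n k \<longleftrightarrow>
 a = 0 \<and> int n < int r - 1
 \<or> a = 0 \<and> int n = int r - 1 \<and> Legendre (-1) P ^ lm * Legendre (int k') P = eps
 \<or> a > 0 \<and> int n < int r - 2
 \<or> a > 0 \<and> int n = int r - 2 \<and> [int lp - int lm = 0] (mod 8)"
 unfolding conditions_1_def Let_def a_def[symmetric] k'_def[symmetric] G ..
 show ?thesis
 proof (cases "a = 0")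
 case True
 then have "int k = int k'" using k by simp
 moreover have "Legendre (int k') P = Legendre (-1) P ^ lm * eps \<longleftrightarrow> Legendre (-1) P ^ lm * Legendre (int k') P = eps"
 using Legendre_neg1_pow[of lm] Legendre_neg1[OF p] by (auto split: if_splits)
 ultimately show ?thesis unfolding E C LD using True pk nr by auto
 next
 case False
 define L where "L = Legendre (- ?D) P"
 \<comment> \<open>On a unimodular block of rank 2 isotropy modulo p is a sign condition. The
   determinant transfers it to the p-modular block, whose rank n is even, and there
   \<open>oddity\<close> turns it into a congruence for the signature.\<close>
 have H: "L = 1 \<longleftrightarrow> [int lp - int lm = 0] (mod 8)" if r2: "r - n = 2"
 proof -
 have r2': "r = n + 2" using r2 by simp
 have n2: "even n" using r2' even_r by simp
 note o = p_form.oddity[OF p_form n2]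
 obtain c where c: "n = 2 * c" using n2 by blast
 obtain t where t: "int lp - int lm = 4 * t" using o by blast
 have "2 * int c + 2 = 4 * t + 2 * int lm" using r r2' c t by linarith
 then have "even (c + 1 + lm)" by presburger
 then have X: "Legendre (-1) P ^ c = Legendre (-1) P * Legendre (-1) P ^ lm"
 using Legendre_neg1_sq unfolding Legendre_neg1_pow[of c] Legendre_neg1_pow[of lm] by (cases "even c") auto
 have Y: "Legendre (- ?D) P = Legendre (-1) P * (Legendre (-1) P ^ lm * eps)"
 using Legendre_mult[OF p, of "-1" ?D] LD by simp
 have Z: "Legendre (- ?D) P = eps * Legendre (-1) P ^ c" unfolding Y X by (simp only: mult_ac)
 have "n div 2 = c" using c by simp
 then show ?thesis using o unfolding L_def Z by simp
 qed
 show ?thesis unfolding E[folded L_def] C using False pk nr H by auto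
 qed
qed

lemma Ep_iff:
 assumes "k > 0"
 shows "Ep (int k) \<longleftrightarrow> conditions_p lp lm p eps n k"
proof -
 define a k' where "a = multiplicity p k" and "k' = k div p ^ a"
 have k: "int k = P ^ a * int k'" "\<not> P dvd int k'" using multiplicity_parts[OF assms(1)] by (simp_all add: a_def k'_def)
 let ?I = "{r - n..<r}" and ?D = "\<Prod>a\<in>{r - n..<r}. w a"
 have s: "(\<Sum>a\<in>?I. d a * y a * y a) = P * (\<Sum>a\<in>?I. w a * y a * y a)" for y
 unfolding sum_distrib_left using d_w by (intro sum.cong) auto
 have C: "conditions_p lp lm p eps n k \<longleftrightarrow>
 a = 1 \<and> n > 1
 \<or> a = 1 \<and> n = 1 \<and> Legendre (int k') P = eps
 \<or> a > 1 \<and> n > 2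
 \<or> a > 1 \<and> n = 2 \<and> [int lp - int lm = 0] (mod 8)"
 unfolding conditions_p_def Let_def a_def[symmetric] k'_def[symmetric] ..
 show ?thesis
 proof (cases "a = 0")
 case True
 have "\<not> Ep (int k)"
 proof
 assume "Ep (int k)"
 then obtain y where "[P * (\<Sum>a\<in>?I. w a * y a * y a) = int k] (mod P\<^sup>2)" unfolding Ep_def s by blast
 then have "[P * (\<Sum>a\<in>?I. w a * y a * y a) = int k] (mod P)" by (rule cong_dvd_modulus) (simp add: power2_eq_square)
 then have "P dvd int k" using cong_dvd_iff by fastforce
 then show False using k True by simp
 qed
 then show ?thesis unfolding C using True by simp
 next
 case False
 then obtain a' where a': "a = Suc a'" by (cases a) auto
 \<comment> \<open>The form on the p-modular block is p times a form with unit coefficients, so k is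
   divided by p once; a > 1 means that p still divides the quotient.\<close>
 define k1 where "k1 = P ^ a' * int k'"
 have k1: "int k = P * k1" using k(1) a' by (simp add: k1_def mult.assoc)
 have pk: "P dvd k1 \<longleftrightarrow> a > 1" using k(2) a' unfolding k1_def by (cases a') auto
 have "[P * x = P * k1] (mod P\<^sup>2) \<longleftrightarrow> [x = k1] (mod P)" for x
 proof -
 have "P * P dvd P * x - P * k1 \<longleftrightarrow> P * P dvd P * (x - k1)" by (simp add: right_diff_distrib)
 then show ?thesis using P0 by (simp add: cong_iff_dvd_diff power2_eq_square)
 qed
 then have "Ep (int k) \<longleftrightarrow> (\<exists>y. [(\<Sum>a\<in>?I. w a * y a * y a) = k1] (mod P) \<and> (\<exists>a\<in>?I. \<not> P dvd y a))"
 unfolding Ep_def s k1 by simp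
 then have E: "Ep (int k) \<longleftrightarrow> (if P dvd k1 then n \<ge> 3 \<or> n = 2 \<and> Legendre (- ?D) P = 1
 else n \<ge> 2 \<or> n = 1 \<and> Legendre k1 P = Legendre ?D P)"
 using diagonal_solvable_iff[OF p, of ?I w k1] w_unit nr by auto
 have "Legendre (- ?D) P = 1 \<longleftrightarrow> [int lp - int lm = 0] (mod 8)" if n2: "n = 2"
 proof -
 have "even n" "n div 2 = 1" using n2 by auto
 then show ?thesis using p_form.oddity[OF p_form] Legendre_mult[OF p, of "-1" ?D] w_eps by (simp add: mult.commute)
 qed
 moreover have "k1 = int k'" if "a = 1" using that a' by (simp add: k1_def)
 ultimately show ?thesis unfolding E C using pk False w_eps by auto
 qed
qed

end

section \<open>Necessity and sufficiency of the local conditions\<close>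

context genus_lattice
begin

text \<open>Primitivity and divisor in Bezout form, on coordinates.\<close>

definition rep :: "int \<Rightarrow> int \<Rightarrow> bool" where
 "rep k \<delta> \<longleftrightarrow> (\<exists>x. (\<exists>z. (\<Sum>i<r. z i * x i) = 1) \<and> b x x = k \<and> (\<forall>i<r. \<delta> dvd gr x i) \<and> (\<exists>y. (\<Sum>i<r. y i * gr x i) = \<delta>))"

lemma b_add_left: "b (\<lambda>k. x k + y k) z = b x z + b y z" by (rule bl_add_left)
lemma b_add_right: "b z (\<lambda>k. x k + y k) = b z x + b z y" by (rule bl_add_right)
lemma b_scale_left: "b (\<lambda>k. c * x k) z = c * b x z" by (rule bl_scale_left)
lemma b_scale_right: "b z (\<lambda>k. c * x k) = c * b z x" by (rule bl_scale_right)
lemmas b_lin = b_add_left b_add_right b_scale_left b_scale_right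

lemma dvd_b: "(\<And>i. i < r ==> q dvd gr x i) ==> q dvd b y x"
 unfolding b_gr by (intro dvd_sum) auto

lemma dvd_b': "(\<And>i. i < r ==> q dvd x i) ==> q dvd b x y"
 unfolding b_gr by (intro dvd_sum) auto

lemma dvd_gr: "(\<And>i. i < r ==> q dvd x i) ==> q dvd gr x i"
 unfolding gr_def by (intro dvd_sum) auto

text \<open>A prime that divides x divides all products with x, so divisor 1 already entails
  primitivity.\<close>

lemma rep_1I:
 assumes "b x x = k" "\<And>q. prime q ==> \<exists>i<r. \<not> int q dvd gr x i"
 shows "rep k 1"
proof -
 obtain y where y: "(\<Sum>i<r. y i * gr x i) = 1" using no_prime_divisor_comb[OF assms(2)] by blast
 have "\<exists>i<r. \<not> int q dvd x i" if "prime q" for q using assms(2)[OF that] dvd_gr by blast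
 then obtain z where "(\<Sum>i<r. z i * x i) = 1" using no_prime_divisor_comb by blast
 then show ?thesis using y assms(1) unfolding rep_def by auto
qed

text \<open>The divisor d divides \<open>h\<close> applied to \<open>gr x\<close>, which is p x; by
  primitivity d divides p, and conversely p divides d by assumption.\<close>

lemma rep_pI:
 assumes "b x x = k" "\<And>i. i < r ==> P dvd gr x i" "\<And>q. prime q ==> \<exists>i<r. \<not> int q dvd x i"
 shows "rep k P"
proof -
 obtain z where z: "(\<Sum>i<r. z i * x i) = 1" using no_prime_divisor_comb[OF assms(3)] by blast
 obtain d u where d: "d \<ge> 0" "(\<Sum>i<r. u i * gr x i) = d" "\<And>i. i < r ==> d dvd gr x i"
 by (rule ideal_gen[where w = "gr x" and r = r]) (rule that)
 have "d dvd P * x i" if "i < r" for i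
 unfolding hgr[OF that, symmetric] using d(3) by (intro dvd_sum) auto
 then have "d dvd (\<Sum>i<r. z i * (P * x i))" by (intro dvd_sum) auto
 also have "(\<Sum>i<r. z i * (P * x i)) = P * (\<Sum>i<r. z i * x i)" by (simp add: sum_distrib_left mult_ac)
 finally have 1: "d dvd P" using z by simp
 have 2: "P dvd d" unfolding d(2)[symmetric] using assms(2) by (intro dvd_sum) auto
 have "d = P" using d(1) P0 by (intro zdvd_antisym_nonneg 1 2) auto
 then show ?thesis using d(2) z assms(1,2) unfolding rep_def by auto
qed

end

context genus_lattice_basis
begin

lemma nd_W: "nd P {..<r} (\<lambda>i a. W i a)"
 using nd_of_det[OF primeP W_unit] .

lemma nd_W_transpose: "nd P {..<r} (\<lambda>a i. W i a)"
proof (rule nd_of_det[OF primeP])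
 have "mt r (\<lambda>a i. W i a) = transpose_mat (mt r W)" by (rule eq_matI) auto
 then show "\<not> P dvd det (mt r (\<lambda>a i. W i a))" using W_unit det_transpose[of "mt r W" r] by simp
qed

definition comb :: "(nat \<Rightarrow> int) \<Rightarrow> nat \<Rightarrow> int" where
 "comb y k = (\<Sum>a<r. y a * W k a)"

lemma b_comb: "b (comb x) (comb y) = (\<Sum>a<r. x a * y a * d a)"
 unfolding comb_def using obas_comb[OF W, of x y] by simp

lemma b_comb_basis: "a < r ==> b (\<lambda>k. W k a) (comb y) = y a * d a"
proof -
 assume a: "a < r"
 have "b (\<lambda>k. W k a) (comb y) = (\<Sum>a'<r. y a' * b (\<lambda>k. W k a) (\<lambda>k. W k a'))"
 unfolding comb_def by (rule bl_sum_right)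
 also have "... = (\<Sum>a'<r. if a' = a then y a * d a else 0)" using a bW by (intro sum.cong) auto
 finally show ?thesis using a by simp
qed

text \<open>Over the localization at p the products with the vector are generated by the numbers
  \<open>y a * d a\<close>, and \<open>d a\<close> is a unit exactly on the first block.\<close>

lemma p_dvd_gr_comb_iff:
 "(\<forall>i<r. P dvd gr (comb y) i) \<longleftrightarrow> (\<forall>a<r - n. P dvd y a)"
proof
 assume h: "\<forall>i<r. P dvd gr (comb y) i"
 show "\<forall>a<r - n. P dvd y a"
 proof (intro allI impI)
 fix a assume a: "a < r - n"
 have "P dvd b (\<lambda>k. W k a) (comb y)" using h by (intro dvd_b) auto
 then have "P dvd y a * d a" using b_comb_basis a by simp
 then show "P dvd y a" using d_unit[OF a] primeP prime_dvd_mult_iff by blast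
 qed
next
 assume h: "\<forall>a<r - n. P dvd y a"
 have "P dvd (\<Sum>i<r. W i a * gr (comb y) i)" if a: "a < r" for a
 proof -
 have "P dvd y a * d a" using h d_w[of a] a by (cases "a < r - n") auto
 then show ?thesis using b_comb_basis[OF a] by (simp add: b_gr)
 qed
 then show "\<forall>i<r. P dvd gr (comb y) i" using nd_W_transpose unfolding nd_def by auto
qed

lemma p_dvd_combD:
 assumes "\<And>i. i < r ==> P dvd comb y i" "a < r"
 shows "P dvd y a"
 using nd_W assms unfolding nd_def comb_def by (auto simp: mult.commute)

text \<open>Cramer's rule: the common denominator D = det W is a unit at p and therefore harmless
  modulo powers of p.\<close>

lemma expand:
 obtains D c where "\<not> P dvd D" "\<And>i. i < r ==> D * x i = comb c i" "D * D * b x x = (\<Sum>a<r. c a * c a * d a)"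
 "\<And>i. i < r ==> D * gr x i = gr (comb c) i"
proof -
 obtain A where A: "\<And>i j. i < r ==> j < r ==> (\<Sum>k<r. W i k * A k j) = (if i = j then det (mt r W) else 0)"
 and "\<And>i j. i < r ==> j < r ==> (\<Sum>k<r. A i k * W k j) = (if i = j then det (mt r W) else 0)"
 by (rule ex_adj[where n = r and S = W]) (rule that)
 define D where "D = det (mt r W)"
 define c where "c = (\<lambda>a. \<Sum>j<r. A a j * x j)"
 have e: "D * x i = comb c i" if i: "i < r" for i
 proof -
 have "comb c i = (\<Sum>j<r. (\<Sum>a<r. W i a * A a j) * x j)"
 unfolding comb_def c_def sum_distrib_left sum_distrib_right by (subst sum.swap) (simp add: mult_ac)
 also have "... = (\<Sum>j<r. if i = j then D * x j else 0)" using i A by (intro sum.cong) (auto simp: D_def)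
 finally show ?thesis using i by simp
 qed
 have "b (comb c) (comb c) = b (\<lambda>i. D * x i) (\<lambda>i. D * x i)" using e by (intro bl_cong) auto
 then have "D * D * b x x = (\<Sum>a<r. c a * c a * d a)" unfolding b_comb b_lin by (simp add: mult.assoc)
 moreover have "D * gr x i = gr (comb c) i" for i
 unfolding gr_scale[symmetric] using e unfolding gr_def by (intro sum.cong) auto
 ultimately show ?thesis using that[of D c] e W_unit by (simp add: D_def)
qed

lemma unit_inverse_mod:
 assumes "\<not> P dvd D" obtains E where "[E * D = 1] (mod P\<^sup>2)" "\<not> P dvd E"
proof -
 have "coprime D (P\<^sup>2)" using prime_imp_coprime[OF primeP assms] by (simp add: coprime_commute)
 then obtain E where E: "[D * E = 1] (mod P\<^sup>2)" using cong_solve_coprime_int by blast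
 have "[D * E = 1] (mod P)" using E by (rule cong_dvd_modulus) (simp add: power2_eq_square)
 then have "\<not> P dvd E" using cong_dvd_iff[of "D * E" 1 P] primeP by (auto simp: not_prime_unit)
 then show ?thesis using that E by (simp add: mult.commute)
qed

lemma norm_mod:
 assumes "\<not> P dvd D" "D * D * k = (\<Sum>a<r. c a * c a * d a)"
 obtains E where "\<not> P dvd E" "[(\<Sum>a<r. d a * (E * c a) * (E * c a)) = k] (mod P\<^sup>2)"
proof -
 obtain E where E: "[E * D = 1] (mod P\<^sup>2)" "\<not> P dvd E" using unit_inverse_mod[OF assms(1)] by blast
 have "(\<Sum>a<r. d a * (E * c a) * (E * c a)) = E * E * (\<Sum>a<r. c a * c a * d a)"
 by (simp add: sum_distrib_left mult_ac)
 also have "... = (E * D) * (E * D) * k" unfolding assms(2)[symmetric] by (simp add: mult_ac)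
 finally have "(\<Sum>a<r. d a * (E * c a) * (E * c a)) = (E * D) * (E * D) * k" .
 moreover have "[(E * D) * (E * D) * k = 1 * 1 * k] (mod P\<^sup>2)" using E by (intro cong_mult cong_refl)
 ultimately show ?thesis using that E(2) by simp
qed

text \<open>The p-modular block drops out of the norm modulo p. Were all coordinates on the first
  block divisible by p, p would divide every product with x, against divisor 1.\<close>

lemma rep_1_imp_E1:
 assumes "rep k 1" shows "E1 k"
proof -
 obtain x y where x: "b x x = k" "(\<Sum>i<r. y i * gr x i) = 1" using assms unfolding rep_def by blast
 obtain D c where D0: "\<not> P dvd D" "\<And>i. i < r ==> D * x i = comb c i" "D * D * b x x = (\<Sum>a<r. c a * c a * d a)"
 "\<And>i. i < r ==> D * gr x i = gr (comb c) i"
 by (rule expand[where x = x]) (rule that)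
 note D = D0(1) D0(3)[unfolded x(1)] D0(4)
 obtain E where E: "\<not> P dvd E" "[(\<Sum>a<r. d a * (E * c a) * (E * c a)) = k] (mod P\<^sup>2)" using norm_mod[OF D(1,2)] by blast
 have "[(\<Sum>a<r. d a * (E * c a) * (E * c a)) = k] (mod P)" using E(2) by (rule cong_dvd_modulus) (simp add: power2_eq_square)
 then have X: "[(\<Sum>a<r - n. d a * (E * c a) * (E * c a)) + (\<Sum>a\<in>{r - n..<r}. d a * (E * c a) * (E * c a)) = k] (mod P)"
 unfolding sum_split .
 have "P dvd (\<Sum>a\<in>{r - n..<r}. d a * (E * c a) * (E * c a))" using d_w by (intro dvd_sum) auto
 then have Z: "[(\<Sum>a<r - n. d a * (E * c a) * (E * c a)) + (\<Sum>a\<in>{r - n..<r}. d a * (E * c a) * (E * c a)) =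
 (\<Sum>a<r - n. d a * (E * c a) * (E * c a)) + 0] (mod P)"
 by (intro cong_add cong_refl) (simp only: cong_0_iff)
 have 1: "[(\<Sum>a<r - n. d a * (E * c a) * (E * c a)) = k] (mod P)"
 using cong_trans[OF cong_sym[OF Z] X] by (simp only: add_0_right)
 have "\<exists>a<r - n. \<not> P dvd E * c a"
 proof (rule ccontr)
 assume "\<not> ?thesis"
 then have "\<forall>a<r - n. P dvd c a" using E(1) primeP prime_dvd_mult_iff by blast
 then have "\<forall>i<r. P dvd gr (comb c) i" unfolding p_dvd_gr_comb_iff .
 then have "P dvd D * gr x i" if "i < r" for i using that D(3)[OF that] by simp
 then have "P dvd gr x i" if "i < r" for i using that D(1) primeP prime_dvd_mult_iff by blast
 then have "P dvd (\<Sum>i<r. y i * gr x i)" by (intro dvd_sum) auto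
 then show False using x(2) primeP by (simp add: not_prime_unit)
 qed
 then show ?thesis using 1 unfolding E1_def by (intro exI[of _ "\<lambda>a. E * c a"] conjI)
qed

text \<open>Divisor p makes the coordinates on the first block multiples of p, so that block adds a
  multiple of p^2 to the norm; primitivity then puts a unit coordinate into the other block.\<close>

lemma rep_p_imp_Ep:
 assumes "rep k P" shows "Ep k"
proof -
 obtain x z where x: "b x x = k" "(\<Sum>i<r. z i * x i) = 1" "\<And>i. i < r ==> P dvd gr x i" using assms unfolding rep_def by blast
 obtain D c where D0: "\<not> P dvd D" "\<And>i. i < r ==> D * x i = comb c i" "D * D * b x x = (\<Sum>a<r. c a * c a * d a)"
 "\<And>i. i < r ==> D * gr x i = gr (comb c) i"
 by (rule expand[where x = x]) (rule that)
 note D = D0(1) D0(3)[unfolded x(1)] D0(4) D0(2)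
 obtain E where E: "\<not> P dvd E" "[(\<Sum>a<r. d a * (E * c a) * (E * c a)) = k] (mod P\<^sup>2)" using norm_mod[OF D(1,2)] by blast
 have "P dvd D * gr x i" if "i < r" for i using x(3)[OF that] by simp
 then have "\<forall>i<r. P dvd gr (comb c) i" using D(3) by simp
 then have c0: "\<forall>a<r - n. P dvd c a" unfolding p_dvd_gr_comb_iff .
 have "P\<^sup>2 dvd (\<Sum>a<r - n. d a * (E * c a) * (E * c a))"
 proof (rule dvd_sum)
 fix a assume "a \<in> {..<r - n}"
 then have "P dvd E * c a" using c0 by simp
 then have "P * P dvd (E * c a) * (E * c a)" by (intro mult_dvd_mono)
 then show "P\<^sup>2 dvd d a * (E * c a) * (E * c a)" by (simp add: power2_eq_square mult.assoc)
 qed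
 then have Z: "[(\<Sum>a<r - n. d a * (E * c a) * (E * c a)) + (\<Sum>a\<in>{r - n..<r}. d a * (E * c a) * (E * c a)) =
 0 + (\<Sum>a\<in>{r - n..<r}. d a * (E * c a) * (E * c a))] (mod P\<^sup>2)"
 by (intro cong_add cong_refl) (simp only: cong_0_iff)
 have 1: "[(\<Sum>a\<in>{r - n..<r}. d a * (E * c a) * (E * c a)) = k] (mod P\<^sup>2)"
 using cong_trans[OF cong_sym[OF Z] E(2)[unfolded sum_split]] by (simp only: add_0_left)
 have "\<exists>a\<in>{r - n..<r}. \<not> P dvd E * c a"
 proof (rule ccontr)
 assume "\<not> ?thesis"
 then have A: "\<forall>a\<in>{r - n..<r}. P dvd E * c a" by blast
 have "P dvd c a" if "a < r" for a
 proof (cases "a < r - n")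
 case True then show ?thesis using c0 by blast
 next
 case False
 then have "a \<in> {r - n..<r}" using that by simp
 then have "P dvd E * c a" using A by blast
 then show ?thesis using E(1) primeP prime_dvd_mult_iff by blast
 qed
 then have "P dvd comb c i" for i unfolding comb_def by (intro dvd_sum) auto
 then have "P dvd D * x i" if "i < r" for i using D(4)[OF that] by simp
 then have "P dvd x i" if "i < r" for i using that D(1) primeP prime_dvd_mult_iff by blast
 then have "P dvd (\<Sum>i<r. z i * x i)" by (intro dvd_sum) auto
 then show False using x(2) primeP by (simp add: not_prime_unit)
 qed
 then show ?thesis using 1 unfolding Ep_def by (intro exI[of _ "\<lambda>a. E * c a"] conjI)
qed

lemma E1_vector:
 assumes "E1 k" obtains w0 i where "P dvd k - b w0 w0" "i < r" "\<not> P dvd gr w0 i"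
proof -
 obtain y where y: "[(\<Sum>a<r - n. d a * y a * y a) = k] (mod P)" "\<exists>a<r - n. \<not> P dvd y a" using assms unfolding E1_def by blast
 have "b (comb y) (comb y) = (\<Sum>a<r - n. d a * y a * y a) + (\<Sum>a\<in>{r - n..<r}. y a * y a * d a)"
 unfolding b_comb sum_split by (simp add: mult_ac)
 then have e: "k - b (comb y) (comb y) = (k - (\<Sum>a<r - n. d a * y a * y a)) - (\<Sum>a\<in>{r - n..<r}. y a * y a * d a)" by simp
 have "P dvd (\<Sum>a\<in>{r - n..<r}. y a * y a * d a)" using d_w by (intro dvd_sum) auto
 moreover have "P dvd k - (\<Sum>a<r - n. d a * y a * y a)" using cong_sym[OF y(1)] by (simp only: cong_iff_dvd_diff)
 ultimately have "P dvd k - b (comb y) (comb y)" unfolding e by (rule dvd_diff[rotated])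
 moreover obtain i where "i < r" "\<not> P dvd gr (comb y) i" using p_dvd_gr_comb_iff y(2) by blast
 ultimately show ?thesis using that by blast
qed

lemma Ep_vector:
 assumes "Ep k" obtains w0 where "P * P dvd k - b w0 w0" "\<And>i. i < r ==> P dvd gr w0 i" "\<exists>i<r. \<not> P dvd w0 i"
proof -
 obtain y0 where y0: "[(\<Sum>a\<in>{r - n..<r}. d a * y0 a * y0 a) = k] (mod P\<^sup>2)" "\<exists>a\<in>{r - n..<r}. \<not> P dvd y0 a"
 using assms unfolding Ep_def by blast
 define y where "y = (\<lambda>a. if a < r - n then 0 else y0 a)"
 have "b (comb y) (comb y) = (\<Sum>a\<in>{r - n..<r}. d a * y0 a * y0 a)"
 unfolding b_comb sum_split by (simp add: y_def mult_ac)
 then have "P * P dvd k - b (comb y) (comb y)" using cong_sym[OF y0(1)] by (simp add: cong_iff_dvd_diff power2_eq_square)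
 moreover have "P dvd gr (comb y) i" if "i < r" for i using p_dvd_gr_comb_iff[of y] that by (simp add: y_def)
 moreover have "\<exists>i<r. \<not> P dvd comb y i"
 proof (rule ccontr)
 assume "\<not> ?thesis"
 then have "P dvd y a" if "a < r" for a using p_dvd_combD[of y a] that by blast
 moreover have "y a = y0 a" if "a \<in> {r - n..<r}" for a using that by (simp add: y_def)
 ultimately have "P dvd y0 a" if "a \<in> {r - n..<r}" for a using that by (metis atLeastLessThan_iff)
 then show False using y0(2) by blast
 qed
 ultimately show ?thesis using that by blast
qed

text \<open>Indefiniteness is the bound on the signature that \<open>smaller\<close> asks for. The
  rational zero it leads to is cleared of denominators and divided by the gcd of its
  coordinates.\<close>

lemma isotropic_vector:
 assumes "lp \<ge> 1" "lm \<ge> 1" "lp + lm \<ge> 3"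
 obtains e z where "b e e = 0" "(\<Sum>i<r. z i * e i) = 1"
proof -
 let ?X = "image_mset d (mset_set {..<r})"
 have r4: "r \<ge> 4" using assms r even_r by presburger
 have "even (int lp - int lm)" using even_r r by simp
 have "\<exists>Y. witt (fr ?X) (fr Y) \<and> size Y < size ?X"
 proof (rule p_form.smaller[OF p_form])
 show "even (size ?X)" using even_r by simp
 show "size ?X \<ge> 4" using r4 by simp
 show "\<bar>int lp - int lm\<bar> \<le> int (size ?X) - 2" using assms r by auto
 show "even (int lp - int lm)" by fact
 qed
 then obtain Y where Y: "witt (fr ?X) (fr Y)" "size Y < size ?X" by blast
 let ?xs = "map (\<lambda>a. rat_of_int (d a)) [0..<r]"
 have e: "mset ?xs = fr ?X" by (simp add: multiset.map_comp comp_def atLeast0LessThan)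
 have "witt (mset ?xs) (fr Y)" unfolding e by (rule Y(1))
 moreover have "size (fr Y) < length ?xs" using Y(2) by simp
 ultimately have "\<exists>v. (\<exists>i<length ?xs. v i ~= 0) \<and> (\<Sum>i<length ?xs. ?xs ! i * v i * v i) = 0"
 by (rule witt_smaller_imp_isotropic)
 moreover have len: "length ?xs = r" by simp
 ultimately obtain v where v: "\<exists>i<r. v i ~= 0" "(\<Sum>i<r. ?xs ! i * v i * v i) = 0" unfolding len by blast
 obtain N y where N: "N > 0" "\<And>i. i < r ==> rat_of_int N * v i = of_int (y i)"
 by (rule clear_denominators[where v = v and r = r]) (rule that)
 have "rat_of_int (\<Sum>a<r. y a * y a * d a) = (\<Sum>a<r. (of_int N * v a) * (of_int N * v a) * of_int (d a))"
 using N(2) by simp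
 also have "... = of_int N * of_int N * (\<Sum>i<r. ?xs ! i * v i * v i)" unfolding sum_distrib_left
 by (intro sum.cong) (auto simp: mult_ac)
 finally have "rat_of_int (\<Sum>a<r. y a * y a * d a) = rat_of_int 0" using v(2) by simp
 then have iso: "b (comb y) (comb y) = 0" unfolding b_comb by (simp only: of_int_eq_iff)
 obtain a where a: "a < r" "v a ~= 0" using v(1) by blast
 then have "rat_of_int N * v a ~= 0" using N(1) by simp
 then have "y a ~= 0" using N(2)[OF a(1)] by auto
 moreover have "d a ~= 0" using W a by (auto simp: obas_def)
 ultimately have ne: "b (\<lambda>k. W k a) (comb y) ~= 0" using b_comb_basis[OF a(1)] by simp
 obtain D u where D: "D \<ge> 0" "(\<Sum>i<r. u i * comb y i) = D" "\<And>i. i < r ==> D dvd comb y i"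
 by (rule ideal_gen[where w = "comb y" and r = r]) (rule that)
 have D0: "D ~= 0"
 proof
 assume "D = 0"
 then have "0 dvd b (comb y) (\<lambda>k. W k a)" using D(3) by (intro dvd_b') auto
 then show False using ne by (simp add: b_sym)
 qed
 define e where "e = (\<lambda>i. comb y i div D)"
 have e: "comb y i = D * e i" if "i < r" for i using D(3)[OF that] by (simp add: e_def)
 have "b (comb y) (comb y) = b (\<lambda>i. D * e i) (\<lambda>i. D * e i)" using e by (intro bl_cong) auto
 then have "D * (D * b e e) = 0" using iso unfolding b_lin by simp
 then have "b e e = 0" using D0 by simp
 moreover have "(\<Sum>i<r. u i * comb y i) = D * (\<Sum>i<r. u i * e i)" unfolding sum_distrib_left using e by (intro sum.cong) auto
 then have "(\<Sum>i<r. u i * e i) = 1" using D(2) D0 by simp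
 ultimately show ?thesis using that by blast
qed

lemma prime_dvd_p: "prime q ==> int q dvd P ==> q = p"
 using prime_nat_dvd_int[OF _ p(1)] by simp

lemma coprime_2P: "coprime 2 P"
 using prime_imp_coprime[OF primeP P2] by (simp only: coprime_commute)

lemma half_dvd: "even x ==> P dvd x ==> 2 * P dvd x"
 using coprime_2P by (rule divides_mult[rotated 2])

text \<open>The divisor of e is 1 or p, which gives the two cases. In both, evenness lets f be made
  isotropic by subtracting a multiple of e, so the norm of a combination of e, m f and u is linear
  in m.\<close>

lemma represents_suff:
 assumes "lp \<ge> 1" "lm \<ge> 1" "lp + lm \<ge> 3" and k: "even k"
 shows "E1 k ==> rep k 1" "Ep k ==> rep k P"
proof -
 obtain e z where e: "b e e = 0" and z: "(\<Sum>i<r. z i * e i) = 1" using isotropic_vector[OF assms(1-3)] by blast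
 have "(E1 k --> rep k 1) \<and> (Ep k --> rep k P)"
 proof (cases "\<exists>i<r. \<not> P dvd gr e i")
 case True
 have "\<exists>i<r. \<not> int q dvd gr e i" if q: "prime q" for q
 proof (cases "q = p")
 case False
 show ?thesis
 proof (rule ccontr)
 assume "\<not> ?thesis"
 then have "int q dvd (\<Sum>i<r. z i * e i)" using prime_dvd_gr[OF q False] by (intro dvd_sum) auto
 then show False using z q by (simp add: not_prime_unit)
 qed
 qed (use True in simp)
 from no_prime_divisor_comb[OF this] obtain f0 where f0: "(\<Sum>i<r. f0 i * gr e i) = 1" by blast
 then have f0e: "b f0 e = 1" "b e f0 = 1" using b_gr[of f0 e] b_sym[of e f0] by simp_all
 define t where "t = b f0 f0 div 2"
 have t: "b f0 f0 = 2 * t" using ev[of f0] by (simp add: t_def)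
 define f where "f = (\<lambda>i. f0 i + (- t) * e i)"
 have f: "b e f = 1" "b f e = 1" "b f f = 0" unfolding f_def b_lin using e f0e t by simp_all
 obtain k2 where k2: "k = 2 * k2" using k by blast
 have 1: "rep k 1"
 proof (rule rep_1I)
 let ?x = "\<lambda>i. e i + k2 * f i"
 show "b ?x ?x = k" unfolding b_lin using e f k2 by simp
 fix q :: nat assume q: "prime q"
 show "\<exists>i<r. \<not> int q dvd gr ?x i"
 proof (rule ccontr)
 assume "\<not> ?thesis"
 then have "int q dvd b f ?x" by (intro dvd_b) auto
 then show False unfolding b_lin using f q by (simp add: not_prime_unit)
 qed
 qed
 have "rep k P" if "Ep k"
 proof -
 obtain w0 where w0: "P * P dvd k - b w0 w0" "\<And>i. i < r ==> P dvd gr w0 i" "\<exists>i<r. \<not> P dvd w0 i"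
 using Ep_vector[OF \<open>Ep k\<close>] by blast
 define A B where "A = b w0 f" and "B = b w0 e"
 have AB: "P dvd A" "P dvd B" unfolding A_def B_def b_sym[of w0] using w0(2) by (auto intro: dvd_b)
 \<comment> \<open>The corrections make u orthogonal to e and f. Both A and B are multiples of p, so
   u agrees with w0 modulo p and its norm changes by a multiple of 2 p^2.\<close>
 define u where "u = (\<lambda>i. w0 i + ((- A) * e i + (- B) * f i))"
 have AB': "b w0 f = A" "b w0 e = B" "b f w0 = A" "b e w0 = B"
 unfolding A_def B_def b_sym[of f w0] b_sym[of e w0] by simp_all
 have ue: "b e u = 0" "b u e = 0" "b f u = 0" "b u f = 0"
 unfolding u_def b_lin using e f AB' by simp_all
 have "b u u = b w0 w0 - 2 * (A * B)"
 proof -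
 have "b u v = b w0 v + ((- A) * b e v + (- B) * b f v)" for v
 unfolding u_def by (simp only: b_add_left b_scale_left)
 from this[of u] have "b u u = b w0 u" using ue by simp
 also have "b w0 u = b w0 w0 + ((- A) * b w0 e + (- B) * b w0 f)"
 unfolding u_def by (simp only: b_add_right b_scale_right)
 finally show ?thesis using AB' by (simp add: algebra_simps)
 qed
 then have kb: "k - b u u = (k - b w0 w0) + 2 * (A * B)" by simp
 have AB2: "P * P dvd A * B" using AB by (rule mult_dvd_mono)
 have "P * P dvd k - b u u" unfolding kb by (rule dvd_add[OF w0(1) dvd_mult[OF AB2]])
 moreover have "even (k - b u u)" using k ev[of u] by simp
 moreover have "coprime 2 (P * P)" using coprime_2P by simp
 ultimately have "2 * (P * P) dvd k - b u u" by (metis divides_mult)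
 then obtain m where m: "k - b u u = 2 * (P * P) * m" by blast
 \<comment> \<open>The factors p in front of e and f keep all products divisible by p, and modulo p
   the vector is still w0, hence not divisible by p.\<close>
 let ?x = "\<lambda>i. P * e i + ((m * P) * f i + u i)"
 have bx: "b e ?x = m * P" "b f ?x = P" unfolding b_lin using e f ue by simp_all
 show ?thesis
 proof (rule rep_pI)
 have "b ?x ?x = P * b e ?x + ((m * P) * b f ?x + b u ?x)" by (simp only: b_add_left b_scale_left)
 also have "b u ?x = b u u" unfolding b_lin using ue by simp
 finally show "b ?x ?x = k" using m unfolding bx by (simp add: algebra_simps)
 have "P dvd gr u i" if "i < r" for i
 unfolding u_def gr_add gr_scale using w0(2)[OF that] AB by (intro dvd_add) auto
 then show "P dvd gr ?x i" if "i < r" for i unfolding gr_add gr_scale using that by (intro dvd_add) auto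
 fix q :: nat assume q: "prime q"
 show "\<exists>i<r. \<not> int q dvd ?x i"
 proof (rule ccontr)
 assume "\<not> ?thesis"
 then have dv: "\<And>i. i < r ==> int q dvd ?x i" by blast
 then have "int q dvd b ?x f" by (intro dvd_b') auto
 then have qp: "q = p" using prime_dvd_p[OF q] bx(2) by (simp add: b_sym)
 have "P dvd w0 i" if "i < r" for i
 proof -
 have x: "P dvd P * e i + ((m * P) * f i + u i)" using dv[OF that] qp by simp
 have "P dvd P * (e i + m * f i)" by simp
 from dvd_diff[OF x this] have U: "P dvd u i" by (simp add: algebra_simps)
 have w: "w0 i = u i + (A * e i + B * f i)" by (simp add: u_def)
 show ?thesis unfolding w using U AB by (intro dvd_add dvd_mult2)
 qed
 then show False using w0(3) by blast
 qed
 qed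
 qed
 then show ?thesis using 1 by blast
 next
 case False
 then have pe: "\<And>i. i < r ==> P dvd gr e i" by blast
 \<comment> \<open>As \<open>g\<close> times \<open>h\<close> is p, the products of f0 with lattice
   vectors are p times those given by z. So b(e, f0) = p, and the norm of f0 is divisible by
   2p.\<close>
 define f0 where "f0 = (\<lambda>k. \<Sum>j<r. h k j * z j)"
 have gf0: "gr f0 i = P * z i" if "i < r" for i unfolding f0_def by (rule grh[OF that])
 have "b e f0 = (\<Sum>i<r. P * (z i * e i))" unfolding b_gr using gf0 by (intro sum.cong) auto
 then have f0e: "b e f0 = P" using z by (simp add: sum_distrib_left[symmetric])
 have "P dvd b f0 f0" using gf0 by (intro dvd_b) auto
 then obtain t where t: "b f0 f0 = 2 * P * t" using half_dvd ev by blast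
 define f where "f = (\<lambda>i. f0 i + (- t) * e i)"
 have f0e': "b f0 e = P" using f0e b_sym by simp
 have f: "b e f = P" "b f e = P" "b f f = 0" unfolding f_def b_lin using e f0e f0e' t by (simp_all add: algebra_simps)
 have gf: "P dvd gr f i" if "i < r" for i unfolding f_def gr_add gr_scale using gf0 pe that by (intro dvd_add) auto
 have 1: "rep k 1" if "E1 k"
 proof -
 obtain w0 i0 where w0: "P dvd k - b w0 w0" "i0 < r" "\<not> P dvd gr w0 i0" using E1_vector[OF \<open>E1 k\<close>] by blast
 have "P dvd b w0 f" "P dvd b w0 e" using gf pe by (auto intro: dvd_b)
 then obtain A B where AB: "b w0 f = P * A" "b w0 e = P * B" by blast
 \<comment> \<open>p divides all products with e and with f, so subtracting their multiples leaves
   the functional of w0 unchanged modulo p; this is what keeps the divisor of the final vector prime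
   to p.\<close>
 define u where "u = (\<lambda>i. w0 i + ((- A) * e i + (- B) * f i))"
 have AB': "b f w0 = P * A" "b e w0 = P * B" using AB b_sym by simp_all
 have ue: "b e u = 0" "b u e = 0" "b f u = 0" "b u f = 0"
 unfolding u_def b_lin using e f AB AB' by simp_all
 have "b u u = b w0 w0 - P * (2 * (A * B))"
 proof -
 have "b u v = b w0 v + ((- A) * b e v + (- B) * b f v)" for v
 unfolding u_def by (simp only: b_add_left b_scale_left)
 from this[of u] have "b u u = b w0 u" using ue by simp
 also have "b w0 u = b w0 w0 + ((- A) * b w0 e + (- B) * b w0 f)"
 unfolding u_def by (simp only: b_add_right b_scale_right)
 finally show ?thesis using AB by (simp add: algebra_simps)
 qed
 then have kb: "k - b u u = (k - b w0 w0) + P * (2 * (A * B))" by simp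
 have "P dvd k - b u u" unfolding kb by (rule dvd_add[OF w0(1) dvd_triv_left])
 moreover have "even (k - b u u)" using k ev[of u] by simp
 ultimately obtain m where m: "k - b u u = 2 * P * m" using half_dvd by blast
 let ?x = "\<lambda>i. e i + (m * f i + u i)"
 have bx: "b e ?x = m * P" "b f ?x = P" unfolding b_lin using e f ue by simp_all
 show ?thesis
 proof (rule rep_1I)
 have "b ?x ?x = b e ?x + (m * b f ?x + b u ?x)" by (simp only: b_add_left b_scale_left)
 also have "b u ?x = b u u" unfolding b_lin using ue by simp
 finally show "b ?x ?x = k" using m unfolding bx by (simp add: algebra_simps)
 fix q :: nat assume q: "prime q"
 show "\<exists>i<r. \<not> int q dvd gr ?x i"
 proof (rule ccontr)
 assume "\<not> ?thesis"
 then have dv: "\<And>i. i < r ==> int q dvd gr ?x i" by blast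
 then have "int q dvd b f ?x" by (intro dvd_b) auto
 then have qp: "q = p" using prime_dvd_p[OF q] bx(2) by simp
 have "gr w0 i0 = gr ?x i0 - (gr e i0 + m * gr f i0) + (A * gr e i0 + B * gr f i0)"
 unfolding u_def gr_add gr_scale by simp
 moreover have "P dvd gr ?x i0 - (gr e i0 + m * gr f i0) + (A * gr e i0 + B * gr f i0)"
 using dv[OF w0(2)] pe[OF w0(2)] gf[OF w0(2)] qp by (intro dvd_add dvd_diff) auto
 ultimately show False using w0(3) by simp
 qed
 qed
 qed
 have "rep k P" if "Ep k"
 proof -
 obtain w0 where w0: "P * P dvd k - b w0 w0" "\<And>i. i < r ==> P dvd gr w0 i" using Ep_vector[OF \<open>Ep k\<close>] by blast
 have "P dvd b w0 w0" using w0(2) by (intro dvd_b) auto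
 moreover have "P dvd k - b w0 w0" using w0(1) dvd_mult_left by blast
 ultimately have "P dvd k" by (metis diff_add_cancel dvd_add)
 then obtain m where m: "k = 2 * P * m" using half_dvd[OF k] by blast
 \<comment> \<open>\<open>Ep k\<close> makes k a multiple of 2p, and b(e, f) = p, so the plane of e
   and f alone already represents k.\<close>
 let ?x = "\<lambda>i. e i + m * f i"
 have bx: "b f ?x = P" unfolding b_lin using f by simp
 show ?thesis
 proof (rule rep_pI)
 show "b ?x ?x = k" unfolding b_lin using e f m by (simp add: algebra_simps)
 show "P dvd gr ?x i" if "i < r" for i unfolding gr_add gr_scale using pe gf that by (intro dvd_add) auto
 fix q :: nat assume q: "prime q"
 show "\<exists>i<r. \<not> int q dvd ?x i"
 proof (rule ccontr)
 assume "\<not> ?thesis"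
 then have dv: "\<And>i. i < r ==> int q dvd ?x i" by blast
 then have "int q dvd b ?x f" by (intro dvd_b') auto
 then have qp: "q = p" using prime_dvd_p[OF q] bx by (simp add: b_sym)
 \<comment> \<open>If p divided the vector, its product with f would be divisible by p^2, since p
   also divides all products with f; but that product is p.\<close>
 have "P * P dvd (\<Sum>i<r. ?x i * gr f i)" using dv gf qp by (intro dvd_sum mult_dvd_mono) auto
 then have "P * P dvd P" using bx b_sym[of ?x f] by (simp add: b_gr)
 then have "P dvd 1" using P0 by (metis dvd_mult_cancel_left mult.right_neutral less_irrefl)
 then show False using primeP by (simp add: not_prime_unit)
 qed
 qed
 qed
 then show ?thesis using 1 by blast
 qed
 then show "E1 k ==> rep k 1" "Ep k ==> rep k P" by blast+
qed

end

subsection \<open>From lattices to integer functions\<close>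

definition ent :: "'a mat \<Rightarrow> nat \<Rightarrow> nat \<Rightarrow> 'a" where
 "ent G = (\<lambda>i j. G $$ (i, j))"

lemma mt_ent: "G \<in> carrier_mat r r ==> mt r (ent G) = G"
 by (rule eq_matI) (auto simp: ent_def)

lemma bil_bl:
 assumes "G \<in> carrier_mat r r" "x \<in> carrier_vec r" "y \<in> carrier_vec r"
 shows "bil G x y = bl {..<r} (ent G) (\<lambda>i. x $ i) (\<lambda>i. y $ i)"
 using assms unfolding bil_def bl_row scalar_prod_def ent_def by (auto simp: scalar_prod_def atLeast0LessThan intro!: sum.cong)

lemma bl_vec: "bl {..<r} S (\<lambda>i. vec r x $ i) (\<lambda>i. vec r y $ i) = bl {..<r} S x y"
 by (intro bl_cong) auto

text \<open>Only the exponent p is extracted from the isomorphism. The images of the cosets of v and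
  of (p + 1) v agree, so p v is integral; comparing 1 with p + 1 avoids having to identify the
  neutral coset.\<close>

lemma disc_group_exponent:
 assumes iso: "disc_group G \<cong> product_group {..<n} (\<lambda>_. integer_mod_group p)" and p: "p > 0"
 and G: "G \<in> carrier_mat r r" and v: "v \<in> dual_lattice G"
 shows "rat_of_nat p \<cdot>\<^sub>v v \<in> map_vec rat_of_int ` carrier_vec r"
proof -
 have rk: "rk G = r" using G by (simp add: rk_def)
 let ?L = "map_vec rat_of_int ` carrier_vec r"
 let ?M = "(monoid_vec TYPE(rat) r)\<lparr>carrier := dual_lattice G\<rparr>"
 let ?Q = "disc_group G" and ?P = "product_group {..<n} (\<lambda>_. integer_mod_group p)"
 have Q: "?Q = ?M Mod ?L" by (simp add: disc_group_def rk)
 have vc: "v \<in> carrier_vec r" using v rk by (simp add: dual_lattice_def)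
 define C where "C = (\<lambda>k::nat. {l + rat_of_nat k \<cdot>\<^sub>v v |l. l \<in> ?L})"
 have Lc: "l \<in> carrier_vec r" if "l \<in> ?L" for l using that by auto
 have L_add: "l + l' \<in> ?L" if ll: "l \<in> ?L" "l' \<in> ?L" for l l'
 proof -
 obtain x y where xy: "x \<in> carrier_vec r" "y \<in> carrier_vec r" "l = map_vec rat_of_int x" "l' = map_vec rat_of_int y" using ll by blast
 then have e: "l + l' = map_vec rat_of_int (x + y)" by (intro eq_vecI) auto
 show ?thesis by (rule image_eqI[where f = "map_vec rat_of_int" and x = "x + y", OF e]) (use xy in simp)
 qed
 have L_zero: "0\<^sub>v r \<in> ?L"
 proof -
 have e: "0\<^sub>v r = map_vec rat_of_int (0\<^sub>v r)" by (intro eq_vecI) auto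
 show ?thesis by (rule image_eqI[where f = "map_vec rat_of_int" and x = "0\<^sub>v r", OF e]) simp
 qed
 have dual: "rat_of_nat k \<cdot>\<^sub>v v \<in> dual_lattice G" for k
 proof -
 have "bil (map_mat rat_of_int G) (rat_of_nat k \<cdot>\<^sub>v v) (map_vec rat_of_int x) \<in> \<int>" if x: "x \<in> carrier_vec r" for x
 proof -
 have "bil (map_mat rat_of_int G) v (map_vec rat_of_int x) \<in> \<int>" using v x unfolding dual_lattice_def rk by blast
 moreover have "bil (map_mat rat_of_int G) (rat_of_nat k \<cdot>\<^sub>v v) (map_vec rat_of_int x)
 = rat_of_nat k * bil (map_mat rat_of_int G) v (map_vec rat_of_int x)"
 unfolding bil_def using vc x G by (intro smult_scalar_prod_distrib[of _ r]) auto
 ultimately show ?thesis by simp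
 qed
 then show ?thesis using vc rk by (simp add: dual_lattice_def)
 qed
 have car: "carrier ?Q = (\<lambda>a. (\<lambda>l. l + a) ` ?L) ` dual_lattice G"
 unfolding Q FactGroup_def RCOSETS_def r_coset_def by (simp add: monoid_vec_simps UNION_singleton_eq_range)
 have C_carrier: "C k \<in> carrier ?Q" for k
 proof -
 have "C k = (\<lambda>l. l + rat_of_nat k \<cdot>\<^sub>v v) ` ?L" unfolding C_def by blast
 then show ?thesis unfolding car using dual[of k] by blast
 qed
 have C_mult: "C k \<otimes>\<^bsub>?Q\<^esub> C m = C (k + m)" for k m
 proof -
 have "C k \<otimes>\<^bsub>?Q\<^esub> C m = {c + c' |c c'. c \<in> C k \<and> c' \<in> C m}"
 unfolding Q FactGroup_def set_mult_def by (auto simp: monoid_vec_simps)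
 also have "... = C (k + m)"
 proof (intro subset_antisym subsetI)
 fix x assume "x \<in> {c + c' |c c'. c \<in> C k \<and> c' \<in> C m}"
 then obtain l l' where l: "l \<in> ?L" "l' \<in> ?L" "x = (l + rat_of_nat k \<cdot>\<^sub>v v) + (l' + rat_of_nat m \<cdot>\<^sub>v v)" unfolding C_def by blast
 have "x = (l + l') + rat_of_nat (k + m) \<cdot>\<^sub>v v"
 unfolding l(3) using Lc[OF l(1)] Lc[OF l(2)] vc by (intro eq_vecI) (auto simp: algebra_simps)
 then show "x \<in> C (k + m)" unfolding C_def using L_add[OF l(1,2)] by blast
 next
 fix x assume "x \<in> C (k + m)"
 then obtain l where l: "l \<in> ?L" "x = l + rat_of_nat (k + m) \<cdot>\<^sub>v v" unfolding C_def by blast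
 have "x = (l + rat_of_nat k \<cdot>\<^sub>v v) + (0\<^sub>v r + rat_of_nat m \<cdot>\<^sub>v v)"
 unfolding l(2) using Lc[OF l(1)] vc by (intro eq_vecI) (auto simp: algebra_simps)
 then show "x \<in> {c + c' |c c'. c \<in> C k \<and> c' \<in> C m}" unfolding C_def using l(1) L_zero by blast
 qed
 finally show ?thesis .
 qed
 obtain \<phi> where \<phi>: "\<phi> \<in> hom ?Q ?P" "bij_betw \<phi> (carrier ?Q) (carrier ?P)" using iso unfolding is_iso_def iso_def by blast
 have \<phi>_mult: "\<phi> (C (k + m)) = \<phi> (C k) \<otimes>\<^bsub>?P\<^esub> \<phi> (C m)" for k m
 using hom_mult[OF \<phi>(1) C_carrier C_carrier, of k m] C_mult by simp
 have \<phi>_carrier: "\<phi> (C k) \<in> (\<Pi>\<^sub>E i\<in>{..<n}. {0..<int p})" for k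
 using hom_in_carrier[OF \<phi>(1) C_carrier, of k] p by (simp add: carrier_integer_mod_group)
 have pow: "\<phi> (C (Suc k)) i = (int (Suc k) * \<phi> (C 1) i) mod int p" if i: "i < n" for k i
 proof (induction k)
 case 0
 have "0 \<le> \<phi> (C 1) i" "\<phi> (C 1) i < int p" using \<phi>_carrier[of 1] i by (auto simp: PiE_iff)
 then show ?case by simp
 next
 case (Suc k)
 have "\<phi> (C (Suc (Suc k))) i = (\<phi> (C (Suc k)) i + \<phi> (C 1) i) mod int p"
 using \<phi>_mult[of "Suc k" 1] i by (simp add: product_group_def)
 also have "... = ((int (Suc k) * \<phi> (C 1) i) mod int p + \<phi> (C 1) i) mod int p" unfolding Suc ..
 also have "... = (int (Suc k) * \<phi> (C 1) i + \<phi> (C 1) i) mod int p" by (simp only: mod_add_left_eq)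
 also have "int (Suc k) * \<phi> (C 1) i + \<phi> (C 1) i = int (Suc (Suc k)) * \<phi> (C 1) i" by (simp add: algebra_simps)
 finally show ?case .
 qed
 have "\<phi> (C (Suc p)) = \<phi> (C 1)"
 proof (rule PiE_ext[OF \<phi>_carrier \<phi>_carrier])
 fix i assume i: "i \<in> {..<n}"
 then have b: "0 \<le> \<phi> (C 1) i" "\<phi> (C 1) i < int p" using \<phi>_carrier[of 1] by (auto simp: PiE_iff)
 have "\<phi> (C (Suc p)) i = (int p * \<phi> (C 1) i + \<phi> (C 1) i) mod int p" using pow[of i p] i by (simp add: algebra_simps)
 then show "\<phi> (C (Suc p)) i = \<phi> (C 1) i" using b by simp
 qed
 then have "C (Suc p) = C 1" using \<phi>(2) C_carrier unfolding bij_betw_def by (meson inj_onD)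
 moreover have "0\<^sub>v r + rat_of_nat (Suc p) \<cdot>\<^sub>v v \<in> C (Suc p)" unfolding C_def using L_zero by blast
 ultimately obtain l where l: "l \<in> ?L" "0\<^sub>v r + rat_of_nat (Suc p) \<cdot>\<^sub>v v = l + rat_of_nat 1 \<cdot>\<^sub>v v" unfolding C_def by blast
 have "rat_of_nat p \<cdot>\<^sub>v v = l"
 proof (rule eq_vecI)
 show "dim_vec (rat_of_nat p \<cdot>\<^sub>v v) = dim_vec l" using Lc[OF l(1)] vc by simp
 fix i assume "i < dim_vec l"
 then have i: "i < r" using Lc[OF l(1)] by simp
 have "(0\<^sub>v r + rat_of_nat (Suc p) \<cdot>\<^sub>v v) $ i = (l + rat_of_nat 1 \<cdot>\<^sub>v v) $ i" using l(2) by simp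
 then show "(rat_of_nat p \<cdot>\<^sub>v v) $ i = l $ i" using i vc Lc[OF l(1)] by (simp add: algebra_simps)
 qed
 then show ?thesis using l(1) by simp
qed

text \<open>The columns of the inverse Gram matrix form the dual basis, and p times a dual vector is
  integral.\<close>

lemma p_inverse:
 assumes G: "G \<in> carrier_mat r r" "transpose_mat G = G" and D: "det G ~= 0"
 and ex: "\<And>v. v \<in> dual_lattice G ==> rat_of_nat p \<cdot>\<^sub>v v \<in> map_vec rat_of_int ` carrier_vec r"
 obtains h where "\<And>i j. i < r ==> j < r ==> (\<Sum>k<r. ent G i k * h k j) = (if i = j then int p else 0)"
 "\<And>i j. i < r ==> j < r ==> (\<Sum>k<r. h i k * ent G k j) = (if i = j then int p else 0)"
proof -
 let ?g = "ent G"
 have rk: "rk G = r" using G by (simp add: rk_def)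
 define D' where "D' = det (mt r ?g)"
 have D0: "rat_of_int D' ~= 0" using D mt_ent[OF G(1)] by (simp add: D'_def)
 have sym: "?g i j = ?g j i" if "i < r" "j < r" for i j
 using G that unfolding ent_def by (metis carrier_matD index_transpose_mat(1))
 obtain A where A0: "\<And>i j. i < r ==> j < r ==> (\<Sum>k<r. ?g i k * A k j) = (if i = j then det (mt r ?g) else 0)"
 "\<And>i j. i < r ==> j < r ==> (\<Sum>k<r. A i k * ?g k j) = (if i = j then det (mt r ?g) else 0)"
 by (rule ex_adj[where n = r and S = ?g]) (rule that)
 note A = A0[folded D'_def]
 have "\<exists>y. \<forall>k<r. rat_of_nat p * (rat_of_int (A k j) / rat_of_int D') = rat_of_int (y k)" if j: "j < r" for j
 proof -
 define v where "v = vec r (\<lambda>k. rat_of_int (A k j) / rat_of_int D')"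
 have "v \<in> dual_lattice G"
 unfolding dual_lattice_def rk
 proof (intro CollectI conjI ballI)
 show "v \<in> carrier_vec r" by (simp add: v_def)
 fix x :: "int vec" assume x: "x \<in> carrier_vec r"
 have "bil (map_mat rat_of_int G) v (map_vec rat_of_int x) = bl {..<r} (ent (map_mat rat_of_int G)) (\<lambda>k. v $ k) (\<lambda>k. map_vec rat_of_int x $ k)"
 using G x by (intro bil_bl) (auto simp: v_def)
 also have "... = bl {..<r} (\<lambda>i j. rat_of_int (?g i j)) (\<lambda>k. rat_of_int (A k j) / rat_of_int D') (\<lambda>k. rat_of_int (x $ k))"
 using G x by (intro bl_cong) (auto simp: v_def ent_def)
 also have "... = bl {..<r} (\<lambda>i j. rat_of_int (?g i j)) (\<lambda>k. rat_of_int (x $ k)) (\<lambda>k. rat_of_int (A k j) / rat_of_int D')"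
 using sym by (intro bl_sym) auto
 also have "... = (\<Sum>i<r. rat_of_int (x $ i) * (\<Sum>k<r. rat_of_int (?g i k) * (rat_of_int (A k j) / rat_of_int D')))"
 by (rule bl_row)
 also have "... = (\<Sum>i<r. if i = j then rat_of_int (x $ i) else 0)"
 proof (rule sum.cong[OF refl])
 fix i assume i: "i \<in> {..<r}"
 have "(\<Sum>k<r. rat_of_int (?g i k) * (rat_of_int (A k j) / rat_of_int D')) = rat_of_int (\<Sum>k<r. ?g i k * A k j) / rat_of_int D'"
 by (simp add: sum_divide_distrib)
 moreover have "(\<Sum>k<r. ?g i k * A k j) = (if i = j then D' else 0)" using A(1) i j by simp
 ultimately have "(\<Sum>k<r. rat_of_int (?g i k) * (rat_of_int (A k j) / rat_of_int D')) = (if i = j then 1 else 0)"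
 using D0 by (simp only: split: if_splits) auto
 then show "rat_of_int (x $ i) * (\<Sum>k<r. rat_of_int (?g i k) * (rat_of_int (A k j) / rat_of_int D')) = (if i = j then rat_of_int (x $ i) else 0)"
 by (simp only:) simp
 qed
 also have "... = rat_of_int (x $ j)" using j by simp
 finally show "bil (map_mat rat_of_int G) v (map_vec rat_of_int x) \<in> \<int>" by simp
 qed
 then obtain y where y: "y \<in> carrier_vec r" "rat_of_nat p \<cdot>\<^sub>v v = map_vec rat_of_int y" using ex by blast
 have "rat_of_nat p * (rat_of_int (A k j) / rat_of_int D') = rat_of_int (y $ k)" if "k < r" for k
 using arg_cong[OF y(2), of "\<lambda>u. u $ k"] that y(1) by (simp add: v_def)
 then show ?thesis by blast
 qed
 then obtain H where H: "\<And>j k. j < r ==> k < r ==> rat_of_nat p * (rat_of_int (A k j) / rat_of_int D') = rat_of_int (H j k)" by metis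
 have Ap: "int p * A k j = D' * H j k" if "j < r" "k < r" for j k
 proof -
 have "rat_of_int (int p * A k j) = rat_of_int (D' * H j k)" using H[OF that] D0 by (simp add: field_simps)
 then show ?thesis by (simp only: of_int_eq_iff)
 qed
 have D1: "D' ~= 0" using D0 by simp
 show ?thesis
 proof (rule that[of "\<lambda>k j. H j k"])
 fix i j assume ij: "i < r" "j < r"
 have "D' * (\<Sum>k<r. ?g i k * H j k) = (\<Sum>k<r. ?g i k * (int p * A k j))"
 unfolding sum_distrib_left using Ap ij by (intro sum.cong) auto
 also have "... = int p * (\<Sum>k<r. ?g i k * A k j)" by (simp add: sum_distrib_left mult_ac)
 finally show "(\<Sum>k<r. ?g i k * H j k) = (if i = j then int p else 0)" using A(1)[OF ij] D1 by (simp split: if_splits)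
 have "D' * (\<Sum>k<r. H k i * ?g k j) = (\<Sum>k<r. (int p * A i k) * ?g k j)"
 unfolding sum_distrib_left using Ap ij by (intro sum.cong) auto
 also have "... = int p * (\<Sum>k<r. A i k * ?g k j)" by (simp add: sum_distrib_left mult_ac)
 finally show "(\<Sum>k<r. H k i * ?g k j) = (if i = j then int p else 0)" using A(2)[OF ij] D1 by (simp split: if_splits)
 qed
qed

lemma signature_obas:
 assumes "has_signature G lp lm"
 shows "\<exists>V. obas {..<lp + lm} (\<lambda>i j. real_of_int (ent G i j)) V (\<lambda>i. if i < lp then 1 else -1)"
proof -
 let ?r = "lp + lm"
 obtain T where G: "G \<in> carrier_mat ?r ?r" and T: "T \<in> carrier_mat ?r ?r"
 "transpose_mat T * map_mat real_of_int G * T = mat ?r ?r (\<lambda>(i, j). if i ~= j then 0 else if i < lp then 1 else -1)"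
 using assms unfolding has_signature_def by blast
 have m: "mt ?r (\<lambda>i j. real_of_int (ent G i j)) = map_mat real_of_int G" using G by (intro eq_matI) (auto simp: ent_def)
 have "bl {..<?r} (\<lambda>i j. real_of_int (ent G i j)) (\<lambda>k. ent T k a) (\<lambda>k. ent T k c) = (if a = c then if a < lp then 1 else -1 else 0)"
 if "a < ?r" "c < ?r" for a c
 using mt_congruence[OF that, of "ent T" "\<lambda>i j. real_of_int (ent G i j)"] that unfolding m mt_ent[OF T(1)] T(2) by auto
 then have "obas {..<?r} (\<lambda>i j. real_of_int (ent G i j)) (ent T) (\<lambda>i. if i < lp then 1 else -1)"
 unfolding obas_def by auto
 then show ?thesis by blast
qed

lemma genus_lattice_ex:
 assumes p: "prime p" "odd p" and gen: "in_genus_II G lp lm p eps n"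
 shows "G \<in> carrier_mat (lp + lm) (lp + lm)" and "\<exists>h. genus_lattice (lp + lm) n p lp lm eps (ent G) h"
proof -
 let ?r = "lp + lm"
 have el: "even_lattice G" and sg: "has_signature G lp lm" and iso: "disc_group G \<cong> product_group {..<n} (\<lambda>_. integer_mod_group p)"
 and eps: "eps \<in> {1, -1}" and js: "jordan_sign G p n eps" using gen unfolding in_genus_II_def by auto
 show G: "G \<in> carrier_mat ?r ?r" using sg by (simp add: has_signature_def)
 have rk: "rk G = ?r" using G by (simp add: rk_def)
 have tr: "transpose_mat G = G" using el by (simp add: even_lattice_def)
 have p0: "p > 0" using p(1) prime_gt_0_nat by blast
 obtain V where V: "obas {..<?r} (\<lambda>i j. real_of_int (ent G i j)) V (\<lambda>i. if i < lp then 1 else -1)" using signature_obas[OF sg] by blast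
 have m: "mt ?r (\<lambda>i j. real_of_int (ent G i j)) = map_mat real_of_int G" using G by (intro eq_matI) (auto simp: ent_def)
 have "(det (mt ?r V))\<^sup>2 * real_of_int (det G) = (\<Prod>i<?r. if i < lp then 1 else -1)"
 using obas_det[OF V] unfolding m of_int_hom.hom_det .
 moreover have "(\<Prod>i<?r. if i < lp then 1 else -1 :: real) ~= 0" by simp
 ultimately have D: "det G ~= 0" by auto
 obtain h where h: "\<And>i j. i < ?r ==> j < ?r ==> (\<Sum>k<?r. ent G i k * h k j) = (if i = j then int p else 0)"
 "\<And>i j. i < ?r ==> j < ?r ==> (\<Sum>k<?r. h i k * ent G k j) = (if i = j then int p else 0)"
 using p_inverse[OF G tr D disc_group_exponent[OF iso p0 G]] by blast
 note jt = jordan_truncate[OF p(1) G js, folded ent_def]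
 have "genus_lattice ?r n p lp lm eps (ent G) h"
 proof
 show "symon {..<?r} (ent G)" unfolding symon_def
 proof (intro ballI)
 fix i j assume "i \<in> {..<?r}" "j \<in> {..<?r}"
 then show "ent G i j = ent G j i" using G tr unfolding ent_def by (metis carrier_matD index_transpose_mat(1) lessThan_iff)
 qed
 show "even (bl {..<?r} (ent G) x x)" for x
 proof -
 have "even (bil G (vec ?r x) (vec ?r x))" using el by (simp add: even_lattice_def rk)
 then show ?thesis using bil_bl[OF G, of "vec ?r x" "vec ?r x"] by (simp add: bl_vec)
 qed
 show "n \<le> ?r" using jt by blast
 show "\<exists>T B. \<not> int p dvd det (mt ?r T) \<and>
 (let S = (\<lambda>j k. bl {..<?r} (ent G) (\<lambda>i. T i j) (\<lambda>i. T i k)) in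
 \<not> int p dvd det (mt (?r - n) S) \<and>
 (\<forall>j<?r. \<forall>k<?r. (j < ?r - n) ~= (k < ?r - n) --> (int p)\<^sup>2 dvd S j k) \<and>
 (\<forall>j<n. \<forall>k<n. [S (?r - n + j) (?r - n + k) = int p * B j k] (mod (int p)\<^sup>2)) \<and>
 \<not> int p dvd det (mt n B) \<and> eps = Legendre (det (mt n B)) (int p))"
 using jt by blast
 show "eps = 1 \<or> eps = -1" using eps by auto
 qed (use p h signature_obas[OF sg] in auto)
 then show "\<exists>h. genus_lattice ?r n p lp lm eps (ent G) h" by blast
qed

text \<open>Dividing by the gcd d of the coordinates gives y with d y = x, so primitivity forces d =
  1. Conversely a Bezout relation for x recovers the multiplier from any vector with a multiple on
  the line of x.\<close>

lemma primitive_vec_iff: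
 assumes G: "rk G = r" and x: "x \<in> carrier_vec r" and x0: "x ~= 0\<^sub>v r"
 shows "primitive_vec G x \<longleftrightarrow> (\<exists>z. (\<Sum>i<r. z i * x $ i) = 1)"
proof
 assume pr: "primitive_vec G x"
 obtain d u where d: "d \<ge> 0" "(\<Sum>i<r. u i * x $ i) = d" "\<And>i. i < r ==> d dvd x $ i"
 by (rule ideal_gen[where w = "\<lambda>i. x $ i" and r = r]) (rule that)
 obtain i where i: "i < r" "x $ i ~= 0" using x x0 by (metis carrier_vecD eq_vecI index_zero_vec)
 then have d0: "d ~= 0" using d(3) by auto
 define y where "y = vec r (\<lambda>i. x $ i div d)"
 have "d \<cdot>\<^sub>v y = 1 \<cdot>\<^sub>v x" using x d(3) by (intro eq_vecI) (auto simp: y_def)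
 then have "d \<cdot>\<^sub>v y \<in> range (\<lambda>c. c \<cdot>\<^sub>v x)" by (rule range_eqI)
 moreover have "y \<in> carrier_vec r" by (simp add: y_def)
 ultimately obtain c where c: "y = c \<cdot>\<^sub>v x" using pr d0 unfolding primitive_vec_def G by blast
 have "y $ i = c * x $ i" using arg_cong[OF c, of "\<lambda>v. v $ i"] i x by simp
 then have "x $ i div d = c * x $ i" using i by (simp add: y_def)
 moreover have "d * (x $ i div d) = x $ i" using d(3)[OF i(1)] by simp
 ultimately have "d * (c * x $ i) = x $ i" by simp
 then have "x $ i * (d * c - 1) = 0" by (simp add: algebra_simps)
 then have "d * c = 1" using i(2) by simp
 moreover have "d > 0" using d(1) d0 by simp
 ultimately have "d = 1" using pos_zmult_eq_1_iff by blast
 then show "\<exists>z. (\<Sum>i<r. z i * x $ i) = 1" using d(2) by blast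
next
 assume "\<exists>z. (\<Sum>i<r. z i * x $ i) = 1"
 then obtain z where z: "(\<Sum>i<r. z i * x $ i) = 1" by blast
 show "primitive_vec G x" unfolding primitive_vec_def G
 proof (intro conjI ballI allI impI)
 show "x \<in> carrier_vec r" by (rule x)
 fix y m assume y: "y \<in> carrier_vec r" and m: "m ~= 0 \<and> m \<cdot>\<^sub>v y \<in> range (\<lambda>c. c \<cdot>\<^sub>v x)"
 then obtain c where c: "m \<cdot>\<^sub>v y = c \<cdot>\<^sub>v x" by blast
 have e: "m * y $ i = c * x $ i" if "i < r" for i
 using arg_cong[OF c, of "\<lambda>v. v $ i"] that x y by simp
 define s where "s = (\<Sum>i<r. z i * y $ i)"
 have "m * s = (\<Sum>i<r. z i * (m * y $ i))" by (simp add: s_def sum_distrib_left mult_ac)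
 also have "... = (\<Sum>i<r. z i * (c * x $ i))" using e by (intro sum.cong) auto
 also have "... = c * (\<Sum>i<r. z i * x $ i)" by (simp add: sum_distrib_left mult_ac)
 finally have cs: "c = m * s" using z by simp
 have "y $ i = s * x $ i" if "i < r" for i using e[OF that] m unfolding cs by simp
 then have "y = s \<cdot>\<^sub>v x" using x y by (intro eq_vecI) auto
 then show "y \<in> range (\<lambda>c. c \<cdot>\<^sub>v x)" by blast
 qed
qed

text \<open>A nonzero norm makes the ideal b(x, L) nonzero, so the definite description in
  \<open>lat_div\<close> has exactly one solution, the gcd of the coordinates of the
  functional.\<close>

lemma lat_div_eq:
 assumes G: "G \<in> carrier_mat r r" and sym: "symon {..<r} (ent G)" and x: "x \<in> carrier_vec r" and nz: "bil G x x ~= 0"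
 shows "(\<exists>y. (\<Sum>i<r. y i * (\<Sum>k<r. ent G i k * x $ k)) = lat_div G x) \<and> (\<forall>i<r. lat_div G x dvd (\<Sum>k<r. ent G i k * x $ k)) \<and> lat_div G x \<ge> 0"
proof -
 let ?w = "\<lambda>i. \<Sum>k<r. ent G i k * x $ k"
 have rk: "rk G = r" using G by (simp add: rk_def)
 obtain d u where d: "d \<ge> 0" "(\<Sum>i<r. u i * ?w i) = d" "\<And>i. i < r ==> d dvd ?w i"
 by (rule ideal_gen[where w = ?w and r = r]) (rule that)
 have b: "bil G x y = (\<Sum>i<r. y $ i * ?w i)" if "y \<in> carrier_vec r" for y
 proof -
 have "bil G x y = bl {..<r} (ent G) (\<lambda>i. y $ i) (\<lambda>i. x $ i)"
 unfolding bil_bl[OF G x that] using sym by (intro bl_sym) (auto simp: symon_def)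
 then show ?thesis by (simp add: bl_row)
 qed
 have im: "bil G x ` carrier_vec r = range ((*) d)"
 proof (intro subset_antisym subsetI)
 fix t assume "t \<in> bil G x ` carrier_vec r"
 then obtain y where y: "y \<in> carrier_vec r" "t = bil G x y" by blast
 have "d dvd t" unfolding y(2) b[OF y(1)] using d(3) by (intro dvd_sum) auto
 then show "t \<in> range ((*) d)" by blast
 next
 fix t assume "t \<in> range ((*) d)"
 then obtain c where c: "t = d * c" by blast
 have "bil G x (vec r (\<lambda>i. c * u i)) = (\<Sum>i<r. (c * u i) * ?w i)" by (subst b) auto
 also have "... = c * d" unfolding d(2)[symmetric] by (simp add: sum_distrib_left mult.assoc)
 finally show "t \<in> bil G x ` carrier_vec r" unfolding c by (metis mult.commute image_eqI vec_carrier)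
 qed
 have "d ~= 0"
 proof
 assume "d = 0"
 moreover have "bil G x x \<in> range ((*) d)" unfolding im[symmetric] using x by blast
 ultimately show False using nz by auto
 qed
 then have "d > 0" using d(1) by simp
 have "lat_div G x = d" unfolding lat_div_def rk
 proof (rule the_equality)
 show "0 < d \<and> bil G x ` carrier_vec r = range ((*) d)" using \<open>d > 0\<close> im by blast
 fix d' assume d': "0 < d' \<and> bil G x ` carrier_vec r = range ((*) d')"
 then have "d * 1 \<in> range ((*) d')" "d' * 1 \<in> range ((*) d)" using im by blast+
 then obtain a c where "d * 1 = d' * a" "d' * 1 = d * c" by blast
 then have dd: "d' dvd d" "d dvd d'" by (metis dvd_triv_left mult_1_right)+
 show "d' = d" using d' \<open>d > 0\<close> by (intro zdvd_antisym_nonneg dd) auto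
 qed
 then show ?thesis using d by blast
qed

lemma represents_iff_rep:
 assumes L: "genus_lattice r n p lp lm eps (ent G) h" and G: "G \<in> carrier_mat r r" and k: "k > 0" and \<delta>: "\<delta> > 0"
 shows "represents G k \<delta> \<longleftrightarrow> genus_lattice.rep r (ent G) (int k) \<delta>"
proof -
 interpret genus_lattice r n p lp lm eps "ent G" h by (rule L)
 have rk: "rk G = r" using G by (simp add: rk_def)
 have nz: "x ~= 0\<^sub>v r" if "bil G x x = int k" for x
 using that k G by (auto simp: bil_def)
 show ?thesis
 proof
 assume "represents G k \<delta>"
 then obtain x where x: "primitive_vec G x" "bil G x x = int k" "lat_div G x = \<delta>" unfolding represents_def by blast
 have xc: "x \<in> carrier_vec r" using x(1) rk by (simp add: primitive_vec_def)
 have "\<exists>z. (\<Sum>i<r. z i * x $ i) = 1" using primitive_vec_iff[OF rk xc nz[OF x(2)]] x(1) by blast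
 moreover have "bil G x x ~= 0" using x(2) k by simp
 note ld = lat_div_eq[OF G sym xc this, unfolded x(3)]
 ultimately show "rep (int k) \<delta>" unfolding rep_def gr_def
 using ld x(2) bil_bl[OF G xc xc] by (intro exI[of _ "\<lambda>i. x $ i"]) auto
 next
 assume "rep (int k) \<delta>"
 then obtain x z y where x: "(\<Sum>i<r. z i * x i) = 1" "b x x = int k" "\<forall>i<r. \<delta> dvd gr x i" "(\<Sum>i<r. y i * gr x i) = \<delta>"
 unfolding rep_def by blast
 let ?x = "vec r x"
 have xc: "?x \<in> carrier_vec r" by simp
 have q: "bil G ?x ?x = int k" using bil_bl[OF G xc xc] x(2) by (simp add: bl_vec)
 have "(\<Sum>i<r. z i * ?x $ i) = 1" using x(1) by simp
 then have pr: "primitive_vec G ?x" using primitive_vec_iff[OF rk xc nz[OF q]] by blast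
 have "bil G ?x ?x ~= 0" using q k by simp
 note ld = lat_div_eq[OF G sym xc this]
 have w: "(\<Sum>k<r. ent G i k * ?x $ k) = gr x i" for i by (simp add: gr_def)
 obtain y' where y': "(\<Sum>i<r. y' i * gr x i) = lat_div G ?x" and dv: "\<forall>i<r. lat_div G ?x dvd gr x i"
 using ld unfolding w by blast
 have 1: "\<delta> dvd lat_div G ?x" unfolding y'[symmetric] using x(3) by (intro dvd_sum) auto
 have 2: "lat_div G ?x dvd \<delta>" unfolding x(4)[symmetric] using dv by (intro dvd_sum) auto
 have "lat_div G ?x \<ge> 0" using ld by simp
 then have "lat_div G ?x = \<delta>" using \<delta> by (intro zdvd_antisym_nonneg 1 2) auto
 then show "represents G k \<delta>" unfolding represents_def using pr q by blast
 qed
qed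

theorem main_genus:
 assumes k: "k > 0" "even k" and p: "prime p" "odd p" and gen: "in_genus_II G lp lm p eps n"
 shows "represents G k 1 ==> conditions_1 G lp lm p eps n k"
 and "represents G k (int p) ==> conditions_p lp lm p eps n k"
 and "lp \<ge> 1 ==> lm \<ge> 1 ==> lp + lm \<ge> 3 ==> conditions_1 G lp lm p eps n k ==> represents G k 1"
 and "lp \<ge> 1 ==> lm \<ge> 1 ==> lp + lm \<ge> 3 ==> conditions_p lp lm p eps n k ==> represents G k (int p)"
proof -
 have G: "G \<in> carrier_mat (lp + lm) (lp + lm)" by (rule genus_lattice_ex(1)[OF p gen])
 obtain h where L: "genus_lattice (lp + lm) n p lp lm eps (ent G) h" using genus_lattice_ex(2)[OF p gen] by blast
 interpret genus_lattice "lp + lm" n p lp lm eps "ent G" h by (rule L)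
 have "\<exists>W d w. genus_lattice_basis (lp + lm) n p lp lm eps (ent G) h W d w"
 by (rule jordan_basis, intro exI genus_lattice_basis.intro L genus_lattice_basis_axioms.intro) blast+
 then obtain W d w where B: "genus_lattice_basis (lp + lm) n p lp lm eps (ent G) h W d w" by blast
 interpret B: genus_lattice_basis "lp + lm" n p lp lm eps "ent G" h W d w by (rule B)
 have rk: "rk G = lp + lm" using G by (simp add: rk_def)
 have 1: "represents G k 1 \<longleftrightarrow> rep (int k) 1" "represents G k (int p) \<longleftrightarrow> rep (int k) (int p)"
 using represents_iff_rep[OF L G k(1)] P0 by auto
 note E = B.E1_iff[OF k(1) rk] B.Ep_iff[OF k(1)]
 show "represents G k 1 ==> conditions_1 G lp lm p eps n k" using B.rep_1_imp_E1 1 E by blast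
 show "represents G k (int p) ==> conditions_p lp lm p eps n k" using B.rep_p_imp_Ep 1 E by blast
 have ke: "even (int k)" using k by simp
 show "lp \<ge> 1 ==> lm \<ge> 1 ==> lp + lm \<ge> 3 ==> conditions_1 G lp lm p eps n k ==> represents G k 1"
 using B.represents_suff(1) ke 1 E by blast
 show "lp \<ge> 1 ==> lm \<ge> 1 ==> lp + lm \<ge> 3 ==> conditions_p lp lm p eps n k ==> represents G k (int p)"
 using B.represents_suff(2) ke 1 E by blast
qed

subsection \<open>Jordan decompositions with integer entries\<close>

lemma padic_eqI:
 assumes "x \<in> carrier (padic_int p)" "\<And>N. [x N = z] (mod int p ^ N)"
 shows "x = padic_of_int p z"
proof
 fix N
 have "0 \<le> x N" "x N < int p ^ N" using assms(1) by (simp_all add: padic_int_def)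
 then show "x N = padic_of_int p z N" using assms(2)[of N] by (simp add: padic_of_int_def cong_def)
qed

lemma padic_ring_mat: "p > 0 ==> A \<in> carrier_mat m m ==> ring_mat (padic_int p) m (map_mat (padic_of_int p) A)"
 unfolding ring_mat_def elements_mat_def using padic_of_int_carrier by auto

lemma padic_ring_det:
 assumes p: "p > 0" and A: "A \<in> carrier_mat m m"
 shows "ring_det (padic_int p) (map_mat (padic_of_int p) A) = padic_of_int p (det A)"
proof (rule padic_eqI)
 let ?A = "map_mat (padic_of_int p) A"
 note d = padic_det_level[OF p padic_ring_mat[OF p A]]
 show "ring_det (padic_int p) ?A \<in> carrier (padic_int p)" by (rule d(1))
 fix N
 have "[det (mt m (lev N ?A)) = det (mt m (ent A))] (mod int p ^ N)"
 using A by (intro det_mt_cong) (simp add: lev_def ent_def padic_of_int_def cong_def)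
 then show "[ring_det (padic_int p) ?A N = det A] (mod int p ^ N)"
 using cong_trans[OF d(2)] by (simp add: mt_ent[OF A])
qed

lemma padic_matmult:
 assumes p: "p > 0" and A: "A \<in> carrier_mat m m" and B: "B \<in> carrier_mat m m"
 shows "ring_mat_mult (padic_int p) (map_mat (padic_of_int p) A) (map_mat (padic_of_int p) B) = map_mat (padic_of_int p) (A * B)"
 (is "?L = ?R")
proof (rule eq_matI)
 show "dim_row ?L = dim_row ?R" "dim_col ?L = dim_col ?R" using A B by (simp_all add: ring_mat_mult_def)
 fix i j assume "i < dim_row ?R" "j < dim_col ?R"
 then have ij: "i < m" "j < m" using A B by simp_all
 let ?A = "map_mat (padic_of_int p) A" and ?B = "map_mat (padic_of_int p) B"
 have c: "?A \<in> carrier_mat m m" "?B \<in> carrier_mat m m" using A B by auto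
 have e: "?A $$ (i, j) \<in> carrier (padic_int p)" "?B $$ (i, j) \<in> carrier (padic_int p)" if "i < m" "j < m" for i j
 using that A B padic_of_int_carrier[OF p] by auto
 have "?L $$ (i, j) = padic_of_int p ((A * B) $$ (i, j))"
 proof (rule padic_eqI)
 show "?L $$ (i, j) \<in> carrier (padic_int p)" by (rule padic_matmult_level(1)[OF p c e ij])
 fix N
 have "[(?L $$ (i, j)) N = (\<Sum>l<m. lev N ?A i l * lev N ?B l j)] (mod int p ^ N)" by (rule padic_matmult_level(2)[OF p c e ij])
 also have "[(\<Sum>l<m. lev N ?A i l * lev N ?B l j) = (\<Sum>l<m. A $$ (i, l) * B $$ (l, j))] (mod int p ^ N)"
 using A B ij by (intro cong_sum cong_mult) (auto simp: lev_def padic_of_int_def cong_def)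
 also have "(\<Sum>l<m. A $$ (i, l) * B $$ (l, j)) = (A * B) $$ (i, j)"
 using A B ij by (simp add: scalar_prod_def atLeast0LessThan)
 finally show "[(?L $$ (i, j)) N = (A * B) $$ (i, j)] (mod int p ^ N)" .
 qed
 then show "?L $$ (i, j) = ?R $$ (i, j)" using ij A B by simp
qed

lemma padic_of_int_mult: "padic_of_int p x \<otimes>\<^bsub>padic_int p\<^esub> padic_of_int p y = padic_of_int p (x * y)"
 by (rule ext) (simp add: padic_mult_level padic_of_int_def mod_mult_eq)

text \<open>Inverses modulo the powers p^i are unique, hence compatible, and form a p-adic
  integer.\<close>

lemma padic_of_int_unit:
 assumes p: "prime p" and u: "\<not> int p dvd u"
 shows "padic_of_int p u \<in> Units (padic_int p)"
proof -
 have p0: "p > 0" using p prime_gt_0_nat by blast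
 interpret cring "padic_int p" by (rule padic_int_cring[OF p0])
 have cop: "coprime u (int p ^ i)" for i
 using prime_imp_coprime[of "int p" u] p u by (simp add: coprime_commute)
 have "\<exists>z. \<forall>i. [u * z i = 1] (mod int p ^ i)" using cong_solve_coprime_int[OF cop] by metis
 then obtain z where z: "\<And>i. [u * z i = 1] (mod int p ^ i)" by blast
 define y where "y = (\<lambda>i. z i mod int p ^ i)"
 have "y \<in> carrier (padic_int p)"
 proof -
 have "z (Suc i) mod int p ^ Suc i mod int p ^ i = z i mod int p ^ i" for i
 proof -
 have "[u * z (Suc i) = 1] (mod int p ^ i)" using z[of "Suc i"] by (rule cong_dvd_modulus) simp
 then have "[u * z (Suc i) = u * z i] (mod int p ^ i)" using cong_trans[OF _ cong_sym[OF z[of i]]] by blast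
 then have "[z (Suc i) = z i] (mod int p ^ i)" using cong_mult_lcancel[OF cop] by blast
 then show ?thesis unfolding cong_def by (simp add: mod_mod_cancel)
 qed
 then show ?thesis unfolding y_def using p0 by (simp add: padic_int_def)
 qed
 moreover have "padic_of_int p u \<otimes>\<^bsub>padic_int p\<^esub> y = \<one>\<^bsub>padic_int p\<^esub>"
 proof (rule ext)
 fix i
 have "(u * z i) mod int p ^ i = 1 mod int p ^ i" using z[of i] by (simp add: cong_def)
 then show "(padic_of_int p u \<otimes>\<^bsub>padic_int p\<^esub> y) i = \<one>\<^bsub>padic_int p\<^esub> i"
 unfolding padic_mult_level y_def padic_of_int_def mod_mult_eq by (simp add: padic_int_def)
 qed
 ultimately show ?thesis using padic_of_int_carrier[OF p0, of u] m_comm unfolding Units_def by fastforce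
qed

text \<open>An integer change of basis with determinant prime to p is invertible over the p-adic
  integers, so a concrete example can be verified with integer matrices.\<close>

lemma jordan_signI:
 assumes p: "prime p" and G: "G \<in> carrier_mat r r" and r: "r = m + n"
 and T: "T \<in> carrier_mat r r" "\<not> int p dvd det T"
 and A: "A \<in> carrier_mat m m" "transpose_mat A = A" "\<not> int p dvd det A"
 and B: "B \<in> carrier_mat n n" "transpose_mat B = B" "\<not> int p dvd det B"
 and eq: "transpose_mat T * (G * T) = four_block_mat A (0\<^sub>m m n) (0\<^sub>m n m) (int p \<cdot>\<^sub>m B)"
 shows "jordan_sign G p n (Legendre (det B) (int p))"
proof -
 let ?R = "padic_int p" and ?f = "map_mat (padic_of_int p)"
 have p0: "p > 0" using p prime_gt_0_nat by blast
 have rk: "rk G = r" using G by (simp add: rk_def)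
 have uni: "unimodular ?R l (?f C)" if "C \<in> carrier_mat l l" "transpose_mat C = C" "\<not> int p dvd det C" for l C
 proof -
 have "transpose_mat (?f C) = ?f (transpose_mat C)" by (rule eq_matI) auto
 then show ?thesis unfolding unimodular_def
 using that padic_ring_mat[OF p0] padic_ring_det[OF p0] padic_of_int_unit[OF p] by metis
 qed
 have iso: "ring_isometric ?R r (?f G) (orth_sum ?R (?f A) (map_mat (\<lambda>c. padic_of_int p (int p) \<otimes>\<^bsub>?R\<^esub> c) (?f B)))"
 unfolding ring_isometric_def
 proof (intro exI conjI)
 show "ring_mat ?R r (?f T)" by (rule padic_ring_mat[OF p0 T(1)])
 show "ring_det ?R (?f T) \<in> Units ?R" using padic_ring_det[OF p0 T(1)] padic_of_int_unit[OF p T(2)] by simp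
 have "transpose_mat (?f T) = ?f (transpose_mat T)" by (rule eq_matI) auto
 moreover have "ring_mat_mult ?R (?f G) (?f T) = ?f (G * T)" by (rule padic_matmult[OF p0 G T(1)])
 moreover have "ring_mat_mult ?R (?f (transpose_mat T)) (?f (G * T)) = ?f (transpose_mat T * (G * T))"
 using G T by (intro padic_matmult[OF p0, of _ r]) auto
 moreover have "?f (four_block_mat A (0\<^sub>m m n) (0\<^sub>m n m) (int p \<cdot>\<^sub>m B)) =
 orth_sum ?R (?f A) (map_mat (\<lambda>c. padic_of_int p (int p) \<otimes>\<^bsub>?R\<^esub> c) (?f B))"
 proof -
 have "padic_of_int p 0 = \<zero>\<^bsub>?R\<^esub>" by (rule ext) (simp add: padic_of_int_def padic_int_def)
 then show ?thesis
 unfolding orth_sum_def using A(1) B(1) by (intro eq_matI) (auto simp: padic_of_int_mult)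
 qed
 ultimately show "ring_mat_mult ?R (transpose_mat (?f T)) (ring_mat_mult ?R (?f G) (?f T)) =
 orth_sum ?R (?f A) (map_mat (\<lambda>c. padic_of_int p (int p) \<otimes>\<^bsub>?R\<^esub> c) (?f B))" using eq by simp
 qed
 have "[ring_det ?R (?f B) 1 = det B] (mod int p)"
 unfolding padic_ring_det[OF p0 B(1)] by (simp add: padic_of_int_def cong_def)
 then have L: "Legendre (det B) (int p) = Legendre (ring_det ?R (?f B) 1) (int p)" using Legendre_cong by metis
 have rn: "r - n = m" "n \<le> r" using r by auto
 show ?thesis unfolding jordan_sign_def rk rn(1)
 using rn(2) uni[OF A] uni[OF B] iso L by blast
qed

subsection \<open>A definite lattice of discriminant 433\<close>

text \<open>Tridiagonal with leading minors 4, 15, 56, 433: the determinant is prime, and the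
  diagonal is large enough to exclude norm 2.\<close>

definition hf :: "nat \<Rightarrow> nat \<Rightarrow> int" where
 "hf i j = (if i = j then (if i = 3 then 8 else 4) else if i = Suc j \<or> j = Suc i then 1 else 0)"

text \<open>The columns of this upper triangular matrix are orthogonal; the last one is the last column
 of the adjugate.\<close>

definition vf :: "nat \<Rightarrow> nat \<Rightarrow> int" where
 "vf i j = [[1, -1, 1, -1], [0, 4, -4, 4], [0, 0, 15, -15], [0, 0, 0, 56]] ! i ! j"

text \<open>Norms of the columns of \<open>vf\<close>, the products of consecutive leading minors: 1
  * 4, 4 * 15, 15 * 56 and 56 * 433.\<close>

definition nf :: "nat \<Rightarrow> int" where
 "nf j = [4, 60, 840, 24248] ! j"

definition Hm :: "int mat" where
 "Hm = mt 4 hf"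

lemma less4: "i < 4 \<longleftrightarrow> i = 0 \<or> i = 1 \<or> i = 2 \<or> i = (3::nat)"
 by linarith

lemma sum4: "(\<Sum>i<4. f i) = f 0 + f 1 + f 2 + f (3::nat)" for f :: "nat \<Rightarrow> 'a :: comm_monoid_add"
 by (simp add: eval_nat_numeral ac_simps)

lemma sum3: "(\<Sum>i<3. f i) = f 0 + f 1 + f (2::nat)" for f :: "nat \<Rightarrow> 'a :: comm_monoid_add"
 by (simp add: eval_nat_numeral ac_simps)

lemma hf_rows:
 "(\<Sum>k<4. hf 0 k * x k) = 4 * x 0 + x 1"
 "(\<Sum>k<4. hf 1 k * x k) = x 0 + 4 * x 1 + x 2"
 "(\<Sum>k<4. hf 2 k * x k) = x 1 + 4 * x 2 + x 3"
 "(\<Sum>k<4. hf 3 k * x k) = x 2 + 8 * x (3::nat)"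
 unfolding sum4 by (simp_all add: hf_def)

lemma hf_sym: "hf i j = hf j i"
 by (auto simp: hf_def)

lemma bl_hf: "bl {..<4} hf x y = x 0 * (4 * y 0 + y 1) + x 1 * (y 0 + 4 * y 1 + y 2)
 + x 2 * (y 1 + 4 * y 2 + y 3) + x 3 * (y 2 + 8 * y 3)"
 unfolding bl_row sum4[of "\<lambda>j. x j * (\<Sum>k<4. hf j k * y k)"] hf_rows ..

lemma vf_vals:
 "vf 0 0 = 1" "vf 0 1 = -1" "vf 0 2 = 1" "vf 0 3 = -1" "vf 1 0 = 0" "vf 1 1 = 4" "vf 1 2 = -4" "vf 1 3 = 4"
 "vf 2 0 = 0" "vf 2 1 = 0" "vf 2 2 = 15" "vf 2 3 = -15" "vf 3 0 = 0" "vf 3 1 = 0" "vf 3 2 = 0" "vf 3 3 = 56"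
 by (simp_all add: vf_def numeral_2_eq_2 numeral_3_eq_3)

lemma nf_vals: "nf 0 = 4" "nf 1 = 60" "nf 2 = 840" "nf 3 = 24248"
 by (simp_all add: nf_def numeral_2_eq_2 numeral_3_eq_3)

lemma obas_hf: "obas {..<4} hf vf nf"
 unfolding obas_def bl_hf by (auto simp: less4 vf_vals vf_vals[unfolded One_nat_def] nf_vals nf_vals[unfolded One_nat_def])

lemma Hm_carrier: "Hm \<in> carrier_mat 4 4" and rk_Hm: "rk Hm = 4"
 by (simp_all add: Hm_def rk_def)

lemma bl_ent_Hm: "bl {..<4} (ent Hm) x y = bl {..<4} hf x y"
 by (intro bl_cong) (auto simp: Hm_def ent_def)

lemma Hm_even: "even_lattice Hm"
proof -
 have "even (bil Hm x x)" if "x \<in> carrier_vec 4" for x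
 proof -
 have "bl {..<4} hf y y = 2 * (2 * y 0 * y 0 + y 0 * y 1 + 2 * y 1 * y 1 + y 1 * y 2 + 2 * y 2 * y 2 + y 2 * y 3 + 4 * y 3 * y 3)" for y
 unfolding bl_hf by (simp add: algebra_simps)
 then show ?thesis using bil_bl[OF Hm_carrier that that] bl_ent_Hm by simp
 qed
 moreover have "transpose_mat Hm = Hm" by (rule eq_matI) (auto simp: Hm_def hf_sym)
 ultimately show ?thesis unfolding even_lattice_def rk_Hm using Hm_carrier by simp
qed

lemma Hm_signature: "has_signature Hm 4 0"
proof -
 define S where "S = (\<lambda>i j. real_of_int (hf i j))"
 define V where "V = (\<lambda>i j. real_of_int (vf i j) / sqrt (real_of_int (nf j)))"
 have m: "map_mat real_of_int Hm = mt 4 S" by (rule eq_matI) (auto simp: Hm_def S_def)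
 have nfp: "nf a > 0" if "a < 4" for a using that by (auto simp: less4 nf_vals nf_vals[unfolded One_nat_def])
 have o: "bl {..<4} S (\<lambda>k. V k a) (\<lambda>k. V k c) = (if a = c then 1 else 0)" if ac: "a < 4" "c < 4" for a c
 proof -
 have "bl {..<4} S (\<lambda>k. V k a) (\<lambda>k. V k c) =
 bl {..<4} S (\<lambda>k. inverse (sqrt (real_of_int (nf a))) * real_of_int (vf k a)) (\<lambda>k. inverse (sqrt (real_of_int (nf c))) * real_of_int (vf k c))"
 by (intro bl_cong) (auto simp: V_def field_simps)
 also have "... = inverse (sqrt (real_of_int (nf a))) * (inverse (sqrt (real_of_int (nf c))) * bl {..<4} S (\<lambda>k. real_of_int (vf k a)) (\<lambda>k. real_of_int (vf k c)))"
 by (simp only: bl_scale_left bl_scale_right)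
 also have "bl {..<4} S (\<lambda>k. real_of_int (vf k a)) (\<lambda>k. real_of_int (vf k c)) = real_of_int (bl {..<4} hf (\<lambda>k. vf k a) (\<lambda>k. vf k c))"
 by (simp add: bl_def S_def)
 also have "bl {..<4} hf (\<lambda>k. vf k a) (\<lambda>k. vf k c) = (if a = c then nf a else 0)" using obas_hf ac unfolding obas_def by auto
 finally have "bl {..<4} S (\<lambda>k. V k a) (\<lambda>k. V k c) = (if a = c then real_of_int (nf a) / (sqrt (real_of_int (nf a)) * sqrt (real_of_int (nf a))) else 0)"
 by (simp add: field_simps)
 moreover have "sqrt (real_of_int (nf a)) * sqrt (real_of_int (nf a)) = real_of_int (nf a)"
 unfolding real_sqrt_mult_self using nfp[OF ac(1)] by simp
 then have q: "real_of_int (nf a) / (sqrt (real_of_int (nf a)) * sqrt (real_of_int (nf a))) = 1"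
 using nfp[OF ac(1)] by (simp only:) simp
 ultimately show ?thesis by (simp only: q)
 qed
 then have ob: "obas {..<4} S V (\<lambda>i. 1)" by (simp add: obas_def)
 have "det (mt 4 V) ~= 0" using obas_det[OF ob] by auto
 then have "mt 4 V \<in> Units (Matrix.ring_mat TYPE(real) 4 ())" by (intro det_non_zero_imp_unit) auto
 then obtain B where B: "B \<in> carrier_mat 4 4" "B * mt 4 V = 1\<^sub>m 4" "mt 4 V * B = 1\<^sub>m 4"
 unfolding Units_def by (auto simp: ring_mat_simps)
 have "invertible_mat (mt 4 V)" unfolding invertible_mat_def inverts_mat_def using B by (auto intro!: exI[of _ B])
 moreover have "transpose_mat (mt 4 V) * mt 4 S * mt 4 V = mat 4 4 (\<lambda>(i, j). if i ~= j then 0 else if i < 4 then 1 else -1)"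
 proof -
 have "transpose_mat (mt 4 V) * mt 4 S * mt 4 V = mt 4 (\<lambda>i j. if i = j then 1 else 0)" by (rule obas_mat[OF ob])
 also have "... = mat 4 4 (\<lambda>(i, j). if i ~= j then 0 else if i < 4 then 1 else -1)" by (rule eq_matI) auto
 finally show ?thesis .
 qed
 ultimately have "\<exists>T\<in>carrier_mat 4 4. invertible_mat T \<and> transpose_mat T * map_mat real_of_int Hm * T =
 mat 4 4 (\<lambda>(i, j). if i ~= j then 0 else if i < 4 then 1 else -1)" unfolding m by (intro bexI[of _ "mt 4 V"]) auto
 then show ?thesis using Hm_carrier unfolding has_signature_def by simp
qed

text \<open>433 is less than 21^2, so trial division up to 20 decides.\<close>

lemma prime_433: "prime (433::nat)"
proof -
 have small: "a = 1" if ab: "a * b = 433" and a: "a \<le> 20" for a b :: nat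
 proof -
 have d: "a dvd 433" unfolding ab[symmetric] by (rule dvd_triv_left)
 have "a = 0 \<or> a = 1 \<or> a = 2 \<or> a = 3 \<or> a = 4 \<or> a = 5 \<or> a = 6 \<or> a = 7 \<or> a = 8 \<or> a = 9 \<or> a = 10 \<or> a = 11 \<or>
 a = 12 \<or> a = 13 \<or> a = 14 \<or> a = 15 \<or> a = 16 \<or> a = 17 \<or> a = 18 \<or> a = 19 \<or> a = 20" using a by presburger
 then show ?thesis using d by (elim disjE) simp_all
 qed
 have "m = 1 \<or> m = 433" if h: "m dvd 433" for m :: nat
 proof -
 obtain l where l: "433 = m * l" using h unfolding dvd_def by blast
 have "m \<le> 20 \<or> l \<le> 20"
 proof (rule ccontr)
 assume "\<not> ?thesis"
 then have "21 * 21 \<le> m * l" by (intro mult_le_mono) simp_all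
 then show False using l by simp
 qed
 then show ?thesis
 proof
 assume "m \<le> 20"
 then show ?thesis using small[OF l[symmetric]] by simp
 next
 assume "l \<le> 20"
 then have "l = 1" using small[of l m] l by (simp add: mult.commute)
 then show ?thesis using l by simp
 qed
 qed
 then show ?thesis unfolding prime_nat_iff by simp
qed

lemma det_upper:
 assumes "\<And>i j. i < n ==> j < i ==> f i j = (0::int)"
 shows "det (mt n f) = (\<Prod>i<n. f i i)"
proof -
 have "det (mt n f) = prod_list (diag_mat (mt n f))"
 using assms by (intro det_upper_triangular[of _ n]) auto
 also have "diag_mat (mt n f) = map (\<lambda>i. f i i) [0..<n]" by (simp add: diag_mat_def)
 also have "prod_list (map (\<lambda>i. f i i) [0..<n]) = (\<Prod>i<n. f i i)"
 by (metis atLeast_upt prod.distinct_set_conv_list distinct_upt)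
 finally show ?thesis .
qed

lemma less3: "i < 3 \<longleftrightarrow> i = 0 \<or> i = 1 \<or> i = (2::nat)"
 by linarith

lemma prod3: "(\<Prod>i<3. f i) = f 0 * f 1 * f (2::nat)"
 by (simp add: eval_nat_numeral mult_ac)

lemma prod4: "(\<Prod>i<4. f i) = f 0 * f 1 * f 2 * f (3::nat)"
 by (simp add: eval_nat_numeral mult_ac)

lemmas vals = vf_vals vf_vals[unfolded One_nat_def] nf_vals nf_vals[unfolded One_nat_def]

text \<open>The first three basis vectors span the unimodular part, of determinant 56. The last one
  is replaced by the last column of the adjugate, which is orthogonal to them and has norm 433 * 56
  = 24248, so L1 is the form 56. The change of basis has determinant 56, a unit at 433.\<close>

lemma Hm_jordan: "jordan_sign Hm 433 1 (Legendre 56 433)"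
proof -
 define tf where "tf = (\<lambda>i j. if j = 3 then vf i 3 else if i = j then 1 else 0)"
 have det3: "det (mt 3 hf) = 56"
 proof -
 have "bl {..<3} hf x y = x 0 * (4 * y 0 + y 1) + x 1 * (y 0 + 4 * y 1 + y 2) + x 2 * (y 1 + 4 * y 2)" for x y
 unfolding bl_row sum3 by (simp add: hf_def)
 then have "bl {..<3} hf (\<lambda>k. vf k a) (\<lambda>k. vf k c) = (if a = c then nf a else 0)" if "a < 3" "c < 3" for a c
 using that unfolding less3 by (elim disjE) (simp_all add: vals)
 moreover have "nf a ~= 0" if "a < 3" for a using that unfolding less3 by (elim disjE) (simp_all add: vals)
 ultimately have "obas {..<3} hf vf nf" by (simp add: obas_def)
 then have "(det (mt 3 vf))\<^sup>2 * det (mt 3 hf) = (\<Prod>i<3. nf i)" by (rule obas_det)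
 moreover have "(\<Prod>i<3. nf i) = 201600" by (simp add: prod3 vals)
 moreover have "det (mt 3 vf) = 60"
 proof -
 have "det (mt 3 vf) = (\<Prod>i<3. vf i i)"
 proof (rule det_upper)
 fix i j :: nat assume ij: "i < 3" "j < i"
 then have "j < 3" by simp
 with ij show "vf i j = 0" unfolding less3 by (elim disjE) (simp_all add: vals)
 qed
 then show ?thesis by (simp add: prod3 vals)
 qed
 ultimately show ?thesis by simp
 qed
 have detT: "det (mt 4 tf) = 56"
 proof -
 have "tf i j = 0" if "i < 4" "j < i" for i j
 proof -
 have "j ~= 3" "i ~= j" using that by auto
 then show ?thesis by (simp add: tf_def)
 qed
 then have "det (mt 4 tf) = (\<Prod>i<4. tf i i)" by (rule det_upper)
 also have "... = 56" by (simp add: prod4 tf_def vals)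
 finally show ?thesis .
 qed
 have nd: "\<not> int 433 dvd 56" by simp
 have det1: "det (mt 1 (\<lambda>i j. 56)) = (56::int)" by (subst det_upper) auto
 have "jordan_sign Hm 433 1 (Legendre (det (mt 1 (\<lambda>i j. 56))) (int 433))"
 proof (rule jordan_signI[OF prime_433 Hm_carrier, of 3 1 "mt 4 tf" "mt 3 hf" "mt 1 (\<lambda>i j. 56)"])
 show "transpose_mat (mt 3 hf) = mt 3 hf" by (rule eq_matI) (auto simp: hf_sym)
 show "transpose_mat (mt 1 (\<lambda>i j. 56)) = mt 1 (\<lambda>i j. 56 :: int)" by (rule eq_matI) auto
 show "transpose_mat (mt 4 tf) * (Hm * mt 4 tf) = four_block_mat (mt 3 hf) (0\<^sub>m 3 1) (0\<^sub>m 1 3) (int 433 \<cdot>\<^sub>m mt 1 (\<lambda>i j. 56))"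
 (is "?L = ?R")
 proof (rule eq_matI)
 fix i j assume "i < dim_row ?R" "j < dim_col ?R"
 then have ij: "i < 4" "j < 4" by simp_all
 have a: "?L = transpose_mat (mt 4 tf) * mt 4 hf * mt 4 tf" unfolding Hm_def by (rule assoc_mult_mat[symmetric]) auto
 have "(transpose_mat (mt 4 tf) * mt 4 hf * mt 4 tf) $$ (i, j) = bl {..<4} hf (\<lambda>k. tf k i) (\<lambda>k. tf k j)"
 by (rule mt_congruence[OF ij])
 then have "?L $$ (i, j) = bl {..<4} hf (\<lambda>k. tf k i) (\<lambda>k. tf k j)" by (simp only: a)
 also have "... = (if i < 3 then if j < 3 then hf i j else 0 else if j < 3 then 0 else 24248)"
 unfolding bl_hf using ij unfolding less4 by (elim disjE; simp add: tf_def vals hf_def)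
 also have "... = ?R $$ (i, j)"
 proof -
 have "i - 3 < 1" "j - 3 < 1" using ij by auto
 then show ?thesis using ij by (subst index_mat_four_block(1)) auto
 qed
 finally show "?L $$ (i, j) = ?R $$ (i, j)" .
 qed auto
 qed (use det3 detT nd det1 in auto)
 then show ?thesis unfolding det1 by simp
qed

lemma Hm_dual_iff:
 "v \<in> dual_lattice Hm \<longleftrightarrow> v \<in> carrier_vec 4 \<and> 4 * v $ 0 + v $ 1 \<in> \<int> \<and> v $ 0 + 4 * v $ 1 + v $ 2 \<in> \<int> \<and>
 v $ 1 + 4 * v $ 2 + v $ 3 \<in> \<int> \<and> v $ 2 + 8 * v $ 3 \<in> \<int>"
proof -
 let ?G = "map_mat rat_of_int Hm"
 have b: "bil ?G v (map_vec rat_of_int x) = of_int (x $ 0) * (4 * v $ 0 + v $ 1) + of_int (x $ 1) * (v $ 0 + 4 * v $ 1 + v $ 2)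
 + of_int (x $ 2) * (v $ 1 + 4 * v $ 2 + v $ 3) + of_int (x $ 3) * (v $ 2 + 8 * v $ 3)"
 if "x \<in> carrier_vec 4" "v \<in> carrier_vec 4" for x
 proof -
 have e: "ent ?G i j = of_int (hf i j)" if "i < 4" "j < 4" for i j using that by (simp add: ent_def Hm_def)
 have "bil ?G v (map_vec rat_of_int x) = bl {..<4} (ent ?G) (\<lambda>i. v $ i) (\<lambda>i. map_vec rat_of_int x $ i)"
 using Hm_carrier that by (intro bil_bl) auto
 also have "... = bl {..<4} (\<lambda>i j. of_int (hf i j)) (\<lambda>i. v $ i) (\<lambda>i. of_int (x $ i))"
 using e that by (intro bl_cong) auto
 finally show ?thesis unfolding bl_def sum4 by (simp add: hf_def algebra_simps)
 qed
 show ?thesis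
 proof
 assume v: "v \<in> dual_lattice Hm"
 then have vc: "v \<in> carrier_vec 4" by (simp add: dual_lattice_def rk_Hm)
 have "bil ?G v (map_vec rat_of_int (vec 4 (\<lambda>k. if k = i then 1 else 0))) \<in> \<int>" for i :: nat
 using v by (simp add: dual_lattice_def rk_Hm)
 from this[of 0] this[of 1] this[of 2] this[of 3]
 show "v \<in> carrier_vec 4 \<and> 4 * v $ 0 + v $ 1 \<in> \<int> \<and> v $ 0 + 4 * v $ 1 + v $ 2 \<in> \<int> \<and>
 v $ 1 + 4 * v $ 2 + v $ 3 \<in> \<int> \<and> v $ 2 + 8 * v $ 3 \<in> \<int>"
 using vc by (simp add: b)
 next
 assume h: "v \<in> carrier_vec 4 \<and> 4 * v $ 0 + v $ 1 \<in> \<int> \<and> v $ 0 + 4 * v $ 1 + v $ 2 \<in> \<int> \<and>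
 v $ 1 + 4 * v $ 2 + v $ 3 \<in> \<int> \<and> v $ 2 + 8 * v $ 3 \<in> \<int>"
 show "v \<in> dual_lattice Hm" unfolding dual_lattice_def rk_Hm
 proof (intro CollectI conjI ballI)
 show "v \<in> carrier_vec 4" using h by blast
 fix x :: "int vec" assume x: "x \<in> carrier_vec 4"
 have h': "4 * v $ 0 + v $ 1 \<in> \<int>" "v $ 0 + 4 * v $ 1 + v $ 2 \<in> \<int>"
 "v $ 1 + 4 * v $ 2 + v $ 3 \<in> \<int>" "v $ 2 + 8 * v $ 3 \<in> \<int>" using h by blast+
 note m = Ints_mult[OF Ints_of_int]
 show "bil ?G v (map_vec rat_of_int x) \<in> \<int>" unfolding b[OF x conjunct1[OF h]]
 by (rule Ints_add[OF Ints_add[OF Ints_add[OF m[OF h'(1)] m[OF h'(2)]] m[OF h'(3)]] m[OF h'(4)]])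
 qed
 qed
qed

text \<open>The coefficients -1, 4, -15, 56 of the last adjugate column combine the four rows to 433
  times the last coordinate.\<close>

lemma Hm_dual_last:
 assumes "v \<in> dual_lattice Hm" shows "433 * v $ 3 \<in> \<int>"
proof -
 have "433 * v $ 3 = - (4 * v $ 0 + v $ 1) + 4 * (v $ 0 + 4 * v $ 1 + v $ 2) - 15 * (v $ 1 + 4 * v $ 2 + v $ 3) + 56 * (v $ 2 + 8 * v $ 3)"
 by (simp add: algebra_simps)
 moreover have h: "4 * v $ 0 + v $ 1 \<in> \<int>" "v $ 0 + 4 * v $ 1 + v $ 2 \<in> \<int>"
 "v $ 1 + 4 * v $ 2 + v $ 3 \<in> \<int>" "v $ 2 + 8 * v $ 3 \<in> \<int>" using assms unfolding Hm_dual_iff by blast+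
 note m = Ints_mult[OF Ints_numeral]
 have "- (4 * v $ 0 + v $ 1) + 4 * (v $ 0 + 4 * v $ 1 + v $ 2) - 15 * (v $ 1 + 4 * v $ 2 + v $ 3) + 56 * (v $ 2 + 8 * v $ 3) \<in> \<int>"
 by (rule Ints_add[OF Ints_diff[OF Ints_add[OF Ints_minus[OF h(1)] m[OF h(2)]] m[OF h(3)]] m[OF h(4)]])
 ultimately show ?thesis by (simp only:)
qed

text \<open>The first isomorphism theorem for 433 times the last coordinate, taken modulo 433: once
  the last coordinate of a dual vector is integral, the rows make the others integral one after
  another.\<close>

lemma Hm_disc: "disc_group Hm \<cong> product_group {..<1::nat} (\<lambda>_. integer_mod_group 433)"
proof -
 let ?M = "(monoid_vec TYPE(rat) 4)\<lparr>carrier := dual_lattice Hm\<rparr>"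
 let ?P = "product_group {..<1::nat} (\<lambda>_. integer_mod_group 433)"
 let ?L = "map_vec rat_of_int ` carrier_vec 4"
 define \<phi> where "\<phi> = (\<lambda>v :: rat vec. \<lambda>i\<in>{..<1::nat}. \<lfloor>433 * v $ 3\<rfloor> mod int 433)"
 have sm: "carrier ?M = dual_lattice Hm" "\<And>x y. x \<otimes>\<^bsub>?M\<^esub> y = x + y" "\<one>\<^bsub>?M\<^esub> = 0\<^sub>v 4"
 by (simp_all add: monoid_vec_simps)
 have dc: "v \<in> carrier_vec 4" if "v \<in> dual_lattice Hm" for v using that unfolding Hm_dual_iff by blast
 have dadd: "v + w \<in> dual_lattice Hm" if vw: "v \<in> dual_lattice Hm" "w \<in> dual_lattice Hm" for v w
 proof -
 have c: "v \<in> carrier_vec 4" "w \<in> carrier_vec 4" using dc vw by blast+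
 have *: "(a + a') + (b + b') = (a + b) + (a' + b')" "4 * (a + a') + (b + b') = (4 * a + b) + (4 * a' + b')"
 "(a + a') + 4 * (b + b') + (c + c') = (a + 4 * b + c) + (a' + 4 * b' + c')"
 "(a + a') + 8 * (b + b') = (a + 8 * b) + (a' + 8 * b')" for a a' b b' c c' :: rat by (simp_all add: algebra_simps)
 show ?thesis using vw c unfolding Hm_dual_iff by (simp add: *(2-4) del: distrib_left_numeral)
 qed
 have grpM: "group ?M"
 proof (rule groupI)
 show "x \<otimes>\<^bsub>?M\<^esub> y \<in> carrier ?M" if "x \<in> carrier ?M" "y \<in> carrier ?M" for x y using dadd that unfolding sm by blast
 show "\<one>\<^bsub>?M\<^esub> \<in> carrier ?M" unfolding sm Hm_dual_iff by simp
 show "x \<otimes>\<^bsub>?M\<^esub> y \<otimes>\<^bsub>?M\<^esub> z = x \<otimes>\<^bsub>?M\<^esub> (y \<otimes>\<^bsub>?M\<^esub> z)" if "x \<in> carrier ?M" "y \<in> carrier ?M" "z \<in> carrier ?M" for x y z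
 using that dc unfolding sm by (intro assoc_add_vec) blast+
 show "\<one>\<^bsub>?M\<^esub> \<otimes>\<^bsub>?M\<^esub> x = x" if "x \<in> carrier ?M" for x using that dc unfolding sm by simp
 show "\<exists>y\<in>carrier ?M. y \<otimes>\<^bsub>?M\<^esub> x = \<one>\<^bsub>?M\<^esub>" if x: "x \<in> carrier ?M" for x
 proof (intro bexI)
 have xc: "x \<in> carrier_vec 4" using x dc unfolding sm by blast
 then show "- x \<otimes>\<^bsub>?M\<^esub> x = \<one>\<^bsub>?M\<^esub>" unfolding sm by (intro eq_vecI) auto
 have *: "4 * - a + - b = - (4 * a + b)" "- a + 4 * - b + - c = - (a + 4 * b + c)" "- a + 8 * - b = - (a + 8 * b)" for a b c :: rat by simp_all
 show "- x \<in> carrier ?M" using x xc unfolding sm Hm_dual_iff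
 by (simp only: index_uminus_vec(1) carrier_vecD * Ints_minus uminus_carrier_vec)
 qed
 qed
 have grpP: "group ?P" by simp
 have fl: "of_int \<lfloor>433 * v $ 3\<rfloor> = 433 * v $ 3" if "v \<in> dual_lattice Hm" for v
 using Hm_dual_last[OF that] by (metis Ints_cases floor_of_int)
 have hom: "\<phi> \<in> hom ?M ?P"
 proof (rule homI)
 show "\<phi> x \<in> carrier ?P" for x by (simp add: \<phi>_def carrier_integer_mod_group)
 fix x y assume xy: "x \<in> carrier ?M" "y \<in> carrier ?M"
 have c: "x \<in> carrier_vec 4" "y \<in> carrier_vec 4" using dc xy unfolding sm by blast+
 have "\<lfloor>433 * (x + y) $ 3\<rfloor> = \<lfloor>433 * x $ 3\<rfloor> + \<lfloor>433 * y $ 3\<rfloor>"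
 proof -
 have d: "x \<in> dual_lattice Hm" "y \<in> dual_lattice Hm" using xy unfolding sm by blast+
 have "(x + y) $ 3 = x $ 3 + y $ 3" by (rule index_add_vec(1)) (simp add: carrier_vecD[OF c(2)])
 then have "433 * (x + y) $ 3 = 433 * x $ 3 + 433 * y $ 3" by (simp only: distrib_left)
 also have "... = rat_of_int (\<lfloor>433 * x $ 3\<rfloor> + \<lfloor>433 * y $ 3\<rfloor>)" by (simp only: of_int_add fl[OF d(1)] fl[OF d(2)])
 finally have "433 * (x + y) $ 3 = rat_of_int (\<lfloor>433 * x $ 3\<rfloor> + \<lfloor>433 * y $ 3\<rfloor>)" .
 then show ?thesis by (simp only: floor_of_int)
 qed
 then show "\<phi> (x \<otimes>\<^bsub>?M\<^esub> y) = \<phi> x \<otimes>\<^bsub>?P\<^esub> \<phi> y"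
 unfolding sm by (auto simp: \<phi>_def product_group_def mod_add_eq)
 qed
 interpret gh: group_hom ?M ?P \<phi>
 using grpM grpP hom by (simp add: group_hom_def group_hom_axioms_def)
 have ker: "kernel ?M ?P \<phi> = ?L"
 proof (intro subset_antisym subsetI)
 fix v assume "v \<in> kernel ?M ?P \<phi>"
 then have v: "v \<in> dual_lattice Hm" "\<phi> v = \<one>\<^bsub>?P\<^esub>" unfolding kernel_def sm by auto
 have "\<lfloor>433 * v $ 3\<rfloor> mod 433 = 0" using fun_cong[OF v(2), of 0] by (simp add: \<phi>_def)
 then obtain t where "\<lfloor>433 * v $ 3\<rfloor> = 433 * t" by (metis mod_0_imp_dvd dvd_def)
 then have "433 * v $ 3 = of_int (433 * t)" using fl[OF v(1)] by metis
 then have "v $ 3 = of_int t" by simp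
 then have 3: "v $ 3 \<in> \<int>" by simp
 have h: "v $ 0 + 4 * v $ 1 + v $ 2 \<in> \<int>" "v $ 1 + 4 * v $ 2 + v $ 3 \<in> \<int>" "v $ 2 + 8 * v $ 3 \<in> \<int>"
 using v(1) unfolding Hm_dual_iff by blast+
 have "(v $ 2 + 8 * v $ 3) - 8 * v $ 3 \<in> \<int>" using h(3) 3 by (intro Ints_diff Ints_mult Ints_numeral)
 then have 2: "v $ 2 \<in> \<int>" by simp
 have "(v $ 1 + 4 * v $ 2 + v $ 3) - 4 * v $ 2 - v $ 3 \<in> \<int>" using h(2) 2 3 by (intro Ints_diff Ints_mult Ints_numeral)
 then have 1: "v $ 1 \<in> \<int>" by simp
 have "(v $ 0 + 4 * v $ 1 + v $ 2) - 4 * v $ 1 - v $ 2 \<in> \<int>" using h(1) 1 2 by (intro Ints_diff Ints_mult Ints_numeral)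
 then have 0: "v $ 0 \<in> \<int>" by simp
 have all: "v $ i = of_int \<lfloor>v $ i\<rfloor>" if "i < 4" for i
 using that 0 1 2 3 unfolding less4 by (metis Ints_cases floor_of_int)
 have "v = map_vec rat_of_int (vec 4 (\<lambda>i. \<lfloor>v $ i\<rfloor>))" using dc[OF v(1)] all by (intro eq_vecI) auto
 then show "v \<in> ?L" by (metis image_eqI vec_carrier)
 next
 fix v assume "v \<in> ?L"
 then obtain x where x: "x \<in> carrier_vec 4" "v = map_vec rat_of_int x" by blast
 have vi: "v $ i \<in> \<int>" if "i < 4" for i using x that by simp
 have "v \<in> dual_lattice Hm" unfolding Hm_dual_iff
 using x(1) vi[of 0] vi[of 1] vi[of 2] vi[of 3] unfolding x(2) by simp
 moreover have "\<phi> v = \<one>\<^bsub>?P\<^esub>"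
 proof -
 have "433 * v $ 3 = rat_of_int (433 * x $ 3)" using x by simp
 then have "\<lfloor>433 * v $ 3\<rfloor> = 433 * x $ 3" by (simp only: floor_of_int)
 then show ?thesis by (simp add: \<phi>_def)
 qed
 ultimately show "v \<in> kernel ?M ?P \<phi>" unfolding kernel_def sm by simp
 qed
 have surj: "\<phi> ` carrier ?M = carrier ?P"
 proof (intro subset_antisym subsetI)
 fix y assume "y \<in> \<phi> ` carrier ?M"
 then show "y \<in> carrier ?P" using hom_in_carrier[OF hom] by auto
 next
 fix y assume y: "y \<in> carrier ?P"
 then have ye: "y \<in> (\<Pi>\<^sub>E i\<in>{..<1::nat}. {0..<433})" by (simp add: carrier_integer_mod_group)
 \<comment> \<open>116 inverts 56 modulo 433: 116 * 56 = 6496 = 15 * 433 + 1.\<close>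
 define t where "t = rat_of_int (116 * y 0) / 433"
 define v where "v = vec 4 (\<lambda>i. t * of_int (vf i 3))"
 have v: "v $ 0 = - t" "v $ 1 = 4 * t" "v $ 2 = -15 * t" "v $ 3 = 56 * t" by (simp_all add: v_def vf_vals vf_vals[unfolded One_nat_def])
 have "v \<in> dual_lattice Hm" unfolding Hm_dual_iff v by (simp add: v_def t_def)
 moreover have "\<phi> v = y"
 proof (rule ext)
 fix i
 have "433 * v $ 3 = rat_of_int (6496 * y 0)" by (simp add: v(4) t_def)
 then have f: "\<lfloor>433 * v $ 3\<rfloor> = 6496 * y 0" by (simp only: floor_of_int)
 have "0 \<le> y 0" "y 0 < 433" using ye by (auto simp: PiE_iff)
 moreover have "(6496 * y 0) mod 433 = (y 0 + 433 * (15 * y 0)) mod 433" by simp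
 ultimately have "(6496 * y 0) mod 433 = y 0" by (simp only: mod_mult_self2 mod_pos_pos_trivial)
 then show "\<phi> v i = y i"
 using ye f by (cases "i = 0") (auto simp: \<phi>_def PiE_iff extensional_def)
 qed
 ultimately show "y \<in> \<phi> ` carrier ?M" unfolding sm by blast
 qed
 show ?thesis using gh.FactGroup_iso[OF surj] unfolding ker disc_group_def rk_Hm .
qed

lemma Hm_genus: "in_genus_II Hm 4 0 433 (Legendre 56 433) 1"
proof -
 have "Legendre 56 433 \<in> {1, -1}" using Legendre_unit[of 433 56] by auto
 then show ?thesis unfolding in_genus_II_def using Hm_even Hm_signature Hm_disc Hm_jordan by blast
qed

lemma Hm_symon: "symon {..<4} (ent Hm)"
 by (auto simp: symon_def ent_def Hm_def hf_sym)

text \<open>The norm is written as a sum of squares with weights. A nonzero first or last coordinate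
  costs at least 3 or 7, and once these vanish the middle coordinates have weight 3.\<close>

lemma Hm_not_2: "\<not> represents Hm 2 1"
proof
 assume "represents Hm 2 1"
 then obtain x where x: "primitive_vec Hm x" "bil Hm x x = 2" unfolding represents_def by auto
 have xc: "x \<in> carrier_vec 4" using x(1) rk_Hm by (simp add: primitive_vec_def)
 define a b c d where "a = x $ 0" and "b = x $ 1" and "c = x $ 2" and "d = x $ 3"
 have "a * (4 * a + b) + b * (a + 4 * b + c) + c * (b + 4 * c + d) + d * (c + 8 * d) = 2"
 using x(2) bil_bl[OF Hm_carrier xc xc] unfolding bl_ent_Hm bl_hf a_def b_def c_def d_def by simp
 then have q: "(a + b)\<^sup>2 + (b + c)\<^sup>2 + (c + d)\<^sup>2 + 3 * a\<^sup>2 + 2 * b\<^sup>2 + 2 * c\<^sup>2 + 7 * d\<^sup>2 = 2"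
 by (simp add: power2_eq_square algebra_simps)
 have sq: "t = 0 \<or> t\<^sup>2 \<ge> 1" for t :: int
 using zero_less_power2[of t] by linarith
 note n = zero_le_power2[of "a + b"] zero_le_power2[of "b + c"] zero_le_power2[of "c + d"]
 zero_le_power2[of a] zero_le_power2[of b] zero_le_power2[of c] zero_le_power2[of d]
 have a: "a = 0" using sq[of a] q n by linarith
 have d: "d = 0" using sq[of d] q n by linarith
 have q': "(b + c)\<^sup>2 + 3 * b\<^sup>2 + 3 * c\<^sup>2 = 2" using q unfolding a d by simp
 have "b = 0" using sq[of b] q' n by linarith
 moreover have "c = 0" using sq[of c] q' n by linarith
 ultimately show False using q' by simp
qed

text \<open>With H the Gram matrix, the identity shows that |H x|^2 is at most 10 times the norm of
  x, here 60620, which is less than 433^2; so H x divisible by 433 must vanish. The norm 6062 = 433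
  * 14 is chosen because 14 and 56 differ by a square, which meets the sign condition for n =
  1.\<close>

lemma Hm_not_6062: "\<not> represents Hm 6062 433"
proof
 assume "represents Hm 6062 433"
 then obtain x where x: "primitive_vec Hm x" "bil Hm x x = 6062" "lat_div Hm x = 433" unfolding represents_def by auto
 have xc: "x \<in> carrier_vec 4" using x(1) rk_Hm by (simp add: primitive_vec_def)
 define a b c d where "a = x $ 0" and "b = x $ 1" and "c = x $ 2" and "d = x $ 3"
 define u0 u1 u2 u3 where "u0 = 4 * a + b" and "u1 = a + 4 * b + c" and "u2 = b + 4 * c + d" and "u3 = c + 8 * d"
 have q: "a * u0 + b * u1 + c * u2 + d * u3 = 6062"
 using x(2) bil_bl[OF Hm_carrier xc xc]
 unfolding bl_ent_Hm bl_hf a_def b_def c_def d_def u0_def u1_def u2_def u3_def by simp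
 have "bil Hm x x ~= 0" using x(2) by simp
 then have dv: "433 dvd (\<Sum>k<4. ent Hm i k * x $ k)" if "i < 4" for i
 using lat_div_eq[OF Hm_carrier Hm_symon xc] that unfolding x(3) by blast
 have e: "(\<Sum>k<4. ent Hm i k * x $ k) = (\<Sum>k<4. hf i k * x $ k)" if "i < 4" for i
 using that by (intro sum.cong) (auto simp: ent_def Hm_def)
 have u: "433 dvd u0" "433 dvd u1" "433 dvd u2" "433 dvd u3"
 using dv[of 0] dv[of 1] dv[of 2] dv[of 3] e[of 0] e[of 1] e[of 2] e[of 3]
 unfolding hf_rows a_def b_def c_def d_def u0_def u1_def u2_def u3_def by simp_all
 have "10 * (a * u0 + b * u1 + c * u2 + d * u3) - (u0\<^sup>2 + u1\<^sup>2 + u2\<^sup>2 + u3\<^sup>2) =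
 2 * (a + b)\<^sup>2 + 2 * (b + c)\<^sup>2 + 2 * (c - d)\<^sup>2 + (a - c)\<^sup>2 + (b - d)\<^sup>2 + 20 * a\<^sup>2 + 17 * b\<^sup>2 + 17 * c\<^sup>2 + 12 * d\<^sup>2"
 unfolding u0_def u1_def u2_def u3_def by (simp add: power2_eq_square algebra_simps)
 also have "... \<ge> 0" by simp
 finally have bd: "u0\<^sup>2 + u1\<^sup>2 + u2\<^sup>2 + u3\<^sup>2 \<le> 60620" using q by simp
 have zero: "t = 0" if "433 dvd t" "t\<^sup>2 \<le> 60620" for t :: int
 proof (rule ccontr)
 assume "t ~= 0"
 then have "433 \<le> \<bar>t\<bar>" using that(1) dvd_imp_le_int[of t 433] by simp
 then have "433\<^sup>2 \<le> t\<^sup>2" by (metis abs_of_nonneg abs_le_square_iff zero_le_numeral)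
 then show False using that(2) by simp
 qed
 note n = zero_le_power2[of u0] zero_le_power2[of u1] zero_le_power2[of u2] zero_le_power2[of u3]
 have "u0 = 0" "u1 = 0" "u2 = 0" "u3 = 0" using zero u bd n by (smt (verit))+
 then show False using q by simp
qed

lemma multiplicity_433: "multiplicity (433::nat) 2 = 0" "multiplicity (433::nat) 6062 = 1"
proof -
 show "multiplicity (433::nat) 2 = 0" by (rule not_dvd_imp_multiplicity_0) simp
 show "multiplicity (433::nat) 6062 = 1" by (rule multiplicity_eqI) simp_all
qed

lemma Hm_conditions: "conditions_1 Hm 4 0 433 (Legendre 56 433) 1 2" "conditions_p 4 0 433 (Legendre 56 433) 1 6062"
proof -
 show "conditions_1 Hm 4 0 433 (Legendre 56 433) 1 2"
 unfolding conditions_1_def Let_def multiplicity_433 rk_Hm by simp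
 have "Legendre 56 (int 433) = Legendre 14 (int 433) * Legendre (2\<^sup>2) (int 433)"
 using Legendre_mult[OF prime_433, of 14 4] by simp
 moreover have "Legendre (2\<^sup>2) (int 433) = 1" by (rule Legendre_sq[OF prime_433]) simp_all
 ultimately have "Legendre 14 433 = Legendre 56 433" by simp
 then show "conditions_p 4 0 433 (Legendre 56 433) 1 6062"
 unfolding conditions_p_def Let_def multiplicity_433 by simp
qed

text \<open>The clause that the conditions are possibly not sufficient is rendered by the last two
  conjuncts, one for each divisor. Both are witnessed by the definite lattice \<open>Hm\<close> of
  signature (4, 0), so the failure is not an effect of small rank.\<close>

theorem theorem5p3:
 fixes G :: "int mat" and k p lp lm n :: nat and eps :: int
 assumes "k > 0" and "even k"
 and "prime p" and "odd p"
 and "in_genus_II G lp lm p eps n"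
 shows
 "(lp \<ge> 1 \<and> lm \<ge> 1 \<and> lp + lm \<ge> 3 \<longrightarrow>
 (represents G k 1 \<longleftrightarrow> conditions_1 G lp lm p eps n k) \<and>
 (represents G k (int p) \<longleftrightarrow> conditions_p lp lm p eps n k))
 \<and> (lp = 1 \<or> lm = 0 \<longrightarrow>
 (represents G k 1 \<longrightarrow> conditions_1 G lp lm p eps n k) \<and>
 (represents G k (int p) \<longrightarrow> conditions_p lp lm p eps n k))
 \<and> (\<exists>H l q rp rm e m. l > 0 \<and> even l \<and> prime q \<and> odd q \<and> in_genus_II H rp rm q e m \<and>
 (rp = 1 \<or> rm = 0) \<and> rp + rm \<ge> 3 \<and>
 conditions_1 H rp rm q e m l \<and> \<not> represents H l 1)
 \<and> (\<exists>H l q rp rm e m. l > 0 \<and> even l \<and> prime q \<and> odd q \<and> in_genus_II H rp rm q e m \<and>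
 (rp = 1 \<or> rm = 0) \<and> rp + rm \<ge> 3 \<and>
 conditions_p rp rm q e m l \<and> \<not> represents H l (int q))"
proof (intro conjI)
 note m = main_genus[OF assms]
 have h433: "int 433 = 433" by simp
 show "lp \<ge> 1 \<and> lm \<ge> 1 \<and> lp + lm \<ge> 3 \<longrightarrow>
 (represents G k 1 \<longleftrightarrow> conditions_1 G lp lm p eps n k) \<and>
 (represents G k (int p) \<longleftrightarrow> conditions_p lp lm p eps n k)"
 using m by blast
 show "lp = 1 \<or> lm = 0 \<longrightarrow>
 (represents G k 1 \<longrightarrow> conditions_1 G lp lm p eps n k) \<and>
 (represents G k (int p) \<longrightarrow> conditions_p lp lm p eps n k)"
 using m by blast
 show "\<exists>H l q rp rm e m. l > 0 \<and> even l \<and> prime q \<and> odd q \<and> in_genus_II H rp rm q e m \<and>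
 (rp = 1 \<or> rm = 0) \<and> rp + rm \<ge> 3 \<and>
 conditions_1 H rp rm q e m l \<and> \<not> represents H l 1"
 by (rule exI[of _ Hm], rule exI[of _ "2::nat"], rule exI[of _ "433::nat"], rule exI[of _ "4::nat"], rule exI[of _ "0::nat"],
 rule exI[of _ "Legendre 56 433"], rule exI[of _ "1::nat"], intro conjI Hm_genus prime_433 Hm_conditions(1) Hm_not_2) simp_all
 show "\<exists>H l q rp rm e m. l > 0 \<and> even l \<and> prime q \<and> odd q \<and> in_genus_II H rp rm q e m \<and>
 (rp = 1 \<or> rm = 0) \<and> rp + rm \<ge> 3 \<and>
 conditions_p rp rm q e m l \<and> \<not> represents H l (int q)"
 by (rule exI[of _ Hm], rule exI[of _ "6062::nat"], rule exI[of _ "433::nat"], rule exI[of _ "4::nat"], rule exI[of _ "0::nat"],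
 rule exI[of _ "Legendre 56 433"], rule exI[of _ "1::nat"], intro conjI Hm_genus prime_433 Hm_conditions(2) Hm_not_6062[folded h433]) simp_all
qed

end
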